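(* Let $0<s<2$, let $\Omega:S^1\to\mathbb{R}$ be smooth, strictly positive, with $\Omega(\theta+\pi)=\Omega(\theta)$, and let $W(\mathbf{x})=|\mathbf{x}|^{-s}\Omega(\theta)+|\mathbf{x}|^2$ on $\mathbb{R}^2$. Let $\tilde\Omega$ be the angular part of the Fourier transform of $|\mathbf{x}|^{-s}\Omega(\theta)$ (defined in the context). Then $W$ has the LIC (linear interpolation convexity) property if and only if $\tilde\Omega$ is nonnegative.
   Context: $S^1=[-\pi,\pi)$ is the set of angles (mod $2\pi$); $\theta$ is the angle of $\mathbf{x}\in\mathbb{R}^2\setminus\{0\}$, i.e. $\mathbf{x}/|\mathbf{x}|=(\cos\theta,\sin\theta)$. The energy is $E[\rho]=\frac12\int_{\mathbb{R}^2}\int_{\mathbb{R}^2}W(\mathbf{x}-\mathbf{y})\rho(\mathbf{y})\,\mathrm{d}\mathbf{y}\,\rho(\mathbf{x})\,\mathrm{d}\mathbf{x}$, where $\rho(\mathbf{x})\mathrm{d}\mathbf{x}$ denotes integration against a Borel measure $\rho$. LIC property: $W$ has the LIC property if for any two compactly supported probability measures $\rho_0\neq\rho_1$ on $\mathbb{R}^2$ with finite energy and with the same center of mass, the function $t\mapsto E[(1-t)\rho_0+t\rho_1]$, $t\in[0,1]$, is strictly convex (equivalently $E[\rho_0-\rho_1]>0$). The Fourier transform is $\mathcal{F}[f](\xi)=\int_{\mathbb{R}^2}f(\mathbf{x})e^{-2\pi i\mathbf{x}\cdot\xi}\,\mathrm{d}\mathbf{x}$ (extended to tempered distributions). Writing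 $\xi=|\xi|(\cos\varphi,\sin\varphi)$, the function $\tilde\Omega$ is defined by $\mathcal{F}[|\mathbf{x}|^{-s}\Omega(\theta)](\xi)=|\xi|^{-2+s}\tilde\Omega(\varphi)$; explicitly, $$\tilde\Omega(\varphi)=\tau_{2-s}\int_{-\pi}^{\pi}|\cos(\varphi-\theta)|^{-2+s}\Big(\Omega(\theta)-\Omega(\varphi+\tfrac{\pi}{2})\Big)\mathrm{d}\theta+c_s\,\Omega(\varphi+\tfrac{\pi}{2}),$$ with $\tau_r=(2\pi)^{-r}\Gamma(r)\cos\frac{r\pi}{2}$ and $c_s=\pi^{s-1}\frac{\Gamma((2-s)/2)}{\Gamma(s/2)}$. *)

theory Defs
  imports "HOL-Probability.Probability"
begin

type_synonym plane = "real \<times> real"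

(* Functions on the circle are represented by 2 pi-periodic functions on the real line. *)

definition smooth :: "(real \<Rightarrow> real) \<Rightarrow> bool" where
  "smooth f \<longleftrightarrow> (\<forall>k x. (deriv ^^ k) f differentiable (at x))"

(* For x \<noteq> 0 this is the angle in (-pi, pi] with x = norm x * (cos, sin) of it. *)
definition angle :: "plane \<Rightarrow> real" where
  "angle x = Arg (Complex (fst x) (snd x))"

section \<open>Interaction energy and linear interpolation convexity\<close>

definition anisotropic_riesz :: "real \<Rightarrow> (real \<Rightarrow> real) \<Rightarrow> plane \<Rightarrow> real" where
  "anisotropic_riesz s \<Omega> x = norm x powr (- s) * \<Omega> (angle x)"

(* The potential is singular at the origin. Its value there has to be infinity (and not what
   0 powr (- s) = 0 would give), so that measures with atoms have infinite energy. *)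
definition potential :: "real \<Rightarrow> (real \<Rightarrow> real) \<Rightarrow> plane \<Rightarrow> ennreal" where
  "potential s \<Omega> x =
     (if x = 0 then \<infinity> else ennreal (anisotropic_riesz s \<Omega> x + (norm x)\<^sup>2))"

definition energy :: "(plane \<Rightarrow> ennreal) \<Rightarrow> plane measure \<Rightarrow> ennreal" where
  "energy W \<rho> = (1 / 2) * (\<integral>\<^sup>+x. (\<integral>\<^sup>+y. W (x - y) \<partial>\<rho>) \<partial>\<rho>)"

definition compactly_supported_prob :: "plane measure \<Rightarrow> bool" where
  "compactly_supported_prob \<rho> \<longleftrightarrow>
     prob_space \<rho> \<and> sets \<rho> = sets borel \<and> (\<exists>K. compact K \<and> emeasure \<rho> (- K) = 0)"

definition center_of_mass :: "plane measure \<Rightarrow> plane" where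
  "center_of_mass \<rho> = (\<integral>x. x \<partial>\<rho>)"

(* The measure (1 - t) \<rho>0 + t \<rho>1, for 0 \<le> t \<le> 1. *)
definition interpolation :: "real \<Rightarrow> plane measure \<Rightarrow> plane measure \<Rightarrow> plane measure" where
  "interpolation t \<rho>0 \<rho>1 = measure_of UNIV (sets borel)
     (\<lambda>A. ennreal (1 - t) * emeasure \<rho>0 A + ennreal t * emeasure \<rho>1 A)"

(* Strict convexity of an extended-valued function. If f 0 and f 1 are finite,
   the strict inequality forces f to be finite on all of [0, 1]. *)
definition strictly_convex_01 :: "(real \<Rightarrow> ennreal) \<Rightarrow> bool" where
  "strictly_convex_01 f \<longleftrightarrow>
     (\<forall>a\<in>{0..1}. \<forall>b\<in>{0..1}. \<forall>u\<in>{0<..<1}. a \<noteq> b \<longrightarrow>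
        f ((1 - u) * a + u * b) < ennreal (1 - u) * f a + ennreal u * f b)"

definition LIC :: "(plane \<Rightarrow> ennreal) \<Rightarrow> bool" where
  "LIC W \<longleftrightarrow>
     (\<forall>\<rho>0 \<rho>1. compactly_supported_prob \<rho>0 \<and> compactly_supported_prob \<rho>1 \<and> \<rho>0 \<noteq> \<rho>1 \<and>
        energy W \<rho>0 < \<infinity> \<and> energy W \<rho>1 < \<infinity> \<and>
        center_of_mass \<rho>0 = center_of_mass \<rho>1 \<longrightarrow>
        strictly_convex_01 (\<lambda>t. energy W (interpolation t \<rho>0 \<rho>1)))"

section \<open>Fourier transform of tempered distributions given by functions\<close>

definition fourier :: "(plane \<Rightarrow> complex) \<Rightarrow> plane \<Rightarrow> complex" where
  "fourier f \<xi> = (\<integral>x. f x * exp (- 2 * of_real pi * \<i> * of_real (x \<bullet> \<xi>)) \<partial>lborel)"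

definition dir_deriv :: "plane \<Rightarrow> (plane \<Rightarrow> complex) \<Rightarrow> plane \<Rightarrow> complex" where
  "dir_deriv v f x = frechet_derivative f (at x) v"

(* All iterated directional derivatives exist and decay faster than any power. *)
definition schwartz :: "(plane \<Rightarrow> complex) \<Rightarrow> bool" where
  "schwartz f \<longleftrightarrow>
     (\<forall>vs. (\<forall>x. fold dir_deriv vs f differentiable (at x)) \<and>
           (\<forall>k. \<exists>C. \<forall>x. norm x ^ k * norm (fold dir_deriv vs f x) \<le> C))"

(* u and v are functions acting on Schwartz functions by integration, and
   v is the distributional Fourier transform of u: <v, f> = <u, fourier f>. *)
definition has_fourier_transform :: "(plane \<Rightarrow> real) \<Rightarrow> (plane \<Rightarrow> real) \<Rightarrow> bool" where
  "has_fourier_transform u v \<longleftrightarrow>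
     (\<forall>f. schwartz f \<longrightarrow>
        integrable lborel (\<lambda>x. of_real (u x) * fourier f x) \<and>
        integrable lborel (\<lambda>\<xi>. of_real (v \<xi>) * f \<xi>) \<and>
        (\<integral>x. of_real (u x) * fourier f x \<partial>lborel) = (\<integral>\<xi>. of_real (v \<xi>) * f \<xi> \<partial>lborel))"

(* The angular part is unique as a continuous function on the circle, and it exists for
   0 < s < 2 and \<Omega> smooth and pi-periodic (it is real-valued because \<Omega> is even). Explicitly,
     Omega_tilde s \<Omega> \<phi>
       = \<tau> * (integral over \<theta> from - pi to pi of
                \<bar>cos (\<phi> - \<theta>)\<bar> powr (s - 2) * (\<Omega> \<theta> - \<Omega> (\<phi> + pi / 2)))
         + c * \<Omega> (\<phi> + pi / 2)
   with \<tau> = (2 * pi) powr (s - 2) * Gamma (2 - s) * cos ((2 - s) * pi / 2)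
   and  c = pi powr (s - 1) * Gamma ((2 - s) / 2) / Gamma (s / 2). *)
definition Omega_tilde :: "real \<Rightarrow> (real \<Rightarrow> real) \<Rightarrow> real \<Rightarrow> real" where
  "Omega_tilde s \<Omega> = (THE g. continuous_on UNIV g \<and> (\<forall>\<phi>. g (\<phi> + 2 * pi) = g \<phi>) \<and>
     has_fourier_transform (anisotropic_riesz s \<Omega>)
       (\<lambda>\<xi>. norm \<xi> powr (- 2 + s) * g (angle \<xi>)))"

end

theory Submission
  imports Defs "HOL-Complex_Analysis.Cauchy_Integral_Formula" "HOL-Real_Asymp.Real_Asymp"
begin

text \<open>
  Write \<open>U\<close> for the anisotropic Riesz kernel, \<open>g\<close> for \<open>Omega_tilde s \<Omega>\<close>, and
  \<open>H \<xi> = norm \<xi> powr (s - 2) * g (angle \<xi>)\<close> for the Fourier transform of \<open>U\<close>. Along the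
  interpolation between two measures of finite energy the energy is a quadratic polynomial in the
  time, so that it is strictly convex if and only if the energy of the difference \<open>\<mu>\<close> of the two
  measures is positive. Since \<open>\<mu>\<close> has total mass and first moment zero, the quadratic
  confinement contributes nothing to this energy, and in Fourier variables the Riesz part is half
  the integral of \<open>H\<close> times the squared modulus of the Fourier transform of \<open>\<mu>\<close>
  (\<open>strictly_convex_energy_iff\<close>). Hence the LIC property says that this integral is positive for
  all admissible pairs of distinct measures.

  If \<open>g\<close> is nonnegative, the integral is nonnegative. If it vanishes, the Fourier transform of
  \<open>\<mu>\<close> vanishes on an open cone on which \<open>g\<close> is positive; as \<open>\<mu>\<close> has compact support, its
  Fourier transform is entire along every line and therefore vanishes identically, so that
  \<open>\<mu> = 0\<close> (\<open>energy_positive\<close>). If \<open>g\<close> is negative in some direction, then long wave packets with a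
  frequency in that direction, made compatible with the moment conditions by taking a second
  difference, have negative energy (\<open>LIC_imp_angular_part_nonneg\<close>).

  Three facts make this rigorous. First, \<open>H\<close> exists: \<open>U\<close> is a superposition of the dilates
  \<open>x \<mapsto> \<Phi> (t x)\<close> of one integrable bump, weighted by \<open>t powr (s - 1)\<close>, and this
  can be transformed dilate by dilate because the Fourier transform of the bump decays
  quadratically (\<open>has_fourier_transform_mellin\<close>). The angular part is unique because Gaussian
  averages recover a locally integrable homogeneous function at its points of continuity
  (\<open>Omega_tilde_eq_angular_part\<close>). Second, the isotropic Riesz energy is a superposition of Gaussian
  energies, which in Fourier variables are integrals of nonnegative functions. So a finite energy
  makes \<open>norm \<xi> powr (s - 2)\<close> integrable against the squared modulus of the Fourier transform of
  the measure, and mutual energies are finite (\<open>finite_riesz_energy_imp\<close>, \<open>mutual_riesz_le\<close>).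
  Third, with this majorant at hand, the Fourier formula for anisotropic energies follows from the one
  for the Gaussian averages of \<open>U\<close>, whose Fourier transforms are integrable, by dominated convergence
  on both sides (\<open>mutual_riesz_identity\<close>).
\<close>

section \<open>Integrals over the plane\<close>

lemma measurable_fst_plane [measurable (raw)]:
  "f \<in> borel_measurable M \<Longrightarrow> (\<lambda>x. fst (f x :: plane)) \<in> borel_measurable M"
  by (rule measurable_compose[of f M borel]) (auto intro!: borel_measurable_continuous_onI continuous_intros)

lemma measurable_snd_plane [measurable (raw)]:
  "f \<in> borel_measurable M \<Longrightarrow> (\<lambda>x. snd (f x :: plane)) \<in> borel_measurable M"
  by (rule measurable_compose[of f M borel]) (auto intro!: borel_measurable_continuous_onI continuous_intros)

lemma plane_norm: "norm (x::plane) = sqrt ((fst x)\<^sup>2 + (snd x)\<^sup>2)"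
  by (simp add: norm_prod_def)

lemma plane_inner: "(x::plane) \<bullet> y = fst x * fst y + snd x * snd y"
  by (simp add: inner_prod_def)

lemma nn_integral_plane:
  assumes [measurable]: "f \<in> borel_measurable borel"
  shows "(\<integral>\<^sup>+x. f x \<partial>(lborel::plane measure)) = (\<integral>\<^sup>+x. \<integral>\<^sup>+y. f (x, y) \<partial>lborel \<partial>lborel)"
proof -
  have "(\<integral>\<^sup>+x. f x \<partial>(lborel::plane measure)) = (\<integral>\<^sup>+x. f x \<partial>(lborel \<Otimes>\<^sub>M lborel))"
    by (simp add: lborel_prod)
  also have "\<dots> = (\<integral>\<^sup>+x. \<integral>\<^sup>+y. f (x, y) \<partial>lborel \<partial>lborel)"
    by (rule lborel.nn_integral_fst[symmetric]) (simp add: lborel_prod)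
  finally show ?thesis .
qed

lemma integrable_plane_mult:
  fixes f g :: "real \<Rightarrow> 'a::{real_normed_field, banach, second_countable_topology}"
  assumes "integrable lborel f" "integrable lborel g"
  shows "integrable (lborel::plane measure) (\<lambda>x. f (fst x) * g (snd x))"
    and "(\<integral>x. f (fst x) * g (snd x) \<partial>(lborel::plane measure)) = (\<integral>x. f x \<partial>lborel) * (\<integral>x. g x \<partial>lborel)"
proof -
  have [measurable]: "f \<in> borel_measurable borel" "g \<in> borel_measurable borel"
    using assms by (auto dest: borel_measurable_integrable)
  show i: "integrable (lborel::plane measure) (\<lambda>x. f (fst x) * g (snd x))"
  proof (rule integrableI_bounded)
    have "(\<integral>\<^sup>+x. ennreal (norm (f (fst x) * g (snd x))) \<partial>(lborel::plane measure))
       = (\<integral>\<^sup>+x. \<integral>\<^sup>+y. ennreal (norm (f x)) * ennreal (norm (g y)) \<partial>lborel \<partial>lborel)"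
      by (subst nn_integral_plane) (auto simp: norm_mult ennreal_mult)
    also have "\<dots> = (\<integral>\<^sup>+x. ennreal (norm (f x)) \<partial>lborel) * (\<integral>\<^sup>+x. ennreal (norm (g x)) \<partial>lborel)"
      by (simp add: nn_integral_cmult nn_integral_multc)
    also have "\<dots> < \<infinity>"
      using assms by (auto simp: integrable_iff_bounded ennreal_mult_less_top)
    finally show "(\<integral>\<^sup>+x. ennreal (norm (f (fst x) * g (snd x))) \<partial>(lborel::plane measure)) < \<infinity>" .
  qed simp
  have "(\<integral>x. f (fst x) * g (snd x) \<partial>(lborel::plane measure)) = (\<integral>x. f (fst x) * g (snd x) \<partial>(lborel \<Otimes>\<^sub>M lborel))"
    by (simp add: lborel_prod)
  also have "\<dots> = (\<integral>x. (\<integral>y. f (fst (x,y)) * g (snd (x,y)) \<partial>lborel) \<partial>lborel)"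
    by (rule lborel_pair.integral_fst'[symmetric]) (use i in \<open>simp add: lborel_prod\<close>)
  also have "\<dots> = (\<integral>x. f x \<partial>lborel) * (\<integral>x. g x \<partial>lborel)"
    by simp
  finally show "(\<integral>x. f (fst x) * g (snd x) \<partial>(lborel::plane measure)) = (\<integral>x. f x \<partial>lborel) * (\<integral>x. g x \<partial>lborel)" .
qed

lemma nn_integral_plane_affine:
  assumes [measurable]: "f \<in> borel_measurable borel" and "c \<noteq> 0"
  shows "(\<integral>\<^sup>+x. f x \<partial>(lborel::plane measure)) = ennreal (c\<^sup>2) * (\<integral>\<^sup>+x. f (t + c *\<^sub>R x) \<partial>lborel)"
  by (subst lborel_affine[OF assms(2), of t])
    (simp add: nn_integral_density nn_integral_distr nn_integral_cmult power2_eq_square)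

lemma integral_plane_affine:
  fixes f :: "plane \<Rightarrow> 'a::{banach, second_countable_topology}"
  assumes [measurable]: "f \<in> borel_measurable borel" and "c \<noteq> 0"
  shows "(\<integral>x. f x \<partial>lborel) = c\<^sup>2 *\<^sub>R (\<integral>x. f (t + c *\<^sub>R x) \<partial>lborel)"
  by (subst lborel_affine[OF assms(2), of t])
    (simp add: integral_density integral_distr power2_eq_square)

lemma integrable_plane_affine:
  fixes f :: "plane \<Rightarrow> 'a::{banach, second_countable_topology}"
  assumes i: "integrable lborel f" and c: "c \<noteq> 0"
  shows "integrable lborel (\<lambda>x. f (t + c *\<^sub>R x))"
proof -
  have [measurable]: "f \<in> borel_measurable borel"
    using i by (auto dest: borel_measurable_integrable)
  have "(\<integral>\<^sup>+x. norm (f x) \<partial>lborel) < \<infinity>" using i by (simp add: integrable_iff_bounded)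
  then have "ennreal (c\<^sup>2) * (\<integral>\<^sup>+x. norm (f (t + c *\<^sub>R x)) \<partial>lborel) < \<infinity>"
    by (subst (asm) nn_integral_plane_affine[OF _ c, of _ t]) auto
  then have "(\<integral>\<^sup>+x. norm (f (t + c *\<^sub>R x)) \<partial>lborel) < \<infinity>"
    using c by (auto simp: ennreal_mult_less_top)
  then show ?thesis by (intro integrableI_bounded) auto
qed

lemma integral_swap:
  fixes f :: "'a \<Rightarrow> 'b \<Rightarrow> 'c::{banach, second_countable_topology}"
  assumes "sigma_finite_measure M" "sigma_finite_measure N"
    and [measurable]: "case_prod f \<in> borel_measurable (M \<Otimes>\<^sub>M N)"
    and fin: "(\<integral>\<^sup>+x. \<integral>\<^sup>+y. norm (f x y) \<partial>N \<partial>M) < \<infinity>"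
  shows "(\<integral>x. \<integral>y. f x y \<partial>N \<partial>M) = (\<integral>y. \<integral>x. f x y \<partial>M \<partial>N)"
    and "integrable M (\<lambda>x. \<integral>y. f x y \<partial>N)" and "integrable N (\<lambda>y. \<integral>x. f x y \<partial>M)"
proof -
  interpret pair_sigma_finite M N using assms by (simp add: pair_sigma_finite_def)
  have "(\<integral>\<^sup>+z. norm (case_prod f z) \<partial>(M \<Otimes>\<^sub>M N)) = (\<integral>\<^sup>+x. \<integral>\<^sup>+y. norm (f x y) \<partial>N \<partial>M)"
    by (subst M2.nn_integral_fst[symmetric]) auto
  with fin have i: "integrable (M \<Otimes>\<^sub>M N) (case_prod f)"
    by (intro integrableI_bounded) auto
  show "(\<integral>x. \<integral>y. f x y \<partial>N \<partial>M) = (\<integral>y. \<integral>x. f x y \<partial>M \<partial>N)"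
    by (rule Fubini_integral[symmetric, OF i])
  show "integrable M (\<lambda>x. \<integral>y. f x y \<partial>N)" by (rule integrable_fst[OF i])
  show "integrable N (\<lambda>y. \<integral>x. f x y \<partial>M)" by (rule integrable_snd[OF i])
qed

lemma nn_integral_swap:
  assumes "sigma_finite_measure M" "sigma_finite_measure N"
    and [measurable]: "case_prod f \<in> borel_measurable (M \<Otimes>\<^sub>M N)"
  shows "(\<integral>\<^sup>+x. \<integral>\<^sup>+y. f x y \<partial>N \<partial>M) = (\<integral>\<^sup>+y. \<integral>\<^sup>+x. f x y \<partial>M \<partial>N)"
proof -
  interpret pair_sigma_finite M N using assms by (simp add: pair_sigma_finite_def)
  show ?thesis using Fubini[of "case_prod f"] by simp
qed

lemma set_integrable_powr_0_1:
  assumes "p > -1" shows "set_integrable lborel {0<..1::real} (\<lambda>x. x powr p)"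
proof -
  have "(\<lambda>x. x powr p) integrable_on {0..1::real}"
    by (rule integrable_on_powr_from_0) (use assms in auto)
  then have "(\<lambda>x. x powr p) absolutely_integrable_on {0..1::real}"
    by (rule nonnegative_absolutely_integrable_1) auto
  then have "set_integrable lborel {0..1} (\<lambda>x::real. x powr p)"
    unfolding set_integrable_def by (subst (asm) integrable_completion) auto
  then show ?thesis by (rule set_integrable_subset) auto
qed

lemma set_integrable_powr_1_inf:
  assumes "p < -1" shows "set_integrable lborel {1..} (\<lambda>x::real. x powr p)"
proof -
  have "(\<lambda>x. x powr p) integrable_on {1::real..}"
    using has_integral_powr_to_inf[of p 1] assms by (auto simp: integrable_on_def)
  then have "(\<lambda>x. x powr p) absolutely_integrable_on {1::real..}"
    by (rule nonnegative_absolutely_integrable_1) auto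
  then show ?thesis
    unfolding set_integrable_def by (subst (asm) integrable_completion) auto
qed

lemma nn_integral_even:
  assumes [measurable]: "f \<in> borel_measurable borel" and even: "\<And>x::real. f (-x) = f x"
  shows "(\<integral>\<^sup>+x. f x \<partial>lborel) = 2 * (\<integral>\<^sup>+x\<in>{0<..}. f x \<partial>lborel)"
proof -
  have neg: "(\<integral>\<^sup>+x\<in>{..<0}. f x \<partial>lborel) = (\<integral>\<^sup>+x\<in>{0<..}. f x \<partial>lborel)"
    by (subst nn_integral_real_affine[where c="-1" and t=0])
       (auto simp: even intro!: nn_integral_cong split: split_indicator)
  have "(\<integral>\<^sup>+x. f x \<partial>lborel) = (\<integral>\<^sup>+x. f x * indicator {..<0} x + f x * indicator {0<..} x \<partial>lborel)"
    by (rule nn_integral_cong_AE) (use AE_lborel_singleton[of 0] in \<open>auto split: split_indicator\<close>)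
  also have "\<dots> = (\<integral>\<^sup>+x\<in>{..<0}. f x \<partial>lborel) + (\<integral>\<^sup>+x\<in>{0<..}. f x \<partial>lborel)"
    by (rule nn_integral_add) auto
  finally show ?thesis by (simp add: neg mult_2)
qed


lemma powr_mult_square: "0 < t \<Longrightarrow> (t::real) powr p * t\<^sup>2 = t powr (p + 2)"
  by (simp add: powr_add)

text \<open>The weight behaves like \<open>t powr (s - 1)\<close> near zero and like \<open>t powr (s - 3)\<close> at infinity. It
  dominates all integrals over dilations: both those of the kernel and those of its Fourier transform.\<close>
lemma set_integrable_mellin_weight:
  assumes "0 < s" "s < 2"
  shows "set_integrable lborel {0<..} (\<lambda>t::real. t powr (s - 1) / (1 + t\<^sup>2))"
  unfolding set_integrable_def
proof (rule Bochner_Integration.integrable_bound)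
  show "integrable lborel (\<lambda>t::real. indicator {0<..1} t *\<^sub>R t powr (s - 1) + indicator {1..} t *\<^sub>R t powr (s - 3))"
    using set_integrable_powr_0_1[of "s - 1"] set_integrable_powr_1_inf[of "s - 3"] assms
    by (auto simp: set_integrable_def)
  show "AE t in lborel. norm (indicator {0<..} t *\<^sub>R (t powr (s - 1) / (1 + t\<^sup>2)))
     \<le> norm (indicator {0<..1} t *\<^sub>R t powr (s - 1) + indicator {1..} t *\<^sub>R t powr (s - 3))"
  proof (rule AE_I2)
    fix t :: real
    show "norm (indicator {0<..} t *\<^sub>R (t powr (s - 1) / (1 + t\<^sup>2)))
     \<le> norm (indicator {0<..1} t *\<^sub>R t powr (s - 1) + indicator {1..} t *\<^sub>R t powr (s - 3))"
    proof (cases "0 < t")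
      case t: True
      have p: "t powr (s - 3) * t\<^sup>2 = t powr (s - 1)"
        using powr_mult_square[OF t, of "s - 3"] by simp
      have a: "t powr (s - 1) / (1 + t\<^sup>2) \<le> t powr (s - 1)"
        using t by (auto simp: divide_simps add_pos_nonneg intro!: mult_right_mono)
      have b: "t powr (s - 1) / (1 + t\<^sup>2) \<le> t powr (s - 3)"
        unfolding p[symmetric] using t by (auto simp: divide_simps add_pos_nonneg algebra_simps)
      show ?thesis using a b t by (auto split: split_indicator)
    qed auto
  qed
qed simp

text \<open>The norm of \<open>(x, y)\<close> dominates the geometric mean of the two
  coordinates, so the weight is at most a product of two functions of one variable.\<close>
lemma integrable_radial_weight:
  assumes "0 < a" "a < 2"
  shows "integrable lborel (\<lambda>x::plane. norm x powr (-a) / (1 + (norm x)\<^sup>2))"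
proof -
  define h :: "real \<Rightarrow> real" where "h x = \<bar>x\<bar> powr (-a/2) / sqrt (1 + x\<^sup>2)" for x
  have [measurable]: "h \<in> borel_measurable borel" unfolding h_def by measurable
  have even: "(\<integral>\<^sup>+x. h x \<partial>lborel) = 2 * (\<integral>\<^sup>+x\<in>{0<..}. h x \<partial>lborel)"
    by (rule nn_integral_even) (auto simp: h_def)
  have "(\<integral>\<^sup>+x\<in>{0<..}. h x \<partial>lborel)
    \<le> (\<integral>\<^sup>+t. ennreal (indicator {0<..1} t *\<^sub>R t powr (-a/2) + indicator {1..} t *\<^sub>R t powr (-a/2 - 1)) \<partial>lborel)"
  proof (rule nn_integral_mono)
    fix t :: real
    show "ennreal (h t) * indicator {0<..} t \<le> ennreal (indicator {0<..1} t *\<^sub>R t powr (-a/2) + indicator {1..} t *\<^sub>R t powr (-a/2 - 1))"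
    proof (cases "0 < t")
      case t: True
      have p: "t powr (-a/2 - 1) * t = t powr (-a/2)"
        using t by (simp add: powr_mult_base mult.commute)
      have a: "h t \<le> t powr (-a/2)"
        using t unfolding h_def by (auto simp: divide_simps add_pos_nonneg intro!: mult_right_mono)
      have "t \<le> sqrt (1 + t\<^sup>2)" by (rule real_le_rsqrt) simp
      then have "t powr (-a/2 - 1) * t \<le> t powr (-a/2 - 1) * sqrt (1 + t\<^sup>2)"
        by (intro mult_left_mono) auto
      then have b: "h t \<le> t powr (-a/2 - 1)"
        unfolding h_def p using t by (simp add: divide_le_eq add_pos_nonneg)
      have "h t \<le> indicator {0<..1} t *\<^sub>R t powr (-a/2) + indicator {1..} t *\<^sub>R t powr (-a/2 - 1)"
        using a b t by (auto split: split_indicator)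
      then show ?thesis using t by (simp add: ennreal_leI del: ennreal_plus)
    qed auto
  qed
  also have "\<dots> < \<infinity>"
  proof -
    have "integrable lborel (\<lambda>t::real. indicator {0<..1} t *\<^sub>R t powr (-a/2) + indicator {1..} t *\<^sub>R t powr (-a/2 - 1))"
      using set_integrable_powr_0_1[of "-a/2"] set_integrable_powr_1_inf[of "-a/2 - 1"] assms
      by (auto simp: set_integrable_def)
    then show ?thesis
      by (subst (asm) integrable_iff_bounded) auto
  qed
  finally have fin: "(\<integral>\<^sup>+x. h x \<partial>lborel) < \<infinity>"
    unfolding even by (simp add: ennreal_mult_less_top)
  have "(\<integral>\<^sup>+x. ennreal (norm x powr (-a) / (1 + (norm x)\<^sup>2)) \<partial>(lborel::plane measure))
     \<le> (\<integral>\<^sup>+x. \<integral>\<^sup>+y. ennreal (h x) * ennreal (h y) \<partial>lborel \<partial>lborel)"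
    unfolding nn_integral_plane[of "\<lambda>x. ennreal (norm x powr (-a) / (1 + (norm x)\<^sup>2))", simplified]
  proof (rule nn_integral_mono_AE, use AE_lborel_singleton[of 0] in eventually_elim, rule nn_integral_mono_AE, use AE_lborel_singleton[of 0] in eventually_elim)
    fix x y :: real assume x: "x \<noteq> 0" and y: "y \<noteq> 0"
    have n: "(norm (x,y))\<^sup>2 = x\<^sup>2 + y\<^sup>2" by (simp add: norm_prod_def)
    have "(norm (x,y))\<^sup>2 \<ge> \<bar>x\<bar> * \<bar>y\<bar>"
      using sum_squares_bound[of "\<bar>x\<bar>" "\<bar>y\<bar>"] mult_nonneg_nonneg[of "\<bar>x\<bar>" "\<bar>y\<bar>"]
      unfolding n power2_abs by linarith
    then have "((norm (x,y))\<^sup>2) powr (-a/2) \<le> (\<bar>x\<bar> * \<bar>y\<bar>) powr (-a/2)"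
      using x y assms by (intro powr_mono2') auto
    also have "((norm (x,y))\<^sup>2) powr (-a/2) = norm (x,y) powr (-a)"
      using powr_powr[of "norm (x,y)" 2 "-a/2"] x by (simp add: zero_prod_def)
    also have "(\<bar>x\<bar> * \<bar>y\<bar>) powr (-a/2) = \<bar>x\<bar> powr (-a/2) * \<bar>y\<bar> powr (-a/2)"
      by (simp add: powr_mult)
    finally have 1: "norm (x,y) powr (-a) \<le> \<bar>x\<bar> powr (-a/2) * \<bar>y\<bar> powr (-a/2)" .
    have "sqrt ((1 + x\<^sup>2) * (1 + y\<^sup>2)) \<le> 1 + (norm (x,y))\<^sup>2"
      unfolding n power2_eq_square[of "1 + (x\<^sup>2 + y\<^sup>2)"]
      by (rule real_le_lsqrt) (auto simp: power2_eq_square[of "1 + (x\<^sup>2 + y\<^sup>2)"] intro!: mult_mono)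
    then have "norm (x,y) powr (-a) / (1 + (norm (x,y))\<^sup>2) \<le> (\<bar>x\<bar> powr (-a/2) * \<bar>y\<bar> powr (-a/2)) / sqrt ((1 + x\<^sup>2) * (1 + y\<^sup>2))"
      using 1 by (intro frac_le) (auto simp: add_pos_nonneg)
    also have "\<dots> = h x * h y" by (simp add: h_def real_sqrt_mult)
    finally show "ennreal (norm (x,y) powr (-a) / (1 + (norm (x,y))\<^sup>2)) \<le> ennreal (h x) * ennreal (h y)"
      by (simp add: ennreal_mult[symmetric] h_def ennreal_leI)
  qed
  also have "\<dots> = (\<integral>\<^sup>+x. h x \<partial>lborel) * (\<integral>\<^sup>+x. h x \<partial>lborel)"
    by (simp add: nn_integral_cmult nn_integral_multc)
  also have "\<dots> < \<infinity>" using fin by (simp add: ennreal_mult_less_top)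
  finally show ?thesis by (intro integrableI_bounded) auto
qed

text \<open>An integrable product that is comparable to itself under translations by at most one. It serves as
  the common majorant for functions with enough decay.\<close>
definition decay_weight :: "plane \<Rightarrow> real" where
  "decay_weight y = inverse (1 + (fst y)\<^sup>2) * inverse (1 + (snd y)\<^sup>2)"

lemma decay_weight_nonneg: "0 \<le> decay_weight y"
  by (auto simp: decay_weight_def)

lemma inverse_square_le_decay_weight: "1 / (1 + (norm x)\<^sup>2)\<^sup>2 \<le> decay_weight x"
proof -
  have "(1 + (fst x)\<^sup>2) * (1 + (snd x)\<^sup>2) \<le> (1 + (norm x)\<^sup>2)\<^sup>2"
    unfolding power2_eq_square[of "1 + _"] by (intro mult_mono) (auto simp: plane_norm)
  moreover have "decay_weight x = 1 / ((1 + (fst x)\<^sup>2) * (1 + (snd x)\<^sup>2))"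
    by (simp add: decay_weight_def divide_inverse)
  ultimately show ?thesis
    by (simp only:) (intro divide_left_mono mult_pos_pos zero_less_power, auto simp: add_pos_nonneg)
qed

lemma integrable_decay_weight: "integrable lborel decay_weight"
proof -
  have i: "integrable lborel (\<lambda>x::real. inverse (1 + x\<^sup>2))"
    using integrable_inverse_1_plus_square
    by (simp add: set_integrable_def interval_lebesgue_integrable_def)
  show ?thesis
    unfolding decay_weight_def[abs_def] by (rule integrable_plane_mult(1)[OF i i])
qed

lemma decay_weight_shift:
  assumes "norm v \<le> 1" shows "decay_weight (y + v) \<le> 9 * decay_weight y"
proof -
  have aux: "inverse (1 + (a + b)\<^sup>2) \<le> 3 * inverse (1 + a\<^sup>2)" if "\<bar>b\<bar> \<le> 1" for a b :: real
  proof -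
    have "b\<^sup>2 \<le> 1" using that by (simp add: abs_square_le_1)
    moreover have "a\<^sup>2 \<le> 2 * (a+b)\<^sup>2 + 2 * b\<^sup>2"
      using zero_le_power2[of "a + 2*b"] by (simp add: power2_eq_square algebra_simps)
    ultimately have "1 + a\<^sup>2 \<le> 3 * (1 + (a+b)\<^sup>2)" by (smt (verit) zero_le_power2)
    then show ?thesis by (simp add: divide_simps add_pos_nonneg)
  qed
  have "\<bar>fst v\<bar> \<le> 1" "\<bar>snd v\<bar> \<le> 1"
    using norm_fst_le[of "fst v" "snd v"] norm_snd_le[of "snd v" "fst v"] assms by auto
  then have "decay_weight (y + v) \<le> (3 * inverse (1 + (fst y)\<^sup>2)) * (3 * inverse (1 + (snd y)\<^sup>2))"
    unfolding decay_weight_def by (intro mult_mono) (auto simp: aux add_pos_nonneg)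
  then show ?thesis by (simp add: decay_weight_def)
qed

section \<open>Fourier integrals of Gaussians\<close>

lemma exp_kernel: "exp (- 2 * of_real pi * \<i> * of_real r) = cis (- (2 * pi * r))"
  by (simp add: cis_conv_exp mult_ac)

lemma fourier_cis: "fourier f \<xi> = (\<integral>x. f x * cis (- (2 * pi * (x \<bullet> \<xi>))) \<partial>lborel)"
  by (simp only: fourier_def exp_kernel)

lemma measurable_cis [measurable]: "cis \<in> borel_measurable borel"
  by (intro borel_measurable_continuous_onI continuous_intros)

lemma gaussian_integral_1d:
  fixes a t :: real assumes a: "a > 0"
  shows "integrable lborel (\<lambda>x. of_real (exp (- (pi * a\<^sup>2 * x\<^sup>2))) * cis (2 * pi * (x * t)))"
    and "(\<integral>x. of_real (exp (- (pi * a\<^sup>2 * x\<^sup>2))) * cis (2 * pi * (x * t)) \<partial>lborel)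
          = of_real (exp (- (pi * t\<^sup>2 / a\<^sup>2)) / a)"
proof -
  define c where "c = a * sqrt (2 * pi)"
  have c: "c > 0" using a by (simp add: c_def)
  have c2: "c\<^sup>2 = 2 * pi * a\<^sup>2" by (simp add: c_def power_mult_distrib)
  let ?g = "\<lambda>y. of_real (std_normal_density y) * cis (2 * pi * t / c * y)"
  have ig: "integrable lborel ?g"
    by (rule Bochner_Integration.integrable_bound[OF integrable_normal_density[of 1 0]])
       (auto simp: norm_mult)
  have "char std_normal_distribution (2 * pi * t / c) = (\<integral>y. std_normal_density y *\<^sub>R iexp (2 * pi * t / c * y) \<partial>lborel)"
    unfolding char_def by (subst integral_density) auto
  also have "\<dots> = (\<integral>y. ?g y \<partial>lborel)"
    by (simp add: cis_conv_exp scaleR_conv_of_real)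
  finally have g: "(\<integral>y. ?g y \<partial>lborel) = of_real (exp (- (2 * pi * t / c)\<^sup>2 / 2))"
    by (simp add: char_std_normal_distribution)
  have scale: "?g (0 + c * x) = of_real (1 / sqrt (2 * pi)) * (of_real (exp (- (pi * a\<^sup>2 * x\<^sup>2))) * cis (2 * pi * (x * t)))" for x
    using c by (simp add: std_normal_density_def power_mult_distrib c2 mult_ac)
  have cancel: "of_real (sqrt (2 * pi)) * (of_real (1 / sqrt (2 * pi)) * z) = z" for z :: complex
    by simp
  have "integrable lborel (\<lambda>x. ?g (0 + c * x))"
    using c by (intro lborel_integrable_real_affine[OF ig]) auto
  then have "integrable lborel (\<lambda>x. of_real (sqrt (2 * pi)) * (of_real (1 / sqrt (2 * pi)) * (of_real (exp (- (pi * a\<^sup>2 * x\<^sup>2))) * cis (2 * pi * (x * t)))))"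
    unfolding scale by (rule integrable_mult_right)
  then show "integrable lborel (\<lambda>x. of_real (exp (- (pi * a\<^sup>2 * x\<^sup>2))) * cis (2 * pi * (x * t)))"
    by (simp only: cancel)
  have "(\<integral>y. ?g y \<partial>lborel) = \<bar>c\<bar> *\<^sub>R (\<integral>x. ?g (0 + c * x) \<partial>lborel)"
    using c by (intro lborel_integral_real_affine) auto
  then have "of_real (exp (- (2 * pi * t / c)\<^sup>2 / 2))
    = of_real c * (of_real (1 / sqrt (2 * pi)) * (\<integral>x. of_real (exp (- (pi * a\<^sup>2 * x\<^sup>2))) * cis (2 * pi * (x * t)) \<partial>lborel))"
    unfolding scale g using c by (simp add: scaleR_conv_of_real)
  moreover have "(2 * pi * t / c)\<^sup>2 / 2 = pi * t\<^sup>2 / a\<^sup>2"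
    unfolding power_divide c2 power_mult_distrib using a by (simp add: power2_eq_square)
  moreover have "c * (1 / sqrt (2 * pi)) = a" by (simp add: c_def)
  ultimately have "of_real (exp (- (pi * t\<^sup>2 / a\<^sup>2)))
    = complex_of_real a * (\<integral>x. of_real (exp (- (pi * a\<^sup>2 * x\<^sup>2))) * cis (2 * pi * (x * t)) \<partial>lborel)"
    by (metis (no_types, lifting) ab_semigroup_mult_class.mult_ac(1) minus_divide_left of_real_mult)
  then show "(\<integral>x. of_real (exp (- (pi * a\<^sup>2 * x\<^sup>2))) * cis (2 * pi * (x * t)) \<partial>lborel)
          = of_real (exp (- (pi * t\<^sup>2 / a\<^sup>2)) / a)"
    using a by (simp add: field_simps)
qed

lemma gaussian_integral_plane:
  fixes \<xi> :: plane assumes a: "a > 0"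
  shows "integrable lborel (\<lambda>x. of_real (exp (- (pi * a\<^sup>2 * (norm x)\<^sup>2))) * cis (2 * pi * (x \<bullet> \<xi>)))"
    and "(\<integral>x. of_real (exp (- (pi * a\<^sup>2 * (norm x)\<^sup>2))) * cis (2 * pi * (x \<bullet> \<xi>)) \<partial>lborel)
          = of_real (exp (- (pi * (norm \<xi>)\<^sup>2 / a\<^sup>2)) / a\<^sup>2)"
proof -
  have eq: "of_real (exp (- (pi * a\<^sup>2 * (norm x)\<^sup>2))) * cis (2 * pi * (x \<bullet> \<xi>)) =
     (of_real (exp (- (pi * a\<^sup>2 * (fst x)\<^sup>2))) * cis (2 * pi * (fst x * fst \<xi>))) *
     (of_real (exp (- (pi * a\<^sup>2 * (snd x)\<^sup>2))) * cis (2 * pi * (snd x * snd \<xi>)))" for x :: plane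
    by (simp add: plane_norm plane_inner distrib_left exp_diff exp_minus field_simps flip: cis_mult)
  note i = integrable_plane_mult[OF gaussian_integral_1d(1)[OF a] gaussian_integral_1d(1)[OF a]]
  show "integrable lborel (\<lambda>x. of_real (exp (- (pi * a\<^sup>2 * (norm x)\<^sup>2))) * cis (2 * pi * (x \<bullet> \<xi>)))"
    unfolding eq by (rule i)
  show "(\<integral>x. of_real (exp (- (pi * a\<^sup>2 * (norm x)\<^sup>2))) * cis (2 * pi * (x \<bullet> \<xi>)) \<partial>lborel)
          = of_real (exp (- (pi * (norm \<xi>)\<^sup>2 / a\<^sup>2)) / a\<^sup>2)"
    unfolding eq i(2) gaussian_integral_1d(2)[OF a]
    by (simp add: plane_norm distrib_left add_divide_distrib power2_eq_square flip: of_real_mult exp_add)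
qed

lemma gaussian_real_integral:
  assumes a: "a > 0"
  shows "integrable lborel (\<lambda>x::plane. exp (- (pi * a\<^sup>2 * (norm x)\<^sup>2)))"
    and "(\<integral>x. exp (- (pi * a\<^sup>2 * (norm (x::plane))\<^sup>2)) \<partial>lborel) = 1 / a\<^sup>2"
proof -
  have i: "integrable lborel (\<lambda>x::plane. complex_of_real (exp (- (pi * a\<^sup>2 * (norm x)\<^sup>2))))"
    using gaussian_integral_plane(1)[OF a, of 0] by simp
  then show "integrable lborel (\<lambda>x::plane. exp (- (pi * a\<^sup>2 * (norm x)\<^sup>2)))"
    by (simp only: complex_of_real_integrable_eq)
  have "complex_of_real (\<integral>x. exp (- (pi * a\<^sup>2 * (norm (x::plane))\<^sup>2)) \<partial>lborel) = complex_of_real (1 / a\<^sup>2)"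
    using gaussian_integral_plane(2)[OF a, of 0] by (simp flip: integral_complex_of_real)
  then show "(\<integral>x. exp (- (pi * a\<^sup>2 * (norm (x::plane))\<^sup>2)) \<partial>lborel) = 1 / a\<^sup>2"
    by (simp only: of_real_eq_iff)
qed

lemma fourier_modulated_gaussian:
  assumes a: "a > 0"
  shows "fourier (\<lambda>\<xi>. of_real (exp (- (pi * a\<^sup>2 * (norm \<xi>)\<^sup>2))) * cis (2 * pi * (z \<bullet> \<xi>))) x
     = of_real (exp (- (pi * (norm (z - x))\<^sup>2 / a\<^sup>2)) / a\<^sup>2)"
proof -
  have "cis (2 * pi * (z \<bullet> \<xi>)) * cis (- (2 * pi * (\<xi> \<bullet> x))) = cis (2 * pi * (\<xi> \<bullet> (z - x)))" for \<xi>
    by (simp add: cis_mult inner_diff_right inner_commute algebra_simps)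
  then show ?thesis
    unfolding fourier_cis gaussian_integral_plane(2)[OF a, symmetric] by (simp add: mult.assoc)
qed

section \<open>Gaussians times polynomials are Schwartz functions\<close>

inductive plane_poly :: "(plane \<Rightarrow> complex) \<Rightarrow> bool" where
  "plane_poly (\<lambda>x. c)"
| "plane_poly (\<lambda>x. of_real (fst x))"
| "plane_poly (\<lambda>x. of_real (snd x))"
| "plane_poly p \<Longrightarrow> plane_poly q \<Longrightarrow> plane_poly (\<lambda>x. p x + q x)"
| "plane_poly p \<Longrightarrow> plane_poly q \<Longrightarrow> plane_poly (\<lambda>x. p x * q x)"

lemma plane_poly_derivative:
  assumes "plane_poly p"
  shows "\<exists>p'. plane_poly p' \<and> (\<exists>D. \<forall>x. (p has_derivative D x) (at x) \<and> D x v = p' x)"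
  using assms
proof induction
  case (1 c)
  show ?case
    by (rule exI[of _ "\<lambda>x. 0"], intro conjI exI[of _ "\<lambda>x v. 0"] plane_poly.intros allI) auto
next
  case 2
  show ?case
    by (rule exI[of _ "\<lambda>x. of_real (fst v)"], intro conjI exI[of _ "\<lambda>x v. of_real (fst v)"] plane_poly.intros allI)
       (auto intro!: derivative_eq_intros)
next
  case 3
  show ?case
    by (rule exI[of _ "\<lambda>x. of_real (snd v)"], intro conjI exI[of _ "\<lambda>x v. of_real (snd v)"] plane_poly.intros allI)
       (auto intro!: derivative_eq_intros)
next
  case (4 p q)
  then obtain p' q' D E where "plane_poly p'" "plane_poly q'"
    "\<And>x. (p has_derivative D x) (at x)" "\<And>x. D x v = p' x" "\<And>x. (q has_derivative E x) (at x)" "\<And>x. E x v = q' x"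
    by metis
  then show ?case
    by (intro exI[of _ "\<lambda>x. p' x + q' x"] conjI exI[of _ "\<lambda>x v. D x v + E x v"] plane_poly.intros allI)
       (auto intro!: derivative_eq_intros)
next
  case (5 p q)
  then obtain p' q' D E where "plane_poly p'" "plane_poly q'"
    "\<And>x. (p has_derivative D x) (at x)" "\<And>x. D x v = p' x" "\<And>x. (q has_derivative E x) (at x)" "\<And>x. E x v = q' x"
    by metis
  then show ?case
    by (intro exI[of _ "\<lambda>x. p x * q' x + p' x * q x"] conjI exI[of _ "\<lambda>x v. p x * E x v + D x v * q x"] plane_poly.intros 5 allI)
       (auto intro!: derivative_eq_intros)
qed

lemma plane_poly_bound:
  assumes "plane_poly p" shows "\<exists>C m. \<forall>x. norm (p x) \<le> C * (1 + norm x) ^ m"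
  using assms
proof induction
  case (1 c) show ?case by (rule exI[of _ "norm c"], rule exI[of _ 0]) auto
next
  case 2 
  have "\<bar>fst x\<bar> \<le> 1 + norm x" for x :: plane using norm_fst_le[of "fst x" "snd x"] by auto
  then show ?case by (intro exI[of _ 1] exI[of _ "1::nat"]) auto
next
  case 3
  have "\<bar>snd x\<bar> \<le> 1 + norm x" for x :: plane using norm_snd_le[of "snd x" "fst x"] by auto
  then show ?case by (intro exI[of _ 1] exI[of _ "1::nat"]) auto
next
  case (4 p q)
  then obtain C m D n where b: "\<And>x. norm (p x) \<le> C * (1 + norm x) ^ m" "\<And>x. norm (q x) \<le> D * (1 + norm x) ^ n"
    by metis
  have "norm (p x + q x) \<le> (\<bar>C\<bar> + \<bar>D\<bar>) * (1 + norm x) ^ (m + n)" for x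
  proof -
    have "C * (1 + norm x) ^ m \<le> \<bar>C\<bar> * (1 + norm x) ^ (m+n)"
      by (intro mult_mono power_increasing) auto
    moreover have "D * (1 + norm x) ^ n \<le> \<bar>D\<bar> * (1 + norm x) ^ (m+n)"
      by (intro mult_mono power_increasing) auto
    ultimately show ?thesis using b[of x] norm_triangle_ineq[of "p x" "q x"] by (simp add: distrib_right)
  qed
  then show ?case by blast
next
  case (5 p q)
  then obtain C m D n where b: "\<And>x. norm (p x) \<le> C * (1 + norm x) ^ m" "\<And>x. norm (q x) \<le> D * (1 + norm x) ^ n"
    by metis
  have "norm (p x * q x) \<le> (C * D) * (1 + norm x) ^ (m + n)" for x
  proof -
    have "norm (p x) * norm (q x) \<le> (C * (1 + norm x) ^ m) * (D * (1 + norm x) ^ n)"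
      using order_trans[OF norm_ge_zero b(1)[of x]] by (intro mult_mono b) auto
    then show ?thesis by (simp add: norm_mult power_add mult_ac)
  qed
  then show ?case by blast
qed

text \<open>This class of functions is closed under directional derivatives. The coefficients \<open>b\<close> and \<open>c\<close> of
  the linear term are complex, so that it contains translated as well as modulated Gaussians.\<close>
definition gauss_poly :: "real \<Rightarrow> complex \<Rightarrow> complex \<Rightarrow> (plane \<Rightarrow> complex) \<Rightarrow> plane \<Rightarrow> complex" where
  "gauss_poly A b c p x = p x * exp (- (of_real A * (of_real (fst x) ^ 2 + of_real (snd x) ^ 2)) + b * of_real (fst x) + c * of_real (snd x))"

lemma gauss_poly_derivative:
  assumes "plane_poly p"
  shows "gauss_poly A b c p differentiable (at x)"
    and "\<exists>q. plane_poly q \<and> dir_deriv v (gauss_poly A b c p) = gauss_poly A b c q"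
proof -
  let ?e = "\<lambda>x::plane. exp (- (of_real A * (of_real (fst x) ^ 2 + of_real (snd x) ^ 2)) + b * of_real (fst x) + c * of_real (snd x))"
  obtain p' D where p: "plane_poly p'" "\<And>x. (p has_derivative D x) (at x)" "\<And>x. D x v = p' x"
    using plane_poly_derivative[OF assms] by metis
  let ?q = "\<lambda>x v. (of_real (- 2 * A * fst v) * of_real (fst x) + of_real (- 2 * A * snd v) * of_real (snd x) + (b * of_real (fst v) + c * of_real (snd v)))"
  have d: "(gauss_poly A b c p has_derivative (\<lambda>v. p x * (?q x v * ?e x) + D x v * ?e x)) (at x)" for x
  proof -
    have i: "((\<lambda>x. - (of_real A * (of_real (fst x) ^ 2 + of_real (snd x) ^ 2)) + b * of_real (fst x) + c * of_real (snd x))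
      has_derivative ?q x) (at x)"
      by (auto intro!: derivative_eq_intros simp: algebra_simps)
    have "(exp has_derivative (\<lambda>h. exp z * h)) (at z)" for z :: complex
      using DERIV_exp[of z] by (simp add: has_field_derivative_def)
    from has_derivative_compose[OF i this]
    have "(?e has_derivative (\<lambda>v. ?e x * ?q x v)) (at x)" .
    from has_derivative_mult[OF p(2)[of x] this] show ?thesis
      unfolding gauss_poly_def[abs_def] by (simp add: mult_ac)
  qed
  show "gauss_poly A b c p differentiable (at x)" using d[of x] unfolding differentiable_def by blast
  have "dir_deriv v (gauss_poly A b c p) = gauss_poly A b c (\<lambda>x. p x * ?q x v + p' x)"
    unfolding dir_deriv_def frechet_derivative_at[OF d, symmetric]
    by (auto simp: gauss_poly_def p algebra_simps)
  moreover have "plane_poly (\<lambda>x. p x * ?q x v + p' x)"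
    by (intro plane_poly.intros p assms)
  ultimately show "\<exists>q. plane_poly q \<and> dir_deriv v (gauss_poly A b c p) = gauss_poly A b c q" by blast
qed

lemma power_le_exp: "r \<ge> 0 \<Longrightarrow> r ^ k \<le> fact k * exp (r::real)"
proof -
  assume r: "r \<ge> 0"
  have "(\<Sum>n\<in>{k}. inverse (fact n) * r ^ n) \<le> (\<Sum>n. inverse (fact n) * r ^ n)"
    by (rule sum_le_suminf[OF summable_exp]) (use r in auto)
  then show ?thesis by (simp add: exp_def field_simps scaleR_conv_of_real)
qed

lemma gauss_poly_decay:
  assumes "plane_poly p" and A: "A > 0"
  shows "\<exists>C. \<forall>x. norm x ^ k * norm (gauss_poly A b c p x) \<le> C"
proof -
  obtain C m where C: "\<And>x. norm (p x) \<le> C * (1 + norm x) ^ m" using plane_poly_bound[OF assms(1)] by metis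
  define B where "B = norm b + norm c + 1"
  have "norm x ^ k * norm (gauss_poly A b c p x) \<le> \<bar>C\<bar> * fact (k + m) * exp (1 + B\<^sup>2 / (4 * A))" for x
  proof -
    let ?r = "norm x"
    have f: "\<bar>fst x\<bar> \<le> ?r" "\<bar>snd x\<bar> \<le> ?r" 
      using norm_fst_le[of "fst x" "snd x"] norm_snd_le[of "snd x" "fst x"] by auto
    have "Re (b * of_real (fst x)) \<le> norm b * ?r"
      using complex_Re_le_cmod[of "b * of_real (fst x)"] mult_left_mono[OF f(1), of "norm b"] by (simp add: norm_mult)
    moreover have "Re (c * of_real (snd x)) \<le> norm c * ?r"
      using complex_Re_le_cmod[of "c * of_real (snd x)"] mult_left_mono[OF f(2), of "norm c"] by (simp add: norm_mult)
    ultimately have "Re (- (of_real A * (of_real (fst x) ^ 2 + of_real (snd x) ^ 2)) + b * of_real (fst x) + c * of_real (snd x))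
       \<le> - (A * ?r\<^sup>2) + norm b * ?r + norm c * ?r"
      by (simp add: plane_norm flip: of_real_power)
    then have e: "norm (exp (- (of_real A * (of_real (fst x) ^ 2 + of_real (snd x) ^ 2)) + b * of_real (fst x) + c * of_real (snd x)))
      \<le> exp (- (A * ?r\<^sup>2) + (norm b + norm c) * ?r)" by (simp add: distrib_right)
    have pw: "(1 + ?r) ^ (k+m) \<le> fact (k+m) * exp (1 + ?r)" by (rule power_le_exp) simp
    have "?r ^ k * norm (gauss_poly A b c p x)
       \<le> (1 + ?r) ^ k * ((\<bar>C\<bar> * (1 + ?r) ^ m) * exp (- (A * ?r\<^sup>2) + (norm b + norm c) * ?r))"
      unfolding gauss_poly_def norm_mult
      by (intro mult_mono power_mono e order_trans[OF C]) auto
    also have "\<dots> = \<bar>C\<bar> * (1 + ?r) ^ (k+m) * exp (- (A * ?r\<^sup>2) + (norm b + norm c) * ?r)"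
      by (simp add: power_add)
    also have "\<dots> \<le> \<bar>C\<bar> * (fact (k+m) * exp (1 + ?r)) * exp (- (A * ?r\<^sup>2) + (norm b + norm c) * ?r)"
      by (intro mult_right_mono mult_left_mono pw) auto
    also have "\<dots> = \<bar>C\<bar> * fact (k+m) * exp (1 + (B * ?r - A * ?r\<^sup>2))"
      by (simp add: exp_add[symmetric] B_def algebra_simps)
    also have "B * ?r - A * ?r\<^sup>2 \<le> B\<^sup>2 / (4 * A)"
      using A zero_le_power2[of "2 * A * ?r - B"] by (simp add: field_simps power2_eq_square)
    finally show ?thesis by (simp add: mult_left_mono)
  qed
  then show ?thesis by blast
qed

lemma schwartz_gauss_poly:
  assumes "plane_poly p" and A: "A > 0"
  shows "schwartz (gauss_poly A b c p)"
  unfolding schwartz_def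
proof
  fix vs
  have "\<exists>q. plane_poly q \<and> fold dir_deriv vs (gauss_poly A b c p) = gauss_poly A b c q"
    using assms(1)
  proof (induction vs arbitrary: p)
    case (Cons v vs)
    then show ?case using gauss_poly_derivative(2)[OF Cons.prems, of v A b c] by fastforce
  qed auto
  then obtain q where "plane_poly q" "fold dir_deriv vs (gauss_poly A b c p) = gauss_poly A b c q" by blast
  then show "(\<forall>x. fold dir_deriv vs (gauss_poly A b c p) differentiable (at x)) \<and>
           (\<forall>k. \<exists>C. \<forall>x. norm x ^ k * norm (fold dir_deriv vs (gauss_poly A b c p) x) \<le> C)"
    using gauss_poly_derivative(1) gauss_poly_decay A by simp
qed

text \<open>Testing a distributional Fourier transform against these functions gives the Gaussian averages of the
  original function.\<close>
lemma schwartz_modulated_gaussian: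
  assumes a: "a > 0"
  shows "schwartz (\<lambda>\<xi>. of_real (exp (- (pi * a\<^sup>2 * (norm \<xi>)\<^sup>2))) * cis (2 * pi * (z \<bullet> \<xi>)))"
proof -
  have "of_real (exp (- (pi * a\<^sup>2 * (norm \<xi>)\<^sup>2))) * cis (2 * pi * (z \<bullet> \<xi>))
    = gauss_poly (pi * a\<^sup>2) (\<i> * of_real (2 * pi * fst z)) (\<i> * of_real (2 * pi * snd z)) (\<lambda>x. 1) \<xi>" for \<xi>
  proof -
    have "of_real (exp (- (pi * a\<^sup>2 * (norm \<xi>)\<^sup>2))) * cis (2 * pi * (z \<bullet> \<xi>))
      = exp (of_real (- (pi * a\<^sup>2 * (norm \<xi>)\<^sup>2)) + \<i> * of_real (2 * pi * (z \<bullet> \<xi>)))"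
      by (simp only: cis_conv_exp exp_of_real[symmetric] exp_add)
    also have "of_real (- (pi * a\<^sup>2 * (norm \<xi>)\<^sup>2)) + \<i> * of_real (2 * pi * (z \<bullet> \<xi>))
       = - (of_real (pi * a\<^sup>2) * (of_real (fst \<xi>) ^ 2 + of_real (snd \<xi>) ^ 2)) + \<i> * of_real (2 * pi * fst z) * of_real (fst \<xi>) + \<i> * of_real (2 * pi * snd z) * of_real (snd \<xi>)"
      by (simp add: plane_norm plane_inner algebra_simps flip: of_real_power)
    finally show ?thesis by (simp add: gauss_poly_def)
  qed
  then show ?thesis using schwartz_gauss_poly[OF plane_poly.intros(1), of "pi * a\<^sup>2"] a by simp
qed

text \<open>Testing against these functions gives the Gaussian averages of the transform itself.\<close>
lemma schwartz_shifted_gaussian: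
  assumes a: "a > 0"
  shows "schwartz (\<lambda>\<xi>. of_real (exp (- (pi * a\<^sup>2 * (norm (z - \<xi>))\<^sup>2))))"
proof -
  have "of_real (exp (- (pi * a\<^sup>2 * (norm (z - \<xi>))\<^sup>2)))
    = gauss_poly (pi * a\<^sup>2) (of_real (2 * pi * a\<^sup>2 * fst z)) (of_real (2 * pi * a\<^sup>2 * snd z)) (\<lambda>x. of_real (exp (- (pi * a\<^sup>2 * (norm z)\<^sup>2)))) \<xi>" for \<xi>
  proof -
    have "- (pi * a\<^sup>2 * (norm (z - \<xi>))\<^sup>2) = - (pi * a\<^sup>2 * (norm z)\<^sup>2) + (- ((pi * a\<^sup>2) * ((fst \<xi>)\<^sup>2 + (snd \<xi>)\<^sup>2)) + (2 * pi * a\<^sup>2 * fst z) * fst \<xi> + (2 * pi * a\<^sup>2 * snd z) * snd \<xi>)"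
      by (simp add: plane_norm) (simp add: power2_diff algebra_simps)
    then have "complex_of_real (exp (- (pi * a\<^sup>2 * (norm (z - \<xi>))\<^sup>2))) = 
      of_real (exp (- (pi * a\<^sup>2 * (norm z)\<^sup>2))) * of_real (exp (- ((pi * a\<^sup>2) * ((fst \<xi>)\<^sup>2 + (snd \<xi>)\<^sup>2)) + (2 * pi * a\<^sup>2 * fst z) * fst \<xi> + (2 * pi * a\<^sup>2 * snd z) * snd \<xi>))"
      by (simp only: exp_add of_real_mult)
    then show ?thesis 
      by (simp only: gauss_poly_def exp_of_real[symmetric] of_real_add of_real_minus of_real_mult of_real_power)
  qed
  then show ?thesis using schwartz_gauss_poly[OF plane_poly.intros(1), of "pi * a\<^sup>2"] a by simp
qed

section \<open>Quadratic decay of Fourier transforms\<close>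

lemma second_difference_line:
  fixes p :: "real \<Rightarrow> 'a::real_inner"
  assumes p1: "\<And>t. (p has_vector_derivative p1 t) (at t)"
    and p2: "\<And>t. (p1 has_vector_derivative p2 t) (at t)"
    and B: "\<And>t. \<bar>t\<bar> \<le> 1 \<Longrightarrow> norm (p2 t) \<le> B"
  shows "norm (p 1 + p (-1) - 2 *\<^sub>R p 0) \<le> 2 * B"
proof -
  have d1: "norm (p1 t - p1 (-t)) \<le> 2 * B" if t: "0 < t" "t < 1" for t
  proof -
    have "\<exists>x\<in>{-t<..<t}. norm (p1 t - p1 (-t)) \<le> norm ((t - (-t)) *\<^sub>R p2 x)"
      using t p2 by (intro mvt_general) (auto intro!: continuous_at_imp_continuous_on has_vector_derivative_continuous simp: has_vector_derivative_def)
    then obtain x where x: "-t < x" "x < t" "norm (p1 t - p1 (-t)) \<le> 2 * t * norm (p2 x)"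
      using t by auto
    have "2 * t * norm (p2 x) \<le> 2 * 1 * B" using x t B[of x] by (intro mult_mono) auto
    then show ?thesis using x(3) by simp
  qed
  have q: "((\<lambda>t. p t + p (-t) - 2 *\<^sub>R p 0) has_vector_derivative (p1 t - p1 (-t))) (at t)" for t
  proof -
    have "((\<lambda>t. p (- t)) has_vector_derivative (-1) *\<^sub>R p1 (-t)) (at t)"
    proof -
      have "(uminus has_vector_derivative (-1::real)) (at t)"
        by (auto intro!: derivative_eq_intros)
      from vector_diff_chain_at[OF this p1[of "-t"]] show ?thesis by (simp add: o_def)
    qed
    from has_vector_derivative_diff[OF has_vector_derivative_add[OF p1[of t] this] has_vector_derivative_const[of "2 *\<^sub>R p 0"]]
    show ?thesis by simp
  qed
  have "\<exists>x\<in>{0<..<1}. norm ((p 1 + p (-1) - 2 *\<^sub>R p 0) - (p 0 + p (-0) - 2 *\<^sub>R p 0)) \<le> norm ((1 - 0) *\<^sub>R (p1 x - p1 (-x)))"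
    using q by (intro mvt_general[where f="\<lambda>t. p t + p (-t) - 2 *\<^sub>R p 0"]) 
      (auto intro!: continuous_at_imp_continuous_on has_vector_derivative_continuous simp: has_vector_derivative_def)
  then show ?thesis using d1 by (auto simp: scaleR_2 intro: order_trans)
qed

lemma norm_integral_le:
  fixes f :: "'a \<Rightarrow> 'b::{banach, second_countable_topology}"
  assumes "integrable M w" "AE x in M. norm (f x) \<le> w x"
  shows "norm (\<integral>x. f x \<partial>M) \<le> (\<integral>x. w x \<partial>M)"
  by (rule order_trans[OF integral_norm_bound integral_mono_AE'])
     (use assms in \<open>auto intro: order_trans[OF norm_ge_zero]\<close>)

lemma norm_fourier_le:
  "norm (fourier f \<xi>) \<le> (\<integral>x. norm (f x) \<partial>lborel)"
  unfolding fourier_cis by (rule order_trans[OF integral_norm_bound]) (simp add: norm_mult)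

lemma integrable_mult_cis:
  assumes "integrable M (f :: _ \<Rightarrow> complex)" and [measurable]: "g \<in> borel_measurable M"
  shows "integrable M (\<lambda>x. f x * cis (g x))"
  by (rule Bochner_Integration.integrable_bound[OF assms(1)])
     (use assms in \<open>auto simp: norm_mult\<close>)

text \<open>Translating by \<open>v = \<xi> / (2 * (norm \<xi>)\<^sup>2)\<close>, in either direction, multiplies the Fourier transform at
  \<open>\<xi>\<close> by \<open>-1\<close>. So the second difference with step \<open>v\<close> has the value \<open>-4\<close> times the transform there, while
  its integral is of the order of the square of the step.\<close>
lemma fourier_decay_second_difference:
  assumes f: "integrable lborel f"
    and diff: "\<And>v y. norm v \<le> 1 \<Longrightarrow> norm (f (y + v) + f (y - v) - 2 * f y) \<le> K * (norm v)\<^sup>2 * decay_weight y"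
    and K: "K \<ge> 0"
  shows "\<exists>C\<ge>0. \<forall>\<xi>. norm (fourier f \<xi>) \<le> C / (1 + (norm \<xi>)\<^sup>2)"
proof -
  have [measurable]: "f \<in> borel_measurable borel" using f by auto
  define A where "A = (\<integral>x. norm (f x) \<partial>lborel)"
  define V where "V = (\<integral>x. decay_weight x \<partial>lborel)"
  have A: "A \<ge> 0" by (simp add: A_def)
  have V: "V \<ge> 0" by (simp add: V_def decay_weight_nonneg)
  have "norm (fourier f \<xi>) \<le> (2 * A + K * V) / (1 + (norm \<xi>)\<^sup>2)" for \<xi>
  proof (cases "norm \<xi> \<le> 1/2")
    case True
    then have "(norm \<xi>)\<^sup>2 \<le> 1" by (simp add: abs_square_le_1)
    then have "A * (1 + (norm \<xi>)\<^sup>2) \<le> A * 2" using A by (intro mult_left_mono) auto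
    then have "A * (1 + (norm \<xi>)\<^sup>2) \<le> 2 * A + K * V" using K V by (simp add: add_increasing2)
    then have "A \<le> (2 * A + K * V) / (1 + (norm \<xi>)\<^sup>2)" by (simp add: pos_le_divide_eq add_pos_nonneg)
    then show ?thesis using norm_fourier_le[of f \<xi>] by (simp add: A_def)
  next
    case False
    then have n: "norm \<xi> > 1/2" by simp
    then have n2: "(norm \<xi>)\<^sup>2 > 1/4" using power_strict_mono[of "1/2" "norm \<xi>" 2] by (simp add: power_divide)
    have nz: "\<xi> \<noteq> 0" using n by auto
    have pos: "(norm \<xi>)\<^sup>2 > 0" using n2 by (rule less_trans[rotated]) simp
    define v where "v = (1 / (2 * (norm \<xi>)\<^sup>2)) *\<^sub>R \<xi>"
    have nv: "norm v = 1 / (2 * norm \<xi>)" using nz by (simp add: v_def power2_eq_square)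
    have v1: "norm v \<le> 1" unfolding nv using n by (subst divide_le_eq_1_pos) auto
    have vx: "v \<bullet> \<xi> = 1/2" using nz by (simp add: v_def power2_norm_eq_inner[symmetric])
    have nv2: "(norm v)\<^sup>2 = 1 / (4 * (norm \<xi>)\<^sup>2)" by (simp add: nv power_divide power_mult_distrib)
    let ?F = "fourier f \<xi>"
    \<comment> \<open>translation by \<open>v\<close> and by \<open>-v\<close> changes the sign of the transform at \<open>\<xi>\<close>\<close>
    have trans: "(\<integral>y. f (w + 1 *\<^sub>R y) * cis (- (2 * pi * (y \<bullet> \<xi>))) \<partial>lborel) = - ?F" if w: "w \<bullet> \<xi> = 1/2 \<or> w \<bullet> \<xi> = -1/2" for w
    proof -
      have "?F = (\<integral>y. f (w + 1 *\<^sub>R y) * cis (- (2 * pi * ((w + 1 *\<^sub>R y) \<bullet> \<xi>))) \<partial>lborel)"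
        unfolding fourier_cis by (subst integral_plane_affine[of _ 1 w]) auto
      also have "\<dots> = (\<integral>y. - (f (w + 1 *\<^sub>R y) * cis (- (2 * pi * (y \<bullet> \<xi>)))) \<partial>lborel)"
      proof (rule Bochner_Integration.integral_cong[OF refl])
        fix y
        have "cis (- (2 * pi * ((w + 1 *\<^sub>R y) \<bullet> \<xi>))) = cis (- (2 * pi * (w \<bullet> \<xi>))) * cis (- (2 * pi * (y \<bullet> \<xi>)))"
          by (simp add: cis_mult inner_add_left algebra_simps)
        also have "cis (- (2 * pi * (w \<bullet> \<xi>))) = -1"
        proof -
          have "2 * pi * (w \<bullet> \<xi>) = pi \<or> 2 * pi * (w \<bullet> \<xi>) = - pi" using w by (elim disjE) simp_all
          then show ?thesis by (elim disjE; simp only:; simp add: complex_eq_iff)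
        qed
        finally show "f (w + 1 *\<^sub>R y) * cis (- (2 * pi * ((w + 1 *\<^sub>R y) \<bullet> \<xi>))) = - (f (w + 1 *\<^sub>R y) * cis (- (2 * pi * (y \<bullet> \<xi>))))"
          by simp
      qed
      finally show ?thesis by simp
    qed
    have i: "integrable lborel (\<lambda>y. f (w + 1 *\<^sub>R y) * cis (- (2 * pi * (y \<bullet> \<xi>))))" for w
      by (intro integrable_mult_cis integrable_plane_affine f) auto
    have "(\<integral>y. (f (y + v) + f (y - v) - 2 * f y) * cis (- (2 * pi * (y \<bullet> \<xi>))) \<partial>lborel)
      = (\<integral>y. f (v + 1 *\<^sub>R y) * cis (- (2 * pi * (y \<bullet> \<xi>))) + f (-v + 1 *\<^sub>R y) * cis (- (2 * pi * (y \<bullet> \<xi>)))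
          - 2 * (f y * cis (- (2 * pi * (y \<bullet> \<xi>)))) \<partial>lborel)"
      by (intro Bochner_Integration.integral_cong) (auto simp: algebra_simps)
    also have "\<dots> = - ?F + - ?F - 2 * ?F"
      using i[of v] i[of "-v"] i[of 0] trans[of v] trans[of "-v"] vx
      by (simp add: fourier_cis)
    finally have "- 4 * ?F = (\<integral>y. (f (y + v) + f (y - v) - 2 * f y) * cis (- (2 * pi * (y \<bullet> \<xi>))) \<partial>lborel)"
      by simp
    then have "4 * norm ?F = norm (\<integral>y. (f (y + v) + f (y - v) - 2 * f y) * cis (- (2 * pi * (y \<bullet> \<xi>))) \<partial>lborel)"
      by (metis norm_minus_cancel norm_mult norm_numeral mult_minus_left)
    also have "\<dots> \<le> (\<integral>y. K * (norm v)\<^sup>2 * decay_weight y \<partial>lborel)"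
      using diff[OF v1] by (intro norm_integral_le integrable_mult_right integrable_decay_weight) (auto simp: norm_mult)
    also have "\<dots> = K * V / (4 * (norm \<xi>)\<^sup>2)" by (simp add: V_def nv2)
    finally have "norm ?F \<le> K * V / (16 * (norm \<xi>)\<^sup>2)" by simp
    also have "\<dots> \<le> (2 * A + K * V) / (1 + (norm \<xi>)\<^sup>2)"
      using A K V n2 by (intro frac_le) auto
    finally show ?thesis .
  qed
  then show ?thesis using A K V by (intro exI[of _ "2 * A + K * V"]) auto
qed

text \<open>The second difference of \<open>f\<close> along a line is controlled by the second derivative along that line, and derivatives
  along lines can be computed for a function that is given in polar coordinates.\<close>
lemma fourier_decay:
  assumes f: "integrable lborel f" and K: "K \<ge> 0"
    and f1: "\<And>y v t. ((\<lambda>t. f (y + t *\<^sub>R v)) has_vector_derivative f1 v (y + t *\<^sub>R v)) (at t)"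
    and f2: "\<And>y v t. ((\<lambda>t. f1 v (y + t *\<^sub>R v)) has_vector_derivative f2 v (y + t *\<^sub>R v)) (at t)"
    and bnd: "\<And>v y. norm (f2 v y) \<le> K * (norm v)\<^sup>2 * decay_weight y"
  shows "\<exists>C\<ge>0. \<forall>\<xi>. norm (fourier f \<xi>) \<le> C / (1 + (norm \<xi>)\<^sup>2)"
proof (rule fourier_decay_second_difference[OF f, of "18 * K"])
  fix v y :: plane assume v: "norm v \<le> 1"
  have "norm (f (y + 1 *\<^sub>R v) + f (y + (-1) *\<^sub>R v) - 2 *\<^sub>R f (y + 0 *\<^sub>R v)) \<le> 2 * (9 * K * (norm v)\<^sup>2 * decay_weight y)"
  proof (rule second_difference_line[OF f1 f2])
    fix t :: real assume t: "\<bar>t\<bar> \<le> 1"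
    have "norm (f2 v (y + t *\<^sub>R v)) \<le> K * (norm v)\<^sup>2 * decay_weight (y + t *\<^sub>R v)" by (rule bnd)
    also have "\<dots> \<le> K * (norm v)\<^sup>2 * (9 * decay_weight y)"
      using t v K by (intro mult_left_mono decay_weight_shift) (auto simp: mult_le_one)
    finally show "norm (f2 v (y + t *\<^sub>R v)) \<le> 9 * K * (norm v)\<^sup>2 * decay_weight y" by simp
  qed
  then show "norm (f (y + v) + f (y - v) - 2 * f y) \<le> 18 * K * (norm v)\<^sup>2 * decay_weight y"
    by (simp add: scaleR_conv_of_real)
qed (use K in simp)

lemma schwartz_bound:
  assumes "schwartz f"
  shows "\<exists>C\<ge>0. \<forall>y. norm (fold dir_deriv vs f y) \<le> C * decay_weight y"
proof -
  obtain C where C: "\<And>k x. norm x ^ k * norm (fold dir_deriv vs f x) \<le> C k"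
    using assms unfolding schwartz_def by metis
  have "norm (fold dir_deriv vs f y) \<le> 2 * (C 0 + C 4) * decay_weight y" for y
  proof -
    have "2 * (norm y)\<^sup>2 \<le> 1 + norm y ^ 4"
      using zero_le_power2[of "(norm y)\<^sup>2 - 1"] by (simp add: power2_diff power_mult[symmetric])
    then have "(1 + (norm y)\<^sup>2)\<^sup>2 \<le> 2 * (1 + norm y ^ 4)" by (simp add: power2_sum power_mult[symmetric])
    moreover have "(1 + (fst y)\<^sup>2) * (1 + (snd y)\<^sup>2) \<le> (1 + (norm y)\<^sup>2)\<^sup>2"
      unfolding power2_eq_square[of "1 + _"] by (intro mult_mono) (auto simp: plane_norm)
    ultimately have "norm (fold dir_deriv vs f y) * ((1 + (fst y)\<^sup>2) * (1 + (snd y)\<^sup>2)) \<le> norm (fold dir_deriv vs f y) * (2 * (1 + norm y ^ 4))"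
      by (intro mult_left_mono) auto
    also have "\<dots> \<le> 2 * (C 0 + C 4)" using C[of y 0] C[of y 4] by (simp add: algebra_simps)
    finally show ?thesis by (simp add: decay_weight_def field_simps add_pos_nonneg)
  qed
  moreover have "C 0 \<ge> 0" "C 4 \<ge> 0" using C[of 0 0] C[of 0 4] order_trans[OF norm_ge_zero C[of 0 0, simplified]] by auto
  ultimately show ?thesis by (intro exI[of _ "2 * (C 0 + C 4)"]) auto
qed

lemma schwartz_differentiable: "schwartz f \<Longrightarrow> fold dir_deriv vs f differentiable (at x)"
  unfolding schwartz_def by blast

lemma schwartz_continuous: "schwartz f \<Longrightarrow> continuous_on UNIV f"
  using schwartz_differentiable[of f "[]"]
  by (auto intro!: continuous_at_imp_continuous_on differentiable_imp_continuous_within)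

lemma schwartz_measurable: "schwartz f \<Longrightarrow> f \<in> borel_measurable borel"
  by (intro borel_measurable_continuous_onI schwartz_continuous)

lemma schwartz_integrable:
  assumes f: "schwartz f" shows "integrable lborel f"
proof -
  obtain C where "C \<ge> 0" "\<And>y. norm (f y) \<le> C * decay_weight y" using schwartz_bound[OF f, of "[]"] by auto
  then show ?thesis
    by (intro Bochner_Integration.integrable_bound[OF integrable_mult_right[OF integrable_decay_weight, of C]])
       (use schwartz_measurable[OF f] in \<open>auto intro!: AE_I2 order_trans[OF _ abs_ge_self]\<close>)
qed

lemma dir_deriv_has_derivative:
  assumes "f differentiable (at x)" shows "(f has_derivative (\<lambda>v. dir_deriv v f x)) (at x)"
  using assms by (simp add: dir_deriv_def frechet_derivative_works[symmetric])

lemma dir_deriv_line: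
  assumes "\<And>x. f differentiable (at x)"
  shows "((\<lambda>t. f (y + t *\<^sub>R v)) has_vector_derivative dir_deriv v f (y + t *\<^sub>R v)) (at t)"
proof -
  let ?D = "\<lambda>v. dir_deriv v f (y + t *\<^sub>R v)"
  have l: "linear (\<lambda>w. dir_deriv w f (y + t *\<^sub>R v))"
    using dir_deriv_has_derivative[OF assms, of "y + t *\<^sub>R v"] by (rule has_derivative_linear)
  have "((\<lambda>t. y + t *\<^sub>R v) has_derivative (\<lambda>h. h *\<^sub>R v)) (at t)"
    by (auto intro!: derivative_eq_intros)
  from has_derivative_compose[OF this dir_deriv_has_derivative[OF assms, of "y + t *\<^sub>R v"]]
  show ?thesis by (simp add: has_vector_derivative_def linear_scale[OF l])
qed

text \<open>Linearity in the direction reduces bounds that are uniform over all directions to the two coordinate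
  directions.\<close>
lemma dir_deriv_expand:
  assumes "\<And>x. f differentiable (at x)"
  shows "dir_deriv v f x = of_real (fst v) * dir_deriv (1,0) f x + of_real (snd v) * dir_deriv (0,1) f x"
proof -
  have l: "linear (\<lambda>w. dir_deriv w f x)"
    using dir_deriv_has_derivative[OF assms] by (rule has_derivative_linear)
  have "v = fst v *\<^sub>R (1,0) + snd v *\<^sub>R (0,1)" by simp
  then have "dir_deriv v f x = dir_deriv (fst v *\<^sub>R (1,0) + snd v *\<^sub>R (0,1)) f x" by metis
  also have "\<dots> = fst v *\<^sub>R dir_deriv (1,0) f x + snd v *\<^sub>R dir_deriv (0,1) f x"
    by (simp only: linear_add[OF l] linear_scale[OF l])
  finally show ?thesis by (simp add: scaleR_conv_of_real)
qed

lemma schwartz_fourier_decay: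
  assumes f: "schwartz f"
  shows "\<exists>C\<ge>0. \<forall>\<xi>. norm (fourier f \<xi>) \<le> C / (1 + (norm \<xi>)\<^sup>2)"
proof -
  let ?e = "(1,0) :: plane" and ?e' = "(0,1) :: plane"
  note sd = schwartz_differentiable[OF f]
  have d0: "f differentiable (at x)" for x using sd[of "[]"] by simp
  have d1: "dir_deriv v f differentiable (at x)" for x v using sd[of "[v]"] by simp
  obtain C where C: "\<And>vs. C vs \<ge> 0" "\<And>vs y. norm (fold dir_deriv vs f y) \<le> C vs * decay_weight y"
    using schwartz_bound[OF f] by metis
  define K where "K = C [?e,?e] + C [?e,?e'] + C [?e',?e] + C [?e',?e']"
  show ?thesis
  proof (rule fourier_decay[OF schwartz_integrable[OF f], of K "\<lambda>v. dir_deriv v f" "\<lambda>v. dir_deriv v (dir_deriv v f)"])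
    fix v y :: plane
    have n: "\<bar>fst v\<bar> \<le> norm v" "\<bar>snd v\<bar> \<le> norm v"
      using norm_fst_le[of "fst v" "snd v"] norm_snd_le[of "snd v" "fst v"] by auto
    have dd: "dir_deriv w (dir_deriv v f) x = of_real (fst v) * dir_deriv w (dir_deriv ?e f) x + of_real (snd v) * dir_deriv w (dir_deriv ?e' f) x" for w x
    proof -
      have "dir_deriv v f = (\<lambda>x. of_real (fst v) * dir_deriv ?e f x + of_real (snd v) * dir_deriv ?e' f x)"
        using dir_deriv_expand[OF d0] by blast
      then have "(dir_deriv v f has_derivative (\<lambda>w. of_real (fst v) * dir_deriv w (dir_deriv ?e f) x + of_real (snd v) * dir_deriv w (dir_deriv ?e' f) x)) (at x)"
        by (auto intro!: derivative_eq_intros dir_deriv_has_derivative[OF d1])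
      from frechet_derivative_at[OF this, symmetric] show ?thesis by (simp add: dir_deriv_def[of w "dir_deriv v f"])
    qed
    have b: "norm (of_real (a::real) * (of_real b * z)) \<le> (norm v)\<^sup>2 * norm z" if "\<bar>a\<bar> \<le> norm v" "\<bar>b\<bar> \<le> norm v" for a b and z :: complex
      using that mult_mono[OF that] by (simp add: norm_mult power2_eq_square mult.assoc[symmetric] mult_right_mono)
    let ?D = "\<lambda>a b. dir_deriv b (dir_deriv a f) y"
    have "dir_deriv v (dir_deriv v f) y = of_real (fst v) * (of_real (fst v) * ?D ?e ?e) + of_real (fst v) * (of_real (snd v) * ?D ?e ?e')
       + (of_real (snd v) * (of_real (fst v) * ?D ?e' ?e) + of_real (snd v) * (of_real (snd v) * ?D ?e' ?e'))"
      unfolding dd dir_deriv_expand[of "dir_deriv ?e f" v, OF d1] dir_deriv_expand[of "dir_deriv ?e' f" v, OF d1]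
      by (simp add: distrib_left)
    then have "norm (dir_deriv v (dir_deriv v f) y) \<le> ((norm v)\<^sup>2 * norm (?D ?e ?e) + (norm v)\<^sup>2 * norm (?D ?e ?e'))
       + ((norm v)\<^sup>2 * norm (?D ?e' ?e) + (norm v)\<^sup>2 * norm (?D ?e' ?e'))"
      by (simp only:) (intro norm_triangle_mono b n)
    also have "\<dots> \<le> ((norm v)\<^sup>2 * (C [?e,?e] * decay_weight y) + (norm v)\<^sup>2 * (C [?e,?e'] * decay_weight y))
       + ((norm v)\<^sup>2 * (C [?e',?e] * decay_weight y) + (norm v)\<^sup>2 * (C [?e',?e'] * decay_weight y))"
      using C(2)[of "[?e,?e]" y] C(2)[of "[?e,?e']" y] C(2)[of "[?e',?e]" y] C(2)[of "[?e',?e']" y]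
      by (intro add_mono mult_left_mono) auto
    also have "\<dots> = K * (norm v)\<^sup>2 * decay_weight y" by (simp add: K_def algebra_simps)
    finally show "norm (dir_deriv v (dir_deriv v f) y) \<le> K * (norm v)\<^sup>2 * decay_weight y" .
  qed (auto simp: K_def C intro: dir_deriv_line[OF d0] dir_deriv_line[OF d1])
qed

section \<open>Superpositions of dilates\<close>

text \<open>Bounds for all points of the plane serve as rewrite rules for points that are given by a single variable.\<close>
lemmas [simp del] = split_paired_All split_paired_Ex

lemma integrable_boundI:
  fixes f :: "'a \<Rightarrow> 'b::{banach, second_countable_topology}" and w :: "'a \<Rightarrow> real"
  assumes "integrable M w" "f \<in> borel_measurable M" "AE x in M. norm (f x) \<le> w x"
  shows "integrable M f"
proof (rule Bochner_Integration.integrable_bound[OF assms(1,2)])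
  show "AE x in M. norm (f x) \<le> norm (w x)"
    using assms(3) by eventually_elim simp
qed

lemma fourier_continuous:
  assumes f: "integrable lborel f" shows "continuous_on UNIV (fourier f)"
proof (rule continuous_on_sequentiallyI)
  fix u :: "nat \<Rightarrow> plane" and a assume u: "u \<longlonglongrightarrow> a"
  have [measurable]: "f \<in> borel_measurable borel" using f by auto
  show "(\<lambda>n. fourier f (u n)) \<longlonglongrightarrow> fourier f a"
    unfolding fourier_cis
  proof (rule integral_dominated_convergence[where w="\<lambda>x. norm (f x)"])
    show "AE x in lborel. (\<lambda>n. f x * cis (- (2 * pi * (x \<bullet> u n)))) \<longlonglongrightarrow> f x * cis (- (2 * pi * (x \<bullet> a)))"
    proof (rule AE_I2)
      fix x
      have "isCont cis z" for z using continuous_on_cis[of UNIV "\<lambda>x. x"] by (simp add: continuous_on_eq_continuous_at)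
      then show "(\<lambda>n. f x * cis (- (2 * pi * (x \<bullet> u n)))) \<longlonglongrightarrow> f x * cis (- (2 * pi * (x \<bullet> a)))"
        by (intro tendsto_intros isCont_tendsto_compose[of _ cis] u)
    qed
  qed (use f in \<open>auto simp: norm_mult\<close>)
qed

lemma fourier_measurable: "integrable lborel f \<Longrightarrow> fourier f \<in> borel_measurable borel"
  by (intro borel_measurable_continuous_onI fourier_continuous)

lemma fourier_real_even:
  fixes f :: "plane \<Rightarrow> real"
  assumes f: "integrable lborel f" and even: "\<And>x. f (-x) = f x"
  shows "fourier (\<lambda>x. of_real (f x)) (- \<xi>) = fourier (\<lambda>x. of_real (f x)) \<xi>"
    and "of_real (Re (fourier (\<lambda>x. of_real (f x)) \<xi>)) = fourier (\<lambda>x. of_real (f x)) \<xi>"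
proof -
  let ?F = "fourier (\<lambda>x. of_real (f x))"
  have [measurable]: "f \<in> borel_measurable borel" using f by auto
  have "?F \<xi> = (\<integral>x. of_real (f (0 + (-1) *\<^sub>R x)) * cis (- (2 * pi * ((0 + (-1) *\<^sub>R x) \<bullet> \<xi>))) \<partial>lborel)"
    unfolding fourier_cis by (subst integral_plane_affine[of _ "-1" 0]) auto
  also have "\<dots> = ?F (-\<xi>)" unfolding fourier_cis by (simp add: even)
  finally show 1: "?F (-\<xi>) = ?F \<xi>" ..
  have "cnj (?F \<xi>) = (\<integral>x. cnj (of_real (f x) * cis (- (2 * pi * (x \<bullet> \<xi>)))) \<partial>lborel)"
    unfolding fourier_cis by (simp only: Bochner_Integration.integral_cnj)
  also have "\<dots> = ?F (-\<xi>)" unfolding fourier_cis by (simp add: cis_cnj)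
  finally have "cnj (?F \<xi>) = ?F \<xi>" using 1 by simp
  then show "of_real (Re (?F \<xi>)) = ?F \<xi>"
    by (simp add: complex_eq_iff)
qed

text \<open>Fubini for the integral of \<open>f x * g y * cis (- (2 * pi * (y \<bullet> x)))\<close>.\<close>
lemma fourier_multiplication:
  assumes f: "integrable lborel f" and g: "integrable lborel g"
  shows "(\<integral>x. f x * fourier g x \<partial>lborel) = (\<integral>\<xi>. fourier f \<xi> * g \<xi> \<partial>lborel)"
proof -
  have [measurable]: "f \<in> borel_measurable borel" "g \<in> borel_measurable borel" using f g by auto
  have fin: "(\<integral>\<^sup>+x. \<integral>\<^sup>+y. norm (f x * (g y * cis (- (2 * pi * (y \<bullet> x))))) \<partial>lborel \<partial>lborel) < \<infinity>"
    using f g by (simp add: norm_mult ennreal_mult nn_integral_cmult nn_integral_multc integrable_iff_bounded ennreal_mult_less_top)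
  have "(\<integral>x. f x * fourier g x \<partial>lborel) = (\<integral>x. \<integral>y. f x * (g y * cis (- (2 * pi * (y \<bullet> x)))) \<partial>lborel \<partial>lborel)"
    by (simp add: fourier_cis)
  also have "\<dots> = (\<integral>y. \<integral>x. f x * (g y * cis (- (2 * pi * (y \<bullet> x)))) \<partial>lborel \<partial>lborel)"
    by (rule integral_swap(1)[OF _ _ _ fin]) (auto intro: lborel.sigma_finite_measure_axioms)
  also have "\<dots> = (\<integral>y. (\<integral>x. f x * cis (- (2 * pi * (x \<bullet> y))) * g y \<partial>lborel) \<partial>lborel)"
    by (simp add: mult_ac inner_commute)
  also have "\<dots> = (\<integral>\<xi>. fourier f \<xi> * g \<xi> \<partial>lborel)" by (simp add: fourier_cis)
  finally show ?thesis .
qed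

lemma fourier_scale:
  assumes [measurable]: "f \<in> borel_measurable borel" and t: "t > 0"
  shows "fourier (\<lambda>x. f (t *\<^sub>R x)) \<xi> = of_real (1 / t\<^sup>2) * fourier f (\<xi> /\<^sub>R t)"
proof -
  have "fourier f (\<xi> /\<^sub>R t) = t\<^sup>2 *\<^sub>R (\<integral>x. f (0 + t *\<^sub>R x) * cis (- (2 * pi * ((0 + t *\<^sub>R x) \<bullet> (\<xi> /\<^sub>R t)))) \<partial>lborel)"
    unfolding fourier_cis using t by (subst integral_plane_affine[of _ t 0]) auto
  also have "\<dots> = of_real (t\<^sup>2) * fourier (\<lambda>x. f (t *\<^sub>R x)) \<xi>"
  proof -
    have "(0 + t *\<^sub>R x) \<bullet> (\<xi> /\<^sub>R t) = x \<bullet> \<xi>" for x using t by simp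
    then show ?thesis unfolding fourier_cis by (simp only: scaleR_conv_of_real add_0)
  qed
  finally show ?thesis using t by simp
qed

lemma nn_integral_pos_scale:
  assumes [measurable]: "f \<in> borel_measurable borel" and r: "(r::real) > 0"
  shows "(\<integral>\<^sup>+t\<in>{0<..}. f t \<partial>lborel) = ennreal r * (\<integral>\<^sup>+t\<in>{0<..}. f (r * t) \<partial>lborel)"
  using r by (subst nn_integral_real_affine[where c=r and t=0])
    (auto intro!: arg_cong[where f="\<lambda>x. ennreal r * x"] nn_integral_cong simp: zero_less_mult_iff split: split_indicator)

lemma set_integral_pos_scale:
  fixes f :: "real \<Rightarrow> real"
  assumes r: "(r::real) > 0"
  shows "(LINT t:{0<..}|lborel. f t) = r * (LINT t:{0<..}|lborel. f (r * t))"
  unfolding set_lebesgue_integral_def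
  using r by (subst lborel_integral_real_affine[where c=r and t=0])
    (auto intro!: arg_cong[where f="\<lambda>x. r * x"] Bochner_Integration.integral_cong simp: zero_less_mult_iff split: split_indicator)

definition mellin_const :: "real \<Rightarrow> real" where
  "mellin_const s = (LINT t:{0<..}|lborel. t powr (s - 1) / (1 + t\<^sup>2))"

lemma mellin_const_nonneg: "mellin_const s \<ge> 0"
  unfolding mellin_const_def set_lebesgue_integral_def by (rule integral_nonneg_AE) (auto split: split_indicator)

lemma nn_integral_mellin_weight:
  assumes "0 < s" "s < 2" and r: "r > 0"
  shows "(\<integral>\<^sup>+t\<in>{0<..}. ennreal (t powr (s - 3) / (1 + (r / t)\<^sup>2)) \<partial>lborel) = ennreal (r powr (s - 2) * mellin_const s)"
proof -
  have "(\<integral>\<^sup>+t\<in>{0<..}. ennreal (t powr (s - 3) / (1 + (r / t)\<^sup>2)) \<partial>lborel)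
     = ennreal r * (\<integral>\<^sup>+t\<in>{0<..}. ennreal ((r * t) powr (s - 3) / (1 + (r / (r * t))\<^sup>2)) \<partial>lborel)"
    by (rule nn_integral_pos_scale) (use r in auto)
  also have "(\<integral>\<^sup>+t\<in>{0<..}. ennreal ((r * t) powr (s - 3) / (1 + (r / (r * t))\<^sup>2)) \<partial>lborel)
     = (\<integral>\<^sup>+t\<in>{0<..}. ennreal (r powr (s - 3)) * ennreal (t powr (s - 1) / (1 + t\<^sup>2)) \<partial>lborel)"
  proof (intro nn_integral_cong)
    fix t :: real
    show "ennreal ((r * t) powr (s - 3) / (1 + (r / (r * t))\<^sup>2)) * indicator {0<..} t =
       ennreal (r powr (s - 3)) * ennreal (t powr (s - 1) / (1 + t\<^sup>2)) * indicator {0<..} t"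
    proof (cases "t > 0")
      case t: True
      have "t powr (s - 1) / (1 + t\<^sup>2) = t powr (s - 3) * t\<^sup>2 / (1 + t\<^sup>2)" using powr_mult_square[OF t, of "s - 3"] by simp
      also have "\<dots> = t powr (s - 3) / (1 + (1 / t)\<^sup>2)"
        using t by (simp add: field_simps add_pos_nonneg)
      finally have "(r * t) powr (s - 3) / (1 + (r / (r * t))\<^sup>2) = r powr (s - 3) * (t powr (s - 1) / (1 + t\<^sup>2))"
        using r t by (simp add: powr_mult)
      then show ?thesis by (simp add: ennreal_mult[symmetric])
    qed auto
  qed
  also have "\<dots> = ennreal (r powr (s - 3)) * (\<integral>\<^sup>+t\<in>{0<..}. ennreal (t powr (s - 1) / (1 + t\<^sup>2)) \<partial>lborel)"
    by (simp add: nn_integral_cmult mult.assoc)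
  also have "(\<integral>\<^sup>+t\<in>{0<..}. ennreal (t powr (s - 1) / (1 + t\<^sup>2)) \<partial>lborel) = ennreal (mellin_const s)"
        unfolding mellin_const_def set_lebesgue_integral_def
    by (subst nn_integral_eq_integral[symmetric])
       (use set_integrable_mellin_weight assms in \<open>auto simp: set_integrable_def intro!: nn_integral_cong split: split_indicator\<close>)
  finally have "(\<integral>\<^sup>+t\<in>{0<..}. ennreal (t powr (s - 3) / (1 + (r / t)\<^sup>2)) \<partial>lborel) = ennreal (r * (r powr (s - 3) * mellin_const s))"
    using r mellin_const_nonneg[of s] by (simp add: ennreal_mult)
  also have "r * (r powr (s - 3) * mellin_const s) = r powr (s - 2) * mellin_const s"
    using r powr_mult_base[of r "s - 3"] by simp
  finally show ?thesis .
qed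

text \<open>The dilate \<open>x \<mapsto> \<Phi> (t x)\<close> has the Fourier transform \<open>\<xi> \<mapsto> P (\<xi> / t) / t\<^sup>2\<close> when \<open>\<Phi>\<close> has the
  transform \<open>P\<close>. Weighting by \<open>t powr (s - 1)\<close> and integrating over \<open>t\<close> gives this formula.\<close>
definition mellin_hat :: "real \<Rightarrow> (plane \<Rightarrow> real) \<Rightarrow> plane \<Rightarrow> real" where
  "mellin_hat s P \<xi> = (LINT t:{0<..}|lborel. t powr (s - 3) * P (\<xi> /\<^sub>R t))"

text \<open>Substituting \<open>r * t\<close> for \<open>t\<close> shows homogeneity of degree \<open>s - 2\<close>.\<close>
lemma mellin_hat_scale:
  assumes r: "r > 0"
  shows "mellin_hat s P (r *\<^sub>R \<xi>) = r powr (s - 2) * mellin_hat s P \<xi>"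
proof -
  have i: "inverse (r * t) * r = inverse t" for t
    using r by (cases "t = 0") (simp_all add: field_simps)
  have "mellin_hat s P (r *\<^sub>R \<xi>) = r * (LINT t:{0<..}|lborel. (r * t) powr (s - 3) * P ((r *\<^sub>R \<xi>) /\<^sub>R (r * t)))"
    unfolding mellin_hat_def by (rule set_integral_pos_scale[OF r])
  also have "(LINT t:{0<..}|lborel. (r * t) powr (s - 3) * P ((r *\<^sub>R \<xi>) /\<^sub>R (r * t)))
     = (LINT t:{0<..}|lborel. r powr (s - 3) * (t powr (s - 3) * P (\<xi> /\<^sub>R t)))"
    using r by (intro set_lebesgue_integral_cong) (simp_all add: powr_mult i del: inverse_mult_distrib)
  also have "\<dots> = r powr (s - 3) * mellin_hat s P \<xi>" by (simp add: mellin_hat_def)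
  finally show ?thesis using r powr_mult_base[of r "s - 3"] by (simp add: mult.assoc[symmetric])
qed

lemma mellin_hat_integrable:
  assumes s: "0 < s" "s < 2" and [measurable]: "P \<in> borel_measurable borel"
    and P: "\<And>\<xi>. \<bar>P \<xi>\<bar> \<le> C / (1 + (norm \<xi>)\<^sup>2)" and C: "C \<ge> 0" and \<xi>: "\<xi> \<noteq> 0"
  shows "(\<integral>\<^sup>+t. norm (indicator {0<..} t *\<^sub>R (t powr (s - 3) * P (\<xi> /\<^sub>R t))) \<partial>lborel) \<le> ennreal (C * mellin_const s * norm \<xi> powr (s - 2))"
    and "set_integrable lborel {0<..} (\<lambda>t. t powr (s - 3) * P (\<xi> /\<^sub>R t))"
    and "\<bar>mellin_hat s P \<xi>\<bar> \<le> C * mellin_const s * norm \<xi> powr (s - 2)"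
proof -
  have "(\<integral>\<^sup>+t. norm (indicator {0<..} t *\<^sub>R (t powr (s - 3) * P (\<xi> /\<^sub>R t))) \<partial>lborel)
     \<le> (\<integral>\<^sup>+t. ennreal C * (ennreal (t powr (s - 3) / (1 + (norm \<xi> / t)\<^sup>2)) * indicator {0<..} t) \<partial>lborel)"
  proof (intro nn_integral_mono)
    fix t :: real
    show "ennreal (norm (indicator {0<..} t *\<^sub>R (t powr (s - 3) * P (\<xi> /\<^sub>R t)))) \<le>
       ennreal C * (ennreal (t powr (s - 3) / (1 + (norm \<xi> / t)\<^sup>2)) * indicator {0<..} t)"
    proof (cases "t > 0")
      case t: True
      have "\<bar>t powr (s - 3) * P (\<xi> /\<^sub>R t)\<bar> \<le> t powr (s - 3) * (C / (1 + (norm (\<xi> /\<^sub>R t))\<^sup>2))"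
        using mult_left_mono[OF P[of "\<xi> /\<^sub>R t"], of "t powr (s - 3)"] by (simp add: abs_mult)
      also have "norm (\<xi> /\<^sub>R t) = norm \<xi> / t" using t by (simp add: divide_inverse mult.commute)
      finally show ?thesis using t C by (simp add: ennreal_mult[symmetric] ennreal_leI mult_ac)
    qed auto
  qed
  also have "\<dots> = ennreal C * ennreal (norm \<xi> powr (s - 2) * mellin_const s)"
    using nn_integral_mellin_weight[OF s, of "norm \<xi>"] \<xi> by (subst nn_integral_cmult) auto
  also have "\<dots> = ennreal (C * mellin_const s * norm \<xi> powr (s - 2))"
    using C mellin_const_nonneg[of s] by (simp add: ennreal_mult[symmetric] mult_ac)
  finally show 1: "(\<integral>\<^sup>+t. norm (indicator {0<..} t *\<^sub>R (t powr (s - 3) * P (\<xi> /\<^sub>R t))) \<partial>lborel) \<le> ennreal (C * mellin_const s * norm \<xi> powr (s - 2))" .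
  then show i: "set_integrable lborel {0<..} (\<lambda>t. t powr (s - 3) * P (\<xi> /\<^sub>R t))"
    unfolding set_integrable_def by (intro integrableI_bounded) (auto intro: le_less_trans)
  have "ennreal \<bar>mellin_hat s P \<xi>\<bar> \<le> (\<integral>\<^sup>+t. norm (indicator {0<..} t *\<^sub>R (t powr (s - 3) * P (\<xi> /\<^sub>R t))) \<partial>lborel)"
    unfolding mellin_hat_def set_lebesgue_integral_def real_norm_def[symmetric]
    by (rule integral_norm_bound_ennreal) (use i in \<open>simp add: set_integrable_def\<close>)
  also note 1
  finally show "\<bar>mellin_hat s P \<xi>\<bar> \<le> C * mellin_const s * norm \<xi> powr (s - 2)"
    using C mellin_const_nonneg[of s] by simp
qed

lemma mellin_hat_continuous_on_sphere:
  assumes s: "0 < s" "s < 2" and cont: "continuous_on UNIV P"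
    and P: "\<And>\<xi>. \<bar>P \<xi>\<bar> \<le> C / (1 + (norm \<xi>)\<^sup>2)" and C: "C \<ge> 0" 
    and u: "continuous_on UNIV u" "\<And>\<phi>::real. norm (u \<phi>) = 1"
  shows "continuous_on UNIV (\<lambda>\<phi>. mellin_hat s P (u \<phi>))"
proof (rule continuous_on_sequentiallyI)
  fix x :: "nat \<Rightarrow> real" and a assume x: "x \<longlonglongrightarrow> a"
  have [measurable]: "P \<in> borel_measurable borel" by (intro borel_measurable_continuous_onI cont)
  have ux: "(\<lambda>n. u (x n)) \<longlonglongrightarrow> u a" using u(1) x
    by (auto simp: continuous_on_eq_continuous_at intro: isCont_tendsto_compose)
  have cP: "isCont P z" for z using cont by (simp add: continuous_on_eq_continuous_at)
  show "(\<lambda>n. mellin_hat s P (u (x n))) \<longlonglongrightarrow> mellin_hat s P (u a)"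
    unfolding mellin_hat_def set_lebesgue_integral_def
  proof (rule integral_dominated_convergence)
    show "integrable lborel (\<lambda>t. C * (indicator {0<..} t *\<^sub>R (t powr (s - 1) / (1 + t\<^sup>2))))"
      by (intro integrable_mult_right set_integrable_mellin_weight[OF s, unfolded set_integrable_def])
    show "AE t in lborel. (\<lambda>n. indicator {0<..} t *\<^sub>R (t powr (s - 3) * P (u (x n) /\<^sub>R t))) \<longlonglongrightarrow> indicator {0<..} t *\<^sub>R (t powr (s - 3) * P (u a /\<^sub>R t))"
      by (intro AE_I2 tendsto_intros isCont_tendsto_compose[OF cP] ux)
    fix n
    show "AE t in lborel. norm (indicator {0<..} t *\<^sub>R (t powr (s - 3) * P (u (x n) /\<^sub>R t))) \<le> C * (indicator {0<..} t *\<^sub>R (t powr (s - 1) / (1 + t\<^sup>2)))"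
    proof (rule AE_I2)
      fix t :: real
      show "norm (indicator {0<..} t *\<^sub>R (t powr (s - 3) * P (u (x n) /\<^sub>R t))) \<le> C * (indicator {0<..} t *\<^sub>R (t powr (s - 1) / (1 + t\<^sup>2)))"
      proof (cases "t > 0")
        case t: True
        have "\<bar>t powr (s - 3) * P (u (x n) /\<^sub>R t)\<bar> \<le> t powr (s - 3) * (C / (1 + (norm (u (x n) /\<^sub>R t))\<^sup>2))"
          using mult_left_mono[OF P[of "u (x n) /\<^sub>R t"], of "t powr (s - 3)"] by (simp add: abs_mult)
        also have "norm (u (x n) /\<^sub>R t) = 1 / t" using t by (simp add: divide_inverse u)
        also have "t powr (s - 3) * (C / (1 + (1 / t)\<^sup>2)) = C * (t powr (s - 3) * t\<^sup>2 / (1 + t\<^sup>2))"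
          using t by (simp add: field_simps add_pos_nonneg)
        also have "t powr (s - 3) * t\<^sup>2 = t powr (s - 1)" using powr_mult_square[OF t, of "s - 3"] by simp
        finally show ?thesis using t by simp
      qed auto
    qed
  qed auto
qed

text \<open>Fubini is applied twice, before and after the multiplication formula for each single dilate. The first
  time it is justified by the decay of the transform of the test function, the second time by the decay of
  the transform of \<open>\<Phi>\<close>. The nonnegativity of \<open>\<Phi>\<close> turns the hypothesis on \<open>U\<close> into absolute convergence.\<close>
theorem has_fourier_transform_mellin:
  fixes \<Phi> U :: "plane \<Rightarrow> real"
  assumes s: "0 < s" "s < 2"
    and nonneg: "\<And>x. 0 \<le> \<Phi> x" and even: "\<And>x. \<Phi> (-x) = \<Phi> x" and int: "integrable lborel \<Phi>"
    and decay: "\<And>\<xi>. norm (fourier (\<lambda>x. of_real (\<Phi> x)) \<xi>) \<le> C / (1 + (norm \<xi>)\<^sup>2)" and C: "C \<ge> 0"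
    and U_meas[measurable]: "U \<in> borel_measurable borel" and U_nonneg: "\<And>x. 0 \<le> U x"
    and U_bound: "\<And>x. U x \<le> B * norm x powr (- s)"
    and U: "\<And>x. x \<noteq> 0 \<Longrightarrow> (\<integral>\<^sup>+t\<in>{0<..}. ennreal (t powr (s - 1) * \<Phi> (t *\<^sub>R x)) \<partial>lborel) = ennreal (U x)"
  defines "P \<equiv> \<lambda>\<xi>. Re (fourier (\<lambda>x. of_real (\<Phi> x)) \<xi>)"
  shows "has_fourier_transform U (mellin_hat s P)"
  unfolding has_fourier_transform_def
proof (intro allI impI conjI)
  fix f assume f: "schwartz f"
  have [measurable]: "f \<in> borel_measurable borel" by (rule schwartz_measurable[OF f])
  have [measurable]: "\<Phi> \<in> borel_measurable borel" using int by auto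
  note fi = schwartz_integrable[OF f]
  have [measurable]: "fourier f \<in> borel_measurable borel" by (rule fourier_measurable[OF fi])
  have ic: "integrable lborel (\<lambda>x. complex_of_real (\<Phi> x))" using int by simp
  have Pc: "of_real (P \<xi>) = fourier (\<lambda>x. of_real (\<Phi> x)) \<xi>" for \<xi>
    unfolding P_def by (rule fourier_real_even(2)[OF int even])
  have [measurable]: "P \<in> borel_measurable borel" unfolding P_def using fourier_measurable[OF ic] by measurable
  have Pb: "\<bar>P \<xi>\<bar> \<le> C / (1 + (norm \<xi>)\<^sup>2)" for \<xi>
    using abs_Re_le_cmod decay[of \<xi>] order_trans unfolding P_def by blast
  obtain D where D: "D \<ge> 0" "\<And>x. norm (fourier f x) \<le> D / (1 + (norm x)\<^sup>2)"
    using schwartz_fourier_decay[OF f] by blast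
  have B: "0 \<le> B" using order_trans[OF U_nonneg U_bound, of "(1,0)"] by (simp add: norm_prod_def)
  have nz: "AE x in (lborel::plane measure). x \<noteq> 0" by (rule AE_lborel_singleton)
  show i1: "integrable lborel (\<lambda>x. of_real (U x) * fourier f x)"
  proof (rule integrable_boundI)
    show "integrable lborel (\<lambda>x::plane. B * D * (norm x powr (- s) / (1 + (norm x)\<^sup>2)))"
      by (intro integrable_mult_right integrable_radial_weight s)
    have "U x * norm (fourier f x) \<le> (B * norm x powr (- s)) * (D / (1 + (norm x)\<^sup>2))" for x
      using B by (intro mult_mono U_bound D) auto
    then show "AE x in lborel. norm (of_real (U x) * fourier f x) \<le> B * D * (norm x powr (- s) / (1 + (norm x)\<^sup>2))"
      by (intro AE_I2) (simp add: norm_mult U_nonneg mult_ac)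
  qed simp
  define W where "W = C * mellin_const s"
  have W: "W \<ge> 0" using C mellin_const_nonneg by (simp add: W_def)
  obtain E where E: "E \<ge> 0" "\<And>y. norm (f y) \<le> E * decay_weight y" using schwartz_bound[OF f, of "[]"] by auto
  have "integrable lborel (\<lambda>\<xi>. norm \<xi> powr (s - 2) * norm (f \<xi>))"
  proof (rule integrable_boundI)
    show "integrable lborel (\<lambda>x::plane. E * (norm x powr (- (2 - s)) / (1 + (norm x)\<^sup>2)))"
      by (intro integrable_mult_right integrable_radial_weight) (use s in auto)
    have "norm \<xi> powr (s - 2) * norm (f \<xi>) \<le> norm \<xi> powr (s - 2) * (E * (1 / (1 + (norm \<xi>)\<^sup>2)))" for \<xi>
    proof (intro mult_left_mono order_trans[OF E(2)] E)
      have "(1 + (norm \<xi>)\<^sup>2) \<le> (1 + (fst \<xi>)\<^sup>2) * (1 + (snd \<xi>)\<^sup>2)"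
        by (simp add: plane_norm algebra_simps)
      moreover have "decay_weight \<xi> = 1 / ((1 + (fst \<xi>)\<^sup>2) * (1 + (snd \<xi>)\<^sup>2))"
        by (simp add: decay_weight_def divide_inverse)
      ultimately show "decay_weight \<xi> \<le> 1 / (1 + (norm \<xi>)\<^sup>2)"
        by (simp only:) (intro divide_left_mono, auto simp: add_pos_nonneg)
    qed auto
    then show "AE x in lborel. norm (norm x powr (s - 2) * norm (f x)) \<le> E * (norm x powr (- (2 - s)) / (1 + (norm x)\<^sup>2))"
      by (intro AE_I2) (simp add: mult_ac)
  qed simp
  then have ifw: "integrable lborel (\<lambda>\<xi>. W * (norm \<xi> powr (s - 2) * norm (f \<xi>)))"
    by simp
  have [measurable]: "mellin_hat s P \<in> borel_measurable borel"
    unfolding mellin_hat_def set_lebesgue_integral_def by measurable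
  show i2: "integrable lborel (\<lambda>\<xi>. of_real (mellin_hat s P \<xi>) * f \<xi>)"
  proof (rule Bochner_Integration.integrable_bound[OF ifw])
    show "AE x in lborel. norm (complex_of_real (mellin_hat s P x) * f x) \<le> norm (W * (norm x powr (s - 2) * norm (f x)))"
      using nz
    proof eventually_elim
      fix x :: plane assume x: "x \<noteq> 0"
      have "\<bar>mellin_hat s P x\<bar> * norm (f x) \<le> (W * norm x powr (s - 2)) * norm (f x)"
        using mellin_hat_integrable(3)[OF s _ Pb C x] by (intro mult_right_mono) (auto simp: W_def)
      then show "norm (complex_of_real (mellin_hat s P x) * f x) \<le> norm (W * (norm x powr (s - 2) * norm (f x)))"
        using W by (simp add: norm_mult mult.assoc)
    qed
  qed simp
  let ?k = "\<lambda>x t. (indicator {0<..} t * t powr (s - 1) * \<Phi> (t *\<^sub>R x)) *\<^sub>R fourier f x"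
  let ?k2 = "\<lambda>\<xi> t. (indicator {0<..} t * (t powr (s - 3) * P (\<xi> /\<^sub>R t))) *\<^sub>R f \<xi>"
  have inner: "(\<integral>\<^sup>+t. norm (?k x t) \<partial>lborel) = ennreal (norm (of_real (U x) * fourier f x))" if "x \<noteq> 0" for x
  proof -
    have "(\<integral>\<^sup>+t. norm (?k x t) \<partial>lborel) = (\<integral>\<^sup>+t. (ennreal (t powr (s - 1) * \<Phi> (t *\<^sub>R x)) * indicator {0<..} t) * ennreal (norm (fourier f x)) \<partial>lborel)"
      using nonneg by (intro nn_integral_cong) (auto simp: ennreal_mult split: split_indicator)
    also have "\<dots> = ennreal (U x) * ennreal (norm (fourier f x))"
      by (simp add: nn_integral_multc U[OF that])
    finally show ?thesis using U_nonneg by (simp add: norm_mult ennreal_mult)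
  qed
  have inner': "(\<integral>t. ?k x t \<partial>lborel) = of_real (U x) * fourier f x" if "x \<noteq> 0" for x
  proof -
    have "(\<integral>t. indicator {0<..} t * t powr (s - 1) * \<Phi> (t *\<^sub>R x) \<partial>lborel) = U x"
    proof (rule integral_eq_nn_integral[THEN trans])
      have "(\<integral>\<^sup>+t. ennreal (indicator {0<..} t * t powr (s - 1) * \<Phi> (t *\<^sub>R x)) \<partial>lborel) = ennreal (U x)"
        unfolding U[OF that, symmetric] by (intro nn_integral_cong) (auto split: split_indicator)
      then show "enn2real (\<integral>\<^sup>+t. ennreal (indicator {0<..} t * t powr (s - 1) * \<Phi> (t *\<^sub>R x)) \<partial>lborel) = U x"
        using U_nonneg by simp
    qed (use nonneg in auto)
    then show ?thesis by (simp only: scaleR_conv_of_real integral_mult_left_zero integral_complex_of_real real_scaleR_def)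
  qed
  have fin1: "(\<integral>\<^sup>+x. \<integral>\<^sup>+t. norm (?k x t) \<partial>lborel \<partial>lborel) < \<infinity>"
  proof -
    have "(\<integral>\<^sup>+x. \<integral>\<^sup>+t. norm (?k x t) \<partial>lborel \<partial>lborel) = (\<integral>\<^sup>+x. norm (of_real (U x) * fourier f x) \<partial>lborel)"
      by (intro nn_integral_cong_AE) (use nz inner in auto)
    then show ?thesis using i1 by (simp add: integrable_iff_bounded)
  qed
  have fin2: "(\<integral>\<^sup>+\<xi>. \<integral>\<^sup>+t. norm (?k2 \<xi> t) \<partial>lborel \<partial>lborel) < \<infinity>"
  proof -
    have "(\<integral>\<^sup>+\<xi>. \<integral>\<^sup>+t. norm (?k2 \<xi> t) \<partial>lborel \<partial>lborel) \<le> (\<integral>\<^sup>+\<xi>. norm (W * (norm \<xi> powr (s - 2) * norm (f \<xi>))) \<partial>lborel)"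
    proof (intro nn_integral_mono_AE, use nz in eventually_elim)
      fix \<xi> :: plane assume x: "\<xi> \<noteq> 0"
      have "(\<integral>\<^sup>+t. norm (?k2 \<xi> t) \<partial>lborel) = (\<integral>\<^sup>+t. norm (indicator {0<..} t *\<^sub>R (t powr (s - 3) * P (\<xi> /\<^sub>R t))) \<partial>lborel) * ennreal (norm (f \<xi>))"
        by (subst nn_integral_multc[symmetric]) (auto intro!: nn_integral_cong simp: ennreal_mult)
      also have "\<dots> \<le> ennreal (C * mellin_const s * norm \<xi> powr (s - 2)) * ennreal (norm (f \<xi>))"
        by (intro mult_right_mono mellin_hat_integrable(1)[OF s _ Pb C x]) auto
      also have "\<dots> = ennreal (norm (W * (norm \<xi> powr (s - 2) * norm (f \<xi>))))"
        using W by (simp add: ennreal_mult[symmetric] W_def[symmetric] mult.assoc)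
      finally show "(\<integral>\<^sup>+t. norm (?k2 \<xi> t) \<partial>lborel) \<le> ennreal (norm (W * (norm \<xi> powr (s - 2) * norm (f \<xi>))))" .
    qed
    also have "\<dots> < \<infinity>" using ifw by (simp only: integrable_iff_bounded)
    finally show ?thesis .
  qed
  \<comment> \<open>the multiplication formula for the dilate by \<open>t\<close>\<close>
  have mid: "(\<integral>x. ?k x t \<partial>lborel) = (\<integral>\<xi>. ?k2 \<xi> t \<partial>lborel)" for t
  proof (cases "t > 0")
    case t: True
    let ?\<Phi>t = "\<lambda>x. complex_of_real (\<Phi> (t *\<^sub>R x))"
    have it: "integrable lborel ?\<Phi>t"
      using integrable_plane_affine[OF ic, of t 0] t by simp
    have "(\<integral>x. ?k x t \<partial>lborel) = of_real (t powr (s - 1)) * (\<integral>x. ?\<Phi>t x * fourier f x \<partial>lborel)"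
      using t by (simp add: scaleR_conv_of_real mult.assoc)
    also have "(\<integral>x. ?\<Phi>t x * fourier f x \<partial>lborel) = (\<integral>\<xi>. fourier ?\<Phi>t \<xi> * f \<xi> \<partial>lborel)"
      by (rule fourier_multiplication[OF it fi])
    also have "\<dots> = (\<integral>\<xi>. of_real (1 / t\<^sup>2) * (of_real (P (\<xi> /\<^sub>R t)) * f \<xi>) \<partial>lborel)"
      using fourier_scale[of "\<lambda>x. of_real (\<Phi> x)" t] t by (simp add: Pc mult.assoc)
    also have "\<dots> = of_real (1 / t\<^sup>2) * (\<integral>\<xi>. of_real (P (\<xi> /\<^sub>R t)) * f \<xi> \<partial>lborel)" by (rule integral_mult_right_zero)
    also have "of_real (t powr (s - 1)) * (of_real (1 / t\<^sup>2) * (\<integral>\<xi>. of_real (P (\<xi> /\<^sub>R t)) * f \<xi> \<partial>lborel))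
       = of_real (t powr (s - 3)) * (\<integral>\<xi>. of_real (P (\<xi> /\<^sub>R t)) * f \<xi> \<partial>lborel)"
      using t powr_mult_square[OF t, of "s - 3"] by (simp add: field_simps flip: of_real_mult of_real_power)
    also have "\<dots> = (\<integral>\<xi>. ?k2 \<xi> t \<partial>lborel)"
      using t by (simp add: scaleR_conv_of_real mult.assoc)
    finally show ?thesis .
  qed auto
  have "(\<integral>x. of_real (U x) * fourier f x \<partial>lborel) = (\<integral>x. \<integral>t. ?k x t \<partial>lborel \<partial>lborel)"
  proof (rule integral_cong_AE)
    show "AE x in lborel. of_real (U x) * fourier f x = (\<integral>t. ?k x t \<partial>lborel)"
      using nz by eventually_elim (rule inner'[symmetric])
  qed measurable
  also have "\<dots> = (\<integral>t. \<integral>x. ?k x t \<partial>lborel \<partial>lborel)"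
    by (rule integral_swap(1)[OF _ _ _ fin1]) (auto intro: lborel.sigma_finite_measure_axioms)
  also have "\<dots> = (\<integral>t. \<integral>\<xi>. ?k2 \<xi> t \<partial>lborel \<partial>lborel)" by (simp only: mid)
  also have "\<dots> = (\<integral>\<xi>. \<integral>t. ?k2 \<xi> t \<partial>lborel \<partial>lborel)"
    by (rule integral_swap(1)[OF _ _ _ fin2, symmetric]) (auto intro: lborel.sigma_finite_measure_axioms)
  also have "\<dots> = (\<integral>\<xi>. of_real (mellin_hat s P \<xi>) * f \<xi> \<partial>lborel)"
    unfolding mellin_hat_def set_lebesgue_integral_def
    by (simp only: scaleR_conv_of_real[where 'a=complex] integral_mult_left_zero integral_complex_of_real real_scaleR_def)
  finally show "(\<integral>x. of_real (U x) * fourier f x \<partial>lborel) = (\<integral>\<xi>. of_real (mellin_hat s P \<xi>) * f \<xi> \<partial>lborel)" .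
qed

section \<open>Functions of the angle\<close>

lemma angle_cos_sin:
  assumes "x \<noteq> 0" shows "fst x = norm x * cos (angle x)" "snd x = norm x * sin (angle x)"
proof -
  let ?z = "Complex (fst x) (snd x)"
  have n: "norm ?z = norm x" by (simp add: cmod_def plane_norm)
  have "?z = of_real (norm ?z) * exp (\<i> * of_real (Arg ?z))"
    using Arg_eq[of ?z] assms by (auto simp: complex_eq_iff prod_eq_iff)
  then have "?z = rcis (norm x) (angle x)" unfolding n by (simp add: rcis_def cis_conv_exp angle_def)
  then show "fst x = norm x * cos (angle x)" "snd x = norm x * sin (angle x)"
    by (auto simp: complex_eq_iff)
qed

lemma angle_scale: "t > 0 \<Longrightarrow> angle (t *\<^sub>R x) = angle x"
proof -
  assume t: "t > 0"
  have "Complex (fst (t *\<^sub>R x)) (snd (t *\<^sub>R x)) = of_real t * Complex (fst x) (snd x)"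
    by (simp add: complex_eq_iff)
  then show ?thesis using t by (simp add: angle_def Arg_times_of_real)
qed

lemma angle_uminus: "x \<noteq> 0 \<Longrightarrow> angle (-x) = angle x + pi \<or> angle x = angle (-x) + pi"
proof -
  assume "x \<noteq> 0"
  then have nz: "Complex (fst x) (snd x) \<noteq> 0" by (auto simp: complex_eq_iff prod_eq_iff)
  have "Complex (fst (-x)) (snd (-x)) = - Complex (fst x) (snd x)" by (simp add: complex_eq_iff)
  then show ?thesis unfolding angle_def using Arg_minus[OF nz] by (auto split: if_splits)
qed

lemma angle_polar: "-pi < \<phi> \<Longrightarrow> \<phi> \<le> pi \<Longrightarrow> angle (cos \<phi>, sin \<phi>) = \<phi>"
  using Arg_cis[of \<phi>] by (simp add: angle_def cis.ctr)

lemma pi_periodic_angle_uminus: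
  assumes "\<And>\<theta>. A (\<theta> + pi) = A \<theta>" shows "A (angle (- x)) = A (angle x)"
proof (cases "x = 0")
  case False
  from angle_uminus[OF this] show ?thesis
  proof
    assume "angle (- x) = angle x + pi" then show ?thesis using assms by simp
  next
    assume "angle x = angle (- x) + pi" then show ?thesis using assms[of "angle (-x)"] by simp
  qed
qed simp

lemma pi_periodic_angle_scale:
  assumes per: "\<And>\<theta>. A (\<theta> + pi) = A \<theta>" and t: "t \<noteq> 0"
  shows "A (angle (t *\<^sub>R x)) = A (angle x)"
proof (cases "t > 0")
  case False
  then have "A (angle ((-t) *\<^sub>R x)) = A (angle x)" using t by (subst angle_scale) auto
  then show ?thesis using pi_periodic_angle_uminus[of A "t *\<^sub>R x", OF per] by simp
qed (simp add: angle_scale)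

lemma has_derivative_angle_aux:
  assumes x: "Complex (fst x) (snd x) \<notin> \<real>\<^sub>\<le>\<^sub>0"
  shows "(angle has_derivative (\<lambda>v. (fst x * snd v - snd x * fst v) / (norm x)\<^sup>2)) (at x)"
proof -
  let ?c = "\<lambda>x::plane. Complex (fst x) (snd x)"
  have c: "?c = (\<lambda>x. of_real (fst x) + \<i> * of_real (snd x))" by (auto simp: complex_eq_iff)
  have dc: "(?c has_derivative ?c) (at x)"
    unfolding c by (auto intro!: derivative_eq_intros)
  have "(Ln has_derivative (\<lambda>h. inverse (?c x) * h)) (at (?c x))"
    using has_field_derivative_Ln[OF x] by (simp add: has_field_derivative_def)
  from has_derivative_compose[OF dc this]
  have "((\<lambda>y. Ln (?c y)) has_derivative (\<lambda>v. inverse (?c x) * ?c v)) (at x)" .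
  from bounded_linear.has_derivative[OF bounded_linear_Im this]
  have "((\<lambda>y. Im (Ln (?c y))) has_derivative (\<lambda>v. Im (inverse (?c x) * ?c v))) (at x)" .
  also have "(\<lambda>v. Im (inverse (?c x) * ?c v)) = (\<lambda>v. (fst x * snd v - snd x * fst v) / (norm x)\<^sup>2)"
    by (rule ext) (simp add: plane_norm diff_divide_distrib mult.commute)
  finally have d: "((\<lambda>y. Im (Ln (?c y))) has_derivative (\<lambda>v. (fst x * snd v - snd x * fst v) / (norm x)\<^sup>2)) (at x)" .
  have x0: "x \<in> - {0}" using x by (auto simp: complex_nonpos_Reals_iff)
  show ?thesis
  proof (rule has_derivative_transform_within_open[OF d _ x0])
    fix y :: plane assume "y \<in> - {0}"
    then have "?c y \<noteq> 0" by (auto simp: complex_eq_iff prod_eq_iff)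
    then show "Im (Ln (?c y)) = angle y" by (simp add: angle_def Arg_eq_Im_Ln)
  qed auto
qed

text \<open>For a \<open>pi\<close>-periodic function the branch cut of the angle is invisible, because a point on
  the cut can be traded for its antipode.\<close>
lemma has_derivative_periodic_angle:
  assumes per: "\<And>\<theta>. A (\<theta> + pi) = A \<theta>" and A: "\<And>\<theta>. (A has_real_derivative A' \<theta>) (at \<theta>)"
    and per': "\<And>\<theta>. A' (\<theta> + pi) = A' \<theta>" and x: "x \<noteq> 0"
  shows "((\<lambda>y. A (angle y)) has_derivative (\<lambda>v. A' (angle x) * ((fst x * snd v - snd x * fst v) / (norm x)\<^sup>2))) (at x)"
proof (cases "Complex (fst x) (snd x) \<in> \<real>\<^sub>\<le>\<^sub>0")
  case False
  from has_derivative_compose[OF has_derivative_angle_aux[OF this], of A "\<lambda>h. A' (angle x) * h"] A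
  show ?thesis by (simp add: has_field_derivative_def)
next
  case True
  then have "Complex (fst (-x)) (snd (-x)) \<notin> \<real>\<^sub>\<le>\<^sub>0"
    using x by (auto simp: complex_nonpos_Reals_iff prod_eq_iff)
  from has_derivative_compose[OF has_derivative_angle_aux[OF this], of A "\<lambda>h. A' (angle (-x)) * h"] A
  have "((\<lambda>y. A (angle y)) has_derivative (\<lambda>v. A' (angle (-x)) * ((fst (-x) * snd v - snd (-x) * fst v) / (norm (-x))\<^sup>2))) (at (-x))"
    by (simp add: has_field_derivative_def)
  from has_derivative_compose[OF has_derivative_minus[OF has_derivative_ident] this]
  have "((\<lambda>y. A (angle (-y))) has_derivative (\<lambda>v. A' (angle (-x)) * ((fst (-x) * snd (-v) - snd (-x) * fst (-v)) / (norm (-x))\<^sup>2))) (at x)" .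
  then show ?thesis by (simp add: pi_periodic_angle_uminus[of A, OF per] pi_periodic_angle_uminus[of A', OF per'])
qed

lemma pi_periodic_reduce:
  assumes "\<And>\<theta>. A (\<theta> + pi) = A \<theta>" shows "\<exists>y\<in>{0..pi}. A x = A y"
proof -
  have n: "A (x + real n * pi) = A x" for x and n :: nat
  proof (induction n)
    case (Suc n)
    have "A (x + real (Suc n) * pi) = A ((x + real n * pi) + pi)" by (simp add: algebra_simps)
    then show ?case using Suc assms by simp
  qed simp
  have i: "A (x + of_int k * pi) = A x" for x and k :: int
  proof (cases "k \<ge> 0")
    case True then show ?thesis using n[of x "nat k"] by simp
  next
    case False then show ?thesis using n[of "x + of_int k * pi" "nat (-k)"] by simp
  qed
  define k where "k = \<lfloor>x / pi\<rfloor>"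
  have "of_int k \<le> x / pi" "x / pi \<le> of_int k + 1" unfolding k_def by linarith+
  then have "of_int k * pi \<le> x" "x \<le> (of_int k + 1) * pi"
    using pos_le_divide_eq[OF pi_gt_zero] pos_divide_le_eq[OF pi_gt_zero] by metis+
  then have "x + of_int (- k) * pi \<in> {0..pi}" by (simp add: algebra_simps)
  then show ?thesis using i[of x "- k"] by metis
qed

lemma pi_periodic_bounded:
  assumes "\<And>\<theta>. A (\<theta> + pi) = A \<theta>" and c: "continuous_on UNIV (A :: real \<Rightarrow> real)"
  shows "\<exists>M. \<forall>x. \<bar>A x\<bar> \<le> M"
proof -
  have "compact (A ` {0..pi})" 
    by (rule compact_continuous_image[OF continuous_on_subset[OF c subset_UNIV] compact_Icc])
  from compact_imp_bounded[OF this] obtain M where M: "\<forall>y\<in>A ` {0..pi}. norm y \<le> M"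
    unfolding bounded_iff by (elim exE)
  have "\<bar>A x\<bar> \<le> M" for x
  proof -
    obtain y where "y \<in> {0..pi}" "A x = A y" using pi_periodic_reduce[of A x, OF assms(1)] by blast
    then show ?thesis using M by auto
  qed
  then show ?thesis by blast
qed

lemma line_norm_deriv:
  "((\<lambda>t. (norm (y + t *\<^sub>R v))\<^sup>2) has_real_derivative 2 * ((y + t *\<^sub>R v) \<bullet> v)) (at t)" for y v :: plane
  unfolding power2_norm_eq_inner has_field_derivative_def
  by (auto intro!: derivative_eq_intros simp: inner_commute algebra_simps)

lemma line_inner_deriv:
  "((\<lambda>t. (y + t *\<^sub>R v) \<bullet> v) has_real_derivative (norm v)\<^sup>2) (at t)" for y v :: plane
  unfolding power2_norm_eq_inner has_field_derivative_def
  by (auto intro!: derivative_eq_intros simp: inner_commute algebra_simps)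

lemma line_cross: "fst (y + t *\<^sub>R v) * snd v - snd (y + t *\<^sub>R v) * fst v = fst y * snd v - snd y * fst v" for y v :: plane
  by (simp add: algebra_simps)

section \<open>The angular profile and a bump with that profile\<close>

locale profile =
  fixes \<Omega> :: "real \<Rightarrow> real"
  assumes smooth: "smooth \<Omega>" and pos: "0 < \<Omega> \<theta>" and per: "\<Omega> (\<theta> + pi) = \<Omega> \<theta>"
begin

abbreviation "\<Omega>1 \<equiv> deriv \<Omega>"
abbreviation "\<Omega>2 \<equiv> deriv \<Omega>1"

lemma der: "(\<Omega> has_real_derivative \<Omega>1 x) (at x)" "(\<Omega>1 has_real_derivative \<Omega>2 x) (at x)" "isCont \<Omega>2 x"
proof -
  have "(deriv ^^ k) \<Omega> differentiable (at x)" for k x using smooth by (simp add: smooth_def)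
  note d = this[of 0] this[of 1] this[of 2]
  show "(\<Omega> has_real_derivative \<Omega>1 x) (at x)" "(\<Omega>1 has_real_derivative \<Omega>2 x) (at x)" "isCont \<Omega>2 x"
    using d[of x] by (auto simp: DERIV_deriv_iff_real_differentiable numeral_2_eq_2 intro: differentiable_imp_continuous_within)
qed

lemma per_deriv: "\<Omega>1 (x + pi) = \<Omega>1 x" "\<Omega>2 (x + pi) = \<Omega>2 x"
proof -
  have 1: "\<Omega>1 (x + pi) = \<Omega>1 x" for x
    using der(1)[of "x + pi"] DERIV_unique[OF _ der(1)[of x]] by (simp add: DERIV_shift per)
  show "\<Omega>1 (x + pi) = \<Omega>1 x" by (rule 1)
  show "\<Omega>2 (x + pi) = \<Omega>2 x"
    using der(2)[of "x + pi"] DERIV_unique[OF _ der(2)[of x]] by (simp add: DERIV_shift 1)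
qed

lemma \<Omega>_cont: "continuous_on UNIV \<Omega>" "continuous_on UNIV \<Omega>1" "continuous_on UNIV \<Omega>2"
  by (intro continuous_at_imp_continuous_on ballI DERIV_isCont[OF der(1)] DERIV_isCont[OF der(2)] der(3))+

lemma \<Omega>_bounds: "\<exists>M>0. \<forall>x. \<bar>\<Omega> x\<bar> \<le> M \<and> \<bar>\<Omega>1 x\<bar> \<le> M \<and> \<bar>\<Omega>2 x\<bar> \<le> M"
proof -
  obtain a b c where "\<And>x. \<bar>\<Omega> x\<bar> \<le> a" "\<And>x. \<bar>\<Omega>1 x\<bar> \<le> b" "\<And>x. \<bar>\<Omega>2 x\<bar> \<le> c"
    using pi_periodic_bounded[of \<Omega>, OF per \<Omega>_cont(1)] pi_periodic_bounded[of \<Omega>1, OF per_deriv(1) \<Omega>_cont(2)]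
      pi_periodic_bounded[of \<Omega>2, OF per_deriv(2) \<Omega>_cont(3)] by blast
  note b = this
  have "\<bar>\<Omega> x\<bar> \<le> \<bar>a\<bar> + \<bar>b\<bar> + \<bar>c\<bar> + 1" "\<bar>\<Omega>1 x\<bar> \<le> \<bar>a\<bar> + \<bar>b\<bar> + \<bar>c\<bar> + 1" "\<bar>\<Omega>2 x\<bar> \<le> \<bar>a\<bar> + \<bar>b\<bar> + \<bar>c\<bar> + 1" for x
    using b(1)[of x] b(2)[of x] b(3)[of x] by linarith+
  then show ?thesis by (intro exI[of _ "\<bar>a\<bar> + \<bar>b\<bar> + \<bar>c\<bar> + 1"] conjI allI) linarith+
qed

lemma \<Omega>_lower: "\<exists>m>0. \<forall>x. m \<le> \<Omega> x"
proof -
  have "compact (\<Omega> ` {0..pi})" 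
    by (rule compact_continuous_image[OF continuous_on_subset[OF \<Omega>_cont(1) subset_UNIV] compact_Icc])
  then obtain y where y: "y \<in> {0..pi}" "\<And>z. z \<in> {0..pi} \<Longrightarrow> \<Omega> y \<le> \<Omega> z"
    using compact_attains_inf[of "\<Omega> ` {0..pi}"] by auto
  have "\<Omega> y \<le> \<Omega> x" for x using pi_periodic_reduce[of \<Omega> x, OF per] y(2) by force
  then show ?thesis using pos by blast
qed

lemma cont_angle: "x \<noteq> 0 \<Longrightarrow> isCont (\<lambda>y. \<Omega> (angle y)) x"
  using has_derivative_periodic_angle[of \<Omega> \<Omega>1 x, OF per der(1) per_deriv(1)] has_derivative_continuous by blast

lemma measurable_angle [measurable]: "(\<lambda>y. \<Omega> (angle y)) \<in> borel_measurable borel"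
proof (rule borel_measurable_continuous_countable_exceptions[of "{0}"])
  show "continuous_on (- {0}) (\<lambda>y. \<Omega> (angle y))"
    by (intro continuous_at_imp_continuous_on ballI cont_angle) auto
qed auto

lemma measurable_riesz [measurable]: "anisotropic_riesz s \<Omega> \<in> borel_measurable borel"
  unfolding anisotropic_riesz_def[abs_def] by measurable

text \<open>A non-negative profile with angular part \<open>\<Omega>\<close> that vanishes to fourth order at the origin, so
  that it is twice differentiable along every line.\<close>
definition bump :: "plane \<Rightarrow> real" where
  "bump x = ((norm x)\<^sup>2)\<^sup>2 * exp (- (pi * (norm x)\<^sup>2)) * \<Omega> (angle x)"

definition bump1 :: "plane \<Rightarrow> plane \<Rightarrow> real" where
  "bump1 v x = exp (- (pi * (norm x)\<^sup>2)) *
     ((2 * (norm x)\<^sup>2 - pi * ((norm x)\<^sup>2)\<^sup>2) * (2 * (x \<bullet> v)) * \<Omega> (angle x)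
      + (norm x)\<^sup>2 * (fst x * snd v - snd x * fst v) * \<Omega>1 (angle x))"

definition bump2 :: "plane \<Rightarrow> plane \<Rightarrow> real" where
  "bump2 v x = exp (- (pi * (norm x)\<^sup>2)) *
     ((- pi * (2 * (norm x)\<^sup>2 - pi * ((norm x)\<^sup>2)\<^sup>2) * (2 * (x \<bullet> v))\<^sup>2 + (2 - 2 * pi * (norm x)\<^sup>2) * (2 * (x \<bullet> v))\<^sup>2
        + 2 * (2 * (norm x)\<^sup>2 - pi * ((norm x)\<^sup>2)\<^sup>2) * (norm v)\<^sup>2) * \<Omega> (angle x)
      + (3 - 2 * pi * (norm x)\<^sup>2) * (2 * (x \<bullet> v)) * (fst x * snd v - snd x * fst v) * \<Omega>1 (angle x)
      + (fst x * snd v - snd x * fst v)\<^sup>2 * \<Omega>2 (angle x))"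

text \<open>Along a line the cross product of position and direction is constant, so the derivative of the angle is
  that constant divided by the squared norm.\<close>
lemma line_angle_deriv:
  fixes y v :: plane
  assumes perA: "\<And>\<theta>. A (\<theta> + pi) = A \<theta>" and A: "\<And>\<theta>. (A has_real_derivative A' \<theta>) (at \<theta>)"
    and perA': "\<And>\<theta>. A' (\<theta> + pi) = A' \<theta>" and x: "y + t *\<^sub>R v \<noteq> 0"
  shows "((\<lambda>t. A (angle (y + t *\<^sub>R v))) has_real_derivative
    A' (angle (y + t *\<^sub>R v)) * ((fst y * snd v - snd y * fst v) / (norm (y + t *\<^sub>R v))\<^sup>2)) (at t)"
proof -
  have "((\<lambda>t. y + t *\<^sub>R v) has_derivative (\<lambda>h. h *\<^sub>R v)) (at t)"
    by (auto intro!: derivative_eq_intros)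
  from has_derivative_compose[OF this has_derivative_periodic_angle[of A A', OF perA A perA' x]]
  show ?thesis unfolding has_field_derivative_def
    by (rule has_derivative_eq_rhs) (auto simp: fun_eq_iff field_simps)
qed

text \<open>On a line through the origin the angle takes only two values, which differ by \<open>pi\<close>. There the angular
  factor is constant, which covers the point where the angle is not differentiable.\<close>
lemma bump_line_deriv:
  "((\<lambda>t. bump (y + t *\<^sub>R v)) has_real_derivative bump1 v (y + t *\<^sub>R v)) (at t)"
proof (cases "y + t *\<^sub>R v = 0")
  case False
  then have n: "norm (y + t *\<^sub>R v) \<noteq> 0" by simp
  show ?thesis
    unfolding bump_def bump1_def line_cross
    by (rule derivative_eq_intros line_norm_deriv line_angle_deriv[of \<Omega> \<Omega>1, OF per der(1) per_deriv(1) False] refl)+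
       (use n in \<open>simp add: field_simps power2_eq_square\<close>)
next
  case True
  have eq: "bump (y + t' *\<^sub>R v) = ((norm (y + t' *\<^sub>R v))\<^sup>2)\<^sup>2 * exp (- (pi * (norm (y + t' *\<^sub>R v))\<^sup>2)) * \<Omega> (angle v)" for t'
  proof -
    have "y + t' *\<^sub>R v = (t' - t) *\<^sub>R v" using True by (simp add: algebra_simps eq_neg_iff_add_eq_0)
    then show ?thesis unfolding bump_def using pi_periodic_angle_scale[of \<Omega> "t' - t" v, OF per] by (cases "t' = t") auto
  qed
  show ?thesis unfolding eq bump1_def True
    by (rule derivative_eq_intros line_norm_deriv refl)+ (simp add: True)
qed

lemma bump1_line_deriv:
  "((\<lambda>t. bump1 v (y + t *\<^sub>R v)) has_real_derivative bump2 v (y + t *\<^sub>R v)) (at t)"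
proof (cases "y + t *\<^sub>R v = 0")
  case False
  then have n: "norm (y + t *\<^sub>R v) \<noteq> 0" by simp
  show ?thesis
    unfolding bump1_def bump2_def line_cross
    by (rule derivative_eq_intros line_norm_deriv line_inner_deriv line_angle_deriv[of \<Omega> \<Omega>1, OF per der(1) per_deriv(1) False]
         line_angle_deriv[of \<Omega>1 \<Omega>2, OF per_deriv(1) der(2) per_deriv(2) False] refl)+
       (use n in \<open>simp add: field_simps power2_eq_square\<close>)
next
  case True
  have c: "fst y * snd v - snd y * fst v = 0" using line_cross[of y t v] unfolding True by simp
  have eq: "bump1 v (y + t' *\<^sub>R v) = exp (- (pi * (norm (y + t' *\<^sub>R v))\<^sup>2)) *
     ((2 * (norm (y + t' *\<^sub>R v))\<^sup>2 - pi * ((norm (y + t' *\<^sub>R v))\<^sup>2)\<^sup>2) * (2 * ((y + t' *\<^sub>R v) \<bullet> v)) * \<Omega> (angle v))" for t'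
  proof -
    have "y + t' *\<^sub>R v = (t' - t) *\<^sub>R v" using True by (simp add: algebra_simps eq_neg_iff_add_eq_0)
    then show ?thesis unfolding bump1_def line_cross c using pi_periodic_angle_scale[of \<Omega> "t' - t" v, OF per] by (cases "t' = t") auto
  qed
  show ?thesis unfolding eq bump2_def True
    by (rule derivative_eq_intros line_norm_deriv line_inner_deriv refl)+ (simp add: True)
qed

end

section \<open>Decay of the bump and the Fourier transform of the kernel\<close>

lemma power_mult_gauss_le:
  fixes q :: real
  assumes q: "q \<ge> 0" shows "(1 + q) ^ 5 * exp (- (pi * q)) \<le> 400"
proof -
  have "(1 + q) ^ 5 * exp (- (pi * q)) \<le> (120 * exp (1 + q)) * exp (- (pi * q))"
    using power_le_exp[of "1 + q" 5] q by (intro mult_right_mono) (auto simp: fact_numeral)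
  also have "\<dots> = 120 * exp (1 + (q - pi * q))" by (simp add: exp_add[symmetric] exp_minus exp_diff field_simps)
  also have "\<dots> \<le> 120 * exp 1" using q pi_ge_two by (intro mult_left_mono) (auto simp: mult_le_cancel_right1)
  also have "\<dots> \<le> 400" using exp_le by simp
  finally show ?thesis .
qed

lemma cube_mult_gauss_le_decay_weight:
  "(1 + (norm x)\<^sup>2) ^ 3 * exp (- (pi * (norm x)\<^sup>2)) \<le> 400 * decay_weight x"
proof -
  have p: "1 + (norm x)\<^sup>2 > 0" by (simp add: add_pos_nonneg)
  have "(1 + (norm x)\<^sup>2) ^ 3 * exp (- (pi * (norm x)\<^sup>2)) = (1 + (norm x)\<^sup>2) ^ 5 * exp (- (pi * (norm x)\<^sup>2)) * (1 / (1 + (norm x)\<^sup>2)\<^sup>2)"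
  proof -
    have "P ^ 3 * e = P ^ 5 * e * (1 / P\<^sup>2)" if "P > 0" for P e :: real
      using that by (simp add: eval_nat_numeral)
    then show ?thesis using p .
  qed
  also have "\<dots> \<le> 400 * decay_weight x"
    using power_mult_gauss_le[of "(norm x)\<^sup>2"] inverse_square_le_decay_weight[of x] by (intro mult_mono) auto
  finally show ?thesis .
qed

text \<open>Substituting \<open>t * r\<close> for \<open>t\<close>.\<close>
lemma mellin_radial:
  assumes [measurable]: "h \<in> borel_measurable borel" and r: "r > 0"
  shows "(\<integral>\<^sup>+t\<in>{0<..}. ennreal (t powr (s - 1) * h (t * r)) \<partial>lborel)
    = ennreal (r powr (- s)) * (\<integral>\<^sup>+t\<in>{0<..}. ennreal (t powr (s - 1) * h t) \<partial>lborel)"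
proof -
  have "(\<integral>\<^sup>+t\<in>{0<..}. ennreal (t powr (s - 1) * h t) \<partial>lborel)
    = ennreal r * (\<integral>\<^sup>+t\<in>{0<..}. ennreal ((r * t) powr (s - 1) * h (r * t)) \<partial>lborel)"
    by (rule nn_integral_pos_scale[OF _ r]) measurable
  also have "(\<integral>\<^sup>+t\<in>{0<..}. ennreal ((r * t) powr (s - 1) * h (r * t)) \<partial>lborel)
    = (\<integral>\<^sup>+t. ennreal (r powr (s - 1)) * (ennreal (t powr (s - 1) * h (t * r)) * indicator {0<..} t) \<partial>lborel)"
    using r by (intro nn_integral_cong) (auto simp: powr_mult ennreal_mult'[symmetric] mult_ac split: split_indicator)
  also have "\<dots> = ennreal (r powr (s - 1)) * (\<integral>\<^sup>+t\<in>{0<..}. ennreal (t powr (s - 1) * h (t * r)) \<partial>lborel)"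
    by (rule nn_integral_cmult) measurable
  finally have "ennreal (r powr (- s)) * (\<integral>\<^sup>+t\<in>{0<..}. ennreal (t powr (s - 1) * h t) \<partial>lborel)
     = ennreal (r powr (- s) * (r * r powr (s - 1))) * (\<integral>\<^sup>+t\<in>{0<..}. ennreal (t powr (s - 1) * h (t * r)) \<partial>lborel)"
    using r by (simp add: ennreal_mult mult.assoc)
  also have "r powr (- s) * (r * r powr (s - 1)) = 1"
    using r by (simp add: powr_mult_base powr_add[symmetric])
  finally show ?thesis by simp
qed

definition mellin_mass :: "real \<Rightarrow> (real \<Rightarrow> real) \<Rightarrow> real" where
  "mellin_mass s h = (LINT t:{0<..}|lborel. t powr (s - 1) * h t)"

lemma mellin_mass:
  assumes s: "0 < s" "s < 2" and [measurable]: "h \<in> borel_measurable borel"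
    and h: "\<And>t. t > 0 \<Longrightarrow> 0 < h t" "\<And>t. t > 0 \<Longrightarrow> h t \<le> C / (1 + t\<^sup>2)"
  shows "(\<integral>\<^sup>+t\<in>{0<..}. ennreal (t powr (s - 1) * h t) \<partial>lborel) = ennreal (mellin_mass s h)"
    and "mellin_mass s h > 0"
proof -
  have i: "integrable lborel (\<lambda>t. indicator {0<..} t *\<^sub>R (t powr (s - 1) * h t))"
  proof (rule integrable_boundI)
    show "integrable lborel (\<lambda>t. C * (indicator {0<..} t *\<^sub>R (t powr (s - 1) / (1 + t\<^sup>2))))"
      by (intro integrable_mult_right set_integrable_mellin_weight[OF s, unfolded set_integrable_def])
    show "AE t in lborel. norm (indicator {0<..} t *\<^sub>R (t powr (s - 1) * h t)) \<le> C * (indicator {0<..} t *\<^sub>R (t powr (s - 1) / (1 + t\<^sup>2)))"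
    proof (rule AE_I2)
      fix t :: real
      show "norm (indicator {0<..} t *\<^sub>R (t powr (s - 1) * h t)) \<le> C * (indicator {0<..} t *\<^sub>R (t powr (s - 1) / (1 + t\<^sup>2)))"
      proof (cases "t > 0")
        case True
        then show ?thesis using mult_left_mono[OF h(2)[OF True], of "t powr (s - 1)"] h(1)[OF True] by (simp add: abs_mult mult_ac)
      qed auto
    qed
  qed measurable
  have ae: "AE t in lborel. 0 \<le> indicator {0<..} t *\<^sub>R (t powr (s - 1) * h t)"
    using h(1) by (intro AE_I2) (auto split: split_indicator intro: less_imp_le)
  have "(\<integral>\<^sup>+t\<in>{0<..}. ennreal (t powr (s - 1) * h t) \<partial>lborel) = (\<integral>\<^sup>+t. ennreal (indicator {0<..} t *\<^sub>R (t powr (s - 1) * h t)) \<partial>lborel)"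
    by (intro nn_integral_cong) (auto split: split_indicator)
  also have "\<dots> = ennreal (mellin_mass s h)"
    unfolding mellin_mass_def set_lebesgue_integral_def by (rule nn_integral_eq_integral[OF i ae])
  finally show 1: "(\<integral>\<^sup>+t\<in>{0<..}. ennreal (t powr (s - 1) * h t) \<partial>lborel) = ennreal (mellin_mass s h)" .
  show "mellin_mass s h > 0"
  proof (rule ccontr)
    assume "\<not> mellin_mass s h > 0"
    then have "ennreal (mellin_mass s h) = 0" by (simp add: ennreal_neg)
    then have "(\<integral>\<^sup>+t\<in>{0<..}. ennreal (t powr (s - 1) * h t) \<partial>lborel) = 0" by (simp only: 1)
    then have "AE t in lborel. ennreal (t powr (s - 1) * h t) * indicator {0<..} t = 0"
      by (subst (asm) nn_integral_0_iff_AE) auto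
    then have "AE t in lborel. t \<notin> {0<..<1::real}"
    proof eventually_elim
      fix t :: real assume "ennreal (t powr (s - 1) * h t) * indicator {0<..} t = 0"
      then show "t \<notin> {0<..<1}" using h(1)[of t] by (auto simp: indicator_def ennreal_eq_0_iff mult_le_0_iff not_le[symmetric] split: if_splits)
    qed
    then have "{0<..<1::real} \<in> null_sets lborel" by (subst (asm) AE_iff_null_sets[symmetric]) auto
    then show False by (simp add: null_sets_def)
  qed
qed

context profile begin

lemma bump_nonneg: "0 \<le> bump x"
  unfolding bump_def using pos[of "angle x"] by simp

lemma bump_even: "bump (-x) = bump x"
  unfolding bump_def using pi_periodic_angle_uminus[of \<Omega> x, OF per] by simp

lemma bump_measurable [measurable]: "bump \<in> borel_measurable borel"
  unfolding bump_def[abs_def] by measurable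

text \<open>Each of the two derivatives costs at most one division by the norm, which the fourth-order zero of the
  bump absorbs; the Gaussian factor gives the decay.\<close>
lemma bump_bound: "\<exists>K\<ge>0. (\<forall>x. \<bar>bump x\<bar> \<le> K * decay_weight x) \<and> (\<forall>x v. \<bar>bump2 v x\<bar> \<le> K * (norm v)\<^sup>2 * decay_weight x)"
proof -
  obtain M where M: "M > 0" "\<And>x. \<bar>\<Omega> x\<bar> \<le> M" "\<And>x. \<bar>\<Omega>1 x\<bar> \<le> M" "\<And>x. \<bar>\<Omega>2 x\<bar> \<le> M"
    using \<Omega>_bounds by blast
  have "\<bar>bump x\<bar> \<le> 40000 * M * decay_weight x" for x
  proof -
    define q where "q = (norm x)\<^sup>2"
    have q: "q \<ge> 0" by (simp add: q_def)
    have "\<bar>bump x\<bar> = q\<^sup>2 * exp (- (pi * q)) * \<bar>\<Omega> (angle x)\<bar>" by (simp add: bump_def q_def abs_mult)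
    also have "\<dots> \<le> (1 + q) ^ 3 * exp (- (pi * q)) * M"
    proof (intro mult_mono M)
      have "q\<^sup>2 \<le> (1 + q)\<^sup>2" using q by (intro power_mono) auto
      also have "\<dots> \<le> (1 + q) ^ 3" using q by (intro power_increasing) auto
      finally show "q\<^sup>2 \<le> (1 + q) ^ 3" .
    qed (use q in auto)
    also have "\<dots> \<le> 400 * decay_weight x * M"
      using cube_mult_gauss_le_decay_weight[of x] M by (intro mult_right_mono) (auto simp: q_def)
    also have "\<dots> \<le> 40000 * M * decay_weight x" using M decay_weight_nonneg[of x] by simp
    finally show ?thesis .
  qed
  moreover have "\<bar>bump2 v x\<bar> \<le> (40000 * M) * (norm v)\<^sup>2 * decay_weight x" for x v
  proof -
    \<comment> \<open>\<open>a\<close> and \<open>c\<close> are the inner and the cross product of \<open>x\<close> and \<open>v\<close>, so \<open>a\<^sup>2 + c\<^sup>2 = q * n\<close> bounds both\<close>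
    define q n a c where "q = (norm x)\<^sup>2" and "n = (norm v)\<^sup>2" and "a = x \<bullet> v" and "c = fst x * snd v - snd x * fst v"
    have q: "q \<ge> 0" and n: "n \<ge> 0" by (simp_all add: q_def n_def)
    have ac: "a\<^sup>2 + c\<^sup>2 = q * n"
      by (simp add: a_def c_def q_def n_def plane_norm plane_inner power2_eq_square algebra_simps)
    then have a2: "a\<^sup>2 \<le> q * n" and c2: "c\<^sup>2 \<le> q * n" by (smt (verit) zero_le_power2)+
    have acb: "\<bar>a * c\<bar> \<le> q * n"
    proof -
      have "0 \<le> \<bar>a\<bar> * \<bar>c\<bar>" by simp
      then show ?thesis using ac zero_le_power2[of "\<bar>a\<bar> - \<bar>c\<bar>"]
        unfolding power2_diff abs_mult power2_abs by linarith
    qed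
    have pi4: "pi \<le> 4" using pi_less_4 by simp
    have pq: "pi * q \<le> 4 * q" using pi4 q by (intro mult_right_mono) auto
    have pq0: "0 \<le> pi * q" using q by simp
    have pq2: "pi * q\<^sup>2 \<le> 4 * q\<^sup>2" using pi4 by (intro mult_right_mono) auto
    define X where "X = 2 * q - pi * q\<^sup>2"
    have X: "\<bar>X\<bar> \<le> 2 * q + 4 * q\<^sup>2" unfolding X_def using pq2 q by (smt (verit) pi_gt_zero zero_le_power2 mult_nonneg_nonneg)
    have t1: "\<bar>- pi * X * (2 * a)\<^sup>2 + (2 - 2 * pi * q) * (2 * a)\<^sup>2 + 2 * X * n\<bar> \<le> (64 * q ^ 3 + 72 * q\<^sup>2 + 12 * q) * n"
    proof -
      have "\<bar>pi * X * (4 * a\<^sup>2)\<bar> \<le> 4 * (2 * q + 4 * q\<^sup>2) * (4 * (q * n))"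
        unfolding abs_mult using pi4 X a2 q n by (intro mult_mono) auto
      moreover have "\<bar>(2 - 2 * pi * q) * (4 * a\<^sup>2)\<bar> \<le> (2 + 8 * q) * (4 * (q * n))"
        unfolding abs_mult using a2 q n pq pq0 by (intro mult_mono) auto
      moreover have "\<bar>2 * X * n\<bar> \<le> 2 * (2 * q + 4 * q\<^sup>2) * n"
        unfolding abs_mult using X n by (intro mult_mono) auto
      ultimately have "\<bar>- (pi * X * (4 * a\<^sup>2)) + (2 - 2 * pi * q) * (4 * a\<^sup>2) + 2 * X * n\<bar> \<le>
          4 * (2 * q + 4 * q\<^sup>2) * (4 * (q * n)) + (2 + 8 * q) * (4 * (q * n)) + 2 * (2 * q + 4 * q\<^sup>2) * n"
        by linarith
      then show ?thesis by (simp add: power_mult_distrib algebra_simps power2_eq_square power3_eq_cube)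
    qed
    have t2: "\<bar>(3 - 2 * pi * q) * (2 * a) * c\<bar> \<le> (6 * q + 16 * q\<^sup>2) * n"
    proof -
      have "\<bar>(3 - 2 * pi * q) * (2 * (a * c))\<bar> \<le> (3 + 8 * q) * (2 * (q * n))"
        unfolding abs_mult[of "3 - _"] using acb q n pq pq0 by (intro mult_mono) (auto simp: abs_mult)
      then show ?thesis by (simp add: algebra_simps power2_eq_square)
    qed
    have t3: "\<bar>c\<^sup>2\<bar> \<le> q * n" using c2 by simp
    have "\<bar>bump2 v x\<bar> = exp (- (pi * q)) * \<bar>(- pi * X * (2 * a)\<^sup>2 + (2 - 2 * pi * q) * (2 * a)\<^sup>2 + 2 * X * n) * \<Omega> (angle x)
      + (3 - 2 * pi * q) * (2 * a) * c * \<Omega>1 (angle x) + c\<^sup>2 * \<Omega>2 (angle x)\<bar>"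
      unfolding bump2_def X_def q_def n_def a_def c_def abs_mult[of "exp _"] by simp
    also have "\<dots> \<le> exp (- (pi * q)) * ((64 * q ^ 3 + 72 * q\<^sup>2 + 12 * q) * n * M + (6 * q + 16 * q\<^sup>2) * n * M + q * n * M)"
    proof (rule mult_left_mono)
      have "\<bar>(- pi * X * (2 * a)\<^sup>2 + (2 - 2 * pi * q) * (2 * a)\<^sup>2 + 2 * X * n) * \<Omega> (angle x)\<bar> \<le> (64 * q ^ 3 + 72 * q\<^sup>2 + 12 * q) * n * M"
        unfolding abs_mult[of "_ + _"] using t1 M q n by (intro mult_mono) auto
      moreover have "\<bar>(3 - 2 * pi * q) * (2 * a) * c * \<Omega>1 (angle x)\<bar> \<le> (6 * q + 16 * q\<^sup>2) * n * M"
        unfolding abs_mult[of "(3 - 2 * pi * q) * (2 * a) * c"] using t2 M q n by (intro mult_mono) auto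
      moreover have "\<bar>c\<^sup>2 * \<Omega>2 (angle x)\<bar> \<le> q * n * M"
        unfolding abs_mult[of "c\<^sup>2"] using t3 M q n by (intro mult_mono) auto
      ultimately show "\<bar>(- pi * X * (2 * a)\<^sup>2 + (2 - 2 * pi * q) * (2 * a)\<^sup>2 + 2 * X * n) * \<Omega> (angle x)
      + (3 - 2 * pi * q) * (2 * a) * c * \<Omega>1 (angle x) + c\<^sup>2 * \<Omega>2 (angle x)\<bar>
        \<le> (64 * q ^ 3 + 72 * q\<^sup>2 + 12 * q) * n * M + (6 * q + 16 * q\<^sup>2) * n * M + q * n * M" by linarith
    qed simp
    also have "\<dots> = exp (- (pi * q)) * (64 * q ^ 3 + 88 * q\<^sup>2 + 19 * q) * (n * M)" by (simp add: algebra_simps)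
    also have "\<dots> \<le> exp (- (pi * q)) * (100 * (1 + q) ^ 3) * (n * M)"
    proof (intro mult_right_mono mult_left_mono)
      have "100 * (1 + q) ^ 3 = 100 + 300 * q + 300 * q\<^sup>2 + 100 * q ^ 3"
        by (simp add: power3_eq_cube power2_eq_square algebra_simps)
      moreover have "0 \<le> q\<^sup>2" "0 \<le> q ^ 3" using q by auto
      ultimately show "64 * q ^ 3 + 88 * q\<^sup>2 + 19 * q \<le> 100 * (1 + q) ^ 3" using q by linarith
    qed (use n M in auto)
    also have "\<dots> = 100 * (n * M) * ((1 + q) ^ 3 * exp (- (pi * q)))" by simp
    also have "\<dots> \<le> 100 * (n * M) * (400 * decay_weight x)"
      using cube_mult_gauss_le_decay_weight[of x] n M by (intro mult_left_mono) (auto simp: q_def)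
    also have "\<dots> = (40000 * M) * (norm v)\<^sup>2 * decay_weight x" by (simp add: n_def)
    finally show ?thesis .
  qed
  ultimately show ?thesis using M by (intro exI[of _ "40000 * M"]) auto
qed

lemma bump_integrable: "integrable lborel bump"
proof -
  obtain K where K: "\<And>x. \<bar>bump x\<bar> \<le> K * decay_weight x" using bump_bound by blast
  show ?thesis
    by (rule integrable_boundI[OF integrable_mult_right[OF integrable_decay_weight, of K]]) (use K in auto)
qed

lemma bump_fourier_decay: "\<exists>C\<ge>0. \<forall>\<xi>. norm (fourier (\<lambda>x. of_real (bump x)) \<xi>) \<le> C / (1 + (norm \<xi>)\<^sup>2)"
proof -
  obtain K where K: "K \<ge> 0" "\<And>x v. \<bar>bump2 v x\<bar> \<le> K * (norm v)\<^sup>2 * decay_weight x" using bump_bound by blast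
  show ?thesis
  proof (rule fourier_decay[of _ K "\<lambda>v x. of_real (bump1 v x)" "\<lambda>v x. of_real (bump2 v x)"])
    fix y v :: plane and t :: real
    show "((\<lambda>t. complex_of_real (bump (y + t *\<^sub>R v))) has_vector_derivative of_real (bump1 v (y + t *\<^sub>R v))) (at t)"
      by (rule has_vector_derivative_of_real[OF bump_line_deriv])
    show "((\<lambda>t. complex_of_real (bump1 v (y + t *\<^sub>R v))) has_vector_derivative of_real (bump2 v (y + t *\<^sub>R v))) (at t)"
      by (rule has_vector_derivative_of_real[OF bump1_line_deriv])
  qed (use K bump_integrable in auto)
qed

definition bump_mass :: "real \<Rightarrow> real" where
  "bump_mass s = mellin_mass s (\<lambda>t. (t\<^sup>2)\<^sup>2 * exp (- (pi * t\<^sup>2)))"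

definition bump_hat :: "real \<Rightarrow> plane \<Rightarrow> real" where
  "bump_hat s \<xi> = Re (fourier (\<lambda>x. of_real (bump x / bump_mass s)) \<xi>)"

text \<open>This is the function \<open>Omega_tilde s \<Omega>\<close>, see \<open>Omega_tilde_eq_angular_part\<close>.\<close>
definition angular_part :: "real \<Rightarrow> real \<Rightarrow> real" where
  "angular_part s \<phi> = mellin_hat s (bump_hat s) (cos \<phi>, sin \<phi>)"

lemma bump_mellin:
  assumes s: "0 < s" "s < 2"
  shows "bump_mass s > 0"
    and "x \<noteq> 0 \<Longrightarrow> (\<integral>\<^sup>+t\<in>{0<..}. ennreal (t powr (s - 1) * (bump (t *\<^sub>R x) / bump_mass s)) \<partial>lborel) = ennreal (anisotropic_riesz s \<Omega> x)"
proof -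
  let ?h = "\<lambda>t::real. (t\<^sup>2)\<^sup>2 * exp (- (pi * t\<^sup>2))"
  have h: "?h t \<le> 400 / (1 + t\<^sup>2)" for t
  proof -
    have "(1 + t\<^sup>2) ^ 5 * exp (- (pi * t\<^sup>2)) \<le> 400" by (rule power_mult_gauss_le) simp
    moreover have "(t\<^sup>2)\<^sup>2 * (1 + t\<^sup>2) \<le> (1 + t\<^sup>2) ^ 4 * (1 + t\<^sup>2)"
    proof (rule mult_right_mono)
      have "(t\<^sup>2)\<^sup>2 \<le> (1 + t\<^sup>2)\<^sup>2" by (intro power_mono) auto
      also have "\<dots> \<le> (1 + t\<^sup>2) ^ 4" by (intro power_increasing) auto
      finally show "(t\<^sup>2)\<^sup>2 \<le> (1 + t\<^sup>2) ^ 4" .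
    qed auto
    then have "(t\<^sup>2)\<^sup>2 * (1 + t\<^sup>2) * exp (- (pi * t\<^sup>2)) \<le> (1 + t\<^sup>2) ^ 5 * exp (- (pi * t\<^sup>2))"
      by (intro mult_right_mono) (auto simp: power_numeral_reduce mult_ac)
    ultimately show ?thesis by (simp add: field_simps add_pos_nonneg)
  qed
  note m = mellin_mass[OF s, of ?h 400, folded bump_mass_def]
  show pos': "bump_mass s > 0" by (rule m(2)) (use h in auto)
  have m1: "(\<integral>\<^sup>+t\<in>{0<..}. ennreal (t powr (s - 1) * ?h t) \<partial>lborel) = ennreal (bump_mass s)"
    by (rule m(1)) (use h in auto)
  assume x: "x \<noteq> 0"
  then have nx: "norm x > 0" by simp
  have "(\<integral>\<^sup>+t\<in>{0<..}. ennreal (t powr (s - 1) * (bump (t *\<^sub>R x) / bump_mass s)) \<partial>lborel)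
    = (\<integral>\<^sup>+t. ennreal (\<Omega> (angle x) / bump_mass s) * (ennreal (t powr (s - 1) * ?h (t * norm x)) * indicator {0<..} t) \<partial>lborel)"
  proof (intro nn_integral_cong)
    fix t :: real
    show "ennreal (t powr (s - 1) * (bump (t *\<^sub>R x) / bump_mass s)) * indicator {0<..} t
       = ennreal (\<Omega> (angle x) / bump_mass s) * (ennreal (t powr (s - 1) * ?h (t * norm x)) * indicator {0<..} t)"
    proof (cases "t > 0")
      case t: True
      have "t powr (s - 1) * (bump (t *\<^sub>R x) / bump_mass s) = (\<Omega> (angle x) / bump_mass s) * (t powr (s - 1) * ?h (t * norm x))"
        using t by (simp add: bump_def angle_scale)
      then have "ennreal (t powr (s - 1) * (bump (t *\<^sub>R x) / bump_mass s)) = ennreal (\<Omega> (angle x) / bump_mass s) * ennreal (t powr (s - 1) * ?h (t * norm x))"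
        using pos[of "angle x"] pos' by (simp only:) (rule ennreal_mult, auto intro: less_imp_le)
      then show ?thesis by (simp only: mult.assoc)
    qed auto
  qed
  also have "\<dots> = ennreal (\<Omega> (angle x) / bump_mass s) * (\<integral>\<^sup>+t\<in>{0<..}. ennreal (t powr (s - 1) * ?h (t * norm x)) \<partial>lborel)"
    by (rule nn_integral_cmult) measurable
  also have "(\<integral>\<^sup>+t\<in>{0<..}. ennreal (t powr (s - 1) * ?h (t * norm x)) \<partial>lborel) = ennreal (norm x powr (- s)) * ennreal (bump_mass s)"
    unfolding m1[symmetric] by (rule mellin_radial[OF _ nx]) measurable
  also have "ennreal (\<Omega> (angle x) / bump_mass s) * (ennreal (norm x powr (- s)) * ennreal (bump_mass s)) = ennreal (anisotropic_riesz s \<Omega> x)"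
    using pos' pos[of "angle x"] by (simp add: anisotropic_riesz_def ennreal_mult[symmetric])
  finally show "(\<integral>\<^sup>+t\<in>{0<..}. ennreal (t powr (s - 1) * (bump (t *\<^sub>R x) / bump_mass s)) \<partial>lborel) = ennreal (anisotropic_riesz s \<Omega> x)" .
qed

lemma riesz_nonneg: "0 \<le> anisotropic_riesz s \<Omega> x"
  unfolding anisotropic_riesz_def using pos[of "angle x"] by simp

lemma riesz_bound: "\<exists>M>0. \<forall>x. anisotropic_riesz s \<Omega> x \<le> M * norm x powr (- s)"
proof -
  obtain M where "M > 0" "\<And>x. \<bar>\<Omega> x\<bar> \<le> M" using \<Omega>_bounds by blast
  then show ?thesis
    by (intro exI[of _ M]) (auto simp: anisotropic_riesz_def mult.commute[of M] intro!: mult_left_mono intro: order_trans[OF abs_ge_self])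
qed

lemma bump_hat:
  assumes s: "0 < s" "s < 2"
  shows "continuous_on UNIV (bump_hat s)" "bump_hat s (-\<xi>) = bump_hat s \<xi>"
    and "\<exists>C\<ge>0. \<forall>\<xi>. norm (fourier (\<lambda>x. of_real (bump x / bump_mass s)) \<xi>) \<le> C / (1 + (norm \<xi>)\<^sup>2)"
    and "\<exists>C\<ge>0. \<forall>\<xi>. \<bar>bump_hat s \<xi>\<bar> \<le> C / (1 + (norm \<xi>)\<^sup>2)"
proof -
  have m: "bump_mass s > 0" by (rule bump_mellin(1)[OF s])
  have i: "integrable lborel (\<lambda>x. bump x / bump_mass s)" using bump_integrable by simp
  then have ic: "integrable lborel (\<lambda>x. complex_of_real (bump x / bump_mass s))" by (rule integrable_of_real)
  show "continuous_on UNIV (bump_hat s)" unfolding bump_hat_def[abs_def]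
    by (intro continuous_on_Re fourier_continuous ic)
  show "bump_hat s (-\<xi>) = bump_hat s \<xi>"
    unfolding bump_hat_def by (subst fourier_real_even(1)[OF i]) (auto simp: bump_even)
  obtain C where C: "C \<ge> 0" "\<And>\<xi>. norm (fourier (\<lambda>x. of_real (bump x)) \<xi>) \<le> C / (1 + (norm \<xi>)\<^sup>2)"
    using bump_fourier_decay by blast
  have f: "fourier (\<lambda>x. of_real (bump x / bump_mass s)) \<xi> = fourier (\<lambda>x. of_real (bump x)) \<xi> / of_real (bump_mass s)" for \<xi>
    by (simp add: fourier_def)
  have b: "norm (fourier (\<lambda>x. of_real (bump x / bump_mass s)) \<xi>) \<le> (C / bump_mass s) / (1 + (norm \<xi>)\<^sup>2)" for \<xi>
  proof -
    have "norm (fourier (\<lambda>x. of_real (bump x / bump_mass s)) \<xi>) = norm (fourier (\<lambda>x. of_real (bump x)) \<xi>) / bump_mass s"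
      unfolding f norm_divide using m by simp
    then show ?thesis using divide_right_mono[OF C(2)[of \<xi>], of "bump_mass s"] m by (simp add: mult.commute)
  qed
  then show "\<exists>C\<ge>0. \<forall>\<xi>. norm (fourier (\<lambda>x. of_real (bump x / bump_mass s)) \<xi>) \<le> C / (1 + (norm \<xi>)\<^sup>2)"
    using C m by (intro exI[of _ "C / bump_mass s"]) auto
  have "\<bar>bump_hat s \<xi>\<bar> \<le> (C / bump_mass s) / (1 + (norm \<xi>)\<^sup>2)" for \<xi>
    unfolding bump_hat_def by (rule order_trans[OF abs_Re_le_cmod b])
  then show "\<exists>C\<ge>0. \<forall>\<xi>. \<bar>bump_hat s \<xi>\<bar> \<le> C / (1 + (norm \<xi>)\<^sup>2)"
    using C m by (intro exI[of _ "C / bump_mass s"]) auto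
qed

lemma angular_part_cont: assumes s: "0 < s" "s < 2" shows "continuous_on UNIV (angular_part s)"
proof -
  obtain C where "C \<ge> 0" "\<And>\<xi>. \<bar>bump_hat s \<xi>\<bar> \<le> C / (1 + (norm \<xi>)\<^sup>2)" using bump_hat(4)[OF s] by blast
  then show ?thesis unfolding angular_part_def[abs_def]
    by (intro mellin_hat_continuous_on_sphere[OF s bump_hat(1)[OF s]]) (auto simp: norm_prod_def intro!: continuous_intros)
qed

lemma angular_part_per: "angular_part s (\<phi> + 2 * pi) = angular_part s \<phi>" unfolding angular_part_def by simp

lemma angular_part_per_pi: assumes s: "0 < s" "s < 2" shows "angular_part s (\<phi> + pi) = angular_part s \<phi>"
proof -
  have "bump_hat s ((- cos \<phi>, - sin \<phi>) /\<^sub>R t) = bump_hat s ((cos \<phi>, sin \<phi>) /\<^sub>R t)" for t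
    using bump_hat(2)[OF s, of "(cos \<phi>, sin \<phi>) /\<^sub>R t"] by simp
  then show ?thesis unfolding angular_part_def mellin_hat_def by simp
qed

definition riesz_hat :: "real \<Rightarrow> plane \<Rightarrow> real" where
  "riesz_hat s \<xi> = norm \<xi> powr (- 2 + s) * angular_part s (angle \<xi>)"

lemma riesz_hat_eq: "\<xi> \<noteq> 0 \<Longrightarrow> riesz_hat s \<xi> = mellin_hat s (bump_hat s) \<xi>"
proof -
  assume x: "\<xi> \<noteq> 0"
  have "\<xi> = norm \<xi> *\<^sub>R (cos (angle \<xi>), sin (angle \<xi>))"
    using angle_cos_sin[OF x] by (auto simp: prod_eq_iff)
  then have "mellin_hat s (bump_hat s) \<xi> = mellin_hat s (bump_hat s) (norm \<xi> *\<^sub>R (cos (angle \<xi>), sin (angle \<xi>)))" by simp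
  also have "\<dots> = norm \<xi> powr (s - 2) * angular_part s (angle \<xi>)"
    unfolding angular_part_def using x by (intro mellin_hat_scale) auto
  finally show ?thesis by (simp add: riesz_hat_def)
qed

lemma riesz_hat_measurable [measurable]: assumes s: "0 < s" "s < 2" shows "riesz_hat s \<in> borel_measurable borel"
proof -
  have [measurable]: "bump_hat s \<in> borel_measurable borel" by (rule borel_measurable_continuous_onI[OF bump_hat(1)[OF s]])
  have [measurable]: "mellin_hat s (bump_hat s) \<in> borel_measurable borel"
    unfolding mellin_hat_def[abs_def] set_lebesgue_integral_def by measurable
  have "riesz_hat s = (\<lambda>\<xi>. if \<xi> = 0 then 0 else mellin_hat s (bump_hat s) \<xi>)"
    using riesz_hat_eq by (auto simp: fun_eq_iff riesz_hat_def)
  then show ?thesis by simp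
qed

lemma riesz_hat_bound: assumes s: "0 < s" "s < 2" shows "\<exists>D\<ge>0. \<forall>\<xi>. \<bar>riesz_hat s \<xi>\<bar> \<le> D * norm \<xi> powr (s - 2)"
proof -
  obtain M where "\<And>x. \<bar>angular_part s x\<bar> \<le> M" using pi_periodic_bounded[of "angular_part s", OF angular_part_per_pi[OF s] angular_part_cont[OF s]] by blast
  then have "\<bar>angular_part s x\<bar> \<le> \<bar>M\<bar>" for x by (rule order_trans[OF _ abs_ge_self])
  then show ?thesis
    by (intro exI[of _ "\<bar>M\<bar>"]) (auto simp: riesz_hat_def abs_mult mult.commute[of "\<bar>M\<bar>"] add.commute[of "-2"] intro!: mult_left_mono intro: order_trans)
qed

theorem has_fourier_transform_hat:
  assumes s: "0 < s" "s < 2"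
  shows "has_fourier_transform (anisotropic_riesz s \<Omega>) (riesz_hat s)"
proof -
  obtain C where C: "C \<ge> 0" "\<And>\<xi>. norm (fourier (\<lambda>x. of_real (bump x / bump_mass s)) \<xi>) \<le> C / (1 + (norm \<xi>)\<^sup>2)"
    using bump_hat(3)[OF s] by blast
  obtain B where B: "\<And>x. anisotropic_riesz s \<Omega> x \<le> B * norm x powr (- s)" using riesz_bound by blast
  have m: "bump_mass s > 0" by (rule bump_mellin(1)[OF s])
  have "has_fourier_transform (anisotropic_riesz s \<Omega>) (mellin_hat s (\<lambda>\<xi>. Re (fourier (\<lambda>x. of_real (bump x / bump_mass s)) \<xi>)))"
    by (rule has_fourier_transform_mellin[OF s _ _ _ C(2,1) measurable_riesz riesz_nonneg B bump_mellin(2)[OF s]])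
       (use m bump_nonneg bump_even bump_integrable in auto)
  then have h: "has_fourier_transform (anisotropic_riesz s \<Omega>) (mellin_hat s (bump_hat s))"
    unfolding bump_hat_def[abs_def] .
  show ?thesis unfolding has_fourier_transform_def
  proof (intro allI impI)
    fix f assume f: "schwartz f"
    have [measurable]: "bump_hat s \<in> borel_measurable borel" by (rule borel_measurable_continuous_onI[OF bump_hat(1)[OF s]])
    have [measurable]: "mellin_hat s (bump_hat s) \<in> borel_measurable borel"
      unfolding mellin_hat_def[abs_def] set_lebesgue_integral_def by measurable
    note [measurable] = riesz_hat_measurable[OF s] schwartz_measurable[OF f]
    have ae: "AE \<xi> in lborel. of_real (mellin_hat s (bump_hat s) \<xi>) * f \<xi> = of_real (riesz_hat s \<xi>) * f \<xi>"
      using AE_lborel_singleton[of "0::plane"] by eventually_elim (simp add: riesz_hat_eq)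
    have "integrable lborel (\<lambda>\<xi>. of_real (mellin_hat s (bump_hat s) \<xi>) * f \<xi>) \<longleftrightarrow> integrable lborel (\<lambda>\<xi>. of_real (riesz_hat s \<xi>) * f \<xi>)"
      by (rule integrable_cong_AE[OF _ _ ae]) measurable
    moreover have "(\<integral>\<xi>. of_real (mellin_hat s (bump_hat s) \<xi>) * f \<xi> \<partial>lborel) = (\<integral>\<xi>. of_real (riesz_hat s \<xi>) * f \<xi> \<partial>lborel)"
      by (rule integral_cong_AE[OF _ _ ae]) measurable
    ultimately show "integrable lborel (\<lambda>x. of_real (anisotropic_riesz s \<Omega> x) * fourier f x) \<and> integrable lborel (\<lambda>\<xi>. of_real (riesz_hat s \<xi>) * f \<xi>) \<and>
        (\<integral>x. of_real (anisotropic_riesz s \<Omega> x) * fourier f x \<partial>lborel) = (\<integral>\<xi>. of_real (riesz_hat s \<xi>) * f \<xi> \<partial>lborel)"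
      using h f unfolding has_fourier_transform_def by simp
  qed
qed

end

lemma ball_plane_borel [measurable]: "ball (z::plane) r \<in> sets borel" "- ball (z::plane) r \<in> sets borel"
  by auto

lemma norm_polar: "norm (cos \<phi>, sin \<phi> :: real) = 1"
  by (simp add: plane_norm)

lemma polar_nonzero: "(cos \<phi>, sin \<phi> :: real) \<noteq> 0"
  using norm_polar[of \<phi>] by (metis norm_zero zero_neq_one)

lemma half_powr: "(r / 2) powr (-a) = 2 powr a * r powr (-a)" if "r \<ge> 0" for r a :: real
proof -
  have "r powr (-a) = (r / 2) powr (-a) * 2 powr (-a)" using that powr_mult[of "r / 2" 2 "-a"] by simp
  moreover have "2 powr (-a) * 2 powr a = (1::real)" unfolding powr_add[symmetric] by simp
  ultimately show ?thesis by (metis mult.assoc mult.commute mult.right_neutral)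
qed

lemma integrable_ball_powr:
  assumes a: "0 < a" "a < 2"
  shows "integrable lborel (\<lambda>x::plane. indicator (ball 0 r) x * norm x powr (-a))"
proof (rule integrable_boundI)
  show "integrable lborel (\<lambda>x::plane. (1 + r\<^sup>2) * (norm x powr (-a) / (1 + (norm x)\<^sup>2)))"
    by (intro integrable_mult_right integrable_radial_weight a)
  show "AE x in (lborel::plane measure). norm (indicator (ball 0 r) x * norm x powr (-a)) \<le> (1 + r\<^sup>2) * (norm x powr (-a) / (1 + (norm x)\<^sup>2))"
  proof (rule AE_I2)
    fix x :: plane
    show "norm (indicator (ball 0 r) x * norm x powr (-a)) \<le> (1 + r\<^sup>2) * (norm x powr (-a) / (1 + (norm x)\<^sup>2))"
    proof (cases "norm x < r")
      case True
      have "1 + (norm x)\<^sup>2 \<le> 1 + r\<^sup>2" using True by (simp add: power_mono)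
      then have "norm x powr (-a) * (1 + (norm x)\<^sup>2) \<le> norm x powr (-a) * (1 + r\<^sup>2)" by (intro mult_left_mono) auto
      then show ?thesis using True by (simp add: pos_le_divide_eq add_pos_nonneg mult.commute)
    next
      case False
      then show ?thesis by (auto intro!: mult_nonneg_nonneg divide_nonneg_nonneg)
    qed
  qed
qed measurable

lemma integral_ball_powr:
  assumes r: "r > 0"
  shows "(\<integral>x. indicator (ball 0 r) x * norm (x::plane) powr (-a) \<partial>lborel)
     = r powr (2 - a) * (\<integral>x. indicator (ball 0 1) x * norm (x::plane) powr (-a) \<partial>lborel)"
proof -
  have eq: "indicator (ball 0 r) (0 + r *\<^sub>R x) * norm (0 + r *\<^sub>R x) powr (-a) = r powr (-a) * (indicator (ball 0 1) x * norm x powr (-a))" for x :: plane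
    using r by (auto simp: powr_mult mult_less_cancel_left1 split: split_indicator)
  have "(\<integral>x. indicator (ball 0 r) x * norm (x::plane) powr (-a) \<partial>lborel)
    = r\<^sup>2 *\<^sub>R (\<integral>x. indicator (ball 0 r) (0 + r *\<^sub>R x) * norm (0 + r *\<^sub>R x::plane) powr (-a) \<partial>lborel)"
    using r by (intro integral_plane_affine) auto
  also have "\<dots> = (r powr (-a) * r\<^sup>2) * (\<integral>x. indicator (ball 0 1) x * norm (x::plane) powr (-a) \<partial>lborel)"
    unfolding eq by simp
  also have "r powr (-a) * r\<^sup>2 = r powr (2 - a)" using powr_mult_square[OF r, of "-a"] by simp
  finally show ?thesis .
qed

section \<open>Gaussian averages of functions with a singularity at the origin\<close>

definition gauss_avg :: "(plane \<Rightarrow> real) \<Rightarrow> real \<Rightarrow> plane \<Rightarrow> real" where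
  "gauss_avg F m z = m\<^sup>2 * (\<integral>x. F x * exp (- (pi * m\<^sup>2 * (norm (z - x))\<^sup>2)) \<partial>lborel)"

lemma shifted_gaussian_integral:
  assumes m: "m > 0"
  shows "integrable lborel (\<lambda>x::plane. exp (- (pi * m\<^sup>2 * (norm (z - x))\<^sup>2)))"
    and "m\<^sup>2 * (\<integral>x. exp (- (pi * m\<^sup>2 * (norm (z - x::plane))\<^sup>2)) \<partial>lborel) = 1"
proof -
  have eq: "exp (- (pi * m\<^sup>2 * (norm (z - x))\<^sup>2)) = exp (- (pi * m\<^sup>2 * (norm (- z + 1 *\<^sub>R x))\<^sup>2))" for x
    by (simp add: norm_minus_commute)
  show "integrable lborel (\<lambda>x::plane. exp (- (pi * m\<^sup>2 * (norm (z - x))\<^sup>2)))"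
    unfolding eq by (rule integrable_plane_affine[OF gaussian_real_integral(1)[OF m]]) simp
  have "(\<integral>x. exp (- (pi * m\<^sup>2 * (norm (x::plane))\<^sup>2)) \<partial>lborel) = 1\<^sup>2 *\<^sub>R (\<integral>x. exp (- (pi * m\<^sup>2 * (norm (-z + 1 *\<^sub>R x::plane))\<^sup>2)) \<partial>lborel)"
    by (rule integral_plane_affine) auto
  then have "(\<integral>x. exp (- (pi * m\<^sup>2 * (norm (z - x::plane))\<^sup>2)) \<partial>lborel) = 1 / m\<^sup>2"
    unfolding eq gaussian_real_integral(2)[OF m] by simp
  then show "m\<^sup>2 * (\<integral>x. exp (- (pi * m\<^sup>2 * (norm (z - x::plane))\<^sup>2)) \<partial>lborel) = 1"
    using m by (simp only:) simp
qed

text \<open>After rescaling, the averages are integrals against a fixed Gaussian probability density.\<close>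
lemma gauss_avg_tendsto_bounded:
  fixes F :: "plane \<Rightarrow> real"
  assumes [measurable]: "F \<in> borel_measurable borel" and B: "\<And>x. \<bar>F x\<bar> \<le> B" and cont: "isCont F z"
  shows "(\<lambda>n. gauss_avg F (real (Suc n)) z) \<longlonglongrightarrow> F z"
proof -
  have avg: "gauss_avg F (real (Suc n)) z = (\<integral>y. F (z + (1 / real (Suc n)) *\<^sub>R y) * exp (- (pi * (norm y)\<^sup>2)) \<partial>lborel)" for n
  proof -
    define m where "m = real (Suc n)"
    have m: "m > 0" by (simp add: m_def)
    have "gauss_avg F m z = m\<^sup>2 * ((1 / m)\<^sup>2 *\<^sub>R (\<integral>y. F (z + (1 / m) *\<^sub>R y) * exp (- (pi * m\<^sup>2 * (norm (z - (z + (1 / m) *\<^sub>R y)))\<^sup>2)) \<partial>lborel))"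
      unfolding gauss_avg_def using m by (subst integral_plane_affine[of _ "1/m" z]) auto
    also have "\<dots> = (\<integral>y. F (z + (1 / m) *\<^sub>R y) * exp (- (pi * (norm y)\<^sup>2)) \<partial>lborel)"
      using m by (simp add: power_divide)
    finally show ?thesis by (simp add: m_def)
  qed
  have g: "integrable lborel (\<lambda>y::plane. exp (- (pi * (norm y)\<^sup>2)))" "(\<integral>y. exp (- (pi * (norm (y::plane))\<^sup>2)) \<partial>lborel) = 1"
    using gaussian_real_integral[of 1] by auto
  have "(\<lambda>n. \<integral>y. F (z + (1 / real (Suc n)) *\<^sub>R y) * exp (- (pi * (norm y)\<^sup>2)) \<partial>lborel) \<longlonglongrightarrow> (\<integral>y. F z * exp (- (pi * (norm (y::plane))\<^sup>2)) \<partial>lborel)"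
  proof (rule integral_dominated_convergence)
    show "integrable lborel (\<lambda>y::plane. B * exp (- (pi * (norm y)\<^sup>2)))"
      by (intro integrable_mult_right g)
    show "AE y in lborel. (\<lambda>n. F (z + (1 / real (Suc n)) *\<^sub>R y) * exp (- (pi * (norm y)\<^sup>2))) \<longlonglongrightarrow> F z * exp (- (pi * (norm y)\<^sup>2))"
    proof (rule AE_I2)
      fix y :: plane
      have "(\<lambda>n. 1 / real (Suc n)) \<longlonglongrightarrow> 0" by real_asymp
      then have "(\<lambda>n. z + (1 / real (Suc n)) *\<^sub>R y) \<longlonglongrightarrow> z + 0 *\<^sub>R y" by (intro tendsto_intros)
      then have "(\<lambda>n. z + (1 / real (Suc n)) *\<^sub>R y) \<longlonglongrightarrow> z" by simp
      from isCont_tendsto_compose[OF cont this]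
      show "(\<lambda>n. F (z + (1 / real (Suc n)) *\<^sub>R y) * exp (- (pi * (norm y)\<^sup>2))) \<longlonglongrightarrow> F z * exp (- (pi * (norm y)\<^sup>2))"
        by (rule tendsto_mult[OF _ tendsto_const])
    qed
    fix n
    show "AE y in lborel. norm (F (z + (1 / real (Suc n)) *\<^sub>R y) * exp (- (pi * (norm y)\<^sup>2))) \<le> B * exp (- (pi * (norm y)\<^sup>2))"
      using mult_right_mono[OF B] by (intro AE_I2) (simp add: abs_mult[of _ "exp _"] del: of_nat_Suc)
  qed measurable
  also have "(\<integral>y. F z * exp (- (pi * (norm (y::plane))\<^sup>2)) \<partial>lborel) = F z"
    using g(2) by simp
  finally show ?thesis unfolding avg .
qed

text \<open>The kernel and its Fourier transform are both of this type, with exponents \<open>s\<close> and \<open>2 - s\<close>. The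
  Gaussian average at \<open>z\<close> is split at the radius \<open>norm z / 2\<close>: the part of the function near the origin is
  integrable and meets only the tail of the Gaussian, and the remaining part is bounded by a constant times
  \<open>norm z powr (-a)\<close>.\<close>
locale singular_function =
  fixes F :: "plane \<Rightarrow> real" and a C :: real
  assumes a: "0 < a" "a < 2" and F_meas [measurable]: "F \<in> borel_measurable borel"
    and C: "C \<ge> 0" and F: "\<And>x. \<bar>F x\<bar> \<le> C * norm x powr (-a)"
begin

definition V where "V = (\<integral>x. indicator (ball 0 1) x * norm (x::plane) powr (-a) \<partial>lborel)"

lemma V: "V \<ge> 0" unfolding V_def by (intro integral_nonneg_AE AE_I2) auto

lemma near_part:
  assumes m: "m > 0" and z: "z \<noteq> 0"
  defines "r \<equiv> norm z / 2"
  shows "integrable lborel (\<lambda>x. indicator (ball 0 r) x * F x * exp (- (pi * m\<^sup>2 * (norm (z - x))\<^sup>2)))" (is "integrable _ ?f")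
    and "\<bar>\<integral>x. indicator (ball 0 r) x * F x * exp (- (pi * m\<^sup>2 * (norm (z - x))\<^sup>2)) \<partial>lborel\<bar>
       \<le> exp (- (pi * m\<^sup>2 * r\<^sup>2)) * (C * (r powr (2 - a) * V))"
proof -
  have r: "r > 0" using z by (simp add: r_def)
  have le: "norm (?f x) \<le> exp (- (pi * m\<^sup>2 * r\<^sup>2)) * (C * (indicator (ball 0 r) x * norm x powr (-a)))" for x
  proof (cases "norm x < r")
    case True
    have "r \<le> norm (z - x)" using norm_triangle_ineq2[of z x] True unfolding r_def by linarith
    then have "r\<^sup>2 \<le> (norm (z - x))\<^sup>2" using r by (intro power_mono) auto
    then have "exp (- (pi * m\<^sup>2 * (norm (z - x))\<^sup>2)) \<le> exp (- (pi * m\<^sup>2 * r\<^sup>2))" by (simp add: mult_left_mono)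
    then have "\<bar>F x\<bar> * exp (- (pi * m\<^sup>2 * (norm (z - x))\<^sup>2)) \<le> (C * norm x powr (-a)) * exp (- (pi * m\<^sup>2 * r\<^sup>2))"
      by (intro mult_mono F) (auto simp: C)
    then show ?thesis using True by (simp add: abs_mult mult_ac)
  qed simp
  have i: "integrable lborel (\<lambda>x::plane. exp (- (pi * m\<^sup>2 * r\<^sup>2)) * (C * (indicator (ball 0 r) x * norm x powr (-a))))"
    by (intro integrable_mult_right integrable_ball_powr a)
  show "integrable lborel ?f" by (rule integrable_boundI[OF i]) (use le in auto)
  have "norm (\<integral>x. ?f x \<partial>lborel) \<le> (\<integral>x. exp (- (pi * m\<^sup>2 * r\<^sup>2)) * (C * (indicator (ball 0 r) x * norm (x::plane) powr (-a))) \<partial>lborel)"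
    by (rule norm_integral_le[OF i]) (use le in auto)
  also have "\<dots> = exp (- (pi * m\<^sup>2 * r\<^sup>2)) * (C * (r powr (2 - a) * V))"
    by (simp add: integral_ball_powr[OF r, of a] V_def)
  finally show "\<bar>\<integral>x. ?f x \<partial>lborel\<bar> \<le> exp (- (pi * m\<^sup>2 * r\<^sup>2)) * (C * (r powr (2 - a) * V))" by simp
qed

lemma far_bound:
  assumes z: "z \<noteq> 0"
  shows "\<bar>indicator (- ball 0 (norm z / 2)) x * F x\<bar> \<le> C * 2 powr a * norm z powr (-a)"
proof (cases "norm x < norm z / 2")
  case False
  have "norm x powr (-a) \<le> (norm z / 2) powr (-a)" using False z a by (intro powr_mono2') auto
  also have "\<dots> = 2 powr a * norm z powr (-a)" by (rule half_powr) simp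
  finally have "C * norm x powr (-a) \<le> C * (2 powr a * norm z powr (-a))" using C by (rule mult_left_mono)
  then show ?thesis using F[of x] False by (simp add: mult.assoc)
qed (use C in simp)

lemma far_part:
  assumes m: "m > 0" and z: "z \<noteq> 0"
  defines "r \<equiv> norm z / 2"
  shows "integrable lborel (\<lambda>x. indicator (- ball 0 r) x * F x * exp (- (pi * m\<^sup>2 * (norm (z - x))\<^sup>2)))" (is "integrable _ ?f")
    and "m\<^sup>2 * \<bar>\<integral>x. indicator (- ball 0 r) x * F x * exp (- (pi * m\<^sup>2 * (norm (z - x))\<^sup>2)) \<partial>lborel\<bar> \<le> C * 2 powr a * norm z powr (-a)"
proof -
  let ?K = "C * 2 powr a * norm z powr (-a)"
  have le: "norm (?f x) \<le> ?K * exp (- (pi * m\<^sup>2 * (norm (z - x))\<^sup>2))" for x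
    using mult_right_mono[OF far_bound[OF z, of x], of "exp (- (pi * m\<^sup>2 * (norm (z - x))\<^sup>2))"]
    by (simp add: abs_mult r_def)
  have i: "integrable lborel (\<lambda>x. ?K * exp (- (pi * m\<^sup>2 * (norm (z - x))\<^sup>2)))"
    by (intro integrable_mult_right shifted_gaussian_integral m)
  show "integrable lborel ?f" by (rule integrable_boundI[OF i]) (use le in auto)
  have "norm (\<integral>x. ?f x \<partial>lborel) \<le> (\<integral>x. ?K * exp (- (pi * m\<^sup>2 * (norm (z - x))\<^sup>2)) \<partial>lborel)"
    by (rule norm_integral_le[OF i]) (use le in auto)
  then have "m\<^sup>2 * norm (\<integral>x. ?f x \<partial>lborel) \<le> m\<^sup>2 * (\<integral>x. ?K * exp (- (pi * m\<^sup>2 * (norm (z - x))\<^sup>2)) \<partial>lborel)"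
    by (rule mult_left_mono) simp
  also have "\<dots> = ?K * (m\<^sup>2 * (\<integral>x. exp (- (pi * m\<^sup>2 * (norm (z - x))\<^sup>2)) \<partial>lborel))" by simp
  also have "\<dots> = ?K" unfolding shifted_gaussian_integral(2)[OF m] by simp
  finally show "m\<^sup>2 * \<bar>\<integral>x. ?f x \<partial>lborel\<bar> \<le> ?K" by simp
qed

lemma gauss_avg_split:
  assumes m: "m > 0" and z: "z \<noteq> 0"
  shows "integrable lborel (\<lambda>x. F x * exp (- (pi * m\<^sup>2 * (norm (z - x))\<^sup>2)))"
    and "gauss_avg F m z = m\<^sup>2 * (\<integral>x. indicator (ball 0 (norm z / 2)) x * F x * exp (- (pi * m\<^sup>2 * (norm (z - x))\<^sup>2)) \<partial>lborel)
      + gauss_avg (\<lambda>x. indicator (- ball 0 (norm z / 2)) x * F x) m z"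
proof -
  have eq: "F x * exp (- (pi * m\<^sup>2 * (norm (z - x))\<^sup>2)) = indicator (ball 0 (norm z / 2)) x * F x * exp (- (pi * m\<^sup>2 * (norm (z - x))\<^sup>2))
     + indicator (- ball 0 (norm z / 2)) x * F x * exp (- (pi * m\<^sup>2 * (norm (z - x))\<^sup>2))" for x
    by (auto split: split_indicator)
  note i = near_part(1)[OF m z] far_part(1)[OF m z]
  show "integrable lborel (\<lambda>x. F x * exp (- (pi * m\<^sup>2 * (norm (z - x))\<^sup>2)))"
    unfolding eq by (rule Bochner_Integration.integrable_add[OF i])
  show "gauss_avg F m z = m\<^sup>2 * (\<integral>x. indicator (ball 0 (norm z / 2)) x * F x * exp (- (pi * m\<^sup>2 * (norm (z - x))\<^sup>2)) \<partial>lborel)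
      + gauss_avg (\<lambda>x. indicator (- ball 0 (norm z / 2)) x * F x) m z"
    unfolding gauss_avg_def by (subst eq, subst Bochner_Integration.integral_add[OF i]) (simp add: distrib_left)
qed

text \<open>The bound is uniform in the width of the Gaussian, which makes it a majorant for dominated convergence.\<close>
lemma gauss_avg_bound:
  assumes m: "m > 0" and z: "z \<noteq> 0"
  shows "\<bar>gauss_avg F m z\<bar> \<le> C * 2 powr a * (1 + V) * norm z powr (-a)"
proof -
  define r where "r = norm z / 2"
  have r: "r > 0" using z by (simp add: r_def)
  have e: "m\<^sup>2 * r\<^sup>2 * exp (- (pi * m\<^sup>2 * r\<^sup>2)) \<le> 1"
  proof -
    have "m\<^sup>2 * r\<^sup>2 \<le> exp (m\<^sup>2 * r\<^sup>2)" using exp_ge_add_one_self[of "m\<^sup>2 * r\<^sup>2"] by linarith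
    also have "\<dots> \<le> exp (pi * m\<^sup>2 * r\<^sup>2)" using mult_right_mono[of 1 pi "m\<^sup>2 * r\<^sup>2"] pi_ge_two by (simp add: mult.assoc)
    finally show ?thesis by (simp add: exp_minus field_simps)
  qed
  have "m\<^sup>2 * \<bar>\<integral>x. indicator (ball 0 r) x * F x * exp (- (pi * m\<^sup>2 * (norm (z - x))\<^sup>2)) \<partial>lborel\<bar>
     \<le> m\<^sup>2 * (exp (- (pi * m\<^sup>2 * r\<^sup>2)) * (C * (r powr (2 - a) * V)))"
    unfolding r_def by (intro mult_left_mono near_part(2)[OF m z]) auto
  also have "r powr (2 - a) = r powr (-a) * r\<^sup>2" using powr_mult_square[OF r, of "-a"] by simp
  also have "m\<^sup>2 * (exp (- (pi * m\<^sup>2 * r\<^sup>2)) * (C * (r powr (-a) * r\<^sup>2 * V))) = (m\<^sup>2 * r\<^sup>2 * exp (- (pi * m\<^sup>2 * r\<^sup>2))) * (C * (r powr (-a) * V))"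
    by simp
  also have "\<dots> \<le> 1 * (C * (r powr (-a) * V))" using C V by (intro mult_right_mono e) auto
  also have "\<dots> = C * 2 powr a * V * norm z powr (-a)" unfolding r_def half_powr[OF norm_ge_zero] by simp
  finally have 1: "\<bar>m\<^sup>2 * (\<integral>x. indicator (ball 0 r) x * F x * exp (- (pi * m\<^sup>2 * (norm (z - x))\<^sup>2)) \<partial>lborel)\<bar> \<le> C * 2 powr a * V * norm z powr (-a)"
    by (simp add: abs_mult)
  have 2: "\<bar>gauss_avg (\<lambda>x. indicator (- ball 0 r) x * F x) m z\<bar> \<le> C * 2 powr a * norm z powr (-a)"
    using far_part(2)[OF m z] by (simp add: gauss_avg_def abs_mult r_def)
  show ?thesis unfolding gauss_avg_split(2)[OF m z] r_def[symmetric]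
    using 1 2 by (simp add: distrib_left distrib_right)
qed

lemma gauss_avg_tendsto:
  assumes z: "z \<noteq> 0" and cont: "isCont F z"
  shows "(\<lambda>n. gauss_avg F (real (Suc n)) z) \<longlonglongrightarrow> F z"
proof -
  define r where "r = norm z / 2"
  have r: "r > 0" using z by (simp add: r_def)
  have "(\<lambda>n. (real (Suc n))\<^sup>2 * (\<integral>x. indicator (ball 0 r) x * F x * exp (- (pi * (real (Suc n))\<^sup>2 * (norm (z - x))\<^sup>2)) \<partial>lborel)) \<longlonglongrightarrow> 0"
  proof (rule Lim_null_comparison)
    show "\<forall>\<^sub>F n in sequentially. norm ((real (Suc n))\<^sup>2 * (\<integral>x. indicator (ball 0 r) x * F x * exp (- (pi * (real (Suc n))\<^sup>2 * (norm (z - x))\<^sup>2)) \<partial>lborel))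
      \<le> (real (Suc n))\<^sup>2 * exp (- (pi * (real (Suc n))\<^sup>2 * r\<^sup>2)) * (C * (r powr (2 - a) * V))"
    proof (rule always_eventually, rule allI)
      fix n
      have m: "real (Suc n) > 0" by simp
      show "norm ((real (Suc n))\<^sup>2 * (\<integral>x. indicator (ball 0 r) x * F x * exp (- (pi * (real (Suc n))\<^sup>2 * (norm (z - x))\<^sup>2)) \<partial>lborel))
      \<le> (real (Suc n))\<^sup>2 * exp (- (pi * (real (Suc n))\<^sup>2 * r\<^sup>2)) * (C * (r powr (2 - a) * V))"
        using mult_left_mono[OF near_part(2)[OF m z, folded r_def], of "(real (Suc n))\<^sup>2"] unfolding real_norm_def abs_mult by (simp add: mult.assoc del: of_nat_Suc)
    qed
    have "((\<lambda>m::real. m\<^sup>2 * exp (- (pi * m\<^sup>2 * r\<^sup>2))) \<longlongrightarrow> 0) at_top" using r by real_asymp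
    moreover have "filterlim (\<lambda>n. real (Suc n)) at_top sequentially" by real_asymp
    ultimately have "(\<lambda>n. (real (Suc n))\<^sup>2 * exp (- (pi * (real (Suc n))\<^sup>2 * r\<^sup>2))) \<longlonglongrightarrow> 0" by (rule filterlim_compose)
    then show "(\<lambda>n. (real (Suc n))\<^sup>2 * exp (- (pi * (real (Suc n))\<^sup>2 * r\<^sup>2)) * (C * (r powr (2 - a) * V))) \<longlonglongrightarrow> 0"
      by (rule tendsto_mult_left_zero)
  qed
  moreover have "(\<lambda>n. gauss_avg (\<lambda>x. indicator (- ball 0 r) x * F x) (real (Suc n)) z) \<longlonglongrightarrow> F z"
  proof -
    let ?F = "\<lambda>x. indicator (- ball 0 r) x * F x"
    have cF: "isCont ?F z"
    proof -
      have o: "z \<in> - cball 0 r" using z by (simp add: r_def)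
      have "\<forall>\<^sub>F x in nhds z. x \<in> - cball 0 r" using o by (intro eventually_nhds_in_open) auto
      then have "\<forall>\<^sub>F x in nhds z. ?F x = F x" by eventually_elim simp
      then show ?thesis using cont by (simp only: isCont_cong)
    qed
    have "(\<lambda>n. gauss_avg ?F (real (Suc n)) z) \<longlonglongrightarrow> ?F z"
      by (rule gauss_avg_tendsto_bounded[OF _ far_bound[OF z, folded r_def] cF]) measurable
    then show ?thesis using r by (simp add: r_def)
  qed
  ultimately have "(\<lambda>n. (real (Suc n))\<^sup>2 * (\<integral>x. indicator (ball 0 r) x * F x * exp (- (pi * (real (Suc n))\<^sup>2 * (norm (z - x))\<^sup>2)) \<partial>lborel)
     + gauss_avg (\<lambda>x. indicator (- ball 0 r) x * F x) (real (Suc n)) z) \<longlonglongrightarrow> 0 + F z" by (rule tendsto_add)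
  moreover have "gauss_avg F (real (Suc n)) z = (real (Suc n))\<^sup>2 * (\<integral>x. indicator (ball 0 r) x * F x * exp (- (pi * (real (Suc n))\<^sup>2 * (norm (z - x))\<^sup>2)) \<partial>lborel)
     + gauss_avg (\<lambda>x. indicator (- ball 0 r) x * F x) (real (Suc n)) z" for n
    unfolding r_def by (rule gauss_avg_split(2)[OF _ z]) simp
  ultimately show ?thesis by simp
qed

end

section \<open>The angular part is determined by the distribution\<close>

context profile begin

lemma angle_isCont: "-pi < \<phi> \<Longrightarrow> \<phi> < pi \<Longrightarrow> isCont angle (cos \<phi>, sin \<phi>)"
proof -
  assume p: "-pi < \<phi>" "\<phi> < pi"
  have "cis \<phi> \<notin> \<real>\<^sub>\<le>\<^sub>0"
  proof
    assume "cis \<phi> \<in> \<real>\<^sub>\<le>\<^sub>0"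
    then have "cos \<phi> \<le> 0" "sin \<phi> = 0" by (auto simp: complex_nonpos_Reals_iff)
    moreover from this have "cos \<phi> \<noteq> 0" using sin_zero_abs_cos_one[of \<phi>] by auto
    ultimately have "Arg (cis \<phi>) = pi" by (subst Arg_eq_pi) auto
    then show False using p Arg_cis[of \<phi>] by simp
  qed
  then have "Complex (fst (cos \<phi>, sin \<phi>)) (snd (cos \<phi>, sin \<phi>)) \<notin> \<real>\<^sub>\<le>\<^sub>0" by (simp add: cis.ctr)
  from has_derivative_continuous[OF has_derivative_angle_aux[OF this]] show ?thesis .
qed

lemma isCont_angular:
  assumes "continuous_on UNIV g" "-pi < \<phi>" "\<phi> < pi"
  shows "isCont (\<lambda>\<xi>. norm \<xi> powr (- 2 + s) * g (angle \<xi>)) (cos \<phi>, sin \<phi>)"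
proof -
  have "isCont g (angle (cos \<phi>, sin \<phi>))" using assms(1) by (simp add: continuous_on_eq_continuous_at)
  then have "isCont (\<lambda>\<xi>. g (angle \<xi>)) (cos \<phi>, sin \<phi>)"
    using angle_isCont[OF assms(2,3)] by (rule isCont_o2[rotated])
  moreover note polar_nonzero[of \<phi>]
  ultimately show ?thesis by (intro continuous_intros) auto
qed

text \<open>Gaussian averages of the two candidates agree, because translated Gaussians are test functions. They
  converge to the candidates on the unit circle away from the branch cut of the angle; the cut is reached by
  continuity and the rest of the line by periodicity.\<close>
lemma angular_part_unique:
  assumes s: "0 < s" "s < 2" and g: "continuous_on UNIV g" "\<And>\<phi>. g (\<phi> + 2 * pi) = g \<phi>"
    and ft: "has_fourier_transform (anisotropic_riesz s \<Omega>) (\<lambda>\<xi>. norm \<xi> powr (- 2 + s) * g (angle \<xi>))"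
  shows "g = angular_part s"
proof -
  let ?v = "\<lambda>\<xi>. norm \<xi> powr (- 2 + s) * g (angle \<xi>)"
  let ?G = "\<lambda>m z \<xi>. exp (- (pi * m\<^sup>2 * (norm (z - \<xi>))\<^sup>2)) :: real"
  have vm [measurable]: "?v \<in> borel_measurable borel"
  proof -
    have "integrable lborel (\<lambda>\<xi>. complex_of_real (?v \<xi>) * of_real (?G 1 0 \<xi>))"
      using ft schwartz_shifted_gaussian[of 1 0] unfolding has_fourier_transform_def by auto
    then have "(\<lambda>\<xi>. complex_of_real (?v \<xi>) * of_real (?G 1 0 \<xi>)) \<in> borel_measurable borel" by (auto dest: borel_measurable_integrable)
    then have "(\<lambda>\<xi>. Re (complex_of_real (?v \<xi>) * of_real (?G 1 0 \<xi>)) / ?G 1 0 \<xi>) \<in> borel_measurable borel" by measurable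
    then show ?thesis by simp
  qed
  obtain M where M: "M \<ge> 0" "\<And>\<xi>. \<bar>?v \<xi>\<bar> \<le> M * norm \<xi> powr (-(2 - s))"
  proof -
    have "compact (g ` {-pi..pi})"
      by (rule compact_continuous_image[OF continuous_on_subset[OF g(1) subset_UNIV] compact_Icc])
    from compact_imp_bounded[OF this] obtain M where M: "\<forall>y\<in>g ` {-pi..pi}. norm y \<le> M"
      unfolding bounded_iff by (elim exE)
    have "\<bar>?v \<xi>\<bar> \<le> \<bar>M\<bar> * norm \<xi> powr (-(2 - s))" for \<xi>
    proof -
      have "angle \<xi> \<in> {-pi..pi}" using Arg_bounded[of "Complex (fst \<xi>) (snd \<xi>)"] by (auto simp: angle_def)
      then have "\<bar>g (angle \<xi>)\<bar> \<le> \<bar>M\<bar>" using M by force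
      then show ?thesis by (simp add: abs_mult mult.commute[of "\<bar>M\<bar>"] mult_left_mono)
    qed
    then show ?thesis by (intro that[of "\<bar>M\<bar>"]) auto
  qed
  obtain D where D: "D \<ge> 0" "\<And>\<xi>. \<bar>riesz_hat s \<xi>\<bar> \<le> D * norm \<xi> powr (s - 2)" using riesz_hat_bound[OF s] by blast
  interpret v: singular_function ?v "2 - s" M by unfold_locales (use s in simp, use s in simp, rule vm, rule M(1), rule M(2))
  interpret h: singular_function "riesz_hat s" "2 - s" D by standard (use s D riesz_hat_measurable[OF s] in auto)
  have avg: "gauss_avg ?v m z = gauss_avg (riesz_hat s) m z" if m: "m > 0" for m z
  proof -
    have "(\<integral>\<xi>. of_real (?v \<xi>) * complex_of_real (?G m z \<xi>) \<partial>lborel) = (\<integral>\<xi>. of_real (riesz_hat s \<xi>) * complex_of_real (?G m z \<xi>) \<partial>lborel)"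
      using trans[OF sym[OF ft[unfolded has_fourier_transform_def, rule_format, OF schwartz_shifted_gaussian[OF m, of z], THEN conjunct2, THEN conjunct2]]
         has_fourier_transform_hat[OF s, unfolded has_fourier_transform_def, rule_format, OF schwartz_shifted_gaussian[OF m, of z], THEN conjunct2, THEN conjunct2]] .
    then show ?thesis unfolding gauss_avg_def
      by (simp only: of_real_mult[symmetric] integral_complex_of_real of_real_eq_iff)
  qed
  have eq1: "g \<phi> = angular_part s \<phi>" if p: "-pi < \<phi>" "\<phi> < pi" for \<phi>
  proof -
    note nz = polar_nonzero[of \<phi>] and n1 = norm_polar[of \<phi>]
    have "?v (cos \<phi>, sin \<phi>) = riesz_hat s (cos \<phi>, sin \<phi>)"
    proof (rule LIMSEQ_unique)
      show "(\<lambda>n. gauss_avg ?v (real (Suc n)) (cos \<phi>, sin \<phi>)) \<longlonglongrightarrow> ?v (cos \<phi>, sin \<phi>)"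
        by (rule v.gauss_avg_tendsto[OF nz isCont_angular[OF g(1) p]])
      show "(\<lambda>n. gauss_avg ?v (real (Suc n)) (cos \<phi>, sin \<phi>)) \<longlonglongrightarrow> riesz_hat s (cos \<phi>, sin \<phi>)"
        unfolding avg[of "real (Suc _)", simplified of_nat_0_less_iff, OF zero_less_Suc]
        by (rule h.gauss_avg_tendsto[OF nz]) (use isCont_angular[OF angular_part_cont[OF s] p, of s] in \<open>simp add: riesz_hat_def[abs_def]\<close>)
    qed
    then show ?thesis using n1 p by (simp add: riesz_hat_def angle_polar)
  qed
  have "closed {\<phi>. g \<phi> = angular_part s \<phi>}" by (intro closed_Collect_eq g(1) angular_part_cont[OF s])
  then have "closure {-pi<..<pi} \<subseteq> {\<phi>. g \<phi> = angular_part s \<phi>}" using eq1 by (intro closure_minimal) auto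
  then have eq2: "g \<phi> = angular_part s \<phi>" if "-pi \<le> \<phi>" "\<phi> \<le> pi" for \<phi> using that by auto
  show ?thesis
  proof
    fix \<phi>
    \<comment> \<open>the factor \<open>2\<close> turns the period \<open>2 * pi\<close> into the period \<open>pi\<close>\<close>
    let ?A = "\<lambda>\<theta>. g (2 * \<theta>) - angular_part s (2 * \<theta>)"
    have "?A (\<theta> + pi) = ?A \<theta>" for \<theta> using g(2)[of "2 * \<theta>"] angular_part_per[of s "2 * \<theta>"] by (simp add: distrib_left)
    from pi_periodic_reduce[of ?A "\<phi> / 2", OF this] obtain y where y: "y \<in> {0..pi}" "g \<phi> - angular_part s \<phi> = g (2 * y) - angular_part s (2 * y)" by auto
    have "g (2 * y) = angular_part s (2 * y)"
    proof (cases "2 * y \<le> pi")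
      case True then show ?thesis using y eq2[of "2 * y"] by auto
    next
      case False
      then show ?thesis using y eq2[of "2 * y - 2 * pi"] g(2)[of "2 * y - 2 * pi"] angular_part_per[of s "2 * y - 2 * pi"] by auto
    qed
    then show "g \<phi> = angular_part s \<phi>" using y by simp
  qed
qed

theorem Omega_tilde_eq_angular_part:
  assumes s: "0 < s" "s < 2" shows "Omega_tilde s \<Omega> = angular_part s"
  unfolding Omega_tilde_def
proof (rule the_equality)
  show "continuous_on UNIV (angular_part s) \<and> (\<forall>\<phi>. angular_part s (\<phi> + 2 * pi) = angular_part s \<phi>) \<and>
    has_fourier_transform (anisotropic_riesz s \<Omega>) (\<lambda>\<xi>. norm \<xi> powr (- 2 + s) * angular_part s (angle \<xi>))"
    using angular_part_cont[OF s] angular_part_per has_fourier_transform_hat[OF s] by (simp add: riesz_hat_def[abs_def])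
qed (use angular_part_unique[OF s] in blast)

end

section \<open>Energies of measures on the Fourier side\<close>

definition measure_fourier :: "plane measure \<Rightarrow> plane \<Rightarrow> complex" where
  "measure_fourier \<mu> \<xi> = (\<integral>x. cis (- (2 * pi * (x \<bullet> \<xi>))) \<partial>\<mu>)"

lemma measurable_cnj [measurable]: "cnj \<in> borel_measurable borel"
  by (intro borel_measurable_continuous_onI continuous_intros)

locale plane_prob = prob_space \<mu> for \<mu> :: "plane measure" +
  assumes sets_plane [measurable_cong]: "sets \<mu> = sets borel"
begin

lemma space_plane: "space \<mu> = UNIV" using sets_eq_imp_space_eq[OF sets_plane] by simp

lemma measure_fourier_measurable [measurable]: "measure_fourier \<mu> \<in> borel_measurable borel"
  unfolding measure_fourier_def[abs_def] by measurable

lemma norm_measure_fourier_le: "norm (measure_fourier \<mu> \<xi>) \<le> 1"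
  unfolding measure_fourier_def using norm_integral_le[of \<mu> "\<lambda>x. 1" "\<lambda>x. cis (- (2 * pi * (x \<bullet> \<xi>)))"] prob_space by simp

lemma cnj_measure_fourier: "cnj (measure_fourier \<mu> \<xi>) = (\<integral>x. cis (2 * pi * (x \<bullet> \<xi>)) \<partial>\<mu>)"
  unfolding measure_fourier_def by (subst Bochner_Integration.integral_cnj[symmetric]) (simp add: cis_cnj)

end

locale two_probs = M: plane_prob \<mu> + N: plane_prob \<nu> for \<mu> \<nu>
begin

sublocale P: pair_prob_space \<mu> \<nu> ..

declare M.sets_plane [measurable_cong] N.sets_plane [measurable_cong]

text \<open>Fubini, using that a character of \<open>x - y\<close> is a product of characters of \<open>x\<close> and \<open>y\<close>.\<close>
lemma kernel_energy:
  assumes k: "integrable lborel k"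
  shows "(\<integral>x. \<integral>y. (\<integral>\<xi>. k \<xi> * cis (2 * pi * (\<xi> \<bullet> (x - y))) \<partial>lborel) \<partial>\<nu> \<partial>\<mu>) = (\<integral>\<xi>. k \<xi> * (cnj (measure_fourier \<mu> \<xi>) * measure_fourier \<nu> \<xi>) \<partial>lborel)"
proof -
  have [measurable]: "k \<in> borel_measurable borel" using k by auto
  have sf: "sigma_finite_measure (lborel::plane measure)" by (rule lborel.sigma_finite_measure_axioms)
  have kf: "(\<integral>\<^sup>+\<xi>. norm (k \<xi>) \<partial>lborel) < \<infinity>" using k by (simp add: integrable_iff_bounded)
  have c: "cis (2 * pi * (\<xi> \<bullet> (x - y))) = cis (2 * pi * (x \<bullet> \<xi>)) * cis (- (2 * pi * (y \<bullet> \<xi>)))" for x y \<xi> :: plane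
    by (simp add: cis_mult inner_diff_right inner_commute algebra_simps)
  have fin1: "(\<integral>\<^sup>+y. \<integral>\<^sup>+\<xi>. norm (k \<xi> * cis (2 * pi * (\<xi> \<bullet> (x - y)))) \<partial>lborel \<partial>\<nu>) < \<infinity>" for x
    using kf by (simp add: norm_mult N.emeasure_space_1)
  have 1: "(\<integral>y. (\<integral>\<xi>. k \<xi> * cis (2 * pi * (\<xi> \<bullet> (x - y))) \<partial>lborel) \<partial>\<nu>) = (\<integral>\<xi>. k \<xi> * measure_fourier \<nu> \<xi> * cis (2 * pi * (x \<bullet> \<xi>)) \<partial>lborel)" for x
  proof -
    have "(\<integral>y. (\<integral>\<xi>. k \<xi> * cis (2 * pi * (\<xi> \<bullet> (x - y))) \<partial>lborel) \<partial>\<nu>) = (\<integral>\<xi>. (\<integral>y. k \<xi> * cis (2 * pi * (\<xi> \<bullet> (x - y))) \<partial>\<nu>) \<partial>lborel)"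
      by (rule integral_swap(1)[OF N.sigma_finite_measure_axioms sf _ fin1]) measurable
    also have "\<dots> = (\<integral>\<xi>. k \<xi> * cis (2 * pi * (x \<bullet> \<xi>)) * measure_fourier \<nu> \<xi> \<partial>lborel)"
      unfolding c measure_fourier_def by (simp add: mult.assoc)
    finally show ?thesis by (simp add: mult_ac)
  qed
  have fin2: "(\<integral>\<^sup>+x. \<integral>\<^sup>+\<xi>. norm (k \<xi> * measure_fourier \<nu> \<xi> * cis (2 * pi * (x \<bullet> \<xi>))) \<partial>lborel \<partial>\<mu>) < \<infinity>"
  proof -
    have "(\<integral>\<^sup>+\<xi>. norm (k \<xi> * measure_fourier \<nu> \<xi>) \<partial>lborel) \<le> (\<integral>\<^sup>+\<xi>. norm (k \<xi>) \<partial>lborel)"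
      using N.norm_measure_fourier_le by (intro nn_integral_mono ennreal_leI) (simp add: norm_mult mult_left_le)
    then show ?thesis using kf by (simp add: norm_mult M.emeasure_space_1)
  qed
  have "(\<integral>x. \<integral>y. (\<integral>\<xi>. k \<xi> * cis (2 * pi * (\<xi> \<bullet> (x - y))) \<partial>lborel) \<partial>\<nu> \<partial>\<mu>) = (\<integral>x. (\<integral>\<xi>. k \<xi> * measure_fourier \<nu> \<xi> * cis (2 * pi * (x \<bullet> \<xi>)) \<partial>lborel) \<partial>\<mu>)"
    by (simp only: 1)
  also have "\<dots> = (\<integral>\<xi>. (\<integral>x. k \<xi> * measure_fourier \<nu> \<xi> * cis (2 * pi * (x \<bullet> \<xi>)) \<partial>\<mu>) \<partial>lborel)"
    by (rule integral_swap(1)[OF M.sigma_finite_measure_axioms sf _ fin2]) measurable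
  also have "\<dots> = (\<integral>\<xi>. k \<xi> * measure_fourier \<nu> \<xi> * cnj (measure_fourier \<mu> \<xi>) \<partial>lborel)"
    unfolding M.cnj_measure_fourier by simp
  finally show ?thesis by (simp add: mult_ac)
qed

lemma gauss_energy:
  assumes t: "t > 0"
  shows "integrable lborel (\<lambda>\<xi>. exp (- (pi * (norm \<xi>)\<^sup>2 / t\<^sup>2)) / t\<^sup>2 * Re (cnj (measure_fourier \<mu> \<xi>) * measure_fourier \<nu> \<xi>))"
    and "(\<integral>\<^sup>+x. \<integral>\<^sup>+y. ennreal (exp (- (pi * t\<^sup>2 * (norm (x - y))\<^sup>2))) \<partial>\<nu> \<partial>\<mu>)
    = ennreal (\<integral>\<xi>. exp (- (pi * (norm \<xi>)\<^sup>2 / t\<^sup>2)) / t\<^sup>2 * Re (cnj (measure_fourier \<mu> \<xi>) * measure_fourier \<nu> \<xi>) \<partial>lborel)"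
proof -
  let ?k = "\<lambda>\<xi>::plane. exp (- (pi * (norm \<xi>)\<^sup>2 / t\<^sup>2)) / t\<^sup>2"
  let ?m = "\<lambda>\<xi>. cnj (measure_fourier \<mu> \<xi>) * measure_fourier \<nu> \<xi>"
  have a: "1 / t > 0" using t by simp
  have k0: "?k \<xi> = exp (- (pi * (1/t)\<^sup>2 * (norm \<xi>)\<^sup>2)) * (1 / t\<^sup>2)" for \<xi> by (simp add: power_divide)
  have kr: "integrable lborel ?k" unfolding k0
    by (intro integrable_mult_left gaussian_real_integral(1)[OF a])
  then have k: "integrable lborel (\<lambda>\<xi>. complex_of_real (?k \<xi>))" by (rule integrable_of_real)
  have K: "(\<integral>\<xi>. of_real (?k \<xi>) * cis (2 * pi * (\<xi> \<bullet> z)) \<partial>lborel) = of_real (exp (- (pi * t\<^sup>2 * (norm z)\<^sup>2)))" for z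
  proof -
    have "(\<integral>\<xi>. of_real (?k \<xi>) * cis (2 * pi * (\<xi> \<bullet> z)) \<partial>lborel) = (\<integral>\<xi>. of_real (1 / t\<^sup>2) * (of_real (exp (- (pi * (1/t)\<^sup>2 * (norm \<xi>)\<^sup>2))) * cis (2 * pi * (\<xi> \<bullet> z))) \<partial>lborel)"
      unfolding k0 by (simp add: mult_ac)
    also have "\<dots> = of_real (1 / t\<^sup>2) * of_real (exp (- (pi * (norm z)\<^sup>2 / (1/t)\<^sup>2)) / (1/t)\<^sup>2)"
      unfolding integral_mult_right_zero gaussian_integral_plane(2)[OF a] ..
    also have "\<dots> = of_real (exp (- (pi * t\<^sup>2 * (norm z)\<^sup>2)))"
      using t by (simp add: power_divide mult_ac)
    finally show ?thesis .
  qed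
  have ki: "integrable lborel (\<lambda>\<xi>. of_real (?k \<xi>) * ?m \<xi>)"
  proof (rule integrable_boundI[OF kr])
    have "norm (?m \<xi>) \<le> 1" for \<xi>
      using M.norm_measure_fourier_le[of \<xi>] N.norm_measure_fourier_le[of \<xi>] by (simp add: norm_mult mult_le_one)
    then have "?k \<xi> * norm (?m \<xi>) \<le> ?k \<xi>" for \<xi> by (intro mult_left_le) auto
    moreover have "norm (of_real (?k \<xi>) * ?m \<xi>) = ?k \<xi> * norm (?m \<xi>)" for \<xi>
      unfolding norm_mult[of "of_real _"] norm_of_real by simp
    ultimately show "AE \<xi> in lborel. norm (of_real (?k \<xi>) * ?m \<xi>) \<le> ?k \<xi>"
      by simp
  qed measurable
  have rei: "Re (of_real (?k \<xi>) * ?m \<xi>) = ?k \<xi> * Re (?m \<xi>)" for \<xi> by (simp add: Re_divide_of_real)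
  show "integrable lborel (\<lambda>\<xi>. ?k \<xi> * Re (?m \<xi>))"
    using integrable_Re[OF ki] unfolding rei .
  have "complex_of_real (\<integral>x. \<integral>y. exp (- (pi * t\<^sup>2 * (norm (x - y))\<^sup>2)) \<partial>\<nu> \<partial>\<mu>) = (\<integral>\<xi>. of_real (?k \<xi>) * ?m \<xi> \<partial>lborel)"
    using kernel_energy[OF k] unfolding K by (simp only: integral_complex_of_real)
  then have "(\<integral>x. \<integral>y. exp (- (pi * t\<^sup>2 * (norm (x - y))\<^sup>2)) \<partial>\<nu> \<partial>\<mu>) = Re (\<integral>\<xi>. of_real (?k \<xi>) * ?m \<xi> \<partial>lborel)"
    by (drule_tac arg_cong[where f=Re]) (simp only: Re_complex_of_real)
  also have "\<dots> = (\<integral>\<xi>. ?k \<xi> * Re (?m \<xi>) \<partial>lborel)"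
    using integral_Re[OF ki] unfolding rei by (rule sym)
  finally have eq: "(\<integral>x. \<integral>y. exp (- (pi * t\<^sup>2 * (norm (x - y))\<^sup>2)) \<partial>\<nu> \<partial>\<mu>) = (\<integral>\<xi>. ?k \<xi> * Re (?m \<xi>) \<partial>lborel)" .
  have iy: "integrable \<nu> (\<lambda>y. exp (- (pi * t\<^sup>2 * (norm (x - y))\<^sup>2)))" for x
    by (rule integrable_boundI[of \<nu> "\<lambda>x. 1"]) auto
  have ix: "integrable \<mu> (\<lambda>x. \<integral>y. exp (- (pi * t\<^sup>2 * (norm (x - y))\<^sup>2)) \<partial>\<nu>)"
  proof (rule integrable_boundI[of \<mu> "\<lambda>x. 1"])
    show "AE x in \<mu>. norm (\<integral>y. exp (- (pi * t\<^sup>2 * (norm (x - y))\<^sup>2)) \<partial>\<nu>) \<le> 1"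
    proof (rule AE_I2)
      fix x
      have "norm (\<integral>y. exp (- (pi * t\<^sup>2 * (norm (x - y))\<^sup>2)) \<partial>\<nu>) \<le> (\<integral>y. 1 \<partial>\<nu>)"
        by (rule norm_integral_le) auto
      then show "norm (\<integral>y. exp (- (pi * t\<^sup>2 * (norm (x - y))\<^sup>2)) \<partial>\<nu>) \<le> 1" by (simp add: N.prob_space)
    qed
  qed auto
  have "(\<integral>\<^sup>+x. \<integral>\<^sup>+y. ennreal (exp (- (pi * t\<^sup>2 * (norm (x - y))\<^sup>2))) \<partial>\<nu> \<partial>\<mu>)
     = (\<integral>\<^sup>+x. ennreal (\<integral>y. exp (- (pi * t\<^sup>2 * (norm (x - y))\<^sup>2)) \<partial>\<nu>) \<partial>\<mu>)"
    by (intro nn_integral_cong nn_integral_eq_integral iy) auto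
  also have "\<dots> = ennreal (\<integral>x. \<integral>y. exp (- (pi * t\<^sup>2 * (norm (x - y))\<^sup>2)) \<partial>\<nu> \<partial>\<mu>)"
    by (intro nn_integral_eq_integral ix) auto
  finally show "(\<integral>\<^sup>+x. \<integral>\<^sup>+y. ennreal (exp (- (pi * t\<^sup>2 * (norm (x - y))\<^sup>2))) \<partial>\<nu> \<partial>\<mu>) = ennreal (\<integral>\<xi>. ?k \<xi> * Re (?m \<xi>) \<partial>lborel)"
    unfolding eq .
qed

end

text \<open>The isotropic Riesz kernel up to a constant factor, as a superposition of Gaussians. At the origin this
  formula gives infinity, as required for potentials of measures with atoms.\<close>
definition riesz_kernel :: "real \<Rightarrow> plane \<Rightarrow> ennreal" where
  "riesz_kernel s z = (\<integral>\<^sup>+t\<in>{0<..}. ennreal (t powr (s - 1) * exp (- (pi * t\<^sup>2 * (norm z)\<^sup>2))) \<partial>lborel)"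

definition riesz_mass :: "real \<Rightarrow> real" where
  "riesz_mass s = mellin_mass s (\<lambda>t. exp (- (pi * t\<^sup>2)))"

lemma riesz_kernel_measurable [measurable]: "riesz_kernel s \<in> borel_measurable borel"
  unfolding riesz_kernel_def[abs_def] by measurable

lemma riesz_mass:
  assumes s: "0 < s" "s < 2"
  shows "(\<integral>\<^sup>+t\<in>{0<..}. ennreal (t powr (s - 1) * exp (- (pi * t\<^sup>2))) \<partial>lborel) = ennreal (riesz_mass s)" "riesz_mass s > 0"
proof -
  have b: "exp (- (pi * t\<^sup>2)) \<le> 1 / (1 + t\<^sup>2)" for t :: real
  proof -
    have "1 + t\<^sup>2 \<le> exp (t\<^sup>2)" by (rule exp_ge_add_one_self)
    also have "\<dots> \<le> exp (pi * t\<^sup>2)" using mult_right_mono[of 1 pi "t\<^sup>2"] pi_ge_two by simp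
    finally show ?thesis by (simp add: exp_minus field_simps add_pos_nonneg)
  qed
  show "(\<integral>\<^sup>+t\<in>{0<..}. ennreal (t powr (s - 1) * exp (- (pi * t\<^sup>2))) \<partial>lborel) = ennreal (riesz_mass s)" "riesz_mass s > 0"
    unfolding riesz_mass_def by (rule mellin_mass[OF s, where C=1]; use b in simp)+
qed

lemma riesz_kernel_nonzero:
  assumes s: "0 < s" "s < 2" and z: "z \<noteq> 0"
  shows "riesz_kernel s z = ennreal (riesz_mass s * norm z powr (- s))"
proof -
  have "riesz_kernel s z = (\<integral>\<^sup>+t\<in>{0<..}. ennreal (t powr (s - 1) * exp (- (pi * (t * norm z)\<^sup>2))) \<partial>lborel)"
    unfolding riesz_kernel_def by (simp add: power_mult_distrib mult.assoc)
  also have "\<dots> = ennreal (norm z powr (- s)) * ennreal (riesz_mass s)"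
    unfolding riesz_mass(1)[OF s, symmetric] by (rule mellin_radial) (use z in auto)
  finally show ?thesis using riesz_mass(2)[OF s] by (simp add: ennreal_mult mult.commute)
qed

lemma riesz_kernel_zero:
  assumes s: "0 < s" "s < 2" shows "riesz_kernel s 0 = \<infinity>"
proof (rule ccontr)
  assume "riesz_kernel s 0 \<noteq> \<infinity>"
  then obtain R where R: "R \<ge> 0" "riesz_kernel s 0 = ennreal R" by (cases "riesz_kernel s 0") auto
  have k: "ennreal (riesz_mass s * (1 / r) powr s) \<le> ennreal R" if r: "r > 0" for r :: real
  proof -
    have "riesz_kernel s (r, 0) \<le> riesz_kernel s 0"
      unfolding riesz_kernel_def by (intro nn_integral_mono mult_right_mono ennreal_leI mult_left_mono) auto
    moreover have "norm (r, 0::real) = r" using r by (simp add: norm_prod_def)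
    ultimately show ?thesis using R riesz_kernel_nonzero[OF s, of "(r,0)"] r by (simp add: prod_eq_iff powr_minus_divide powr_divide)
  qed
  \<comment> \<open>a radius \<open>1 / x\<close> at which the kernel already exceeds the supposed value \<open>R\<close> at the origin\<close>
  define x where "x = (R / riesz_mass s + 1) powr (1 / s)"
  have "R / riesz_mass s + 1 > 0" using R riesz_mass(2)[OF s] by (simp add: add_nonneg_pos)
  then have x: "x > 0" "x powr s = R / riesz_mass s + 1"
    using s by (auto simp: x_def powr_powr)
  have "riesz_mass s * x powr s \<le> R" using k[of "1/x"] x R by simp
  then show False unfolding x(2) using riesz_mass(2)[OF s] by (simp add: distrib_left)
qed

definition mutual :: "(plane \<Rightarrow> ennreal) \<Rightarrow> plane measure \<Rightarrow> plane measure \<Rightarrow> ennreal" where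
  "mutual W \<mu> \<nu> = (\<integral>\<^sup>+x. \<integral>\<^sup>+y. W (x - y) \<partial>\<nu> \<partial>\<mu>)"

context two_probs begin

lemma mutual_riesz:
  "mutual (riesz_kernel s) \<mu> \<nu> = (\<integral>\<^sup>+t\<in>{0<..}. ennreal (t powr (s - 1)) *
     ennreal (\<integral>\<xi>. exp (- (pi * (norm \<xi>)\<^sup>2 / t\<^sup>2)) / t\<^sup>2 * Re (cnj (measure_fourier \<mu> \<xi>) * measure_fourier \<nu> \<xi>) \<partial>lborel) \<partial>lborel)"
proof -
  let ?f = "\<lambda>x y t. ennreal (t powr (s - 1) * exp (- (pi * t\<^sup>2 * (norm (x - y::plane))\<^sup>2))) * indicator {0<..} t"
  have sf: "sigma_finite_measure (lborel::real measure)" by (rule lborel.sigma_finite_measure_axioms)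
  have "mutual (riesz_kernel s) \<mu> \<nu> = (\<integral>\<^sup>+x. \<integral>\<^sup>+y. \<integral>\<^sup>+t. ?f x y t \<partial>lborel \<partial>\<nu> \<partial>\<mu>)"
    unfolding mutual_def riesz_kernel_def ..
  also have "\<dots> = (\<integral>\<^sup>+x. \<integral>\<^sup>+t. \<integral>\<^sup>+y. ?f x y t \<partial>\<nu> \<partial>lborel \<partial>\<mu>)"
    by (intro nn_integral_cong nn_integral_swap N.sigma_finite_measure_axioms sf) measurable
  also have "\<dots> = (\<integral>\<^sup>+t. \<integral>\<^sup>+x. \<integral>\<^sup>+y. ?f x y t \<partial>\<nu> \<partial>\<mu> \<partial>lborel)"
    by (intro nn_integral_swap M.sigma_finite_measure_axioms sf) measurable
  also have "\<dots> = (\<integral>\<^sup>+t\<in>{0<..}. ennreal (t powr (s - 1)) *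
     ennreal (\<integral>\<xi>. exp (- (pi * (norm \<xi>)\<^sup>2 / t\<^sup>2)) / t\<^sup>2 * Re (cnj (measure_fourier \<mu> \<xi>) * measure_fourier \<nu> \<xi>) \<partial>lborel) \<partial>lborel)"
  proof (intro nn_integral_cong)
    fix t :: real
    show "(\<integral>\<^sup>+x. \<integral>\<^sup>+y. ?f x y t \<partial>\<nu> \<partial>\<mu>) = ennreal (t powr (s - 1)) *
     ennreal (\<integral>\<xi>. exp (- (pi * (norm \<xi>)\<^sup>2 / t\<^sup>2)) / t\<^sup>2 * Re (cnj (measure_fourier \<mu> \<xi>) * measure_fourier \<nu> \<xi>) \<partial>lborel) * indicator {0<..} t"
    proof (cases "t > 0")
      case True
      then show ?thesis unfolding gauss_energy(2)[OF True, symmetric]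
        by (simp add: ennreal_mult nn_integral_cmult)
    qed simp
  qed
  finally show ?thesis .
qed

end

text \<open>Writing the kernel as a superposition of Gaussians turns the energy into an integral over \<open>t\<close> and \<open>\<xi>\<close> of
  nonnegative functions. Integrating over \<open>t\<close> first produces a positive multiple of
  \<open>norm \<xi> powr (s - 2)\<close>.\<close>
lemma (in plane_prob) finite_riesz_energy_imp:
  assumes fin: "mutual (riesz_kernel s) \<mu> \<mu> < \<infinity>"
  shows "integrable lborel (\<lambda>\<xi>. norm \<xi> powr (s - 2) * (norm (measure_fourier \<mu> \<xi>))\<^sup>2)"
proof -
  interpret two_probs \<mu> \<mu> ..
  let ?k1 = "\<integral>\<^sup>+t\<in>{0<..}. ennreal (t powr (s - 3) * exp (- (pi / t\<^sup>2))) \<partial>lborel"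
  have re: "Re (cnj (measure_fourier \<mu> \<xi>) * measure_fourier \<mu> \<xi>) = (norm (measure_fourier \<mu> \<xi>))\<^sup>2" for \<xi>
    by (simp add: cmod_power2) (simp add: power2_eq_square)
  let ?f = "\<lambda>\<xi> t. ennreal (t powr (s - 3) * exp (- (pi * (norm \<xi>)\<^sup>2 / t\<^sup>2))) * indicator {0<..} t * ennreal ((norm (measure_fourier \<mu> \<xi>))\<^sup>2)"
  have scale: "(\<integral>\<^sup>+t\<in>{0<..}. ennreal (t powr (s - 3) * exp (- (pi * (norm \<xi>)\<^sup>2 / t\<^sup>2))) \<partial>lborel) = ennreal (norm \<xi> powr (s - 2)) * ?k1" if "\<xi> \<noteq> 0" for \<xi> :: plane
  proof -
    define r where "r = norm \<xi>"
    have r: "r > 0" using that by (simp add: r_def)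
    have "(\<integral>\<^sup>+t\<in>{0<..}. ennreal (t powr (s - 3) * exp (- (pi * r\<^sup>2 / t\<^sup>2))) \<partial>lborel)
      = ennreal r * (\<integral>\<^sup>+t\<in>{0<..}. ennreal ((r * t) powr (s - 3) * exp (- (pi * r\<^sup>2 / (r * t)\<^sup>2))) \<partial>lborel)"
      by (rule nn_integral_pos_scale[OF _ r]) measurable
    also have "(\<integral>\<^sup>+t\<in>{0<..}. ennreal ((r * t) powr (s - 3) * exp (- (pi * r\<^sup>2 / (r * t)\<^sup>2))) \<partial>lborel)
      = (\<integral>\<^sup>+t. ennreal (r powr (s - 3)) * (ennreal (t powr (s - 3) * exp (- (pi / t\<^sup>2))) * indicator {0<..} t) \<partial>lborel)"
      using r by (intro nn_integral_cong) (auto simp: powr_mult ennreal_mult'[symmetric] power_mult_distrib mult_ac split: split_indicator)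
    also have "\<dots> = ennreal (r powr (s - 3)) * ?k1" by (rule nn_integral_cmult) measurable
    also have "ennreal r * (ennreal (r powr (s - 3)) * ?k1) = ennreal (r powr (s - 2)) * ?k1"
      using r powr_mult_base[of r "s - 3"] by (simp add: mult.assoc[symmetric] ennreal_mult[symmetric])
    finally show ?thesis by (simp add: r_def)
  qed
  have "mutual (riesz_kernel s) \<mu> \<mu> = (\<integral>\<^sup>+t. \<integral>\<^sup>+\<xi>. ?f \<xi> t \<partial>lborel \<partial>lborel)"
    unfolding mutual_riesz
  proof (intro nn_integral_cong)
    fix t :: real
    show "ennreal (t powr (s - 1)) * ennreal (\<integral>\<xi>. exp (- (pi * (norm \<xi>)\<^sup>2 / t\<^sup>2)) / t\<^sup>2 * Re (cnj (measure_fourier \<mu> \<xi>) * measure_fourier \<mu> \<xi>) \<partial>lborel) * indicator {0<..} t = (\<integral>\<^sup>+\<xi>. ?f \<xi> t \<partial>lborel)"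
    proof (cases "t > 0")
      case t: True
      have "ennreal (\<integral>\<xi>. exp (- (pi * (norm \<xi>)\<^sup>2 / t\<^sup>2)) / t\<^sup>2 * Re (cnj (measure_fourier \<mu> \<xi>) * measure_fourier \<mu> \<xi>) \<partial>lborel)
        = (\<integral>\<^sup>+\<xi>. ennreal (exp (- (pi * (norm \<xi>)\<^sup>2 / t\<^sup>2)) / t\<^sup>2 * (norm (measure_fourier \<mu> \<xi>))\<^sup>2) \<partial>lborel)"
        using nn_integral_eq_integral[OF gauss_energy(1)[OF t]] unfolding re by simp
      then have "ennreal (t powr (s - 1)) * ennreal (\<integral>\<xi>. exp (- (pi * (norm \<xi>)\<^sup>2 / t\<^sup>2)) / t\<^sup>2 * Re (cnj (measure_fourier \<mu> \<xi>) * measure_fourier \<mu> \<xi>) \<partial>lborel)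
        = (\<integral>\<^sup>+\<xi>. ennreal (t powr (s - 1)) * ennreal (exp (- (pi * (norm \<xi>)\<^sup>2 / t\<^sup>2)) / t\<^sup>2 * (norm (measure_fourier \<mu> \<xi>))\<^sup>2) \<partial>lborel)"
        by (simp add: nn_integral_cmult)
      also have "\<dots> = (\<integral>\<^sup>+\<xi>. ?f \<xi> t \<partial>lborel)"
      proof (intro nn_integral_cong)
        fix \<xi> :: plane
        have "t powr (s - 1) * (exp (- (pi * (norm \<xi>)\<^sup>2 / t\<^sup>2)) / t\<^sup>2 * (norm (measure_fourier \<mu> \<xi>))\<^sup>2)
          = (t powr (s - 3) * exp (- (pi * (norm \<xi>)\<^sup>2 / t\<^sup>2))) * (norm (measure_fourier \<mu> \<xi>))\<^sup>2"
          using t powr_mult_square[OF t, of "s - 3"] by (simp add: field_simps)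
        then show "ennreal (t powr (s - 1)) * ennreal (exp (- (pi * (norm \<xi>)\<^sup>2 / t\<^sup>2)) / t\<^sup>2 * (norm (measure_fourier \<mu> \<xi>))\<^sup>2) = ?f \<xi> t"
          using t by (simp add: ennreal_mult[symmetric] del: mult.assoc)
      qed
      finally show ?thesis using t by simp
    qed simp
  qed
  also have "\<dots> = (\<integral>\<^sup>+\<xi>. \<integral>\<^sup>+t. ?f \<xi> t \<partial>lborel \<partial>lborel)"
    by (intro nn_integral_swap lborel.sigma_finite_measure_axioms) measurable
  also have "\<dots> = (\<integral>\<^sup>+\<xi>. ?k1 * ennreal (norm \<xi> powr (s - 2) * (norm (measure_fourier \<mu> \<xi>))\<^sup>2) \<partial>lborel)"
  proof (intro nn_integral_cong_AE, use AE_lborel_singleton[of "0::plane"] in eventually_elim)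
    fix \<xi> :: plane assume x: "\<xi> \<noteq> 0"
    have "(\<integral>\<^sup>+t. ?f \<xi> t \<partial>lborel) = (\<integral>\<^sup>+t\<in>{0<..}. ennreal (t powr (s - 3) * exp (- (pi * (norm \<xi>)\<^sup>2 / t\<^sup>2))) \<partial>lborel) * ennreal ((norm (measure_fourier \<mu> \<xi>))\<^sup>2)"
      by (rule nn_integral_multc) measurable
    also have "\<dots> = ?k1 * ennreal (norm \<xi> powr (s - 2) * (norm (measure_fourier \<mu> \<xi>))\<^sup>2)"
      unfolding scale[OF x] by (simp add: ennreal_mult mult_ac)
    finally show "(\<integral>\<^sup>+t. ?f \<xi> t \<partial>lborel) = ?k1 * ennreal (norm \<xi> powr (s - 2) * (norm (measure_fourier \<mu> \<xi>))\<^sup>2)" .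
  qed
  also have "\<dots> = ?k1 * (\<integral>\<^sup>+\<xi>. ennreal (norm \<xi> powr (s - 2) * (norm (measure_fourier \<mu> \<xi>))\<^sup>2) \<partial>lborel)"
    by (rule nn_integral_cmult) measurable
  finally have "?k1 * (\<integral>\<^sup>+\<xi>. ennreal (norm \<xi> powr (s - 2) * (norm (measure_fourier \<mu> \<xi>))\<^sup>2) \<partial>lborel) < \<infinity>" using fin by simp
  moreover have "?k1 \<noteq> 0"
  proof
    assume "?k1 = 0"
    then have "AE t in lborel. ennreal (t powr (s - 3) * exp (- (pi / t\<^sup>2))) * indicator {0<..} t = 0"
      by (subst (asm) nn_integral_0_iff_AE) auto
    then have "AE t in lborel. t \<notin> {0<..<1::real}"
      by eventually_elim (auto simp: indicator_def ennreal_eq_0_iff mult_le_0_iff not_le[symmetric] split: if_splits)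
    then have "{0<..<1::real} \<in> null_sets lborel" by (subst (asm) AE_iff_null_sets[symmetric]) auto
    then show False by (simp add: null_sets_def)
  qed
  ultimately have "(\<integral>\<^sup>+\<xi>. ennreal (norm \<xi> powr (s - 2) * (norm (measure_fourier \<mu> \<xi>))\<^sup>2) \<partial>lborel) < \<infinity>"
    by (auto simp: ennreal_mult_less_top ennreal_mult_eq_top_iff less_top[symmetric])
  then show ?thesis by (intro integrableI_bounded) auto
qed

context two_probs begin

text \<open>For each Gaussian this is \<open>Re (cnj a * b) \<le> norm a ^ 2 + norm b ^ 2\<close> under the integral in Fourier
  variables; it makes mutual energies finite.\<close>
lemma mutual_riesz_le:
  "mutual (riesz_kernel s) \<mu> \<nu> \<le> mutual (riesz_kernel s) \<mu> \<mu> + mutual (riesz_kernel s) \<nu> \<nu>"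
proof -
  interpret MM: two_probs \<mu> \<mu> ..
  interpret NN: two_probs \<nu> \<nu> ..
  let ?G = "\<lambda>t \<mu> \<nu>. \<integral>\<xi>. exp (- (pi * (norm (\<xi>::plane))\<^sup>2 / t\<^sup>2)) / t\<^sup>2 * Re (cnj (measure_fourier \<mu> \<xi>) * measure_fourier \<nu> \<xi>) \<partial>lborel"
  have le: "?G t \<mu> \<nu> \<le> ?G t \<mu> \<mu> + ?G t \<nu> \<nu>" if t: "t > 0" for t :: real
  proof -
    have "?G t \<mu> \<mu> + ?G t \<nu> \<nu> = (\<integral>\<xi>. exp (- (pi * (norm (\<xi>::plane))\<^sup>2 / t\<^sup>2)) / t\<^sup>2 * Re (cnj (measure_fourier \<mu> \<xi>) * measure_fourier \<mu> \<xi>)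
       + exp (- (pi * (norm (\<xi>::plane))\<^sup>2 / t\<^sup>2)) / t\<^sup>2 * Re (cnj (measure_fourier \<nu> \<xi>) * measure_fourier \<nu> \<xi>) \<partial>lborel)"
      by (rule Bochner_Integration.integral_add[symmetric, OF MM.gauss_energy(1)[OF t] NN.gauss_energy(1)[OF t]])
    also have "\<dots> \<ge> ?G t \<mu> \<nu>"
    proof (rule integral_mono[OF gauss_energy(1)[OF t] Bochner_Integration.integrable_add[OF MM.gauss_energy(1)[OF t] NN.gauss_energy(1)[OF t]]])
      fix \<xi> :: plane
      have h: "x * y \<le> x\<^sup>2 + y\<^sup>2" for x y :: real
        using zero_le_power2[of "x - y"] zero_le_power2[of x] zero_le_power2[of y] unfolding power2_diff by linarith
      have "Re (cnj a * b) \<le> Re (cnj a * a) + Re (cnj b * b)" for a b :: complex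
        using h[of "Re a" "Re b"] h[of "Im a" "Im b"] by (simp add: power2_eq_square)
      then show "exp (- (pi * (norm \<xi>)\<^sup>2 / t\<^sup>2)) / t\<^sup>2 * Re (cnj (measure_fourier \<mu> \<xi>) * measure_fourier \<nu> \<xi>) \<le>
        exp (- (pi * (norm \<xi>)\<^sup>2 / t\<^sup>2)) / t\<^sup>2 * Re (cnj (measure_fourier \<mu> \<xi>) * measure_fourier \<mu> \<xi>) + exp (- (pi * (norm \<xi>)\<^sup>2 / t\<^sup>2)) / t\<^sup>2 * Re (cnj (measure_fourier \<nu> \<xi>) * measure_fourier \<nu> \<xi>)"
        unfolding distrib_left[symmetric] by (intro mult_left_mono) auto
    qed
    finally show ?thesis .
  qed
  have "mutual (riesz_kernel s) \<mu> \<nu> \<le> (\<integral>\<^sup>+t. ennreal (t powr (s - 1)) * ennreal (?G t \<mu> \<mu>) * indicator {0<..} t + ennreal (t powr (s - 1)) * ennreal (?G t \<nu> \<nu>) * indicator {0<..} t \<partial>lborel)"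
    unfolding mutual_riesz
  proof (intro nn_integral_mono)
    fix t :: real
    have nn: "0 \<le> ?G t \<rho> \<rho>" for \<rho>
      by (intro integral_nonneg_AE AE_I2) simp
    show "ennreal (t powr (s - 1)) * ennreal (?G t \<mu> \<nu>) * indicator {0<..} t \<le> ennreal (t powr (s - 1)) * ennreal (?G t \<mu> \<mu>) * indicator {0<..} t + ennreal (t powr (s - 1)) * ennreal (?G t \<nu> \<nu>) * indicator {0<..} t"
    proof (cases "t > 0")
      case True
      have "ennreal (?G t \<mu> \<nu>) \<le> ennreal (?G t \<mu> \<mu>) + ennreal (?G t \<nu> \<nu>)"
        unfolding ennreal_plus[OF nn nn, symmetric] by (rule ennreal_leI[OF le[OF True]])
      then show ?thesis using True by (simp add: distrib_left[symmetric] mult_left_mono)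
    qed simp
  qed
  also have "\<dots> = mutual (riesz_kernel s) \<mu> \<mu> + mutual (riesz_kernel s) \<nu> \<nu>"
    unfolding MM.mutual_riesz NN.mutual_riesz by (rule nn_integral_add) measurable
  finally show ?thesis .
qed

end

lemma (in two_probs) nn_integral_pair:
  assumes [measurable]: "W \<in> borel_measurable borel"
  shows "(\<integral>\<^sup>+z. W (fst z - snd z) \<partial>(\<mu> \<Otimes>\<^sub>M \<nu>)) = mutual W \<mu> \<nu>"
  unfolding mutual_def by (subst N.nn_integral_fst[symmetric]) simp_all

locale riesz_profile = profile +
  fixes s :: real assumes s: "0 < s" "s < 2"
begin

abbreviation "U \<equiv> anisotropic_riesz s \<Omega>"
abbreviation "H \<equiv> riesz_hat s"

lemma H_measurable [measurable]: "H \<in> borel_measurable borel" by (rule riesz_hat_measurable[OF s])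

lemma U_isCont: "z \<noteq> 0 \<Longrightarrow> isCont U z"
  unfolding anisotropic_riesz_def[abs_def] by (intro continuous_intros cont_angle) auto

lemma gauss_avg_fourier:
  assumes m: "m > 0"
  shows "integrable lborel (\<lambda>\<xi>. of_real (H \<xi>) * complex_of_real (exp (- (pi * (1 / m)\<^sup>2 * (norm \<xi>)\<^sup>2))))"
    and "of_real (gauss_avg U m z) = (\<integral>\<xi>. of_real (H \<xi>) * complex_of_real (exp (- (pi * (1 / m)\<^sup>2 * (norm \<xi>)\<^sup>2))) * cis (2 * pi * (\<xi> \<bullet> z)) \<partial>lborel)"
proof -
  have a: "1 / m > 0" using m by simp
  let ?f = "\<lambda>z \<xi>. complex_of_real (exp (- (pi * (1 / m)\<^sup>2 * (norm \<xi>)\<^sup>2))) * cis (2 * pi * (z \<bullet> \<xi>))"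
  note ft = has_fourier_transform_hat[OF s, unfolded has_fourier_transform_def, rule_format, OF schwartz_modulated_gaussian[OF a]]
  show "integrable lborel (\<lambda>\<xi>. of_real (H \<xi>) * complex_of_real (exp (- (pi * (1 / m)\<^sup>2 * (norm \<xi>)\<^sup>2))))"
    using ft[of 0, THEN conjunct2, THEN conjunct1] by simp
  have "(\<integral>x. of_real (U x) * fourier (?f z) x \<partial>lborel) = (\<integral>x. complex_of_real (m\<^sup>2 * (U x * exp (- (pi * m\<^sup>2 * (norm (z - x))\<^sup>2)))) \<partial>lborel)"
    unfolding fourier_modulated_gaussian[OF a] using m by (simp add: power_divide mult_ac)
  also have "\<dots> = of_real (gauss_avg U m z)"
    unfolding integral_complex_of_real gauss_avg_def by simp
  finally have "of_real (gauss_avg U m z) = (\<integral>\<xi>. of_real (H \<xi>) * ?f z \<xi> \<partial>lborel)"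
    using ft[of z, THEN conjunct2, THEN conjunct2] by simp
  then show "of_real (gauss_avg U m z) = (\<integral>\<xi>. of_real (H \<xi>) * complex_of_real (exp (- (pi * (1 / m)\<^sup>2 * (norm \<xi>)\<^sup>2))) * cis (2 * pi * (\<xi> \<bullet> z)) \<partial>lborel)"
    by (simp add: inner_commute mult.assoc)
qed

text \<open>The kernel is infinite on the diagonal, so a finite mutual energy forces the diagonal to be a null set of
  the product measure. Off the diagonal the potential is the finite function
  \<open>U z + (norm z)\<^sup>2\<close>.\<close>
lemma finite_mutual:
  assumes "two_probs \<mu> \<nu>" and fin: "mutual (riesz_kernel s) \<mu> \<nu> < \<infinity>"
  shows "AE z in \<mu> \<Otimes>\<^sub>M \<nu>. fst z - snd z \<noteq> 0"
    and "integrable (\<mu> \<Otimes>\<^sub>M \<nu>) (\<lambda>z. norm (fst z - snd z) powr (-s))"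
    and "integrable (\<mu> \<Otimes>\<^sub>M \<nu>) (\<lambda>z. U (fst z - snd z))"
proof -
  interpret two_probs \<mu> \<nu> by fact
  have f: "(\<integral>\<^sup>+z. riesz_kernel s (fst z - snd z) \<partial>(\<mu> \<Otimes>\<^sub>M \<nu>)) < \<infinity>"
    using fin by (simp add: nn_integral_pair)
  then have "AE z in \<mu> \<Otimes>\<^sub>M \<nu>. riesz_kernel s (fst z - snd z) \<noteq> \<infinity>"
    by (intro nn_integral_noteq_infinite) auto
  then show nz: "AE z in \<mu> \<Otimes>\<^sub>M \<nu>. fst z - snd z \<noteq> 0"
    by eventually_elim (metis riesz_kernel_zero[OF s])
  have "integrable (\<mu> \<Otimes>\<^sub>M \<nu>) (\<lambda>z. riesz_mass s * norm (fst z - snd z) powr (-s))"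
  proof (rule integrableI_bounded)
    have "(\<integral>\<^sup>+z. ennreal (norm (riesz_mass s * norm (fst z - snd z) powr (-s))) \<partial>(\<mu> \<Otimes>\<^sub>M \<nu>)) = (\<integral>\<^sup>+z. riesz_kernel s (fst z - snd z) \<partial>(\<mu> \<Otimes>\<^sub>M \<nu>))"
    proof (intro nn_integral_cong_AE, use nz in eventually_elim)
      fix z :: "plane \<times> plane" assume "fst z - snd z \<noteq> 0"
      then show "ennreal (norm (riesz_mass s * norm (fst z - snd z) powr (-s))) = riesz_kernel s (fst z - snd z)"
        using riesz_kernel_nonzero[OF s] riesz_mass(2)[OF s] by (simp add: abs_mult)
    qed
    then show "(\<integral>\<^sup>+z. ennreal (norm (riesz_mass s * norm (fst z - snd z) powr (-s))) \<partial>(\<mu> \<Otimes>\<^sub>M \<nu>)) < \<infinity>" using f by simp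
  qed measurable
  then show w: "integrable (\<mu> \<Otimes>\<^sub>M \<nu>) (\<lambda>z. norm (fst z - snd z) powr (-s))"
    using integrable_mult_right[of "1 / riesz_mass s" "\<mu> \<Otimes>\<^sub>M \<nu>" "\<lambda>z. riesz_mass s * norm (fst z - snd z) powr (-s)"] riesz_mass(2)[OF s]
    by (simp add: mult.assoc[symmetric])
  obtain M where M: "M > 0" "\<And>x. U x \<le> M * norm x powr (- s)" using riesz_bound by blast
  show "integrable (\<mu> \<Otimes>\<^sub>M \<nu>) (\<lambda>z. U (fst z - snd z))"
    by (rule integrable_boundI[OF integrable_mult_right[OF w, of M]]) (use M riesz_nonneg in auto)
qed

text \<open>Both sides are limits of the corresponding
  expressions for the Gaussian averages of the kernel, whose Fourier transform is integrable.\<close>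
lemma mutual_riesz_identity:
  assumes tp: "two_probs \<mu> \<nu>" and fin: "mutual (riesz_kernel s) \<mu> \<mu> < \<infinity>" "mutual (riesz_kernel s) \<nu> \<nu> < \<infinity>"
  shows "integrable lborel (\<lambda>\<xi>. of_real (H \<xi>) * (cnj (measure_fourier \<mu> \<xi>) * measure_fourier \<nu> \<xi>))"
    and "of_real (\<integral>z. U (fst z - snd z) \<partial>(\<mu> \<Otimes>\<^sub>M \<nu>)) = (\<integral>\<xi>. of_real (H \<xi>) * (cnj (measure_fourier \<mu> \<xi>) * measure_fourier \<nu> \<xi>) \<partial>lborel)"
proof -
  interpret two_probs \<mu> \<nu> by fact
  have fin': "mutual (riesz_kernel s) \<mu> \<nu> < \<infinity>"
    using mutual_riesz_le[of s] fin by (simp add: order_le_less_trans)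
  note nz = finite_mutual(1)[OF tp fin'] and w = finite_mutual(2)[OF tp fin']
  obtain M where M: "M > 0" "\<And>x. U x \<le> M * norm x powr (- s)" using riesz_bound by blast
  interpret sing: singular_function U s M
    by unfold_locales (use s M riesz_nonneg in auto)
  obtain D where D: "D \<ge> 0" "\<And>\<xi>. \<bar>H \<xi>\<bar> \<le> D * norm \<xi> powr (s - 2)" using riesz_hat_bound[OF s] by blast
  let ?m = "\<lambda>\<xi>. cnj (measure_fourier \<mu> \<xi>) * measure_fourier \<nu> \<xi>"
  let ?e = "\<lambda>n \<xi>. exp (- (pi * (1 / real (Suc n))\<^sup>2 * (norm (\<xi>::plane))\<^sup>2))"
  have dom: "integrable lborel (\<lambda>\<xi>. D * (norm \<xi> powr (s - 2) * (norm (measure_fourier \<mu> \<xi>))\<^sup>2 + norm \<xi> powr (s - 2) * (norm (measure_fourier \<nu> \<xi>))\<^sup>2))"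
    by (intro integrable_mult_right Bochner_Integration.integrable_add M.finite_riesz_energy_imp N.finite_riesz_energy_imp fin)
  have bnd: "norm (of_real (H \<xi>) * ?m \<xi>) \<le> D * (norm \<xi> powr (s - 2) * (norm (measure_fourier \<mu> \<xi>))\<^sup>2 + norm \<xi> powr (s - 2) * (norm (measure_fourier \<nu> \<xi>))\<^sup>2)" for \<xi>
  proof -
    have "norm (?m \<xi>) \<le> (norm (measure_fourier \<mu> \<xi>))\<^sup>2 + (norm (measure_fourier \<nu> \<xi>))\<^sup>2"
      using zero_le_power2[of "norm (measure_fourier \<mu> \<xi>) - norm (measure_fourier \<nu> \<xi>)"] zero_le_power2[of "norm (measure_fourier \<mu> \<xi>)"] zero_le_power2[of "norm (measure_fourier \<nu> \<xi>)"]
      unfolding power2_diff norm_mult complex_mod_cnj by linarith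
    then have "\<bar>H \<xi>\<bar> * norm (?m \<xi>) \<le> (D * norm \<xi> powr (s - 2)) * ((norm (measure_fourier \<mu> \<xi>))\<^sup>2 + (norm (measure_fourier \<nu> \<xi>))\<^sup>2)"
      using D by (intro mult_mono D) auto
    then show ?thesis unfolding norm_mult[of "of_real _"] norm_of_real by (simp add: algebra_simps)
  qed
  show iH: "integrable lborel (\<lambda>\<xi>. of_real (H \<xi>) * ?m \<xi>)"
    by (rule integrable_boundI[OF dom]) (use bnd in auto)
  have step: "(\<integral>z. complex_of_real (gauss_avg U (real (Suc n)) (fst z - snd z)) \<partial>(\<mu> \<Otimes>\<^sub>M \<nu>)) = (\<integral>\<xi>. of_real (H \<xi>) * of_real (?e n \<xi>) * ?m \<xi> \<partial>lborel)" for n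
  proof -
    have m: "real (Suc n) > 0" by simp
    have [measurable]: "gauss_avg U (real (Suc n)) \<in> borel_measurable borel"
      unfolding gauss_avg_def[abs_def] by measurable
    have "integrable (\<mu> \<Otimes>\<^sub>M \<nu>) (\<lambda>z. complex_of_real (gauss_avg U (real (Suc n)) (fst z - snd z)))"
    proof (rule integrable_boundI[OF integrable_mult_right[OF w, of "M * 2 powr s * (1 + sing.V)"]])
      show "AE z in \<mu> \<Otimes>\<^sub>M \<nu>. norm (complex_of_real (gauss_avg U (real (Suc n)) (fst z - snd z))) \<le> M * 2 powr s * (1 + sing.V) * norm (fst z - snd z) powr (-s)"
        using nz by eventually_elim (use sing.gauss_avg_bound[OF m] in simp)
    qed measurable
    then have "(\<integral>z. complex_of_real (gauss_avg U (real (Suc n)) (fst z - snd z)) \<partial>(\<mu> \<Otimes>\<^sub>M \<nu>)) = (\<integral>x. \<integral>y. complex_of_real (gauss_avg U (real (Suc n)) (x - y)) \<partial>\<nu> \<partial>\<mu>)"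
      by (subst P.integral_fst'[symmetric]) auto
    also have "\<dots> = (\<integral>x. \<integral>y. (\<integral>\<xi>. (of_real (H \<xi>) * of_real (?e n \<xi>)) * cis (2 * pi * (\<xi> \<bullet> (x - y))) \<partial>lborel) \<partial>\<nu> \<partial>\<mu>)"
      unfolding gauss_avg_fourier(2)[OF m] ..
    also have "\<dots> = (\<integral>\<xi>. of_real (H \<xi>) * of_real (?e n \<xi>) * ?m \<xi> \<partial>lborel)"
      by (rule kernel_energy[OF gauss_avg_fourier(1)[OF m]])
    finally show ?thesis .
  qed
  have lim1: "(\<lambda>n. \<integral>z. complex_of_real (gauss_avg U (real (Suc n)) (fst z - snd z)) \<partial>(\<mu> \<Otimes>\<^sub>M \<nu>)) \<longlonglongrightarrow> (\<integral>z. complex_of_real (U (fst z - snd z)) \<partial>(\<mu> \<Otimes>\<^sub>M \<nu>))"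
  proof (rule integral_dominated_convergence[OF _ _ integrable_mult_right[OF w, of "M * 2 powr s * (1 + sing.V)"]])
    show "AE z in \<mu> \<Otimes>\<^sub>M \<nu>. (\<lambda>n. complex_of_real (gauss_avg U (real (Suc n)) (fst z - snd z))) \<longlonglongrightarrow> complex_of_real (U (fst z - snd z))"
      using nz by eventually_elim (intro tendsto_of_real sing.gauss_avg_tendsto U_isCont)
    fix n
    show "AE z in \<mu> \<Otimes>\<^sub>M \<nu>. norm (complex_of_real (gauss_avg U (real (Suc n)) (fst z - snd z))) \<le> M * 2 powr s * (1 + sing.V) * norm (fst z - snd z) powr (-s)"
      using nz by eventually_elim (use sing.gauss_avg_bound[of "real (Suc n)"] in simp)
    show "(\<lambda>z. complex_of_real (gauss_avg U (real (Suc n)) (fst z - snd z))) \<in> borel_measurable (\<mu> \<Otimes>\<^sub>M \<nu>)"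
      unfolding gauss_avg_def by measurable
  qed measurable
  have lim2: "(\<lambda>n. \<integral>\<xi>. of_real (H \<xi>) * of_real (?e n \<xi>) * ?m \<xi> \<partial>lborel) \<longlonglongrightarrow> (\<integral>\<xi>. of_real (H \<xi>) * ?m \<xi> \<partial>lborel)"
  proof (rule integral_dominated_convergence[OF _ _ dom])
    show "AE \<xi> in lborel. (\<lambda>n. of_real (H \<xi>) * of_real (?e n \<xi>) * ?m \<xi>) \<longlonglongrightarrow> of_real (H \<xi>) * ?m \<xi>"
    proof (rule AE_I2)
      fix \<xi> :: plane
      have "(\<lambda>n. ?e n \<xi>) \<longlonglongrightarrow> 1" by real_asymp
      then have "(\<lambda>n. of_real (H \<xi>) * of_real (?e n \<xi>) * ?m \<xi>) \<longlonglongrightarrow> of_real (H \<xi>) * of_real 1 * ?m \<xi>"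
        by (intro tendsto_mult tendsto_of_real tendsto_const)
      then show "(\<lambda>n. of_real (H \<xi>) * of_real (?e n \<xi>) * ?m \<xi>) \<longlonglongrightarrow> of_real (H \<xi>) * ?m \<xi>" by simp
    qed
    fix n
    show "AE \<xi> in lborel. norm (of_real (H \<xi>) * of_real (?e n \<xi>) * ?m \<xi>) \<le> D * (norm \<xi> powr (s - 2) * (norm (measure_fourier \<mu> \<xi>))\<^sup>2 + norm \<xi> powr (s - 2) * (norm (measure_fourier \<nu> \<xi>))\<^sup>2)"
    proof (rule AE_I2)
      fix \<xi> :: plane
      have "norm (of_real (H \<xi>) * of_real (?e n \<xi>) * ?m \<xi>) = norm (of_real (H \<xi>) * ?m \<xi>) * ?e n \<xi>"
        unfolding norm_mult norm_of_real by simp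
      also have "\<dots> \<le> norm (of_real (H \<xi>) * ?m \<xi>)" by (intro mult_left_le) auto
      finally show "norm (of_real (H \<xi>) * of_real (?e n \<xi>) * ?m \<xi>) \<le> D * (norm \<xi> powr (s - 2) * (norm (measure_fourier \<mu> \<xi>))\<^sup>2 + norm \<xi> powr (s - 2) * (norm (measure_fourier \<nu> \<xi>))\<^sup>2)"
        using bnd[of \<xi>] by linarith
    qed
  qed measurable
  have "(\<integral>z. complex_of_real (U (fst z - snd z)) \<partial>(\<mu> \<Otimes>\<^sub>M \<nu>)) = (\<integral>\<xi>. of_real (H \<xi>) * ?m \<xi> \<partial>lborel)"
    using LIMSEQ_unique[OF lim1 lim2[folded step]] .
  then show "of_real (\<integral>z. U (fst z - snd z) \<partial>(\<mu> \<Otimes>\<^sub>M \<nu>)) = (\<integral>\<xi>. of_real (H \<xi>) * ?m \<xi> \<partial>lborel)"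
    by (simp only: integral_complex_of_real)
qed

end

section \<open>Energies along linear interpolations\<close>

lemma interpolation_sets [measurable_cong, simp]: "sets (interpolation t \<rho>0 \<rho>1) = sets borel"
  unfolding interpolation_def by (metis sets.sets_measure_of_eq space_borel)

lemma emeasure_interpolation:
  assumes t: "0 \<le> t" "t \<le> 1" and [simp]: "sets \<rho>0 = sets borel" "sets \<rho>1 = sets borel" and A: "A \<in> sets borel"
  shows "emeasure (interpolation t \<rho>0 \<rho>1) A = ennreal (1 - t) * emeasure \<rho>0 A + ennreal t * emeasure \<rho>1 A"
proof (rule emeasure_measure_of[OF interpolation_def])
  let ?m = "\<lambda>A. ennreal (1 - t) * emeasure \<rho>0 A + ennreal t * emeasure \<rho>1 A"
  show "positive (sets (interpolation t \<rho>0 \<rho>1)) ?m" by (simp add: positive_def)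
  show "countably_additive (sets (interpolation t \<rho>0 \<rho>1)) ?m"
  proof (rule countably_additiveI)
    fix B :: "nat \<Rightarrow> plane set" assume B: "range B \<subseteq> sets (interpolation t \<rho>0 \<rho>1)" "disjoint_family B"
    have "(\<Sum>i. ?m (B i)) = (\<Sum>i. ennreal (1 - t) * emeasure \<rho>0 (B i)) + (\<Sum>i. ennreal t * emeasure \<rho>1 (B i))"
      by (rule suminf_add[symmetric]) auto
    then show "(\<Sum>i. ?m (B i)) = ?m (\<Union> (range B))"
      using B by (simp add: suminf_emeasure)
  qed
qed (use A in \<open>auto simp: sets.sets_into_space\<close>)

lemma nn_integral_interpolation:
  assumes t: "0 \<le> t" "t \<le> 1" and sets [simp, measurable_cong]: "sets \<rho>0 = sets borel" "sets \<rho>1 = sets borel"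
    and f: "f \<in> borel_measurable borel"
  shows "(\<integral>\<^sup>+x. f x \<partial>interpolation t \<rho>0 \<rho>1) = ennreal (1 - t) * (\<integral>\<^sup>+x. f x \<partial>\<rho>0) + ennreal t * (\<integral>\<^sup>+x. f x \<partial>\<rho>1)"
  using f
proof (induction rule: borel_measurable_induct)
  case (cong f g)
  then show ?case by simp
next
  case (set A)
  then show ?case using emeasure_interpolation[OF t sets] by simp
next
  case (mult u c)
  note [measurable] = mult.hyps
  show ?case using mult.IH by (simp add: nn_integral_cmult distrib_left mult_ac)
next
  case (add u v)
  note [measurable] = add.hyps
  show ?case using add.IH by (simp add: nn_integral_add distrib_left add_ac)
next
  case (seq F)
  note [measurable] = seq.hyps
  have inc: "incseq (\<lambda>i. c * integral\<^sup>N M (F i))" for c :: ennreal and M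
    using seq.hyps by (auto simp: incseq_def le_fun_def intro!: mult_left_mono nn_integral_mono)
  have S: "(\<integral>\<^sup>+x. (SUP i. F i) x \<partial>M) = (SUP i. integral\<^sup>N M (F i))" if "sets M = sets borel" for M
    using seq.hyps that by (simp only: SUP_apply) (intro nn_integral_monotone_convergence_SUP, auto simp: measurable_cong_sets[OF that refl])
  have "(\<integral>\<^sup>+x. (SUP i. F i) x \<partial>interpolation t \<rho>0 \<rho>1) = (SUP i. ennreal (1 - t) * integral\<^sup>N \<rho>0 (F i) + ennreal t * integral\<^sup>N \<rho>1 (F i))"
    by (simp only: S[OF interpolation_sets] seq.IH)
  also have "\<dots> = (SUP i. ennreal (1 - t) * integral\<^sup>N \<rho>0 (F i)) + (SUP i. ennreal t * integral\<^sup>N \<rho>1 (F i))"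
    by (rule ennreal_SUP_add[OF inc inc])
  also have "\<dots> = ennreal (1 - t) * (\<integral>\<^sup>+x. (SUP i. F i) x \<partial>\<rho>0) + ennreal t * (\<integral>\<^sup>+x. (SUP i. F i) x \<partial>\<rho>1)"
    by (simp only: S[OF sets(1)] S[OF sets(2)] SUP_mult_left_ennreal)
  finally show ?case .
qed

lemma energy_interpolation:
  assumes t: "0 \<le> t" "t \<le> 1" and tp: "two_probs \<rho>0 \<rho>1" and [measurable]: "W \<in> borel_measurable borel"
  shows "energy W (interpolation t \<rho>0 \<rho>1) = (1 / 2) *
    (ennreal (1 - t) * (ennreal (1 - t) * mutual W \<rho>0 \<rho>0 + ennreal t * mutual W \<rho>0 \<rho>1)
     + ennreal t * (ennreal (1 - t) * mutual W \<rho>1 \<rho>0 + ennreal t * mutual W \<rho>1 \<rho>1))"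
proof -
  interpret two_probs \<rho>0 \<rho>1 by fact
  note ni = nn_integral_interpolation[OF t M.sets_plane N.sets_plane]
  have "(\<integral>\<^sup>+y. W (x - y) \<partial>interpolation t \<rho>0 \<rho>1) = ennreal (1 - t) * (\<integral>\<^sup>+y. W (x - y) \<partial>\<rho>0) + ennreal t * (\<integral>\<^sup>+y. W (x - y) \<partial>\<rho>1)" for x
    by (rule ni) measurable
  then have "energy W (interpolation t \<rho>0 \<rho>1) = (1/2) * (\<integral>\<^sup>+x. ennreal (1 - t) * (\<integral>\<^sup>+y. W (x - y) \<partial>\<rho>0) + ennreal t * (\<integral>\<^sup>+y. W (x - y) \<partial>\<rho>1) \<partial>interpolation t \<rho>0 \<rho>1)"
    by (simp add: energy_def)
  also have "(\<integral>\<^sup>+x. ennreal (1 - t) * (\<integral>\<^sup>+y. W (x - y) \<partial>\<rho>0) + ennreal t * (\<integral>\<^sup>+y. W (x - y) \<partial>\<rho>1) \<partial>interpolation t \<rho>0 \<rho>1)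
    = ennreal (1 - t) * (\<integral>\<^sup>+x. ennreal (1 - t) * (\<integral>\<^sup>+y. W (x - y) \<partial>\<rho>0) + ennreal t * (\<integral>\<^sup>+y. W (x - y) \<partial>\<rho>1) \<partial>\<rho>0)
     + ennreal t * (\<integral>\<^sup>+x. ennreal (1 - t) * (\<integral>\<^sup>+y. W (x - y) \<partial>\<rho>0) + ennreal t * (\<integral>\<^sup>+y. W (x - y) \<partial>\<rho>1) \<partial>\<rho>1)"
    by (rule ni) measurable
  finally show ?thesis
    by (simp add: nn_integral_add nn_integral_cmult mutual_def)
qed

text \<open>The convexity defect of the quadratic polynomial between \<open>a\<close> and \<open>b\<close> is
  \<open>u * (1 - u) * (a - b)\<^sup>2 / 2\<close> times \<open>e00 + e11 - e01 - e10\<close>.\<close>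
lemma strictly_convex_quadratic:
  fixes e00 e01 e10 e11 :: real
  assumes nn: "0 \<le> e00" "0 \<le> e01" "0 \<le> e10" "0 \<le> e11"
    and f: "\<And>t. 0 \<le> t \<Longrightarrow> t \<le> 1 \<Longrightarrow> f t = (1 / 2) *
      (ennreal (1 - t) * (ennreal (1 - t) * ennreal e00 + ennreal t * ennreal e01)
       + ennreal t * (ennreal (1 - t) * ennreal e10 + ennreal t * ennreal e11))"
  shows "strictly_convex_01 f \<longleftrightarrow> 0 < e00 + e11 - e01 - e10"
proof -
  define q where "q t = (1/2) * ((1 - t) * ((1 - t) * e00 + t * e01) + t * ((1 - t) * e10 + t * e11))" for t
  have half: "(1 / 2 :: ennreal) = ennreal (1/2)"
    by (simp add: divide_ennreal_def)
  have fq: "f t = ennreal (q t)" and q0: "0 \<le> q t" if "0 \<le> t" "t \<le> 1" for t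
  proof -
    have nn': "0 \<le> (1 - t) * e00" "0 \<le> t * e01" "0 \<le> (1 - t) * e10" "0 \<le> t * e11" using that nn by auto
    show "f t = ennreal (q t)"
    proof -
      have "ennreal (1 - t) * (ennreal (1 - t) * ennreal e00 + ennreal t * ennreal e01)
       + ennreal t * (ennreal (1 - t) * ennreal e10 + ennreal t * ennreal e11)
       = ennreal ((1 - t) * ((1 - t) * e00 + t * e01) + t * ((1 - t) * e10 + t * e11))"
        using that nn nn' by (simp add: ennreal_mult[symmetric] ennreal_plus[symmetric] del: ennreal_plus)
      note X = this
      have X0: "0 \<le> (1 - t) * ((1 - t) * e00 + t * e01) + t * ((1 - t) * e10 + t * e11)"
        using that nn by (intro mult_nonneg_nonneg add_nonneg_nonneg) auto
      show ?thesis unfolding f[OF that] half q_def X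
        by (rule ennreal_mult[symmetric]) (use X0 in auto)
    qed
    show "0 \<le> q t" unfolding q_def using that nn by (intro mult_nonneg_nonneg add_nonneg_nonneg) auto
  qed
  have conv: "(1 - u) * q a + u * q b - q ((1 - u) * a + u * b) = (1/2) * u * (1 - u) * (a - b)\<^sup>2 * (e00 + e11 - e01 - e10)" for a b u
    unfolding q_def by (simp add: field_simps power2_eq_square)
  have iff: "f ((1 - u) * a + u * b) < ennreal (1 - u) * f a + ennreal u * f b \<longleftrightarrow> 0 < e00 + e11 - e01 - e10"
    if "a \<in> {0..1}" "b \<in> {0..1}" "u \<in> {0<..<1}" "a \<noteq> b" for a b u
  proof -
    have c: "0 \<le> (1 - u) * a + u * b" "(1 - u) * a + u * b \<le> 1"
      using that convex_bound_le[of a 1 b "1 - u" u] by auto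
    have "f ((1 - u) * a + u * b) < ennreal (1 - u) * f a + ennreal u * f b \<longleftrightarrow> ennreal (q ((1 - u) * a + u * b)) < ennreal ((1 - u) * q a + u * q b)"
      using that q0 by (simp add: fq c ennreal_mult)
    also have "\<dots> \<longleftrightarrow> q ((1 - u) * a + u * b) < (1 - u) * q a + u * q b"
      using q0[OF c] by (simp add: ennreal_less_iff)
    also have "\<dots> \<longleftrightarrow> 0 < (1/2) * u * (1 - u) * (a - b)\<^sup>2 * (e00 + e11 - e01 - e10)"
      unfolding conv[symmetric] by linarith
    also have "\<dots> \<longleftrightarrow> 0 < e00 + e11 - e01 - e10"
    proof -
      have "(1/2) * u * (1 - u) * (a - b)\<^sup>2 > 0" using that by (intro mult_pos_pos) auto
      from mult_less_cancel_left_pos[OF this, of 0] show ?thesis by simp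
    qed
    finally show ?thesis .
  qed
  show ?thesis
  proof
    assume sc: "strictly_convex_01 f"
    have "f ((1 - 1/2) * 0 + 1/2 * 1) < ennreal (1 - 1/2) * f 0 + ennreal (1/2) * f 1"
      by (rule sc[unfolded strictly_convex_01_def, rule_format]) auto
    then show "0 < e00 + e11 - e01 - e10" by (subst (asm) iff) auto
  next
    assume "0 < e00 + e11 - e01 - e10"
    then show "strictly_convex_01 f" unfolding strictly_convex_01_def using iff by blast
  qed
qed


context riesz_profile begin

abbreviation "W \<equiv> potential s \<Omega>"

lemma potential_measurable [measurable]: "W \<in> borel_measurable borel"
  unfolding potential_def[abs_def] by measurable

definition finite_energy :: "plane measure \<Rightarrow> bool" where
  "finite_energy \<rho> \<longleftrightarrow> compactly_supported_prob \<rho> \<and> energy W \<rho> < \<infinity>"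

lemma finite_energy_plane_prob: "finite_energy \<rho> \<Longrightarrow> plane_prob \<rho>"
  by (simp add: finite_energy_def compactly_supported_prob_def plane_prob_def plane_prob_axioms_def)

lemma finite_energy_two_probs: "finite_energy \<mu> \<Longrightarrow> finite_energy \<nu> \<Longrightarrow> two_probs \<mu> \<nu>"
  by (simp add: two_probs_def finite_energy_plane_prob)

lemma riesz_le_potential: "\<exists>c\<ge>0. \<forall>z. riesz_kernel s z \<le> ennreal c * W z"
proof -
  obtain m where m: "m > 0" "\<And>x. m \<le> \<Omega> x" using \<Omega>_lower by blast
  let ?c = "riesz_mass s / m"
  have c: "?c > 0" using m riesz_mass(2)[OF s] by simp
  have "riesz_kernel s z \<le> ennreal ?c * W z" for z
  proof (cases "z = 0")
    case True
    then show ?thesis using m(1) riesz_mass(2)[OF s] by (simp add: potential_def ennreal_mult_top)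
  next
    case False
    have "riesz_mass s * norm z powr (-s) = ?c * (norm z powr (-s) * m)" using m by simp
    also have "\<dots> \<le> ?c * (U z + (norm z)\<^sup>2)"
      using c m(2)[of "angle z"] by (intro mult_left_mono) (auto simp: anisotropic_riesz_def intro!: add_increasing2 mult_left_mono)
    finally have "riesz_kernel s z \<le> ennreal (?c * (U z + (norm z)\<^sup>2))"
      unfolding riesz_kernel_nonzero[OF s False] by (rule ennreal_leI)
    also have "\<dots> = ennreal ?c * ennreal (U z + (norm z)\<^sup>2)"
      by (rule ennreal_mult) (use c riesz_nonneg[of s z] in auto)
    finally show ?thesis using False by (simp only: potential_def if_False)
  qed
  then show ?thesis using c by (intro exI[of _ ?c]) auto
qed

lemma finite_energy_riesz:
  assumes "finite_energy \<rho>" shows "mutual (riesz_kernel s) \<rho> \<rho> < \<infinity>"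
proof -
  interpret plane_prob \<rho> by (rule finite_energy_plane_prob[OF assms])
  interpret two_probs \<rho> \<rho> ..
  obtain c where c: "c \<ge> 0" "\<And>z. riesz_kernel s z \<le> ennreal c * W z" using riesz_le_potential by blast
  have "mutual W \<rho> \<rho> < \<infinity>" using assms by (auto simp: finite_energy_def energy_def mutual_def ennreal_mult_less_top)
  moreover have "mutual (riesz_kernel s) \<rho> \<rho> \<le> ennreal c * mutual W \<rho> \<rho>"
    unfolding nn_integral_pair[OF potential_measurable, symmetric] nn_integral_pair[OF riesz_kernel_measurable, symmetric]
    by (subst nn_integral_cmult[symmetric]) (auto intro!: nn_integral_mono c)
  ultimately show ?thesis by (auto simp: ennreal_mult_less_top intro: le_less_trans)
qed

lemma finite_energy_bounded:
  assumes "finite_energy \<rho>" shows "\<exists>R\<ge>0. AE x in \<rho>. norm x \<le> R"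
proof -
  interpret plane_prob \<rho> by (rule finite_energy_plane_prob[OF assms])
  obtain K where K: "compact K" "emeasure \<rho> (- K) = 0" using assms by (auto simp: finite_energy_def compactly_supported_prob_def)
  from compact_imp_bounded[OF K(1)] obtain R where R: "\<And>x. x \<in> K \<Longrightarrow> norm x \<le> R" unfolding bounded_iff by blast
  have "- K \<in> null_sets \<rho>" using K compact_imp_closed[OF K(1)] by (auto simp: null_sets_def sets_plane)
  then have "AE x in \<rho>. x \<notin> - K" by (rule AE_not_in)
  then have "AE x in \<rho>. norm x \<le> \<bar>R\<bar>" by eventually_elim (use R in force)
  then show ?thesis by (intro exI[of _ "\<bar>R\<bar>"]) auto
qed

lemma finite_energy_moments:
  assumes "finite_energy \<rho>"
  shows "integrable \<rho> (\<lambda>x. x)" "integrable \<rho> (\<lambda>x. (norm x)\<^sup>2)"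
proof -
  interpret plane_prob \<rho> by (rule finite_energy_plane_prob[OF assms])
  obtain R where R: "R \<ge> 0" "AE x in \<rho>. norm x \<le> R" using finite_energy_bounded[OF assms] by blast
  show "integrable \<rho> (\<lambda>x. x)" by (rule integrable_boundI[of \<rho> "\<lambda>x. R"]) (use R in auto)
  show "integrable \<rho> (\<lambda>x. (norm x)\<^sup>2)"
  proof (rule integrable_boundI[of \<rho> "\<lambda>x. R\<^sup>2"])
    show "AE x in \<rho>. norm ((norm x)\<^sup>2) \<le> R\<^sup>2" using R(2) by eventually_elim (simp add: power_mono)
  qed auto
qed

text \<open>Expanding the square shows that the mixed second-order combination of these integrals is
  \<open>-2\<close> times the squared distance of the centers of mass.\<close>
lemma quadratic_energy:
  assumes fe: "finite_energy \<mu>" "finite_energy \<nu>"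
  shows "integrable (\<mu> \<Otimes>\<^sub>M \<nu>) (\<lambda>z. (norm (fst z - snd z))\<^sup>2)"
    and "(\<integral>z. (norm (fst z - snd z))\<^sup>2 \<partial>(\<mu> \<Otimes>\<^sub>M \<nu>)) = (\<integral>x. (norm x)\<^sup>2 \<partial>\<mu>) + (\<integral>x. (norm x)\<^sup>2 \<partial>\<nu>) - 2 * (center_of_mass \<mu> \<bullet> center_of_mass \<nu>)"
proof -
  interpret two_probs \<mu> \<nu> by (rule finite_energy_two_probs[OF fe])
  obtain R where R: "R \<ge> 0" "AE x in \<mu>. norm x \<le> R" using finite_energy_bounded[OF fe(1)] by blast
  obtain R' where R': "R' \<ge> 0" "AE x in \<nu>. norm x \<le> R'" using finite_energy_bounded[OF fe(2)] by blast
  note mm = finite_energy_moments[OF fe(1)] and mn = finite_energy_moments[OF fe(2)]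
  show i: "integrable (\<mu> \<Otimes>\<^sub>M \<nu>) (\<lambda>z. (norm (fst z - snd z))\<^sup>2)"
  proof (rule integrableI_bounded)
    have "(\<integral>\<^sup>+z. ennreal (norm ((norm (fst z - snd z))\<^sup>2)) \<partial>(\<mu> \<Otimes>\<^sub>M \<nu>)) = mutual (\<lambda>z. ennreal ((norm z)\<^sup>2)) \<mu> \<nu>"
      by (subst nn_integral_pair[symmetric]) auto
    also have "\<dots> \<le> (\<integral>\<^sup>+x. \<integral>\<^sup>+y. ennreal ((R + R')\<^sup>2) \<partial>\<nu> \<partial>\<mu>)"
      unfolding mutual_def
    proof (intro nn_integral_mono_AE, use R(2) in eventually_elim, intro nn_integral_mono_AE, use R'(2) in eventually_elim)
      fix x y :: plane assume "norm x \<le> R" "norm y \<le> R'"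
      then have "norm (x - y) \<le> R + R'" using norm_triangle_ineq4[of x y] by linarith
      then show "ennreal ((norm (x - y))\<^sup>2) \<le> ennreal ((R + R')\<^sup>2)" by (intro ennreal_leI power_mono) auto
    qed
    also have "\<dots> < \<infinity>" by (simp add: M.emeasure_space_1 N.emeasure_space_1)
    finally show "(\<integral>\<^sup>+z. ennreal (norm ((norm (fst z - snd z))\<^sup>2)) \<partial>(\<mu> \<Otimes>\<^sub>M \<nu>)) < \<infinity>" .
  qed measurable
  have ex: "(norm (x - y))\<^sup>2 = (norm x)\<^sup>2 - 2 * (x \<bullet> y) + (norm y)\<^sup>2" for x y :: plane
    by (simp add: power2_norm_eq_inner inner_diff_left inner_diff_right inner_commute)
  have lin: "integrable \<rho> (\<lambda>x. c \<bullet> x)" "(\<integral>x. c \<bullet> x \<partial>\<rho>) = c \<bullet> center_of_mass \<rho>" if "finite_energy \<rho>" for c \<rho>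
    using finite_energy_moments(1)[OF that]
      integrable_bounded_linear[OF bounded_linear_inner_right, of \<rho> "\<lambda>x. x" c]
      integral_bounded_linear[OF bounded_linear_inner_right, of \<rho> "\<lambda>x. x" c] by (auto simp: center_of_mass_def)
  have "(\<integral>z. (norm (fst z - snd z))\<^sup>2 \<partial>(\<mu> \<Otimes>\<^sub>M \<nu>)) = (\<integral>x. \<integral>y. (norm (x - y))\<^sup>2 \<partial>\<nu> \<partial>\<mu>)"
    using P.integral_fst'[OF i] by simp
  also have "\<dots> = (\<integral>x. (norm x)\<^sup>2 - 2 * (center_of_mass \<nu> \<bullet> x) + (\<integral>x. (norm x)\<^sup>2 \<partial>\<nu>) \<partial>\<mu>)"
    unfolding ex using mn lin[OF fe(2)] by (simp add: N.prob_space inner_commute)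
  also have "\<dots> = (\<integral>x. (norm x)\<^sup>2 \<partial>\<mu>) - 2 * (center_of_mass \<nu> \<bullet> center_of_mass \<mu>) + (\<integral>x. (norm x)\<^sup>2 \<partial>\<nu>)"
    using mm lin[OF fe(1)] by (simp add: M.prob_space)
  finally show "(\<integral>z. (norm (fst z - snd z))\<^sup>2 \<partial>(\<mu> \<Otimes>\<^sub>M \<nu>)) = (\<integral>x. (norm x)\<^sup>2 \<partial>\<mu>) + (\<integral>x. (norm x)\<^sup>2 \<partial>\<nu>) - 2 * (center_of_mass \<mu> \<bullet> center_of_mass \<nu>)"
    by (simp add: inner_commute)
qed

definition pair_energy :: "plane measure \<Rightarrow> plane measure \<Rightarrow> real" where
  "pair_energy \<mu> \<nu> = (\<integral>z. U (fst z - snd z) \<partial>(\<mu> \<Otimes>\<^sub>M \<nu>)) + (\<integral>z. (norm (fst z - snd z))\<^sup>2 \<partial>(\<mu> \<Otimes>\<^sub>M \<nu>))"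

lemma mutual_potential:
  assumes fe: "finite_energy \<mu>" "finite_energy \<nu>"
  shows "mutual W \<mu> \<nu> = ennreal (pair_energy \<mu> \<nu>)" and "0 \<le> pair_energy \<mu> \<nu>"
proof -
  note tp = finite_energy_two_probs[OF fe]
  interpret two_probs \<mu> \<nu> by (rule tp)
  have fin: "mutual (riesz_kernel s) \<mu> \<nu> < \<infinity>"
    using mutual_riesz_le[of s] finite_energy_riesz[OF fe(1)] finite_energy_riesz[OF fe(2)] by (simp add: order_le_less_trans)
  note i1 = finite_mutual(3)[OF tp fin] and i2 = quadratic_energy(1)[OF fe]
  have "mutual W \<mu> \<nu> = (\<integral>\<^sup>+z. ennreal (U (fst z - snd z) + (norm (fst z - snd z))\<^sup>2) \<partial>(\<mu> \<Otimes>\<^sub>M \<nu>))"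
    unfolding nn_integral_pair[OF potential_measurable, symmetric]
    by (intro nn_integral_cong_AE, use finite_mutual(1)[OF tp fin] in eventually_elim) (simp add: potential_def)
  also have "\<dots> = ennreal (\<integral>z. U (fst z - snd z) + (norm (fst z - snd z))\<^sup>2 \<partial>(\<mu> \<Otimes>\<^sub>M \<nu>))"
    using riesz_nonneg by (intro nn_integral_eq_integral Bochner_Integration.integrable_add i1 i2) (auto simp: add_nonneg_nonneg)
  finally show "mutual W \<mu> \<nu> = ennreal (pair_energy \<mu> \<nu>)"
    unfolding pair_energy_def using i1 i2 by simp
  show "0 \<le> pair_energy \<mu> \<nu>" unfolding pair_energy_def
    using riesz_nonneg by (intro add_nonneg_nonneg integral_nonneg_AE AE_I2) auto
qed

text \<open>The combination \<open>e00 + e11 - e01 - e10\<close> of the mutual energies is computed in Fourier variables, where it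
  is a squared modulus. The quadratic part cancels because the centers of mass agree.\<close>
theorem strictly_convex_energy_iff:
  assumes fe: "finite_energy \<rho>0" "finite_energy \<rho>1" and cm: "center_of_mass \<rho>0 = center_of_mass \<rho>1"
  shows "integrable lborel (\<lambda>\<xi>. H \<xi> * (norm (measure_fourier \<rho>0 \<xi> - measure_fourier \<rho>1 \<xi>))\<^sup>2)"
    and "strictly_convex_01 (\<lambda>t. energy W (interpolation t \<rho>0 \<rho>1)) \<longleftrightarrow>
      0 < (\<integral>\<xi>. H \<xi> * (norm (measure_fourier \<rho>0 \<xi> - measure_fourier \<rho>1 \<xi>))\<^sup>2 \<partial>lborel)"
proof -
  let ?m = "\<lambda>\<mu> \<nu> \<xi>. of_real (H \<xi>) * (cnj (measure_fourier \<mu> \<xi>) * measure_fourier \<nu> \<xi>)"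
  let ?I = "\<lambda>\<mu> \<nu>. (\<integral>z. U (fst z - snd z) \<partial>(\<mu> \<Otimes>\<^sub>M \<nu>))"
  have id: "integrable lborel (?m \<mu> \<nu>)" "of_real (?I \<mu> \<nu>) = (\<integral>\<xi>. ?m \<mu> \<nu> \<xi> \<partial>lborel)" if "finite_energy \<mu>" "finite_energy \<nu>" for \<mu> \<nu>
    using mutual_riesz_identity[OF finite_energy_two_probs[OF that] finite_energy_riesz[OF that(1)] finite_energy_riesz[OF that(2)]] by auto
  have alg: "complex_of_real (H \<xi> * (norm (measure_fourier \<rho>0 \<xi> - measure_fourier \<rho>1 \<xi>))\<^sup>2) = ?m \<rho>0 \<rho>0 \<xi> + ?m \<rho>1 \<rho>1 \<xi> - ?m \<rho>0 \<rho>1 \<xi> - ?m \<rho>1 \<rho>0 \<xi>" for \<xi>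
    unfolding of_real_mult complex_norm_square by (simp add: algebra_simps)
  have "integrable lborel (\<lambda>\<xi>. complex_of_real (H \<xi> * (norm (measure_fourier \<rho>0 \<xi> - measure_fourier \<rho>1 \<xi>))\<^sup>2))"
    unfolding alg by (intro Bochner_Integration.integrable_add Bochner_Integration.integrable_diff id fe)
  then show "integrable lborel (\<lambda>\<xi>. H \<xi> * (norm (measure_fourier \<rho>0 \<xi> - measure_fourier \<rho>1 \<xi>))\<^sup>2)"
    by (simp only: complex_of_real_integrable_eq)
  have "complex_of_real (\<integral>\<xi>. H \<xi> * (norm (measure_fourier \<rho>0 \<xi> - measure_fourier \<rho>1 \<xi>))\<^sup>2 \<partial>lborel) = (\<integral>\<xi>. ?m \<rho>0 \<rho>0 \<xi> + ?m \<rho>1 \<rho>1 \<xi> - ?m \<rho>0 \<rho>1 \<xi> - ?m \<rho>1 \<rho>0 \<xi> \<partial>lborel)"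
    unfolding integral_complex_of_real[symmetric] alg ..
  also have "\<dots> = complex_of_real (?I \<rho>0 \<rho>0 + ?I \<rho>1 \<rho>1 - ?I \<rho>0 \<rho>1 - ?I \<rho>1 \<rho>0)"
    using id[OF fe(1) fe(1)] id[OF fe(2) fe(2)] id[OF fe(1) fe(2)] id[OF fe(2) fe(1)] by simp
  finally have "(\<integral>\<xi>. H \<xi> * (norm (measure_fourier \<rho>0 \<xi> - measure_fourier \<rho>1 \<xi>))\<^sup>2 \<partial>lborel) = ?I \<rho>0 \<rho>0 + ?I \<rho>1 \<rho>1 - ?I \<rho>0 \<rho>1 - ?I \<rho>1 \<rho>0"
    by (simp only: of_real_eq_iff)
  also have "\<dots> = pair_energy \<rho>0 \<rho>0 + pair_energy \<rho>1 \<rho>1 - pair_energy \<rho>0 \<rho>1 - pair_energy \<rho>1 \<rho>0"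
    unfolding pair_energy_def quadratic_energy(2)[OF fe(1) fe(1)] quadratic_energy(2)[OF fe(2) fe(2)]
      quadratic_energy(2)[OF fe(1) fe(2)] quadratic_energy(2)[OF fe(2) fe(1)] cm by simp
  finally have eq: "(\<integral>\<xi>. H \<xi> * (norm (measure_fourier \<rho>0 \<xi> - measure_fourier \<rho>1 \<xi>))\<^sup>2 \<partial>lborel) = pair_energy \<rho>0 \<rho>0 + pair_energy \<rho>1 \<rho>1 - pair_energy \<rho>0 \<rho>1 - pair_energy \<rho>1 \<rho>0" .
  show "strictly_convex_01 (\<lambda>t. energy W (interpolation t \<rho>0 \<rho>1)) \<longleftrightarrow>
      0 < (\<integral>\<xi>. H \<xi> * (norm (measure_fourier \<rho>0 \<xi> - measure_fourier \<rho>1 \<xi>))\<^sup>2 \<partial>lborel)"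
    unfolding eq
    by (rule strictly_convex_quadratic)
       (use mutual_potential fe energy_interpolation[OF _ _ finite_energy_two_probs[OF fe] potential_measurable] in auto)
qed

end

section \<open>Uniqueness of measures and their Fourier transforms\<close>

text \<open>The convolution with a Gaussian at \<open>x\<close> is the mutual Gaussian energy with the point mass at \<open>x\<close>, and
  mutual Gaussian energies are determined by the Fourier transforms.\<close>
lemma gauss_convolution_eq:
  assumes "plane_prob \<rho>0" "plane_prob \<rho>1" and eq: "\<And>\<xi>. measure_fourier \<rho>0 \<xi> = measure_fourier \<rho>1 \<xi>" and t: "t > 0"
  shows "(\<integral>\<^sup>+y. ennreal (exp (- (pi * t\<^sup>2 * (norm (x - y))\<^sup>2))) \<partial>\<rho>0) = (\<integral>\<^sup>+y. ennreal (exp (- (pi * t\<^sup>2 * (norm (x - y))\<^sup>2))) \<partial>\<rho>1)"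
proof -
  have pm: "plane_prob (return borel x)"
    unfolding plane_prob_def plane_prob_axioms_def by (simp add: prob_space_return)
  have 1: "(\<integral>\<^sup>+y. ennreal (exp (- (pi * t\<^sup>2 * (norm (x - y))\<^sup>2))) \<partial>\<rho>)
     = ennreal (\<integral>\<xi>. exp (- (pi * (norm \<xi>)\<^sup>2 / t\<^sup>2)) / t\<^sup>2 * Re (cnj (measure_fourier (return borel x) \<xi>) * measure_fourier \<rho> \<xi>) \<partial>lborel)" if "plane_prob \<rho>" for \<rho>
  proof -
    interpret two_probs "return borel x" \<rho> using that pm by (simp add: two_probs_def)
    have "(\<integral>\<^sup>+x'. \<integral>\<^sup>+y. ennreal (exp (- (pi * t\<^sup>2 * (norm (x' - y))\<^sup>2))) \<partial>\<rho> \<partial>return borel x) = (\<integral>\<^sup>+y. ennreal (exp (- (pi * t\<^sup>2 * (norm (x - y))\<^sup>2))) \<partial>\<rho>)"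
      by (rule nn_integral_return) auto
    then show ?thesis using gauss_energy(2)[OF t] by simp
  qed
  show ?thesis unfolding 1[OF assms(1)] 1[OF assms(2)] eq ..
qed

text \<open>Gaussian averages of \<open>f\<close> have equal integrals by Fubini, and they converge boundedly to \<open>f\<close>.\<close>
lemma integral_eq_of_measure_fourier_eq:
  fixes f :: "plane \<Rightarrow> real"
  assumes pp: "plane_prob \<rho>0" "plane_prob \<rho>1" and eq: "\<And>\<xi>. measure_fourier \<rho>0 \<xi> = measure_fourier \<rho>1 \<xi>"
    and f: "continuous_on UNIV f" "\<And>x. 0 \<le> f x" "\<And>x. f x \<le> 1"
  shows "(\<integral>x. f x \<partial>\<rho>0) = (\<integral>x. f x \<partial>\<rho>1)"
proof -
  have [measurable]: "f \<in> borel_measurable borel" by (rule borel_measurable_continuous_onI[OF f(1)])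
  have gm [measurable]: "gauss_avg f m \<in> borel_measurable borel" for m
    unfolding gauss_avg_def[abs_def] by measurable
  have g0: "0 \<le> gauss_avg f m y" for m y
    unfolding gauss_avg_def using f by (intro mult_nonneg_nonneg integral_nonneg_AE AE_I2) auto
  have fi: "integrable lborel (\<lambda>x. f x * exp (- (pi * m\<^sup>2 * (norm (y - x))\<^sup>2)))" if "m > 0" for m y
    by (rule integrable_boundI[OF shifted_gaussian_integral(1)[OF that, of y]])
       (use f in \<open>auto simp: abs_mult mult_left_le_one_le\<close>)
  have g1: "gauss_avg f m y \<le> 1" if m: "m > 0" for m y
  proof -
    have "gauss_avg f m y \<le> m\<^sup>2 * (\<integral>x. exp (- (pi * m\<^sup>2 * (norm (y - x::plane))\<^sup>2)) \<partial>lborel)"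
      unfolding gauss_avg_def using f
      by (intro mult_left_mono integral_mono fi m shifted_gaussian_integral(1)) (auto simp: mult_left_le_one_le)
    then show ?thesis using shifted_gaussian_integral(2)[OF m] by simp
  qed
  have nn: "(\<integral>\<^sup>+y. ennreal (gauss_avg f m y) \<partial>\<rho>) = (\<integral>\<^sup>+x. ennreal (m\<^sup>2 * f x) * (\<integral>\<^sup>+y. ennreal (exp (- (pi * m\<^sup>2 * (norm (x - y))\<^sup>2))) \<partial>\<rho>) \<partial>lborel)"
    if "plane_prob \<rho>" and m: "m > 0" for \<rho> m
  proof -
    interpret plane_prob \<rho> by fact
    have "(\<integral>\<^sup>+y. ennreal (gauss_avg f m y) \<partial>\<rho>) = (\<integral>\<^sup>+y. \<integral>\<^sup>+x. ennreal (m\<^sup>2 * f x) * ennreal (exp (- (pi * m\<^sup>2 * (norm (x - y))\<^sup>2))) \<partial>lborel \<partial>\<rho>)"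
    proof (intro nn_integral_cong)
      fix y
      have "ennreal (gauss_avg f m y) = ennreal (\<integral>x. m\<^sup>2 * (f x * exp (- (pi * m\<^sup>2 * (norm (y - x))\<^sup>2))) \<partial>lborel)"
        by (simp add: gauss_avg_def)
      also have "\<dots> = (\<integral>\<^sup>+x. ennreal (m\<^sup>2 * (f x * exp (- (pi * m\<^sup>2 * (norm (y - x))\<^sup>2)))) \<partial>lborel)"
        using f by (intro nn_integral_eq_integral[symmetric] integrable_mult_right fi m) auto
      also have "\<dots> = (\<integral>\<^sup>+x. ennreal (m\<^sup>2 * f x) * ennreal (exp (- (pi * m\<^sup>2 * (norm (x - y))\<^sup>2))) \<partial>lborel)"
        using f by (intro nn_integral_cong) (simp add: ennreal_mult norm_minus_commute mult.assoc[symmetric])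
      finally show "ennreal (gauss_avg f m y) = (\<integral>\<^sup>+x. ennreal (m\<^sup>2 * f x) * ennreal (exp (- (pi * m\<^sup>2 * (norm (x - y))\<^sup>2))) \<partial>lborel)" .
    qed
    also have "\<dots> = (\<integral>\<^sup>+x. \<integral>\<^sup>+y. ennreal (m\<^sup>2 * f x) * ennreal (exp (- (pi * m\<^sup>2 * (norm (x - y))\<^sup>2))) \<partial>\<rho> \<partial>lborel)"
      by (rule nn_integral_swap[OF sigma_finite_measure_axioms lborel.sigma_finite_measure_axioms]) measurable
    also have "\<dots> = (\<integral>\<^sup>+x. ennreal (m\<^sup>2 * f x) * (\<integral>\<^sup>+y. ennreal (exp (- (pi * m\<^sup>2 * (norm (x - y))\<^sup>2))) \<partial>\<rho>) \<partial>lborel)"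
      by (intro nn_integral_cong nn_integral_cmult) measurable
    finally show ?thesis .
  qed
  have same: "(\<integral>y. gauss_avg f m y \<partial>\<rho>0) = (\<integral>y. gauss_avg f m y \<partial>\<rho>1)" if m: "m > 0" for m
  proof -
    interpret two_probs \<rho>0 \<rho>1 using pp by (simp add: two_probs_def)
    have e: "(\<integral>y. gauss_avg f m y \<partial>\<rho>) = enn2real (\<integral>\<^sup>+y. ennreal (gauss_avg f m y) \<partial>\<rho>)" if "plane_prob \<rho>" for \<rho>
    proof -
      interpret plane_prob \<rho> by fact
      show ?thesis by (rule integral_eq_nn_integral) (use g0 in auto)
    qed
    show ?thesis unfolding e[OF pp(1)] e[OF pp(2)] nn[OF pp(1) m] nn[OF pp(2) m] gauss_convolution_eq[OF pp eq m] ..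
  qed
  have lim: "(\<lambda>n. \<integral>y. gauss_avg f (real (Suc n)) y \<partial>\<rho>) \<longlonglongrightarrow> (\<integral>y. f y \<partial>\<rho>)" if "plane_prob \<rho>" for \<rho>
  proof -
    interpret plane_prob \<rho> by fact
    show ?thesis
    proof (rule integral_dominated_convergence[where w="\<lambda>x. 1"])
      show "AE y in \<rho>. (\<lambda>n. gauss_avg f (real (Suc n)) y) \<longlonglongrightarrow> f y"
        using f by (intro AE_I2 gauss_avg_tendsto_bounded[where B=1]) (auto simp: continuous_on_eq_continuous_at)
      show "AE y in \<rho>. norm (gauss_avg f (real (Suc n)) y) \<le> 1" for n
        using g0 g1[of "real (Suc n)"] by (intro AE_I2) simp
    qed auto
  qed
  show ?thesis by (rule LIMSEQ_unique[OF lim[OF pp(1)]]) (use lim[OF pp(2)] same in simp)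
qed

text \<open>Continuous functions with values between zero and one decrease to the indicator of a closed set, and closed
  sets generate the Borel sets.\<close>
lemma measure_fourier_inject:
  assumes pp: "plane_prob \<rho>0" "plane_prob \<rho>1" and eq: "\<And>\<xi>. measure_fourier \<rho>0 \<xi> = measure_fourier \<rho>1 \<xi>"
  shows "\<rho>0 = \<rho>1"
proof -
  interpret two_probs \<rho>0 \<rho>1 using pp by (simp add: two_probs_def)
  have closed: "emeasure \<rho>0 F = emeasure \<rho>1 F" if F: "closed F" for F
  proof (cases "F = {}")
    case False
    define f where "f n x = max 0 (1 - real n * infdist x F)" for n :: nat and x :: plane
    have fc: "continuous_on UNIV (f n)" for n unfolding f_def[abs_def] by (intro continuous_intros)
    have fb: "0 \<le> f n x" "f n x \<le> 1" for n x using infdist_nonneg[of x F] by (auto simp: f_def)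
    have [measurable]: "f n \<in> borel_measurable borel" for n by (rule borel_measurable_continuous_onI[OF fc])
    have fl: "(\<lambda>n. f n x) \<longlonglongrightarrow> indicator F x" for x
    proof (cases "x \<in> F")
      case True then show ?thesis by (simp add: f_def)
    next
      case x: False
      then have d: "infdist x F > 0" using in_closed_iff_infdist_zero[OF F False, of x] infdist_nonneg[of x F] by linarith
      obtain N where N: "1 / infdist x F < real N" using reals_Archimedean2 by blast
      have "\<forall>\<^sub>F n in sequentially. f n x = 0"
        using eventually_ge_at_top[of N]
      proof eventually_elim
        fix n assume "N \<le> n"
        then have "1 / infdist x F \<le> real n" using N by linarith
        then have "1 \<le> real n * infdist x F" using d by (simp add: pos_divide_le_eq)
        then show "f n x = 0" by (simp add: f_def)
      qed
      then show ?thesis using x by (simp add: tendsto_eventually)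
    qed
    have lim: "(\<lambda>n. \<integral>x. f n x \<partial>\<rho>) \<longlonglongrightarrow> measure \<rho> F" if "plane_prob \<rho>" for \<rho>
    proof -
      interpret plane_prob \<rho> by fact
      have Fm: "F \<in> sets \<rho>" using F sets_plane by simp
      have "(\<lambda>n. \<integral>x. f n x \<partial>\<rho>) \<longlonglongrightarrow> (\<integral>x. indicator F x \<partial>\<rho>)"
        by (rule integral_dominated_convergence[where w="\<lambda>x. 1"]) (use fl fb Fm in auto)
      then show ?thesis using Fm by (simp add: sets.sets_into_space[OF Fm] Int_absorb2)
    qed
    have "measure \<rho>0 F = measure \<rho>1 F"
      using LIMSEQ_unique[OF lim[OF pp(1)]] lim[OF pp(2)] integral_eq_of_measure_fourier_eq[OF pp eq fc fb] by simp
    then show ?thesis by (simp add: M.emeasure_eq_measure N.emeasure_eq_measure)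
  qed simp
  show ?thesis
  proof (rule measure_eqI_generator_eq[where \<Omega>=UNIV and E="{F. closed F}" and A="\<lambda>_. UNIV"])
    show "Int_stable {F::plane set. closed F}" by (auto simp: Int_stable_def)
    show "sets \<rho>0 = sigma_sets UNIV {F. closed F}" "sets \<rho>1 = sigma_sets UNIV {F. closed F}"
      unfolding M.sets_plane N.sets_plane by (simp_all add: borel_eq_closed)
  qed (use closed M.emeasure_space_1 in \<open>auto simp: M.space_plane\<close>)
qed

section \<open>Fourier transforms of compactly supported measures are entire along lines\<close>

text \<open>Expand the exponential and integrate term by term; boundedness of the support makes the terms
  summable.\<close>
lemma (in plane_prob) measure_fourier_line_series:
  fixes \<xi> \<eta> :: plane
  assumes R: "AE x in \<mu>. norm x \<le> R" "R \<ge> 0"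
  defines "c \<equiv> \<lambda>n. \<integral>x. cis (- (2 * pi * (x \<bullet> \<xi>))) * ((- (2 * pi * \<i> * of_real (x \<bullet> \<eta>))) ^ n / fact n) \<partial>\<mu>"
  shows "norm (c n) \<le> (2 * pi * (R * norm \<eta>)) ^ n / fact n"
    and "(\<lambda>n. c n * of_real t ^ n) sums measure_fourier \<mu> (\<xi> + t *\<^sub>R \<eta>)"
proof -
  let ?f = "\<lambda>n x. cis (- (2 * pi * (x \<bullet> \<xi>))) * ((- (2 * pi * \<i> * of_real (x \<bullet> \<eta>))) ^ n / fact n)"
  have b: "AE x in \<mu>. norm (?f n x) \<le> (2 * pi * (R * norm \<eta>)) ^ n / fact n" for n
    using R(1)
  proof eventually_elim
    fix x :: plane assume x: "norm x \<le> R"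
    have "\<bar>x \<bullet> \<eta>\<bar> \<le> R * norm \<eta>" using Cauchy_Schwarz_ineq2[of x \<eta>] mult_right_mono[OF x, of "norm \<eta>"] by simp
    then have "(2 * pi * \<bar>x \<bullet> \<eta>\<bar>) ^ n \<le> (2 * pi * (R * norm \<eta>)) ^ n" by (intro power_mono mult_left_mono) auto
    then show "norm (?f n x) \<le> (2 * pi * (R * norm \<eta>)) ^ n / fact n"
      by (simp add: norm_mult norm_divide norm_power divide_right_mono)
  qed
  have int1: "integrable \<mu> (\<lambda>x. K)" for K :: real by simp
  have i: "integrable \<mu> (?f n)" for n
    by (rule integrable_boundI[OF int1 _ b]) measurable
  show "norm (c n) \<le> (2 * pi * (R * norm \<eta>)) ^ n / fact n"
    unfolding c_def using norm_integral_le[OF int1 b[of n]] by (simp add: prob_space)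
  have it: "integrable \<mu> (\<lambda>x. ?f n x * of_real t ^ n)" for n by (intro integrable_mult_left i)
  have bt: "AE x in \<mu>. norm (?f n x * of_real t ^ n) \<le> (2 * pi * (R * norm \<eta>) * \<bar>t\<bar>) ^ n / fact n" for n
    using b[of n]
  proof eventually_elim
    fix x assume "norm (?f n x) \<le> (2 * pi * (R * norm \<eta>)) ^ n / fact n"
    then have "norm (?f n x) * \<bar>t\<bar> ^ n \<le> (2 * pi * (R * norm \<eta>)) ^ n / fact n * \<bar>t\<bar> ^ n" by (intro mult_right_mono) auto
    then show "norm (?f n x * of_real t ^ n) \<le> (2 * pi * (R * norm \<eta>) * \<bar>t\<bar>) ^ n / fact n"
      unfolding norm_mult[of _ "of_real t ^ n"] norm_power norm_of_real power_mult_distrib[of _ "\<bar>t\<bar>"] by simp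
  qed
  have se: "summable (\<lambda>n. K ^ n / fact n)" for K :: real
    using summable_exp[of K] by (simp add: divide_inverse mult.commute)
  have ser: "(\<lambda>n. ?f n x * of_real t ^ n) sums cis (- (2 * pi * (x \<bullet> (\<xi> + t *\<^sub>R \<eta>))))" for x
  proof -
    have "(\<lambda>n. (- (2 * pi * \<i> * of_real (x \<bullet> \<eta>)) * of_real t) ^ n /\<^sub>R fact n) sums exp (- (2 * pi * \<i> * of_real (x \<bullet> \<eta>)) * of_real t)"
      by (rule exp_converges)
    then have "(\<lambda>n. cis (- (2 * pi * (x \<bullet> \<xi>))) * ((- (2 * pi * \<i> * of_real (x \<bullet> \<eta>)) * of_real t) ^ n /\<^sub>R fact n)) sums (cis (- (2 * pi * (x \<bullet> \<xi>))) * exp (- (2 * pi * \<i> * of_real (x \<bullet> \<eta>)) * of_real t))"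
      by (rule sums_mult)
    moreover have "exp (- (2 * pi * \<i> * of_real (x \<bullet> \<eta>)) * of_real t) = cis (- (2 * pi * (t * (x \<bullet> \<eta>))))"
      by (simp add: cis_conv_exp mult_ac)
    moreover have "cis (- (2 * pi * (x \<bullet> \<xi>))) * cis (- (2 * pi * (t * (x \<bullet> \<eta>)))) = cis (- (2 * pi * (x \<bullet> (\<xi> + t *\<^sub>R \<eta>))))"
      by (simp add: cis_mult inner_add_right algebra_simps)
    moreover have "cis (- (2 * pi * (x \<bullet> \<xi>))) * ((- (2 * pi * \<i> * of_real (x \<bullet> \<eta>)) * of_real t) ^ n /\<^sub>R fact n) = ?f n x * of_real t ^ n" for n
      unfolding power_mult_distrib[of _ "of_real t"] by (simp add: scaleR_conv_of_real divide_inverse mult_ac)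
    ultimately show ?thesis by simp
  qed
  have sn: "AE x in \<mu>. summable (\<lambda>n. norm (?f n x * of_real t ^ n))"
  proof -
    have "AE x in \<mu>. \<forall>n. norm (?f n x * of_real t ^ n) \<le> (2 * pi * (R * norm \<eta>) * \<bar>t\<bar>) ^ n / fact n"
      using bt by (simp only: AE_all_countable) simp
    then show ?thesis
    proof eventually_elim
      fix x assume h: "\<forall>n. norm (?f n x * of_real t ^ n) \<le> (2 * pi * (R * norm \<eta>) * \<bar>t\<bar>) ^ n / fact n"
      show "summable (\<lambda>n. norm (?f n x * of_real t ^ n))"
        by (rule summable_comparison_test'[OF se[of "2 * pi * (R * norm \<eta>) * \<bar>t\<bar>"], of 0]) (use h in simp)
    qed
  qed
  have ss: "summable (\<lambda>n. \<integral>x. norm (?f n x * of_real t ^ n) \<partial>\<mu>)"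
  proof (rule summable_comparison_test'[OF se[of "2 * pi * (R * norm \<eta>) * \<bar>t\<bar>"], of 0])
    fix n
    have "norm (\<integral>x. norm (?f n x * of_real t ^ n) \<partial>\<mu>) \<le> (\<integral>x. (2 * pi * (R * norm \<eta>) * \<bar>t\<bar>) ^ n / fact n \<partial>\<mu>)"
      by (rule norm_integral_le[OF int1]) (use bt[of n] in simp)
    then show "norm (\<integral>x. norm (?f n x * of_real t ^ n) \<partial>\<mu>) \<le> (2 * pi * (R * norm \<eta>) * \<bar>t\<bar>) ^ n / fact n"
      by (simp add: prob_space)
  qed
  have "(\<lambda>n. \<integral>x. ?f n x * of_real t ^ n \<partial>\<mu>) sums (\<integral>x. (\<Sum>n. ?f n x * of_real t ^ n) \<partial>\<mu>)"
    by (rule sums_integral[OF it sn ss])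
  also have "(\<integral>x. (\<Sum>n. ?f n x * of_real t ^ n) \<partial>\<mu>) = measure_fourier \<mu> (\<xi> + t *\<^sub>R \<eta>)"
    unfolding measure_fourier_def using ser by (simp add: sums_iff)
  finally show "(\<lambda>n. c n * of_real t ^ n) sums measure_fourier \<mu> (\<xi> + t *\<^sub>R \<eta>)"
    unfolding c_def by (simp only: integral_mult_left_zero)
qed

lemma (in plane_prob) measure_fourier_continuous: "continuous_on UNIV (measure_fourier \<mu>)"
proof (rule continuous_on_sequentiallyI)
  fix u :: "nat \<Rightarrow> plane" and a assume u: "u \<longlonglongrightarrow> a"
  show "(\<lambda>n. measure_fourier \<mu> (u n)) \<longlonglongrightarrow> measure_fourier \<mu> a"
    unfolding measure_fourier_def
  proof (rule integral_dominated_convergence[where w="\<lambda>x. 1"])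
    show "AE x in \<mu>. (\<lambda>n. cis (- (2 * pi * (x \<bullet> u n)))) \<longlonglongrightarrow> cis (- (2 * pi * (x \<bullet> a)))"
    proof (rule AE_I2)
      fix x
      have "isCont cis z" for z using continuous_on_cis[of UNIV "\<lambda>x. x"] by (simp add: continuous_on_eq_continuous_at)
      then show "(\<lambda>n. cis (- (2 * pi * (x \<bullet> u n)))) \<longlonglongrightarrow> cis (- (2 * pi * (x \<bullet> a)))"
        by (intro tendsto_intros isCont_tendsto_compose[of _ cis] u)
    qed
  qed auto
qed

text \<open>On the line from the center of the ball to \<open>\<xi>\<close> the difference of the two transforms is a power series with
  infinite radius of convergence that vanishes near zero, hence all its coefficients are zero.\<close>
lemma measure_fourier_eq_of_eq_on_ball:
  assumes pp: "plane_prob \<rho>0" "plane_prob \<rho>1"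
    and R: "R \<ge> 0" "AE x in \<rho>0. norm x \<le> R" "AE x in \<rho>1. norm x \<le> R"
    and e: "e > 0" and eq: "\<And>\<xi>. \<xi> \<in> ball \<xi>0 e \<Longrightarrow> measure_fourier \<rho>0 \<xi> = measure_fourier \<rho>1 \<xi>"
  shows "measure_fourier \<rho>0 \<xi> = measure_fourier \<rho>1 \<xi>"
proof -
  define \<eta> where "\<eta> = \<xi> - \<xi>0"
  define c where "c \<rho> n = (\<integral>x. cis (- (2 * pi * (x \<bullet> \<xi>0))) * ((- (2 * pi * \<i> * of_real (x \<bullet> \<eta>))) ^ n / fact n) \<partial>\<rho>)" for \<rho> n
  let ?K = "2 * pi * (R * norm \<eta>)"
  have s0: "norm (c \<rho>0 n) \<le> ?K ^ n / fact n" "(\<lambda>n. c \<rho>0 n * of_real t ^ n) sums measure_fourier \<rho>0 (\<xi>0 + t *\<^sub>R \<eta>)" for n t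
    using plane_prob.measure_fourier_line_series[OF pp(1) R(2,1), of \<xi>0 \<eta>] unfolding c_def by auto
  have s1: "norm (c \<rho>1 n) \<le> ?K ^ n / fact n" "(\<lambda>n. c \<rho>1 n * of_real t ^ n) sums measure_fourier \<rho>1 (\<xi>0 + t *\<^sub>R \<eta>)" for n t
    using plane_prob.measure_fourier_line_series[OF pp(2) R(3,1), of \<xi>0 \<eta>] unfolding c_def by auto
  define a where "a n = c \<rho>0 n - c \<rho>1 n" for n
  have sa: "(\<lambda>n. a n * of_real t ^ n) sums (measure_fourier \<rho>0 (\<xi>0 + t *\<^sub>R \<eta>) - measure_fourier \<rho>1 (\<xi>0 + t *\<^sub>R \<eta>))" for t
    using sums_diff[OF s0(2) s1(2), of t t] by (simp add: a_def left_diff_distrib)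
  have an: "norm (a n) \<le> 2 * (?K ^ n / fact n)" for n
    using norm_triangle_ineq4[of "c \<rho>0 n" "c \<rho>1 n"] s0(1)[of n] s1(1)[of n] unfolding a_def by linarith
  have summ: "summable (\<lambda>n. a n * z ^ n)" for z
  proof (rule summable_comparison_test'[of "\<lambda>n. 2 * ((?K * norm z) ^ n / fact n)" 0])
    show "summable (\<lambda>n. 2 * ((?K * norm z) ^ n / fact n))"
      using summable_exp[of "?K * norm z"] by (intro summable_mult) (simp add: divide_inverse mult.commute)
    fix n
    show "norm (a n * z ^ n) \<le> 2 * ((?K * norm z) ^ n / fact n)"
      using mult_right_mono[OF an[of n], of "norm z ^ n"] unfolding power_mult_distrib[of ?K] by (simp add: norm_mult norm_power)
  qed
  define f where "f z = (\<Sum>n. a n * z ^ n)" for z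
  have fs: "(\<lambda>n. a n * z ^ n) sums f z" for z using summ[of z] by (simp add: f_def summable_sums)
  have fr: "f (of_real t) = measure_fourier \<rho>0 (\<xi>0 + t *\<^sub>R \<eta>) - measure_fourier \<rho>1 (\<xi>0 + t *\<^sub>R \<eta>)" for t
    using sums_unique2[OF fs sa] .
  \<comment> \<open>the summand \<open>1\<close> keeps the denominator positive when \<open>\<xi> = \<xi>0\<close>\<close>
  define d where "d = e / (norm \<eta> + 1)"
  have d: "d > 0" using e by (simp add: d_def add_nonneg_pos)
  have small: "f (of_real t) = 0" if "\<bar>t\<bar> < d" for t
  proof -
    have "\<bar>t\<bar> * norm \<eta> \<le> \<bar>t\<bar> * (norm \<eta> + 1)" by (intro mult_left_mono) auto
    also have "\<dots> < d * (norm \<eta> + 1)" using that by (intro mult_strict_right_mono) (auto simp: add_nonneg_pos)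
    also have "\<dots> = e" using add_nonneg_pos[OF norm_ge_zero[of \<eta>] zero_less_one] by (simp add: d_def)
    finally have "\<xi>0 + t *\<^sub>R \<eta> \<in> ball \<xi>0 e" by (simp add: dist_norm)
    from eq[OF this] show ?thesis unfolding fr by simp
  qed
  have a0: "a n = 0" for n
  proof (rule ccontr)
    assume n: "a n \<noteq> 0"
    have f0: "f 0 = 0" using small[of 0] d by simp
    have "a 0 = 0" using f0 fs[of 0] by (simp add: sums_iff powser_sums_zero_iff)
    then have "n > 0" using n by (cases n) auto
    obtain r where r: "r > 0" "\<And>z. z \<in> cball 0 r - {0} \<Longrightarrow> f z \<noteq> 0"
      by (rule powser_0_nonzero[of 1 0 a f n]) (use fs f0 n \<open>n > 0\<close> in auto)
    \<comment> \<open>a real point inside both discs: the power series is nonzero there, yet the transforms agree\<close>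
    define t where "t = min (r / 2) (d / 2)"
    have t: "t > 0" "t \<le> r" "t < d" using r d by (auto simp: t_def)
    then have "of_real t \<in> cball 0 r - {0::complex}" by auto
    then show False using r(2) small[of t] t by auto
  qed
  have "f (of_real 1) = 0" by (simp add: f_def a0)
  then show ?thesis unfolding fr by (simp add: \<eta>_def)
qed

section \<open>Positivity of the energy\<close>

lemma open_null_empty:
  assumes "open (S :: plane set)" "AE x in lborel. x \<notin> S" shows "S = {}"
proof -
  have "S \<in> null_sets lborel" using assms by (subst AE_iff_null_sets) auto
  then have "negligible S" by (simp add: negligible_iff_null_sets null_sets_completionI)
  then show ?thesis using open_not_negligible[OF assms(1)] by blast
qed

context riesz_profile begin

text \<open>Otherwise all Gaussian averages of the positive kernel would vanish.\<close>
lemma angular_part_nonzero: "\<exists>\<phi>. angular_part s \<phi> \<noteq> 0"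
proof (rule ccontr)
  assume "\<nexists>\<phi>. angular_part s \<phi> \<noteq> 0"
  then have H0: "H \<xi> = 0" for \<xi> by (simp add: riesz_hat_def)
  obtain M where M: "M > 0" "\<And>x. U x \<le> M * norm x powr (- s)" using riesz_bound by blast
  interpret sing: singular_function U s M
    by unfold_locales (use s M riesz_nonneg in auto)
  let ?z = "(1, 0) :: plane"
  have z: "?z \<noteq> 0" by (simp add: prod_eq_iff)
  have "gauss_avg U (real (Suc n)) ?z = 0" for n
    using gauss_avg_fourier(2)[of "real (Suc n)" ?z] unfolding H0 by simp
  then have "(\<lambda>n. 0) \<longlonglongrightarrow> U ?z" using sing.gauss_avg_tendsto[OF z U_isCont[OF z]] by simp
  then have "U ?z = 0" by (simp add: LIMSEQ_const_iff)
  then show False using pos[of "angle ?z"] by (simp add: anisotropic_riesz_def norm_prod_def)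
qed

text \<open>A nonnegative angular part is positive on an open cone; if the energy of a difference of two
  measures vanishes, so does its Fourier transform on that cone, and by analyticity everywhere.\<close>
theorem energy_positive:
  assumes ge: "\<And>\<phi>. 0 \<le> angular_part s \<phi>" and fe: "finite_energy \<rho>0" "finite_energy \<rho>1" and ne: "\<rho>0 \<noteq> \<rho>1"
    and i: "integrable lborel (\<lambda>\<xi>. H \<xi> * (norm (measure_fourier \<rho>0 \<xi> - measure_fourier \<rho>1 \<xi>))\<^sup>2)"
  shows "0 < (\<integral>\<xi>. H \<xi> * (norm (measure_fourier \<rho>0 \<xi> - measure_fourier \<rho>1 \<xi>))\<^sup>2 \<partial>lborel)"
proof -
  note pp = finite_energy_plane_prob[OF fe(1)] finite_energy_plane_prob[OF fe(2)]
  interpret two_probs \<rho>0 \<rho>1 by (rule finite_energy_two_probs[OF fe])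
  have H: "0 \<le> H \<xi>" for \<xi> using ge by (simp add: riesz_hat_def)
  have nn: "0 \<le> (\<integral>\<xi>. H \<xi> * (norm (measure_fourier \<rho>0 \<xi> - measure_fourier \<rho>1 \<xi>))\<^sup>2 \<partial>lborel)"
    using H by (intro integral_nonneg_AE AE_I2) auto
  show ?thesis
  proof (rule ccontr)
    assume "\<not> ?thesis"
    then have "(\<integral>\<xi>. H \<xi> * (norm (measure_fourier \<rho>0 \<xi> - measure_fourier \<rho>1 \<xi>))\<^sup>2 \<partial>lborel) = 0" using nn by linarith
    then have ae: "AE \<xi> in lborel. H \<xi> * (norm (measure_fourier \<rho>0 \<xi> - measure_fourier \<rho>1 \<xi>))\<^sup>2 = 0"
      using H by (subst (asm) integral_nonneg_eq_0_iff_AE[OF i]) auto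
    obtain \<phi> where \<phi>: "-pi < \<phi>" "\<phi> < pi" "angular_part s \<phi> > 0"
    proof -
      obtain \<phi>' where "angular_part s \<phi>' \<noteq> 0" using angular_part_nonzero by blast
      moreover obtain y where y: "y \<in> {0..pi}" "angular_part s \<phi>' = angular_part s y"
        using pi_periodic_reduce[of "angular_part s" \<phi>', OF angular_part_per_pi[OF s]] by blast
      ultimately have y': "angular_part s y > 0" using ge[of y] by linarith
      show ?thesis
      proof (cases "y = pi")
        case True
        then show ?thesis using that[of 0] y' angular_part_per_pi[OF s, of 0] by simp
      next
        case False
        then show ?thesis using that[of y] y y' by auto
      qed
    qed
    let ?z = "(cos \<phi>, sin \<phi>)"
    have "isCont H ?z" using isCont_angular[OF angular_part_cont[OF s] \<phi>(1,2), of s] by (simp add: riesz_hat_def[abs_def])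
    moreover have "H ?z > 0" using \<phi> norm_polar[of \<phi>] by (simp add: riesz_hat_def angle_polar)
    ultimately have "\<forall>\<^sub>F \<xi> in nhds ?z. H \<xi> > 0"
      by (metis isCont_def tendsto_at_iff_tendsto_nhds order_tendstoD(1))
    then obtain e where e: "e > 0" "\<And>\<xi>. dist \<xi> ?z < e \<Longrightarrow> H \<xi> > 0" by (auto simp: eventually_nhds_metric)
    let ?S = "{\<xi>. measure_fourier \<rho>0 \<xi> \<noteq> measure_fourier \<rho>1 \<xi>} \<inter> ball ?z e"
    have "open ?S" by (intro open_Int open_Collect_neq M.measure_fourier_continuous N.measure_fourier_continuous open_ball)
    moreover have "AE \<xi> in lborel. \<xi> \<notin> ?S"
      using ae
    proof eventually_elim
      fix \<xi> assume h: "H \<xi> * (norm (measure_fourier \<rho>0 \<xi> - measure_fourier \<rho>1 \<xi>))\<^sup>2 = 0"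
      show "\<xi> \<notin> ?S" using h e(2)[of \<xi>] by (auto simp: dist_commute)
    qed
    ultimately have "?S = {}" by (rule open_null_empty)
    then have eq: "measure_fourier \<rho>0 \<xi> = measure_fourier \<rho>1 \<xi>" if "\<xi> \<in> ball ?z e" for \<xi> using that by blast
    obtain R where R: "R \<ge> 0" "AE x in \<rho>0. norm x \<le> R" using finite_energy_bounded[OF fe(1)] by blast
    obtain R' where R': "R' \<ge> 0" "AE x in \<rho>1. norm x \<le> R'" using finite_energy_bounded[OF fe(2)] by blast
    have "measure_fourier \<rho>0 \<xi> = measure_fourier \<rho>1 \<xi>" for \<xi>
      by (rule measure_fourier_eq_of_eq_on_ball[OF pp, of "R + R'" e ?z])
         (use R R' e eq in \<open>auto elim!: eventually_mono\<close>)
    then have "\<rho>0 = \<rho>1" by (rule measure_fourier_inject[OF pp])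
    then show False using ne by simp
  qed
qed

end

section \<open>Perturbations of a uniform density\<close>

lemma cball_plane_borel [measurable]: "cball (z::plane) r \<in> sets borel"
  by auto

lemma integrable_indicator_cball: "integrable lborel (indicator (cball (z::plane) r) :: plane \<Rightarrow> real)"
  by (rule integrable_real_indicator) (use emeasure_bounded_finite[OF bounded_cball, of z r] in auto)

lemma integrable_indicator_ball: "integrable lborel (indicator (ball (z::plane) r) :: plane \<Rightarrow> real)"
  by (rule integrable_real_indicator) (use emeasure_bounded_finite[OF bounded_ball, of z r] in auto)

lemma measure_fourier_density:
  assumes [measurable]: "g \<in> borel_measurable borel" and g: "\<And>x. 0 \<le> g x"
  shows "measure_fourier (density lborel (\<lambda>x. ennreal (g x))) \<xi> = fourier (\<lambda>x. of_real (g x)) \<xi>"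
  unfolding measure_fourier_def fourier_cis using g by (subst integral_density) (auto simp: scaleR_conv_of_real)

context riesz_profile begin

text \<open>The singularity of the kernel is locally integrable.\<close>
lemma finite_energy_density:
  assumes [measurable]: "g \<in> borel_measurable borel" and g: "\<And>x. 0 \<le> g x" "\<And>x. g x \<le> c" "\<And>x. norm x > R \<Longrightarrow> g x = 0"
    and R: "R > 0" and one: "(\<integral>\<^sup>+x. ennreal (g x) \<partial>lborel) = 1"
  shows "finite_energy (density lborel (\<lambda>x. ennreal (g x)))" (is "finite_energy ?\<rho>")
proof -
  have c: "c \<ge> 0" using g(1,2) order_trans by blast
  have prob: "prob_space ?\<rho>" by (rule prob_spaceI) (use one in \<open>simp add: emeasure_density\<close>)
  have "emeasure ?\<rho> (- cball 0 R) = (\<integral>\<^sup>+x. 0 \<partial>(lborel::plane measure))"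
  proof (subst emeasure_density)
    show "(\<integral>\<^sup>+x. ennreal (g x) * indicator (- cball 0 R) x \<partial>lborel) = (\<integral>\<^sup>+x. 0 \<partial>(lborel::plane measure))"
      by (intro nn_integral_cong) (auto simp: g(3) split: split_indicator)
  qed auto
  then have comp: "compactly_supported_prob ?\<rho>"
    unfolding compactly_supported_prob_def using prob by (auto intro!: exI[of _ "cball 0 R"])
  obtain M where M: "M > 0" "\<And>x. U x \<le> M * norm x powr (- s)" using riesz_bound by blast
  define G where "G z = M * (indicator (ball 0 (3 * R)) z * norm z powr (-s)) + indicator (ball 0 (3 * R)) z * (9 * R\<^sup>2)" for z :: plane
  have Gi: "integrable lborel G" unfolding G_def[abs_def]
    by (intro Bochner_Integration.integrable_add integrable_mult_right integrable_mult_left integrable_ball_powr s integrable_indicator_ball)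
  have G0: "0 \<le> G z" for z using M by (simp add: G_def)
  have [measurable]: "G \<in> borel_measurable borel" using Gi by auto
  define K where "K = ennreal c * (\<integral>\<^sup>+z. ennreal (G z) \<partial>lborel)"
  have K: "K < \<infinity>" using Gi G0 by (simp add: K_def integrable_iff_bounded ennreal_mult_less_top)
  have inner: "(\<integral>\<^sup>+y. ennreal (g y) * W (x - y) \<partial>lborel) \<le> K" if x: "norm x \<le> R" for x
  proof -
    have "(\<integral>\<^sup>+y. ennreal (g y) * W (x - y) \<partial>lborel) \<le> (\<integral>\<^sup>+y. ennreal c * ennreal (G (x + (-1) *\<^sub>R y)) \<partial>lborel)"
    proof (intro nn_integral_mono_AE, use AE_lborel_singleton[of x] in eventually_elim)
      fix y :: plane assume y: "y \<noteq> x"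
      show "ennreal (g y) * W (x - y) \<le> ennreal c * ennreal (G (x + (-1) *\<^sub>R y))"
      proof (cases "norm y \<le> R")
        case True
        have n: "norm (x - y) < 3 * R" using norm_triangle_ineq4[of x y] x True R by linarith
        then have "(norm (x - y))\<^sup>2 \<le> (3 * R)\<^sup>2" by (intro power_mono) auto
        then have "U (x - y) + (norm (x - y))\<^sup>2 \<le> G (x - y)"
          using M(2)[of "x - y"] n by (simp add: G_def power_mult_distrib)
        then have "W (x - y) \<le> ennreal (G (x - y))" using y by (simp only: potential_def) (simp add: ennreal_leI del: ennreal_plus)
        then show ?thesis by (intro mult_mono ennreal_leI g) auto
      qed (simp add: g(3))
    qed
    also have "\<dots> = ennreal c * (\<integral>\<^sup>+y. ennreal (G (x + (-1) *\<^sub>R y)) \<partial>lborel)"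
      by (rule nn_integral_cmult) measurable
    also have "\<dots> = K"
      unfolding K_def using nn_integral_plane_affine[of "\<lambda>z. ennreal (G z)" "-1" x] by simp
    finally show ?thesis .
  qed
  have "mutual W ?\<rho> ?\<rho> = (\<integral>\<^sup>+x. ennreal (g x) * (\<integral>\<^sup>+y. ennreal (g y) * W (x - y) \<partial>lborel) \<partial>lborel)"
    unfolding mutual_def by (simp add: nn_integral_density)
  also have "\<dots> \<le> (\<integral>\<^sup>+x. ennreal (g x) * K \<partial>lborel)"
  proof (intro nn_integral_mono)
    fix x
    show "ennreal (g x) * (\<integral>\<^sup>+y. ennreal (g y) * W (x - y) \<partial>lborel) \<le> ennreal (g x) * K"
      using inner[of x] g(3)[of x] by (cases "norm x \<le> R") (auto intro: mult_left_mono)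
  qed
  also have "\<dots> = K" using one by (simp add: nn_integral_multc)
  finally have "mutual W ?\<rho> ?\<rho> < \<infinity>" using K by (rule le_less_trans)
  moreover have "(1 / 2 :: ennreal) = ennreal (1/2)" by (simp add: divide_ennreal_def)
  then have "(1 / 2 :: ennreal) < \<infinity>" by (simp only: ennreal_less_top infinity_ennreal_def)
  ultimately have "energy W ?\<rho> < \<infinity>" unfolding energy_def mutual_def by (metis ennreal_mult_less_top infinity_ennreal_def)
  then show ?thesis using comp by (simp add: finite_energy_def)
qed

text \<open>A multiple of \<open>f\<close> added to a uniform density on a large disc gives a probability density with the same
  center of mass. Only the weak inequality is claimed, which includes the case \<open>f = 0\<close> almost everywhere.\<close>
lemma LIC_perturbation:
  assumes LIC: "LIC W" and [measurable]: "f \<in> borel_measurable borel"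
    and f: "\<And>x. \<bar>f x\<bar> \<le> 1" "\<And>x. norm x > R \<Longrightarrow> f x = 0" and R: "R > 0"
    and mass: "(\<integral>x. f x \<partial>lborel) = 0" and center: "(\<integral>x. f x *\<^sub>R x \<partial>lborel) = 0"
  shows "integrable lborel (\<lambda>\<xi>. H \<xi> * (norm (fourier (\<lambda>x. of_real (f x)) \<xi>))\<^sup>2)"
    and "0 \<le> (\<integral>\<xi>. H \<xi> * (norm (fourier (\<lambda>x. of_real (f x)) \<xi>))\<^sup>2 \<partial>lborel)"
proof -
  let ?B = "cball 0 R :: plane set"
  \<comment> \<open>the two densities are \<open>\<kappa>\<close> and \<open>\<kappa> * (1 + f)\<close> on the disc\<close>
  define \<kappa> where "\<kappa> = 1 / measure lborel ?B"
  have mB: "measure lborel ?B > 0" using R content_cball_pos[of R 0] by simp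
  have \<kappa>: "\<kappa> > 0" using mB by (simp add: \<kappa>_def)
  define g1 where "g1 x = \<kappa> * indicator ?B x" for x
  define g0 where "g0 x = \<kappa> * (indicator ?B x + f x)" for x
  have [measurable]: "g1 \<in> borel_measurable borel" "g0 \<in> borel_measurable borel"
    unfolding g1_def[abs_def] g0_def[abs_def] by measurable
  have iB: "integrable lborel (indicator ?B :: plane \<Rightarrow> real)" by (rule integrable_indicator_cball)
  have fl: "\<bar>f x\<bar> \<le> indicator ?B x" for x using f(1)[of x] f(2)[of x] by (auto split: split_indicator)
  have fi: "integrable lborel f" by (rule integrable_boundI[OF iB]) (use fl in auto)
  have g1n: "0 \<le> g1 x" "g1 x \<le> 2 * \<kappa>" "norm x > R \<Longrightarrow> g1 x = 0" for x
    using \<kappa> by (auto simp: g1_def split: split_indicator)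
  have g0n: "0 \<le> g0 x" "g0 x \<le> 2 * \<kappa>" "norm x > R \<Longrightarrow> g0 x = 0" for x
  proof -
    have "- 1 \<le> f x" "f x \<le> 1" using f(1)[of x] by auto
    then show "0 \<le> g0 x" "g0 x \<le> 2 * \<kappa>" "norm x > R \<Longrightarrow> g0 x = 0"
      using \<kappa> f(2)[of x] by (auto simp: g0_def split: split_indicator)
  qed
  have i1: "integrable lborel g1" unfolding g1_def[abs_def] using iB by simp
  have i0: "integrable lborel g0" unfolding g0_def[abs_def] using iB fi by simp
  have "(\<integral>x. g1 x \<partial>lborel) = 1" unfolding g1_def using mB by (simp add: \<kappa>_def)
  then have o1: "(\<integral>\<^sup>+x. ennreal (g1 x) \<partial>lborel) = 1" using g1n i1 by (simp add: nn_integral_eq_integral)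
  have "(\<integral>x. g0 x \<partial>lborel) = 1" unfolding g0_def using mB iB fi mass by (simp add: \<kappa>_def)
  then have o0: "(\<integral>\<^sup>+x. ennreal (g0 x) \<partial>lborel) = 1" using g0n i0 by (simp add: nn_integral_eq_integral)
  let ?r0 = "density lborel (\<lambda>x. ennreal (g0 x))" and ?r1 = "density lborel (\<lambda>x. ennreal (g1 x))"
  have fe: "finite_energy ?r0" "finite_energy ?r1"
    using finite_energy_density[of g0 "2 * \<kappa>" R] finite_energy_density[of g1 "2 * \<kappa>" R] g0n g1n R o0 o1 by auto
  have cm: "center_of_mass ?r0 = center_of_mass ?r1"
  proof -
    have iv: "integrable lborel (\<lambda>x. h x *\<^sub>R x)" if [measurable]: "h \<in> borel_measurable borel" and h: "\<And>x. \<bar>h x\<bar> \<le> indicator ?B x" for h :: "plane \<Rightarrow> real"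
    proof (rule integrable_boundI[OF integrable_mult_right[OF iB, of R]])
      show "AE x in lborel. norm (h x *\<^sub>R x) \<le> R * indicator ?B x"
      proof (rule AE_I2)
        fix x :: plane
        show "norm (h x *\<^sub>R x) \<le> R * indicator ?B x"
          using h[of x] mult_mono[of "\<bar>h x\<bar>" 1 "norm x" R] R by (cases "norm x \<le> R") (auto split: split_indicator)
      qed
    qed measurable
    have "center_of_mass ?r0 = (\<integral>x. g0 x *\<^sub>R x \<partial>lborel)"
      unfolding center_of_mass_def using g0n by (intro integral_density) auto
    also have "\<dots> = (\<integral>x. \<kappa> *\<^sub>R (indicator ?B x *\<^sub>R x) + \<kappa> *\<^sub>R (f x *\<^sub>R x) \<partial>lborel)"
      by (simp add: g0_def distrib_left scaleR_add_left)
    also have "\<dots> = (\<integral>x. \<kappa> *\<^sub>R (indicator ?B x *\<^sub>R x) \<partial>lborel) + (\<integral>x. \<kappa> *\<^sub>R (f x *\<^sub>R x) \<partial>lborel)"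
      by (intro Bochner_Integration.integral_add integrable_scaleR_right iv) (use fl in auto)
    also have "(\<integral>x. \<kappa> *\<^sub>R (f x *\<^sub>R x) \<partial>lborel) = \<kappa> *\<^sub>R (\<integral>x. f x *\<^sub>R x \<partial>lborel)"
      by (rule integral_scaleR_right)
    also have "(\<integral>x. \<kappa> *\<^sub>R (indicator ?B x *\<^sub>R x) \<partial>lborel) + \<kappa> *\<^sub>R (\<integral>x. f x *\<^sub>R x \<partial>lborel) = (\<integral>x. g1 x *\<^sub>R x \<partial>lborel)"
      by (simp only: center g1_def scaleR_scaleR scaleR_zero_right add_0_right)
    also have "\<dots> = center_of_mass ?r1"
      unfolding center_of_mass_def using g1n by (intro integral_density[symmetric]) auto
    finally show ?thesis .
  qed
  have diff: "measure_fourier ?r0 \<xi> - measure_fourier ?r1 \<xi> = of_real \<kappa> * fourier (\<lambda>x. of_real (f x)) \<xi>" for \<xi>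
  proof -
    have ii: "integrable lborel (\<lambda>x. complex_of_real (h x) * cis (- (2 * pi * (x \<bullet> \<xi>))))" if "integrable lborel h" for h
      by (intro integrable_mult_cis integrable_of_real that) measurable
    have "measure_fourier ?r0 \<xi> - measure_fourier ?r1 \<xi> = (\<integral>x. complex_of_real (g0 x) * cis (- (2 * pi * (x \<bullet> \<xi>))) - complex_of_real (g1 x) * cis (- (2 * pi * (x \<bullet> \<xi>))) \<partial>lborel)"
      using g0n g1n ii[OF i0] ii[OF i1] by (simp add: measure_fourier_density fourier_cis)
    also have "\<dots> = (\<integral>x. of_real \<kappa> * (complex_of_real (f x) * cis (- (2 * pi * (x \<bullet> \<xi>)))) \<partial>lborel)"
      by (intro Bochner_Integration.integral_cong) (auto simp: g0_def g1_def algebra_simps)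
    finally show ?thesis by (simp add: fourier_cis)
  qed
  have sq: "H \<xi> * (norm (measure_fourier ?r0 \<xi> - measure_fourier ?r1 \<xi>))\<^sup>2 = \<kappa>\<^sup>2 * (H \<xi> * (norm (fourier (\<lambda>x. of_real (f x)) \<xi>))\<^sup>2)" for \<xi>
    unfolding diff by (simp add: norm_mult power_mult_distrib)
  note sc = strictly_convex_energy_iff[OF fe cm]
  have "integrable lborel (\<lambda>\<xi>. 1 / \<kappa>\<^sup>2 * (\<kappa>\<^sup>2 * (H \<xi> * (norm (fourier (\<lambda>x. of_real (f x)) \<xi>))\<^sup>2)))"
    using sc(1) unfolding sq by (rule integrable_mult_right)
  then show "integrable lborel (\<lambda>\<xi>. H \<xi> * (norm (fourier (\<lambda>x. of_real (f x)) \<xi>))\<^sup>2)"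
    using \<kappa> by simp
  have "0 \<le> (\<integral>\<xi>. H \<xi> * (norm (measure_fourier ?r0 \<xi> - measure_fourier ?r1 \<xi>))\<^sup>2 \<partial>lborel)"
  proof (cases "?r0 = ?r1")
    case True
    then show ?thesis by simp
  next
    case False
    then have "strictly_convex_01 (\<lambda>t. energy W (interpolation t ?r0 ?r1))"
      using LIC fe cm unfolding LIC_def finite_energy_def by blast
    then show ?thesis using sc(2) by simp
  qed
  then show "0 \<le> (\<integral>\<xi>. H \<xi> * (norm (fourier (\<lambda>x. of_real (f x)) \<xi>))\<^sup>2 \<partial>lborel)"
    unfolding sq using \<kappa> by (simp add: zero_le_mult_iff)
qed

end

lemma fourier_translate:
  assumes [measurable]: "f \<in> borel_measurable borel"
  shows "fourier (\<lambda>x. f (x + v)) \<xi> = cis (2 * pi * (v \<bullet> \<xi>)) * fourier f \<xi>"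
proof -
  have "fourier f \<xi> = (\<integral>x. f (v + 1 *\<^sub>R x) * cis (- (2 * pi * ((v + 1 *\<^sub>R x) \<bullet> \<xi>))) \<partial>lborel)"
    unfolding fourier_cis by (subst integral_plane_affine[of _ 1 v]) auto
  also have "\<dots> = (\<integral>x. cis (- (2 * pi * (v \<bullet> \<xi>))) * (f (x + v) * cis (- (2 * pi * (x \<bullet> \<xi>)))) \<partial>lborel)"
    by (intro Bochner_Integration.integral_cong) (auto simp: cis_mult inner_add_left algebra_simps)
  also have "\<dots> = cis (- (2 * pi * (v \<bullet> \<xi>))) * fourier (\<lambda>x. f (x + v)) \<xi>"
    by (simp add: fourier_cis)
  finally have "cis (2 * pi * (v \<bullet> \<xi>)) * fourier f \<xi> = (cis (2 * pi * (v \<bullet> \<xi>)) * cis (- (2 * pi * (v \<bullet> \<xi>)))) * fourier (\<lambda>x. f (x + v)) \<xi>"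
    by (simp only: mult.assoc)
  then show ?thesis by (simp add: cis_mult)
qed

text \<open>Taking the second difference of any function makes the mass and the first moment vanish, at the cost of a
  trigonometric factor on the Fourier side.\<close>
lemma (in riesz_profile) LIC_second_difference:
  assumes LIC: "LIC W" and hm [measurable]: "h \<in> borel_measurable borel"
    and h: "\<And>x. \<bar>h x\<bar> \<le> 1/4" "\<And>x. norm x > R \<Longrightarrow> h x = 0" and R: "R > 0"
  shows "integrable lborel (\<lambda>\<xi>. H \<xi> * (2 * cos (2 * pi * (v \<bullet> \<xi>)) - 2)\<^sup>2 * (norm (fourier (\<lambda>x. of_real (h x)) \<xi>))\<^sup>2)"
    and "0 \<le> (\<integral>\<xi>. H \<xi> * (2 * cos (2 * pi * (v \<bullet> \<xi>)) - 2)\<^sup>2 * (norm (fourier (\<lambda>x. of_real (h x)) \<xi>))\<^sup>2 \<partial>lborel)"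
proof -
  define f where "f x = h (x + v) + h (x + (-v)) - 2 * h x" for x
  have [measurable]: "f \<in> borel_measurable borel" unfolding f_def[abs_def] by measurable
  have iB: "integrable lborel (indicator (cball 0 R) :: plane \<Rightarrow> real)" by (rule integrable_indicator_cball)
  have hl: "\<bar>h x\<bar> \<le> indicator (cball 0 R) x" for x using h(1)[of x] h(2)[of x] by (auto split: split_indicator)
  have hi: "integrable lborel h" by (rule integrable_boundI[OF iB]) (use hl in auto)
  have hxi: "integrable lborel (\<lambda>x. h x *\<^sub>R x)"
  proof (rule integrable_boundI[OF integrable_mult_right[OF iB, of R]])
    show "AE x in lborel. norm (h x *\<^sub>R x) \<le> R * indicator (cball 0 R) x"
    proof (rule AE_I2)
      fix x :: plane
      show "norm (h x *\<^sub>R x) \<le> R * indicator (cball 0 R) x"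
        using h(1)[of x] h(2)[of x] mult_mono[of "\<bar>h x\<bar>" 1 "norm x" R] R by (cases "norm x \<le> R") (auto split: split_indicator)
    qed
  qed measurable
  have tr: "integrable lborel (\<lambda>x. h (x + w))" "(\<integral>x. h (x + w) \<partial>lborel) = (\<integral>x. h x \<partial>lborel)"
    "integrable lborel (\<lambda>x. h (x + w) *\<^sub>R x)" "(\<integral>x. h (x + w) *\<^sub>R x \<partial>lborel) = (\<integral>x. h x *\<^sub>R x \<partial>lborel) - (\<integral>x. h x \<partial>lborel) *\<^sub>R w" for w
  proof -
    show i1: "integrable lborel (\<lambda>x. h (x + w))" using integrable_plane_affine[OF hi, of 1 w] by (simp add: add.commute)
    show e1: "(\<integral>x. h (x + w) \<partial>lborel) = (\<integral>x. h x \<partial>lborel)" using integral_plane_affine[OF hm, of 1 w] by (simp add: add.commute)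
    have i2: "integrable lborel (\<lambda>x. h (x + w) *\<^sub>R (x + w))" using integrable_plane_affine[OF hxi, of 1 w] by (simp add: add.commute)
    have e2: "(\<integral>x. h (x + w) *\<^sub>R (x + w) \<partial>lborel) = (\<integral>x. h x *\<^sub>R x \<partial>lborel)"
      using integral_plane_affine[of "\<lambda>x. h x *\<^sub>R x" 1 w] by (simp add: add.commute)
    have eq: "h (x + w) *\<^sub>R x = h (x + w) *\<^sub>R (x + w) - h (x + w) *\<^sub>R w" for x by (simp add: scaleR_add_right)
    have i3: "integrable lborel (\<lambda>x. h (x + w) *\<^sub>R w)" using i1 by simp
    show "integrable lborel (\<lambda>x. h (x + w) *\<^sub>R x)" unfolding eq using i2 i3 by (rule Bochner_Integration.integrable_diff)
    show "(\<integral>x. h (x + w) *\<^sub>R x \<partial>lborel) = (\<integral>x. h x *\<^sub>R x \<partial>lborel) - (\<integral>x. h x \<partial>lborel) *\<^sub>R w"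
      unfolding eq Bochner_Integration.integral_diff[OF i2 i3] e2 using i1 e1 by simp
  qed
  have mass: "(\<integral>x. f x \<partial>lborel) = 0" unfolding f_def using tr(1,2)[of v] tr(1,2)[of "-v"] hi by simp
  have center: "(\<integral>x. f x *\<^sub>R x \<partial>lborel) = 0"
  proof -
    have "(\<integral>x. f x *\<^sub>R x \<partial>lborel) = (\<integral>x. h (x + v) *\<^sub>R x + h (x + (-v)) *\<^sub>R x - 2 *\<^sub>R (h x *\<^sub>R x) \<partial>lborel)"
      by (simp add: f_def scaleR_add_left scaleR_diff_left)
    also have "\<dots> = (\<integral>x. h (x + v) *\<^sub>R x \<partial>lborel) + (\<integral>x. h (x + (-v)) *\<^sub>R x \<partial>lborel) - 2 *\<^sub>R (\<integral>x. h x *\<^sub>R x \<partial>lborel)"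
      by (subst Bochner_Integration.integral_diff Bochner_Integration.integral_add integral_scaleR_right;
          (intro Bochner_Integration.integrable_add integrable_scaleR_right tr(3) hxi)?)+ simp
    also have "\<dots> = 0" unfolding tr(4) by (simp add: scaleR_2)
    finally show ?thesis .
  qed
  have f1: "\<bar>f x\<bar> \<le> 1" for x
    using h(1)[of "x + v"] h(1)[of "x + (-v)"] h(1)[of x] unfolding f_def by linarith
  have f2: "f x = 0" if x: "norm x > R + norm v" for x
  proof -
    have "norm (x + v) > R" "norm (x + (-v)) > R" "norm x > R"
      using norm_triangle_ineq4[of "x + v" v, simplified] norm_triangle_ineq[of "x + (-v)" v, simplified] x norm_ge_zero[of v]
      unfolding add_uminus_conv_diff by linarith+
    then show ?thesis by (simp add: f_def h(2))
  qed
  have ft: "fourier (\<lambda>x. of_real (f x)) \<xi> = of_real (2 * cos (2 * pi * (v \<bullet> \<xi>)) - 2) * fourier (\<lambda>x. of_real (h x)) \<xi>" for \<xi>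
  proof -
    have i: "integrable lborel (\<lambda>x. complex_of_real (h (x + w)) * cis (- (2 * pi * (x \<bullet> \<xi>))))" for w
      by (intro integrable_mult_cis integrable_of_real tr(1)) measurable
    have i0: "integrable lborel (\<lambda>x. complex_of_real (h x) * cis (- (2 * pi * (x \<bullet> \<xi>))))"
      by (intro integrable_mult_cis integrable_of_real hi) measurable
    have "fourier (\<lambda>x. of_real (f x)) \<xi> = (\<integral>x. complex_of_real (h (x + v)) * cis (- (2 * pi * (x \<bullet> \<xi>))) + complex_of_real (h (x + (-v))) * cis (- (2 * pi * (x \<bullet> \<xi>)))
       - 2 * (complex_of_real (h x) * cis (- (2 * pi * (x \<bullet> \<xi>)))) \<partial>lborel)"
      unfolding fourier_cis by (intro Bochner_Integration.integral_cong) (auto simp: f_def algebra_simps)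
    also have "\<dots> = fourier (\<lambda>x. of_real (h (x + v))) \<xi> + fourier (\<lambda>x. of_real (h (x + (-v)))) \<xi> - 2 * fourier (\<lambda>x. of_real (h x)) \<xi>"
      unfolding fourier_cis
      by (subst Bochner_Integration.integral_diff Bochner_Integration.integral_add integral_mult_right;
          (intro Bochner_Integration.integrable_add integrable_mult_right i i0)?)+ simp
    also have "\<dots> = (cis (2 * pi * (v \<bullet> \<xi>)) + cis (- (2 * pi * (v \<bullet> \<xi>))) - 2) * fourier (\<lambda>x. of_real (h x)) \<xi>"
    proof -
      have t: "fourier (\<lambda>x. complex_of_real (h (x + w))) \<xi> = cis (2 * pi * (w \<bullet> \<xi>)) * fourier (\<lambda>x. of_real (h x)) \<xi>" for w
        by (rule fourier_translate) measurable
      show ?thesis unfolding t[of v] t[of "-v"] by (simp add: distrib_right left_diff_distrib)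
    qed
    also have "cis (2 * pi * (v \<bullet> \<xi>)) + cis (- (2 * pi * (v \<bullet> \<xi>))) - 2 = of_real (2 * cos (2 * pi * (v \<bullet> \<xi>)) - 2)"
      by (simp add: complex_eq_iff)
    finally show ?thesis .
  qed
  have sq: "H \<xi> * (norm (fourier (\<lambda>x. of_real (f x)) \<xi>))\<^sup>2 = H \<xi> * (2 * cos (2 * pi * (v \<bullet> \<xi>)) - 2)\<^sup>2 * (norm (fourier (\<lambda>x. of_real (h x)) \<xi>))\<^sup>2" for \<xi>
    unfolding ft norm_mult norm_of_real power_mult_distrib power2_abs by simp
  have R': "R + norm v > 0" using R by (simp add: add_pos_nonneg)
  note L = LIC_perturbation[OF LIC _ f1 f2 R' mass center]
  show "integrable lborel (\<lambda>\<xi>. H \<xi> * (2 * cos (2 * pi * (v \<bullet> \<xi>)) - 2)\<^sup>2 * (norm (fourier (\<lambda>x. of_real (h x)) \<xi>))\<^sup>2)"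
    using L(1) unfolding sq by simp
  show "0 \<le> (\<integral>\<xi>. H \<xi> * (2 * cos (2 * pi * (v \<bullet> \<xi>)) - 2)\<^sup>2 * (norm (fourier (\<lambda>x. of_real (h x)) \<xi>))\<^sup>2 \<partial>lborel)"
    using L(2) unfolding sq by simp
qed

section \<open>A compactly supported cutoff with integrable power spectrum\<close>

lemma has_real_derivative_pos_part_power:
  assumes "k \<ge> 2"
  shows "((\<lambda>z. (max 0 z) ^ k) has_real_derivative real k * (max 0 z) ^ (k - 1)) (at (z::real))"
proof -
  consider "z > 0" | "z < 0" | "z = 0" by linarith
  then show ?thesis
  proof cases
    case 1
    have "((\<lambda>z. z ^ k) has_real_derivative real k * z ^ (k - 1)) (at z)"
      by (auto intro!: derivative_eq_intros)
    from has_field_derivative_transform_within_open[OF this, of "{0<..}" "\<lambda>z. (max 0 z) ^ k"] show ?thesis using 1 by simp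
  next
    case 2
    have "((\<lambda>z::real. 0::real) has_real_derivative 0) (at z)" by simp
    from has_field_derivative_transform_within_open[OF this, of "{..<0}" "\<lambda>z. (max 0 z) ^ k"]
    have "((\<lambda>z. (max 0 z) ^ k) has_real_derivative 0) (at z)" using 2 assms by simp
    moreover have "real k * (max 0 z) ^ (k - 1) = 0" using 2 assms by simp
    ultimately show ?thesis by (simp only:)
  next
    case 3
    have "(\<lambda>h. ((max 0 (0 + h)) ^ k - (max 0 0) ^ k) / h) \<midarrow>0\<rightarrow> (0::real)"
    proof (rule Lim_null_comparison)
      show "(\<lambda>h. \<bar>h\<bar>) \<midarrow>0\<rightarrow> (0::real)" by (auto intro!: tendsto_eq_intros)
      have "\<forall>\<^sub>F h::real in at 0. \<bar>h\<bar> < 1"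
        unfolding eventually_at by (intro exI[of _ 1]) auto
      then show "\<forall>\<^sub>F h::real in at 0. norm (((max 0 (0 + h)) ^ k - (max 0 0) ^ k) / h) \<le> \<bar>h\<bar>"
      proof eventually_elim
        fix h :: real assume h: "\<bar>h\<bar> < 1"
        show "norm (((max 0 (0 + h)) ^ k - (max 0 0) ^ k) / h) \<le> \<bar>h\<bar>"
        proof (cases "h > 0")
          case True
          have "h ^ k \<le> h ^ 2" using True h assms by (intro power_decreasing) auto
          then show ?thesis using True assms by (simp add: power2_eq_square divide_le_eq power_0_left)
        next
          case False
          then show ?thesis using assms by (simp add: max_def)
        qed
      qed
    qed
    then have "((\<lambda>z. (max 0 z) ^ k) has_real_derivative 0) (at (0::real))"
      by (simp add: DERIV_def)
    moreover have "real k * (max 0 z) ^ (k - 1) = 0" using 3 assms by simp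
    ultimately show ?thesis unfolding 3 by (simp only:)
  qed
qed

text \<open>The cube makes the function twice continuously differentiable across the unit circle.\<close>
definition cutoff :: "plane \<Rightarrow> real" where
  "cutoff x = (max 0 (1 - (norm x)\<^sup>2)) ^ 3"

lemma cutoff_range: "0 \<le> cutoff x" "cutoff x \<le> 1"
  unfolding cutoff_def by (auto intro!: power_le_one)

lemma pos_part_outside_ball: "norm x > 1 \<Longrightarrow> max 0 (1 - (norm x)\<^sup>2) = 0"
proof -
  assume "norm x > 1"
  then have "1 < (norm x)\<^sup>2" by (rule one_less_power) simp
  then show ?thesis by (intro max_absorb1) linarith
qed

lemma cutoff_support: "norm x > 1 \<Longrightarrow> cutoff x = 0"
  unfolding cutoff_def by (simp only: pos_part_outside_ball) simp

lemma cutoff_continuous: "continuous_on UNIV cutoff"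
  unfolding cutoff_def[abs_def] by (intro continuous_intros)

lemma cutoff_measurable [measurable]: "cutoff \<in> borel_measurable borel"
  by (intro borel_measurable_continuous_onI cutoff_continuous)

lemma cutoff_integrable: "integrable lborel cutoff"
proof (rule integrable_boundI[OF integrable_indicator_cball[of 0 1]])
  show "AE x in lborel. norm (cutoff x) \<le> indicator (cball 0 1) x"
    using cutoff_range cutoff_support by (intro AE_I2) (auto split: split_indicator)
qed measurable

lemma cutoff_fourier_decay: "\<exists>C\<ge>0. \<forall>\<xi>. norm (fourier (\<lambda>x. of_real (cutoff x)) \<xi>) \<le> C / (1 + (norm \<xi>)\<^sup>2)"
proof -
  let ?u = "\<lambda>x::plane. max 0 (1 - (norm x)\<^sup>2)"
  let ?f1 = "\<lambda>v x. 3 * (?u x)\<^sup>2 * (- (2 * (x \<bullet> v)))"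
  let ?f2 = "\<lambda>v x. 12 * (2 * ?u x * (x \<bullet> v)\<^sup>2) - 6 * ((?u x)\<^sup>2 * (norm v)\<^sup>2)"
  have du: "((\<lambda>t. 1 - (norm (y + t *\<^sub>R v))\<^sup>2) has_real_derivative - (2 * ((y + t *\<^sub>R v) \<bullet> v))) (at t)" for y v :: plane and t
    using DERIV_diff[OF DERIV_const line_norm_deriv] by simp
  have d1: "((\<lambda>t. cutoff (y + t *\<^sub>R v)) has_real_derivative ?f1 v (y + t *\<^sub>R v)) (at t)" for y v t
    using DERIV_chain2[OF has_real_derivative_pos_part_power[of 3] du[of y v t]] by (simp add: cutoff_def)
  have d2: "((\<lambda>t. ?f1 v (y + t *\<^sub>R v)) has_real_derivative ?f2 v (y + t *\<^sub>R v)) (at t)" for y v t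
  proof -
    have a: "((\<lambda>t. (?u (y + t *\<^sub>R v))\<^sup>2) has_real_derivative 2 * ?u (y + t *\<^sub>R v) * (- (2 * ((y + t *\<^sub>R v) \<bullet> v)))) (at t)"
      using DERIV_chain2[OF has_real_derivative_pos_part_power[of 2] du[of y v t]] by simp
    show ?thesis
      by (rule derivative_eq_intros a line_inner_deriv refl)+ (simp add: power2_eq_square algebra_simps)
  qed
  show ?thesis
  proof (rule fourier_decay[of _ 120 "\<lambda>v x. of_real (?f1 v x)" "\<lambda>v x. of_real (?f2 v x)"])
    fix y v :: plane and t :: real
    show "((\<lambda>t. complex_of_real (cutoff (y + t *\<^sub>R v))) has_vector_derivative of_real (?f1 v (y + t *\<^sub>R v))) (at t)"
      by (rule has_vector_derivative_of_real[OF d1])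
    show "((\<lambda>t. complex_of_real (?f1 v (y + t *\<^sub>R v))) has_vector_derivative of_real (?f2 v (y + t *\<^sub>R v))) (at t)"
      by (rule has_vector_derivative_of_real[OF d2])
    show "norm (complex_of_real (?f2 v y)) \<le> 120 * (norm v)\<^sup>2 * decay_weight y"
    proof (cases "norm y \<le> 1")
      case True
      have u: "0 \<le> ?u y" "?u y \<le> 1" by auto
      have "\<bar>y \<bullet> v\<bar> \<le> 1 * norm v"
        by (rule order_trans[OF Cauchy_Schwarz_ineq2 mult_right_mono[OF True norm_ge_zero]])
      then have "(y \<bullet> v)\<^sup>2 \<le> (norm v)\<^sup>2" using power_mono[of "\<bar>y \<bullet> v\<bar>" "norm v" 2] by simp
      then have "2 * ?u y * (y \<bullet> v)\<^sup>2 \<le> 2 * 1 * (norm v)\<^sup>2" using u by (intro mult_mono) auto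
      moreover have "0 \<le> 2 * ?u y * (y \<bullet> v)\<^sup>2" using u by (intro mult_nonneg_nonneg) auto
      moreover have "(?u y)\<^sup>2 * (norm v)\<^sup>2 \<le> 1 * (norm v)\<^sup>2" using u by (intro mult_right_mono power_le_one) auto
      moreover have "0 \<le> (?u y)\<^sup>2 * (norm v)\<^sup>2" by simp
      ultimately have "\<bar>?f2 v y\<bar> \<le> 30 * (norm v)\<^sup>2" unfolding abs_le_iff by linarith
      also have "\<dots> \<le> 30 * (norm v)\<^sup>2 * (4 * decay_weight y)"
      proof -
        have "(1 + (norm y)\<^sup>2)\<^sup>2 \<le> 2\<^sup>2" using True power_mono[of "norm y" 1 2] by (intro power_mono) auto
        moreover have "1 + (norm y)\<^sup>2 > 0" by (simp add: add_pos_nonneg)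
        ultimately have "1 / 4 \<le> 1 / (1 + (norm y)\<^sup>2)\<^sup>2" by (intro divide_left_mono mult_pos_pos zero_less_power) auto
        then have "1 \<le> 4 * decay_weight y" using inverse_square_le_decay_weight[of y] by linarith
        then have "30 * (norm v)\<^sup>2 * 1 \<le> 30 * (norm v)\<^sup>2 * (4 * decay_weight y)" by (intro mult_left_mono) auto
        then show ?thesis by simp
      qed
      finally show ?thesis by (simp only: norm_of_real)
    next
      case False
      then have "?u y = 0" by (intro pos_part_outside_ball) simp
      then show ?thesis by (simp add: decay_weight_nonneg)
    qed
  qed (use cutoff_integrable in auto)
qed

definition cutoff_spectrum :: "plane \<Rightarrow> real" where
  "cutoff_spectrum \<xi> = (norm (fourier (\<lambda>x. of_real (cutoff x)) \<xi>))\<^sup>2"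

lemma cutoff_fourier_continuous: "continuous_on UNIV (fourier (\<lambda>x. of_real (cutoff x)))"
  by (intro fourier_continuous integrable_of_real cutoff_integrable)

lemma cutoff_spectrum_continuous: "continuous_on UNIV cutoff_spectrum"
  unfolding cutoff_spectrum_def[abs_def] by (intro continuous_intros cutoff_fourier_continuous)

lemma cutoff_spectrum_integrable: "integrable lborel cutoff_spectrum"
proof -
  have [measurable]: "cutoff_spectrum \<in> borel_measurable borel"
    by (intro borel_measurable_continuous_onI cutoff_spectrum_continuous)
  obtain C where C: "C \<ge> 0" "\<And>\<xi>. norm (fourier (\<lambda>x. of_real (cutoff x)) \<xi>) \<le> C / (1 + (norm \<xi>)\<^sup>2)"
    using cutoff_fourier_decay by blast
  have "cutoff_spectrum \<xi> \<le> C\<^sup>2 * decay_weight \<xi>" for \<xi>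
  proof -
    have "cutoff_spectrum \<xi> \<le> (C / (1 + (norm \<xi>)\<^sup>2))\<^sup>2" unfolding cutoff_spectrum_def by (intro power_mono C) auto
    also have "\<dots> = C\<^sup>2 * (1 / (1 + (norm \<xi>)\<^sup>2)\<^sup>2)" by (simp add: power_divide)
    also have "\<dots> \<le> C\<^sup>2 * decay_weight \<xi>" by (intro mult_left_mono inverse_square_le_decay_weight) auto
    finally show ?thesis .
  qed
  then show ?thesis
    by (intro integrable_boundI[OF integrable_mult_right[OF integrable_decay_weight, of "C\<^sup>2"]] AE_I2)
       (auto simp: cutoff_spectrum_def)
qed

lemma integral_pos_of_continuous:
  fixes f :: "plane \<Rightarrow> real"
  assumes "integrable lborel f" "continuous_on UNIV f" "\<And>x. 0 \<le> f x" "f a > 0"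
  shows "0 < (\<integral>x. f x \<partial>lborel)"
proof (rule ccontr)
  assume "\<not> ?thesis"
  moreover have "0 \<le> (\<integral>x. f x \<partial>lborel)" using assms(3) by (intro integral_nonneg_AE AE_I2) auto
  ultimately have "(\<integral>x. f x \<partial>lborel) = 0" by linarith
  then have "AE x in lborel. f x = 0"
    using assms(3) by (subst (asm) integral_nonneg_eq_0_iff_AE[OF assms(1)]) auto
  then have "AE x in lborel. x \<notin> {x. f x \<noteq> 0}" by simp
  moreover have "open {x. f x \<noteq> 0}" by (intro open_Collect_neq assms(2) continuous_intros)
  ultimately have "{x. f x \<noteq> 0} = {}" by (intro open_null_empty)
  then have "f a = 0" by blast
  then show False using assms(4) by simp
qed

lemma cutoff_spectrum_pos: "0 < (\<integral>\<xi>. cutoff_spectrum \<xi> \<partial>lborel)"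
proof (rule integral_pos_of_continuous[OF cutoff_spectrum_integrable cutoff_spectrum_continuous, of 0])
  have "0 < (\<integral>x. cutoff x \<partial>lborel)"
    by (rule integral_pos_of_continuous[OF cutoff_integrable cutoff_continuous, of 0]) (simp_all add: cutoff_range, simp add: cutoff_def)
  moreover have "fourier (\<lambda>x. of_real (cutoff x)) 0 = of_real (\<integral>x. cutoff x \<partial>lborel)"
    unfolding fourier_cis by simp
  ultimately show "0 < cutoff_spectrum 0" by (simp add: cutoff_spectrum_def)
qed (simp add: cutoff_spectrum_def)

section \<open>Wave packets detect a negative angular part\<close>

lemma fourier_modulation:
  assumes f: "integrable lborel (\<lambda>x. complex_of_real (f x))"
  shows "fourier (\<lambda>x. of_real (f x * cos (2 * pi * (x \<bullet> \<eta>)))) \<xi> = (fourier (\<lambda>x. of_real (f x)) (\<xi> - \<eta>) + fourier (\<lambda>x. of_real (f x)) (\<xi> + \<eta>)) / 2"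
    and "fourier (\<lambda>x. of_real (f x * sin (2 * pi * (x \<bullet> \<eta>)))) \<xi> = (fourier (\<lambda>x. of_real (f x)) (\<xi> - \<eta>) - fourier (\<lambda>x. of_real (f x)) (\<xi> + \<eta>)) / (2 * \<i>)"
proof -
  let ?g = "\<lambda>\<zeta> x. complex_of_real (f x) * cis (- (2 * pi * (x \<bullet> \<zeta>)))"
  have i: "integrable lborel (?g \<zeta>)" for \<zeta> by (intro integrable_mult_cis f) measurable
  have m: "?g (\<xi> - \<eta>) x = of_real (f x) * cis (2 * pi * (x \<bullet> \<eta>)) * cis (- (2 * pi * (x \<bullet> \<xi>)))"
    "?g (\<xi> + \<eta>) x = of_real (f x) * cis (- (2 * pi * (x \<bullet> \<eta>))) * cis (- (2 * pi * (x \<bullet> \<xi>)))" for x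
    by (simp_all add: cis_mult inner_diff_right inner_add_right algebra_simps)
  have c: "of_real (cos \<theta>) = (cis \<theta> + cis (- \<theta>)) / 2" "of_real (sin \<theta>) = (cis \<theta> - cis (- \<theta>)) / (2 * \<i>)" for \<theta>
    by (auto simp: complex_eq_iff)
  have "fourier (\<lambda>x. of_real (f x * cos (2 * pi * (x \<bullet> \<eta>)))) \<xi> = (\<integral>x. (?g (\<xi> - \<eta>) x + ?g (\<xi> + \<eta>) x) / 2 \<partial>lborel)"
    unfolding fourier_cis m of_real_mult c by (intro Bochner_Integration.integral_cong) (auto simp: algebra_simps)
  then show "fourier (\<lambda>x. of_real (f x * cos (2 * pi * (x \<bullet> \<eta>)))) \<xi> = (fourier (\<lambda>x. of_real (f x)) (\<xi> - \<eta>) + fourier (\<lambda>x. of_real (f x)) (\<xi> + \<eta>)) / 2"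
    using i by (simp add: fourier_cis)
  have "fourier (\<lambda>x. of_real (f x * sin (2 * pi * (x \<bullet> \<eta>)))) \<xi> = (\<integral>x. (?g (\<xi> - \<eta>) x - ?g (\<xi> + \<eta>) x) / (2 * \<i>) \<partial>lborel)"
    unfolding fourier_cis m of_real_mult c by (intro Bochner_Integration.integral_cong) (auto simp: algebra_simps diff_divide_distrib)
  then show "fourier (\<lambda>x. of_real (f x * sin (2 * pi * (x \<bullet> \<eta>)))) \<xi> = (fourier (\<lambda>x. of_real (f x)) (\<xi> - \<eta>) - fourier (\<lambda>x. of_real (f x)) (\<xi> + \<eta>)) / (2 * \<i>)"
    using i by (simp add: fourier_cis)
qed

text \<open>The first bound compensates the singularity of the Fourier transform of the kernel at the origin, the second
  one holds at infinity.\<close>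
lemma cos_second_difference_le: "(2 * cos \<theta> - 2)\<^sup>2 \<le> \<theta> ^ 4" "(2 * cos \<theta> - 2)\<^sup>2 \<le> 16" for \<theta> :: real
proof -
  have c: "2 * cos \<theta> - 2 = - 4 * (sin (\<theta> / 2))\<^sup>2" using cos_double_sin[of "\<theta> / 2"] by simp
  have "(sin (\<theta> / 2))\<^sup>2 \<le> (\<theta> / 2)\<^sup>2" using power_mono[OF abs_sin_x_le_abs_x[of "\<theta> / 2"], of 2] by (simp only: power2_abs abs_ge_zero)
  then have "(4 * (sin (\<theta> / 2))\<^sup>2)\<^sup>2 \<le> (\<theta>\<^sup>2)\<^sup>2" by (intro power_mono) (auto simp: power_divide)
  then show "(2 * cos \<theta> - 2)\<^sup>2 \<le> \<theta> ^ 4" unfolding c by simp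
  have "\<bar>2 * cos \<theta> - 2\<bar> \<le> 4" using cos_le_one[of \<theta>] cos_ge_minus_one[of \<theta>] by linarith
  from power_mono[OF this, of 2] show "(2 * cos \<theta> - 2)\<^sup>2 \<le> 16" unfolding power2_abs by simp
qed

context riesz_profile begin

lemma riesz_hat_even: "H (- \<xi>) = H \<xi>"
  unfolding riesz_hat_def using pi_periodic_angle_uminus[of "angular_part s" \<xi>, OF angular_part_per_pi[OF s]] by simp

text \<open>Let \<open>\<xi>0\<close> be a unit vector in a direction in which the angular part is negative. Test with the second
  difference, with step \<open>v = \<xi>0 / 2\<close>, of a cutoff at scale \<open>N\<close> times the cosine and the sine of
  \<open>2 * pi * (x \<bullet> \<xi>0)\<close>. The second difference multiplies the Fourier transform by
  \<open>2 * cos (2 * pi * (v \<bullet> \<xi>)) - 2\<close>, which equals \<open>-4\<close> at \<open>\<xi>0\<close> and vanishes to second order at the origin, so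
  that the product \<open>H' \<xi>\<close> of its square with the transform of the kernel is bounded. Adding the inequalities for cosine and
  sine removes the interference between the frequencies \<open>\<xi>0\<close> and \<open>-\<xi>0\<close>. As \<open>N\<close> grows, the spectrum
  concentrates at these two points, and the inequality becomes \<open>0 \<le> H' \<xi>0\<close>.\<close>
theorem LIC_imp_angular_part_nonneg:
  assumes LIC: "LIC W" shows "0 \<le> angular_part s \<phi>'"
proof (rule ccontr)
  assume neg: "\<not> 0 \<le> angular_part s \<phi>'"
  obtain \<phi> where \<phi>: "-pi < \<phi>" "\<phi> < pi" "angular_part s \<phi> < 0"
  proof -
    obtain y where y: "y \<in> {0..pi}" "angular_part s \<phi>' = angular_part s y"
      using pi_periodic_reduce[of "angular_part s" \<phi>', OF angular_part_per_pi[OF s]] by blast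
    show ?thesis
    proof (cases "y = pi")
      case True
      then show ?thesis using that[of 0] y neg angular_part_per_pi[OF s, of 0] by simp
    next
      case False
      then show ?thesis using that[of y] y neg by auto
    qed
  qed
  define \<xi>0 :: plane where "\<xi>0 = (cos \<phi>, sin \<phi>)"
  have n0: "norm \<xi>0 = 1" by (simp add: \<xi>0_def norm_polar)
  define v where "v = (1/2) *\<^sub>R \<xi>0"
  have nv: "norm v = 1/2" by (simp add: v_def n0)
  define H' where "H' \<xi> = H \<xi> * (2 * cos (2 * pi * (v \<bullet> \<xi>)) - 2)\<^sup>2" for \<xi>
  have [measurable]: "H' \<in> borel_measurable borel" unfolding H'_def[abs_def] by measurable
  have even: "H' (-\<xi>) = H' \<xi>" for \<xi> by (simp add: H'_def riesz_hat_even)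
  have H'neg: "H' \<xi>0 < 0"
  proof -
    have "v \<bullet> \<xi>0 = 1/2" by (simp add: v_def power2_norm_eq_inner[symmetric] n0)
    then have "2 * pi * (v \<bullet> \<xi>0) = pi" by simp
    then have "H' \<xi>0 = 16 * H \<xi>0" unfolding H'_def by (simp only:) simp
    moreover have "H \<xi>0 < 0" using \<phi> n0 by (simp add: riesz_hat_def \<xi>0_def angle_polar norm_polar)
    ultimately show ?thesis by simp
  qed
  have "isCont H \<xi>0" unfolding \<xi>0_def using isCont_angular[OF angular_part_cont[OF s] \<phi>(1,2), of s] by (simp add: riesz_hat_def[abs_def])
  then have c1: "isCont H' \<xi>0" unfolding H'_def[abs_def] by (intro continuous_intros)
  then have "isCont (\<lambda>\<xi>. H' (- \<xi>)) (- \<xi>0)" by (intro isCont_o2[of _ uminus H']) (auto intro!: continuous_intros)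
  then have c2: "isCont H' (- \<xi>0)" by (simp add: even)
  obtain D where D: "D \<ge> 0" "\<And>\<xi>. \<bar>H \<xi>\<bar> \<le> D * norm \<xi> powr (s - 2)" using riesz_hat_bound[OF s] by blast
  define B where "B = D * pi ^ 4 + D * 16"
  have H'B: "\<bar>H' \<xi>\<bar> \<le> B" for \<xi>
  proof (cases "norm \<xi> \<le> 1")
    case True
    have "\<bar>2 * pi * (v \<bullet> \<xi>)\<bar> \<le> pi * norm \<xi>"
      using Cauchy_Schwarz_ineq2[of v \<xi>] by (simp add: abs_mult nv)
    then have "\<bar>2 * pi * (v \<bullet> \<xi>)\<bar> ^ 4 \<le> (pi * norm \<xi>) ^ 4" by (intro power_mono) auto
    then have "(2 * cos (2 * pi * (v \<bullet> \<xi>)) - 2)\<^sup>2 \<le> pi ^ 4 * norm \<xi> ^ 4"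
    proof -
      have e: "\<theta> ^ 4 = \<bar>\<theta>\<bar> ^ 4" for \<theta> :: real by simp
      note cos_second_difference_le(1)[of "2 * pi * (v \<bullet> \<xi>)", unfolded e[of "2 * pi * (v \<bullet> \<xi>)"]]
      also note \<open>\<bar>2 * pi * (v \<bullet> \<xi>)\<bar> ^ 4 \<le> (pi * norm \<xi>) ^ 4\<close>
      finally show ?thesis unfolding power_mult_distrib[of pi] .
    qed
    then have "\<bar>H' \<xi>\<bar> \<le> (D * norm \<xi> powr (s - 2)) * (pi ^ 4 * norm \<xi> ^ 4)"
      unfolding H'_def abs_mult using D by (intro mult_mono D) auto
    also have "\<dots> = D * pi ^ 4 * (norm \<xi> powr (s - 2) * norm \<xi> ^ 4)" by simp
    also have "norm \<xi> powr (s - 2) * norm \<xi> ^ 4 \<le> 1"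
    proof (cases "\<xi> = 0")
      case False
      then have "norm \<xi> powr (s - 2) * norm \<xi> ^ 4 = norm \<xi> powr (s + 2)"
      proof -
        have e: "norm \<xi> ^ 4 = (norm \<xi>)\<^sup>2 * (norm \<xi>)\<^sup>2" by (simp add: eval_nat_numeral)
        have "norm \<xi> powr (s - 2) * (norm \<xi>)\<^sup>2 = norm \<xi> powr s" "norm \<xi> powr s * (norm \<xi>)\<^sup>2 = norm \<xi> powr (s + 2)"
          using False powr_mult_square[of "norm \<xi>" "s - 2"] powr_mult_square[of "norm \<xi>" s] by simp_all
        then show ?thesis by (simp only: e mult.assoc[symmetric])
      qed
      also have "\<dots> \<le> 1" using True s by (intro powr_le1) auto
      finally show ?thesis .
    qed simp
    then have "D * pi ^ 4 * (norm \<xi> powr (s - 2) * norm \<xi> ^ 4) \<le> D * pi ^ 4 * 1" using D by (intro mult_left_mono) auto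
    finally show ?thesis using D by (simp add: B_def)
  next
    case False
    have "norm \<xi> powr (s - 2) \<le> 1 powr (s - 2)" using False s by (intro powr_mono2') auto
    then have "D * norm \<xi> powr (s - 2) \<le> D * 1" using D by (intro mult_left_mono) auto
    then have "\<bar>H \<xi>\<bar> \<le> D * 1" using D(2)[of \<xi>] by linarith
    then have "\<bar>H' \<xi>\<bar> \<le> (D * 1) * 16"
      unfolding H'_def abs_mult using D(1) by (intro mult_mono) (auto simp: cos_second_difference_le)
    moreover have "0 \<le> D * pi ^ 4" using D by (intro mult_nonneg_nonneg) auto
    ultimately show ?thesis unfolding B_def by linarith
  qed
  have km [measurable]: "cutoff_spectrum \<in> borel_measurable borel"
    by (intro borel_measurable_continuous_onI cutoff_spectrum_continuous)
  have k0: "0 \<le> cutoff_spectrum \<xi>" for \<xi> by (simp add: cutoff_spectrum_def)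
  have lim: "(\<lambda>n. \<integral>u. H' (z + (1 / real (Suc n)) *\<^sub>R u) * cutoff_spectrum u \<partial>lborel) \<longlonglongrightarrow> (\<integral>u. H' z * cutoff_spectrum u \<partial>lborel)" if c: "isCont H' z" for z
  proof (rule integral_dominated_convergence[OF _ _ integrable_mult_right[OF cutoff_spectrum_integrable, of B]])
    show "AE u in lborel. (\<lambda>n. H' (z + (1 / real (Suc n)) *\<^sub>R u) * cutoff_spectrum u) \<longlonglongrightarrow> H' z * cutoff_spectrum u"
    proof (rule AE_I2)
      fix u :: plane
      have "(\<lambda>n. 1 / real (Suc n)) \<longlonglongrightarrow> 0" by real_asymp
      then have "(\<lambda>n. z + (1 / real (Suc n)) *\<^sub>R u) \<longlonglongrightarrow> z + 0 *\<^sub>R u" by (intro tendsto_intros)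
      then have "(\<lambda>n. z + (1 / real (Suc n)) *\<^sub>R u) \<longlonglongrightarrow> z" by simp
      from tendsto_mult[OF isCont_tendsto_compose[OF c this] tendsto_const]
      show "(\<lambda>n. H' (z + (1 / real (Suc n)) *\<^sub>R u) * cutoff_spectrum u) \<longlonglongrightarrow> H' z * cutoff_spectrum u" .
    qed
    fix n
    show "AE u in lborel. norm (H' (z + (1 / real (Suc n)) *\<^sub>R u) * cutoff_spectrum u) \<le> B * cutoff_spectrum u"
      using k0 by (intro AE_I2) (simp add: abs_mult mult_right_mono H'B del: of_nat_Suc)
  qed measurable
  have nonneg: "0 \<le> (\<integral>u. H' (\<xi>0 + (1 / real (Suc n)) *\<^sub>R u) * cutoff_spectrum u \<partial>lborel) + (\<integral>u. H' (- \<xi>0 + (1 / real (Suc n)) *\<^sub>R u) * cutoff_spectrum u \<partial>lborel)" for n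
  proof -
    define N where "N = real (Suc n)"
    have N: "N > 0" by (simp add: N_def)
    define q where "q x = cutoff ((1 / N) *\<^sub>R x) / 4" for x :: plane
    have [measurable]: "q \<in> borel_measurable borel" unfolding q_def[abs_def] by measurable
    have q: "0 \<le> q x" "q x \<le> 1/4" "norm x > N \<Longrightarrow> q x = 0" for x
      using cutoff_range[of "(1 / N) *\<^sub>R x"] N cutoff_support[of "(1 / N) *\<^sub>R x"] by (auto simp: q_def field_simps)
    have qi: "integrable lborel q" unfolding q_def[abs_def]
      using integrable_plane_affine[OF cutoff_integrable, of "1/N" 0] N by simp
    then have qc: "integrable lborel (\<lambda>x. complex_of_real (q x))" by (rule integrable_of_real)
    let ?Q = "fourier (\<lambda>x. of_real (q x))"
    have Q: "(norm (?Q \<xi>))\<^sup>2 = N ^ 4 / 16 * cutoff_spectrum (N *\<^sub>R \<xi>)" for \<xi>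
    proof -
      have "?Q \<xi> = fourier (\<lambda>x. of_real (cutoff ((1 / N) *\<^sub>R x))) \<xi> / 4"
        by (simp add: fourier_def q_def)
      also have "fourier (\<lambda>x. of_real (cutoff ((1 / N) *\<^sub>R x))) \<xi> = of_real (1 / (1 / N)\<^sup>2) * fourier (\<lambda>x. of_real (cutoff x)) (\<xi> /\<^sub>R (1 / N))"
        by (rule fourier_scale[of "\<lambda>x. of_real (cutoff x)"]) (use N in auto)
      finally have "?Q \<xi> = of_real (N\<^sup>2 / 4) * fourier (\<lambda>x. of_real (cutoff x)) (N *\<^sub>R \<xi>)"
        using N by (simp add: power_divide)
      then have "norm (?Q \<xi>) = N\<^sup>2 / 4 * norm (fourier (\<lambda>x. of_real (cutoff x)) (N *\<^sub>R \<xi>))"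
        by (simp only: norm_mult norm_of_real) simp
      moreover have "(N\<^sup>2 / 4)\<^sup>2 = N ^ 4 / 16" by (simp add: power_divide)
      ultimately show ?thesis by (simp only: cutoff_spectrum_def power_mult_distrib)
    qed
    have Qi: "integrable lborel (\<lambda>\<xi>. H' \<xi> * (norm (?Q (\<xi> - \<eta>)))\<^sup>2)" and
      Qe: "(\<integral>\<xi>. H' \<xi> * (norm (?Q (\<xi> - \<eta>)))\<^sup>2 \<partial>lborel) = N\<^sup>2 / 16 * (\<integral>u. H' (\<eta> + (1 / N) *\<^sub>R u) * cutoff_spectrum u \<partial>lborel)" for \<eta>
    proof -
      have [measurable]: "?Q \<in> borel_measurable borel" by (rule fourier_measurable[OF qc])
      have eq: "N *\<^sub>R (\<xi> - \<eta>) = - (N *\<^sub>R \<eta>) + N *\<^sub>R \<xi>" for \<xi> by (simp add: algebra_simps)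
      have "integrable lborel (\<lambda>\<xi>. cutoff_spectrum (N *\<^sub>R (\<xi> - \<eta>)))"
        unfolding eq by (rule integrable_plane_affine[OF cutoff_spectrum_integrable]) (use N in simp)
      then have i: "integrable lborel (\<lambda>\<xi>. B * (N ^ 4 / 16 * cutoff_spectrum (N *\<^sub>R (\<xi> - \<eta>))))"
        by (intro integrable_mult_right)
      show "integrable lborel (\<lambda>\<xi>. H' \<xi> * (norm (?Q (\<xi> - \<eta>)))\<^sup>2)"
      proof (rule integrable_boundI[OF i])
        show "AE \<xi> in lborel. norm (H' \<xi> * (norm (?Q (\<xi> - \<eta>)))\<^sup>2) \<le> B * (N ^ 4 / 16 * cutoff_spectrum (N *\<^sub>R (\<xi> - \<eta>)))"
          unfolding Q[symmetric] by (intro AE_I2) (simp add: abs_mult mult_right_mono H'B)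
      qed measurable
      have "(\<integral>\<xi>. H' \<xi> * (norm (?Q (\<xi> - \<eta>)))\<^sup>2 \<partial>lborel) = (1 / N)\<^sup>2 *\<^sub>R (\<integral>u. H' (\<eta> + (1 / N) *\<^sub>R u) * (norm (?Q ((\<eta> + (1 / N) *\<^sub>R u) - \<eta>)))\<^sup>2 \<partial>lborel)"
        using N by (intro integral_plane_affine) auto
      also have "\<dots> = (1 / N)\<^sup>2 * (\<integral>u. N ^ 4 / 16 * (H' (\<eta> + (1 / N) *\<^sub>R u) * cutoff_spectrum u) \<partial>lborel)"
        unfolding Q using N by (simp add: mult_ac)
      also have "\<dots> = ((1 / N)\<^sup>2 * (N ^ 4 / 16)) * (\<integral>u. H' (\<eta> + (1 / N) *\<^sub>R u) * cutoff_spectrum u \<partial>lborel)"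
        by (simp only: integral_mult_right_zero mult.assoc)
      also have "(1 / N)\<^sup>2 * (N ^ 4 / 16) = N\<^sup>2 / 16" using N by (simp add: power_divide eval_nat_numeral)
      finally show "(\<integral>\<xi>. H' \<xi> * (norm (?Q (\<xi> - \<eta>)))\<^sup>2 \<partial>lborel) = N\<^sup>2 / 16 * (\<integral>u. H' (\<eta> + (1 / N) *\<^sub>R u) * cutoff_spectrum u \<partial>lborel)" .
    qed
    let ?h1 = "\<lambda>x. q x * cos (2 * pi * (x \<bullet> \<xi>0))" and ?h2 = "\<lambda>x. q x * sin (2 * pi * (x \<bullet> \<xi>0))"
    have h: "\<bar>?h1 x\<bar> \<le> 1/4" "norm x > N \<Longrightarrow> ?h1 x = 0" "\<bar>?h2 x\<bar> \<le> 1/4" "norm x > N \<Longrightarrow> ?h2 x = 0" for x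
    proof -
      have "\<bar>?h1 x\<bar> \<le> \<bar>q x\<bar> * 1" "\<bar>?h2 x\<bar> \<le> \<bar>q x\<bar> * 1" unfolding abs_mult by (intro mult_left_mono; simp)+
      then show "\<bar>?h1 x\<bar> \<le> 1/4" "\<bar>?h2 x\<bar> \<le> 1/4" using q(1,2)[of x] by auto
      show "norm x > N \<Longrightarrow> ?h1 x = 0" "norm x > N \<Longrightarrow> ?h2 x = 0" using q(3)[of x] by auto
    qed
    have m1: "?h1 \<in> borel_measurable borel" and m2: "?h2 \<in> borel_measurable borel" by measurable
    note L1 = LIC_second_difference[OF LIC m1 h(1,2) N, of v, folded H'_def]
    note L2 = LIC_second_difference[OF LIC m2 h(3,4) N, of v, folded H'_def]
    let ?F1 = "fourier (\<lambda>x. of_real (?h1 x))" and ?F2 = "fourier (\<lambda>x. of_real (?h2 x))"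
    \<comment> \<open>the parallelogram identity\<close>
    have par: "(norm (?F1 \<xi>))\<^sup>2 + (norm (?F2 \<xi>))\<^sup>2 = ((norm (?Q (\<xi> - \<xi>0)))\<^sup>2 + (norm (?Q (\<xi> - (- \<xi>0))))\<^sup>2) / 2" for \<xi>
    proof -
      have p: "(norm ((a + b) / 2))\<^sup>2 + (norm ((a - b) / (2 * \<i>)))\<^sup>2 = ((norm a)\<^sup>2 + (norm b)\<^sup>2) / 2" for a b :: complex
        by (simp add: norm_divide norm_mult power_divide cmod_power2) (simp add: power2_eq_square field_simps)
      show ?thesis unfolding fourier_modulation[OF qc] p by simp
    qed
    have "0 \<le> (\<integral>\<xi>. H' \<xi> * (norm (?F1 \<xi>))\<^sup>2 \<partial>lborel) + (\<integral>\<xi>. H' \<xi> * (norm (?F2 \<xi>))\<^sup>2 \<partial>lborel)"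
      using L1(2) L2(2) by (rule add_nonneg_nonneg)
    also have "\<dots> = (\<integral>\<xi>. H' \<xi> * (norm (?F1 \<xi>))\<^sup>2 + H' \<xi> * (norm (?F2 \<xi>))\<^sup>2 \<partial>lborel)"
      by (rule Bochner_Integration.integral_add[symmetric, OF L1(1) L2(1)])
    also have "\<dots> = (\<integral>\<xi>. (H' \<xi> * (norm (?Q (\<xi> - \<xi>0)))\<^sup>2 + H' \<xi> * (norm (?Q (\<xi> - (- \<xi>0))))\<^sup>2) * (1/2) \<partial>lborel)"
      unfolding distrib_left[symmetric] par by simp
    also have "\<dots> = ((\<integral>\<xi>. H' \<xi> * (norm (?Q (\<xi> - \<xi>0)))\<^sup>2 \<partial>lborel) + (\<integral>\<xi>. H' \<xi> * (norm (?Q (\<xi> - (- \<xi>0))))\<^sup>2 \<partial>lborel)) * (1/2)"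
      unfolding integral_mult_left_zero Bochner_Integration.integral_add[OF Qi[of \<xi>0] Qi[of "- \<xi>0"]] ..
    also have "\<dots> = N\<^sup>2 / 32 * ((\<integral>u. H' (\<xi>0 + (1 / N) *\<^sub>R u) * cutoff_spectrum u \<partial>lborel) + (\<integral>u. H' (- \<xi>0 + (1 / N) *\<^sub>R u) * cutoff_spectrum u \<partial>lborel))"
      unfolding Qe[of \<xi>0] Qe[of "- \<xi>0"] by (simp add: algebra_simps)
    finally have "0 \<le> N\<^sup>2 / 32 * ((\<integral>u. H' (\<xi>0 + (1 / N) *\<^sub>R u) * cutoff_spectrum u \<partial>lborel) + (\<integral>u. H' (- \<xi>0 + (1 / N) *\<^sub>R u) * cutoff_spectrum u \<partial>lborel))" .
    moreover have "N\<^sup>2 / 32 > 0" using N by simp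
    ultimately show ?thesis unfolding N_def[symmetric] by (simp only: zero_le_mult_iff) linarith
  qed
  have "0 \<le> (\<integral>u. H' \<xi>0 * cutoff_spectrum u \<partial>lborel) + (\<integral>u. H' (- \<xi>0) * cutoff_spectrum u \<partial>lborel)"
    by (rule LIMSEQ_le_const[OF tendsto_add[OF lim[OF c1] lim[OF c2]]]) (use nonneg in blast)
  then have "0 \<le> 2 * H' \<xi>0 * (\<integral>u. cutoff_spectrum u \<partial>lborel)" by (simp add: even)
  moreover have "2 * H' \<xi>0 * (\<integral>u. cutoff_spectrum u \<partial>lborel) < 0"
    using H'neg cutoff_spectrum_pos by (simp add: mult_neg_pos)
  ultimately show False by linarith
qed

section \<open>The equivalence\<close>

theorem LIC_iff: "LIC W \<longleftrightarrow> (\<forall>\<phi>. 0 \<le> angular_part s \<phi>)"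
proof
  assume "LIC W" then show "\<forall>\<phi>. 0 \<le> angular_part s \<phi>" using LIC_imp_angular_part_nonneg by blast
next
  assume ge: "\<forall>\<phi>. 0 \<le> angular_part s \<phi>"
  show "LIC W" unfolding LIC_def
  proof (intro allI impI, elim conjE)
    fix \<rho>0 \<rho>1 :: "plane measure"
    assume "compactly_supported_prob \<rho>0" "compactly_supported_prob \<rho>1" "energy W \<rho>0 < \<infinity>" "energy W \<rho>1 < \<infinity>"
      and ne: "\<rho>0 \<noteq> \<rho>1" and cm: "center_of_mass \<rho>0 = center_of_mass \<rho>1"
    then have fe: "finite_energy \<rho>0" "finite_energy \<rho>1" by (simp_all add: finite_energy_def)
    note sc = strictly_convex_energy_iff[OF fe cm]
    show "strictly_convex_01 (\<lambda>t. energy W (interpolation t \<rho>0 \<rho>1))"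
      unfolding sc(2) using ge by (intro energy_positive fe ne sc(1)) auto
  qed
qed

end

theorem theorem2p6:
  fixes s :: real and \<Omega> :: "real \<Rightarrow> real"
  assumes "0 < s" and "s < 2"
    and "smooth \<Omega>"
    and "\<And>\<theta>. 0 < \<Omega> \<theta>"
    and "\<And>\<theta>. \<Omega> (\<theta> + pi) = \<Omega> \<theta>"
  shows "LIC (potential s \<Omega>) \<longleftrightarrow> (\<forall>\<phi>. 0 \<le> Omega_tilde s \<Omega> \<phi>)"
proof -
  interpret riesz_profile \<Omega> s
    by unfold_locales (use assms in auto)
  show ?thesis unfolding Omega_tilde_eq_angular_part[OF s] by (rule LIC_iff)
qed

end
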